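(* Let $N\ge 1$ and let $K$ be an $N$-stranded braid in $S^3$. Then there exists a properly embedded, not necessarily orientable, Lagrangian surface $L$ in $(\mathbb{C}^2,\omega)$ that intersects every 3-sphere about the origin of sufficiently large radius transversely, and this intersection, after rescaling the sphere to the unit sphere, is an $N$-stranded braid that is braid isotopic to $K$.
   Context: Let $(z_1,z_2)$ be the standard complex coordinates on $\mathbb{C}^2$ and $\omega=\frac{i}{2}(dz_1\wedge d\bar z_1+dz_2\wedge d\bar z_2)$. Introduce the rotated complex coordinates $a_1=2^{-1/2}(z_1-\bar z_2)$, $a_2=2^{-1/2}(z_2+\bar z_1)$; in these coordinates the metric is still the standard one and $\omega=\frac{i}{2}(da_1\wedge da_2-d\bar a_1\wedge d\bar a_2)$. A surface is Lagrangian if $\omega$ pulls back to $0$ on it. All manifolds and maps are smooth. Let $S^1\subset\mathbb{C}$ be the unit circle. An $N$-stranded braid in $S^1\times\mathbb{C}$ means a closed braid (possibly with several components): a compact embedded 1-dimensional submanifold whose projection to $S^1$ is an $N$-fold covering map. If it is connected, it is the image of $\theta\mapsto(e^{i\theta},\gamma(\theta))$ for a $2\pi N$-periodic function $\gamma:\mathbb{R}\to\mathbb{C}$ such that the $N$ values $\{\gamma(\theta+2\pi k)\}_{0\le k<N}$ are distinct for every $\theta$. An $N$-stranded braid in $S^3$ is the image of such a braid under the embedding $S^1\times\mathbb{C}\to S^3$, $(\zeta,z)\mapsto(\zeta,z)/(1+|z|^2)^{1/2}$, where $S^3$ is the unit sphere of $\mathbb{C}^2$ with coordinates $(a_1,a_2)$.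 Two braids are braid isotopic if they are isotopic through a 1-parameter family of braids. *)

theory Defs
  imports "HOL-Analysis.Analysis"
begin

section \<open>Smooth maps and submanifolds of Euclidean spaces\<close>

primrec Ck_on :: "nat \<Rightarrow> 'a::euclidean_space set \<Rightarrow> ('a \<Rightarrow> 'b::euclidean_space) \<Rightarrow> bool" where
  "Ck_on 0 S f \<longleftrightarrow> continuous_on S f"
| "Ck_on (Suc k) S f \<longleftrightarrow> (\<forall>x\<in>S. f differentiable (at x)) \<and>
     (\<forall>v. Ck_on k S (\<lambda>x. frechet_derivative f (at x) v))"

text \<open>Meaningful for open sets only; on arbitrary sets use \<open>smooth_map\<close> below.\<close>

definition smooth_on :: "'a::euclidean_space set \<Rightarrow> ('a \<Rightarrow> 'b::euclidean_space) \<Rightarrow> bool" where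
  "smooth_on S f \<longleftrightarrow> (\<forall>k. Ck_on k S f)"

text \<open>A map defined on a subset (a submanifold, possibly times a compact interval) is smooth
  if it extends locally to smooth maps on open sets of the ambient space.\<close>

definition smooth_map :: "'a::euclidean_space set \<Rightarrow> ('a \<Rightarrow> 'b::euclidean_space) \<Rightarrow> bool" where
  "smooth_map A f \<longleftrightarrow>
     (\<forall>x\<in>A. \<exists>U g. open U \<and> x \<in> U \<and> smooth_on U g \<and> (\<forall>y\<in>A \<inter> U. g y = f y))"

definition diffeomorphism ::
  "'a::euclidean_space set \<Rightarrow> 'b::euclidean_space set \<Rightarrow> ('a \<Rightarrow> 'b) \<Rightarrow> ('b \<Rightarrow> 'a) \<Rightarrow> bool" where
  "diffeomorphism A B f g \<longleftrightarrow> homeomorphism A B f g \<and> smooth_map A f \<and> smooth_map B g"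

text \<open>Embedded submanifolds (without boundary) are given by slice charts.\<close>

definition embedded_submanifold :: "nat \<Rightarrow> 'a::euclidean_space set \<Rightarrow> bool" where
  "embedded_submanifold k S \<longleftrightarrow>
     (\<forall>p\<in>S. \<exists>U V \<phi> \<psi> (T :: 'a set). open U \<and> p \<in> U \<and> open V \<and> diffeomorphism U V \<phi> \<psi> \<and>
        subspace T \<and> dim T = k \<and> \<phi> ` (S \<inter> U) = T \<inter> V)"

text \<open>Proper means that the inclusion is a proper map.\<close>

definition properly_embedded_submanifold :: "nat \<Rightarrow> 'a::euclidean_space set \<Rightarrow> bool" where
  "properly_embedded_submanifold k S \<longleftrightarrow>
     embedded_submanifold k S \<and> proper_map (top_of_set S) euclidean (\<lambda>x. x)"

definition tangent_space :: "'a::euclidean_space set \<Rightarrow> 'a \<Rightarrow> 'a set" where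
  "tangent_space S p =
     {v. \<exists>\<epsilon>>0. \<exists>\<gamma>. smooth_on {-\<epsilon><..<\<epsilon>::real} \<gamma> \<and> \<gamma> ` {-\<epsilon><..<\<epsilon>} \<subseteq> S \<and>
           \<gamma> 0 = p \<and> (\<gamma> has_vector_derivative v) (at 0)}"

definition transverse :: "'a::euclidean_space set \<Rightarrow> 'a set \<Rightarrow> bool" where
  "transverse A B \<longleftrightarrow>
     (\<forall>p\<in>A \<inter> B. {u + v |u v. u \<in> tangent_space A p \<and> v \<in> tangent_space B p} = UNIV)"

text \<open>This is \<^const>\<open>covering_space\<close> with homeomorphisms replaced by diffeomorphisms.\<close>

definition smooth_covering ::
  "'a::euclidean_space set \<Rightarrow> ('a \<Rightarrow> 'b::euclidean_space) \<Rightarrow> 'b set \<Rightarrow> bool" where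
  "smooth_covering C p S \<longleftrightarrow> smooth_map C p \<and> p ` C = S \<and>
     (\<forall>x\<in>S. \<exists>T. x \<in> T \<and> openin (top_of_set S) T \<and>
        (\<exists>\<V>. \<Union>\<V> = C \<inter> p -` T \<and> (\<forall>U\<in>\<V>. openin (top_of_set C) U) \<and>
             pairwise disjnt \<V> \<and> (\<forall>U\<in>\<V>. \<exists>q. diffeomorphism U T p q)))"


section \<open>The symplectic form on \<open>\<complex>\<^sup>2\<close>\<close>

type_synonym C2 = "complex \<times> complex"

definition wedge :: "(C2 \<Rightarrow> complex) \<Rightarrow> (C2 \<Rightarrow> complex) \<Rightarrow> C2 \<Rightarrow> C2 \<Rightarrow> complex" where
  "wedge \<alpha> \<beta> u v = \<alpha> u * \<beta> v - \<alpha> v * \<beta> u"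

text \<open>The coordinates \<open>z\<^sub>1 = fst\<close>, \<open>z\<^sub>2 = snd\<close> are linear, hence equal to their differentials.\<close>

definition omega :: "C2 \<Rightarrow> C2 \<Rightarrow> complex" where
  "omega u v = \<i> / 2 * (wedge fst (cnj \<circ> fst) u v + wedge snd (cnj \<circ> snd) u v)"

definition Lagrangian :: "C2 set \<Rightarrow> bool" where
  "Lagrangian L \<longleftrightarrow> (\<forall>p\<in>L. \<forall>u\<in>tangent_space L p. \<forall>v\<in>tangent_space L p. omega u v = 0)"

text \<open>The map taking \<open>(z\<^sub>1, z\<^sub>2)\<close> to the rotated coordinates \<open>(a\<^sub>1, a\<^sub>2)\<close> of the same point.\<close>

definition rot :: "C2 \<Rightarrow> C2" where
  "rot = (\<lambda>(z1, z2). ((z1 - cnj z2) / sqrt 2, (z2 + cnj z1) / sqrt 2))"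

lemma norm_rot: "norm (rot p) = norm p"
proof -
  obtain z1 z2 where p: "p = (z1, z2)" by (cases p)
  have "(cmod (z1 - cnj z2))\<^sup>2 / 2 + (cmod (z2 + cnj z1))\<^sup>2 / 2 = (cmod z1)\<^sup>2 + (cmod z2)\<^sup>2"
    unfolding cmod_power2 by (simp add: power2_eq_square field_simps)
  then show ?thesis
    by (simp add: p rot_def norm_Pair norm_divide power_divide)
qed

lemma omega_rot:
  "omega u v = \<i> / 2 * (wedge (fst \<circ> rot) (snd \<circ> rot) u v
     - wedge (cnj \<circ> fst \<circ> rot) (cnj \<circ> snd \<circ> rot) u v)"
proof -
  have s: "complex_of_real (sqrt 2) * complex_of_real (sqrt 2) = 2"
    by (simp flip: of_real_mult)
  show ?thesis
    by (cases u; cases v) (simp add: omega_def wedge_def rot_def s algebra_simps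
        add_divide_distrib diff_divide_distrib)
qed


section \<open>Braids\<close>

text \<open>Here \<open>S\<^sup>1 \<times> \<complex>\<close> is regarded as a submanifold of \<open>\<complex> \<times> \<complex>\<close>.\<close>

definition braid :: "nat \<Rightarrow> C2 set \<Rightarrow> bool" where
  "braid N K \<longleftrightarrow> K \<subseteq> sphere 0 1 \<times> UNIV \<and> compact K \<and> embedded_submanifold 1 K \<and>
     smooth_covering K fst (sphere 0 1) \<and>
     (\<forall>\<zeta>\<in>sphere 0 1. card {x \<in> K. fst x = \<zeta>} = N)"

definition to_S3 :: "C2 \<Rightarrow> C2" where
  "to_S3 = (\<lambda>(\<zeta>, z). (1 / sqrt (1 + (cmod z)\<^sup>2)) *\<^sub>R (\<zeta>, z))"

text \<open>Subsets of \<open>S\<^sup>3\<close> are given in the coordinates \<open>(a\<^sub>1, a\<^sub>2)\<close>.\<close>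

definition braid_S3 :: "nat \<Rightarrow> C2 set \<Rightarrow> bool" where
  "braid_S3 N K \<longleftrightarrow> (\<exists>K'. braid N K' \<and> K = to_S3 ` K')"

definition braid_isotopic :: "nat \<Rightarrow> C2 set \<Rightarrow> C2 set \<Rightarrow> bool" where
  "braid_isotopic N K0 K1 \<longleftrightarrow>
     (\<exists>F :: real \<times> C2 \<Rightarrow> C2. smooth_map ({0..1} \<times> K0) F \<and>
        (\<forall>x\<in>K0. F (0, x) = x) \<and> (\<lambda>x. F (1, x)) ` K0 = K1 \<and>
        (\<forall>t\<in>{0..1}. braid_S3 N ((\<lambda>x. F (t, x)) ` K0) \<and>
           (\<exists>G. diffeomorphism K0 ((\<lambda>x. F (t, x)) ` K0) (\<lambda>x. F (t, x)) G)))"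

end

(* In the coordinates xi = log a1, eta = a1 a2 the form is again standard, so a closed 1-form
   over the annulus with one branch per strand, permuted like the strands, gives an N-sheeted
   Lagrangian eta = g_p(xi).  Far out (Re xi = u large) take the 1-form
   d(A_p(theta) - eps e^(-u) B_p(theta)): to leading order its real and imaginary components
   are A_p' and eps e^(-u) B_p, so any closed braid with strands A_p' + i B_p occurs up to an
   anisotropic rescaling.  This requires A_p' to have mean zero along every component, which
   is arranged by an isotopy.
   Near a1 = 0 the sheets are the branches of embedded holomorphic discs
   a1 = ((a2 - r)/c)^n.  The two ends are glued with cut-off potentials.  For generic gluing
   parameters (Sard) the sheets meet in finitely many transverse double points, each of which
   is replaced by a Lagrangian handle. *)
theory Submission imports Defs begin

section \<open>Calculus of smooth maps\<close>

text \<open>On a sphere the braid coordinate is a2/|a1| = e^(-2u) e^(-i theta) eta, so the strands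
  of eta must be those of K turned by e^(i theta). The obstacle is that the two components of eta
  are not independent: they are the theta- and u-derivatives of one function. Giving them different
  orders, 1 and e^(-u), decouples them, since the change which the second potential causes in the
  first component is again of order e^(-u). On the sphere of radius r, e^(-u) is close to 1/r, so
  the section is close to the wanted braid scaled by r^(-2) and eps r^(-3); a positive diagonal
  scaling is an isotopy. The inner and outer sheets share nothing but their permutation, so
  crossings during the gluing cannot be excluded and the surface is at first only immersed. A handle
  can be put at a transverse double point of either sign, which is where orientability may be
  lost.\<close>

lemma Ck_on_cong:
  assumes "open S" "\<And>x. x \<in> S \<Longrightarrow> f x = g x" "Ck_on k S f"
  shows "Ck_on k S g"
  using assms(2,3)
proof (induction k arbitrary: f g)
  case 0
  then show ?case using continuous_on_cong[of S S f g] by simp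
next
  case (Suc k)
  have d: "(g has_derivative frechet_derivative f (at x)) (at x)" if "x \<in> S" for x
  proof (rule has_derivative_transform_within_open[where f=f, OF _ assms(1) that])
    show "(f has_derivative frechet_derivative f (at x)) (at x)"
      using Suc.prems(2) that by (simp add: frechet_derivative_works[symmetric])
  qed (use Suc.prems in auto)
  have e: "frechet_derivative f (at x) = frechet_derivative g (at x)" if "x \<in> S" for x
    using d[OF that] by (rule frechet_derivative_at)
  show ?case
  proof (simp, intro conjI ballI allI)
    fix x assume "x \<in> S"
    then show "g differentiable at x" using d differentiable_def by blast
  next
    fix v
    show "Ck_on k S (\<lambda>x. frechet_derivative g (at x) v)"
      by (rule Suc.IH[of "\<lambda>x. frechet_derivative f (at x) v"]) (use e Suc.prems in auto)
  qed
qed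

lemma Ck_on_subset: "T \<subseteq> S \<Longrightarrow> Ck_on k S f \<Longrightarrow> Ck_on k T f"
  by (induction k arbitrary: f) (auto intro: continuous_on_subset)

lemma Ck_on_Suc_D: "Ck_on (Suc k) S f \<Longrightarrow> Ck_on k S f"
proof (induction k arbitrary: f)
  case 0
  then show ?case
    by (auto simp: continuous_on_eq_continuous_within differentiable_imp_continuous_within
        intro: continuous_at_imp_continuous_within)
next
  case (Suc k)
  then show ?case using Ck_on.simps(2) by blast
qed

lemma Ck_on_SucI:
  assumes "open S" "\<And>x. x \<in> S \<Longrightarrow> (f has_derivative f' x) (at x)"
    "\<And>v. Ck_on k S (\<lambda>x. f' x v)"
  shows "Ck_on (Suc k) S f"
proof (simp, intro conjI ballI allI)
  fix x assume "x \<in> S" then show "f differentiable at x" using assms(2) differentiable_def by blast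
next
  fix v
  show "Ck_on k S (\<lambda>x. frechet_derivative f (at x) v)"
    by (rule Ck_on_cong[OF assms(1) _ assms(3)[of v]]) (metis assms(2) frechet_derivative_at)
qed

lemma Ck_on_SucE:
  assumes "Ck_on (Suc k) S f"
  obtains f' where "\<And>x. x \<in> S \<Longrightarrow> (f has_derivative f' x) (at x)" "\<And>v. Ck_on k S (\<lambda>x. f' x v)"
  using assms that[of "\<lambda>x. frechet_derivative f (at x)"] by (simp add: frechet_derivative_works)

lemma Ck_on_const: "Ck_on k S (\<lambda>x. c)"
  by (induction k arbitrary: c) auto

lemma Ck_on_add:
  assumes "open S" "Ck_on k S f" "Ck_on k S g"
  shows "Ck_on k S (\<lambda>x. f x + g x)"
  using assms(2,3)
proof (induction k arbitrary: f g)
  case 0 then show ?case by (auto intro: continuous_intros)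
next
  case (Suc k)
  obtain f' g' where *: "\<And>x. x \<in> S \<Longrightarrow> (f has_derivative f' x) (at x)" "\<And>v. Ck_on k S (\<lambda>x. f' x v)"
   "\<And>x. x \<in> S \<Longrightarrow> (g has_derivative g' x) (at x)" "\<And>v. Ck_on k S (\<lambda>x. g' x v)"
    using Suc.prems by (metis Ck_on_SucE)
  show ?case
    by (rule Ck_on_SucI[OF assms(1), where f'="\<lambda>x v. f' x v + g' x v"])
      (auto intro: has_derivative_add * Suc.IH)
qed

lemma Ck_on_bounded_linear:
  assumes "open S" "bounded_linear L" "Ck_on k S f"
  shows "Ck_on k S (\<lambda>x. L (f x))"
  using assms(3)
proof (induction k arbitrary: f)
  case 0 then show ?case by (simp add: assms(2) linear_continuous_on_compose bounded_linear.continuous_on)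
next
  case (Suc k)
  obtain f' where *: "\<And>x. x \<in> S \<Longrightarrow> (f has_derivative f' x) (at x)" "\<And>v. Ck_on k S (\<lambda>x. f' x v)"
    using Suc.prems by (metis Ck_on_SucE)
  show ?case
    by (rule Ck_on_SucI[OF assms(1), where f'="\<lambda>x v. L (f' x v)"])
      (auto intro: bounded_linear.has_derivative[OF assms(2)] * Suc.IH)
qed

lemma Ck_on_id: "open S \<Longrightarrow> Ck_on k S (\<lambda>x. x)"
proof (cases k)
  case (Suc k)
  assume "open S"
  then show ?thesis unfolding Suc
    by (intro Ck_on_SucI[where f'="\<lambda>x v. v"]) (auto simp: Ck_on_const)
qed auto

lemma Ck_on_bilinear:
  assumes "open S" "bounded_bilinear B" "Ck_on k S f" "Ck_on k S g"
  shows "Ck_on k S (\<lambda>x. B (f x) (g x))"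
  using assms(3,4)
proof (induction k arbitrary: f g)
  case 0 then show ?case using assms(2) by (simp add: bounded_bilinear.continuous_on)
next
  case (Suc k)
  obtain f' g' where *: "\<And>x. x \<in> S \<Longrightarrow> (f has_derivative f' x) (at x)" "\<And>v. Ck_on k S (\<lambda>x. f' x v)"
   "\<And>x. x \<in> S \<Longrightarrow> (g has_derivative g' x) (at x)" "\<And>v. Ck_on k S (\<lambda>x. g' x v)"
    using Suc.prems by (metis Ck_on_SucE)
  show ?case
    by (rule Ck_on_SucI[OF assms(1), where f'="\<lambda>x v. B (f x) (g' x v) + B (f' x v) (g x)"])
      (intro bounded_bilinear.FDERIV[OF assms(2)] * Suc.IH Ck_on_add[OF assms(1)]
        Suc.prems[THEN Ck_on_Suc_D] | assumption)+
qed

lemma Ck_on_sum: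
  assumes "open S" "\<And>i. i \<in> I \<Longrightarrow> Ck_on k S (f i)"
  shows "Ck_on k S (\<lambda>x. \<Sum>i\<in>I. f i x)"
  using assms(2)
  by (induction I rule: infinite_finite_induct) (auto intro: Ck_on_const Ck_on_add[OF assms(1)])

lemma Ck_on_compose:
  assumes "open S" "open T" "g ` S \<subseteq> T" "Ck_on k T f" "Ck_on k S g"
  shows "Ck_on k S (\<lambda>x. f (g x))"
  using assms(4,5)
proof (induction k arbitrary: f)
  case 0 then show ?case using assms(3) continuous_on_compose2[of T f S g] by simp
next
  case (Suc k)
  obtain f' g' where *: "\<And>x. x \<in> T \<Longrightarrow> (f has_derivative f' x) (at x)" "\<And>v. Ck_on k T (\<lambda>x. f' x v)"
   "\<And>x. x \<in> S \<Longrightarrow> (g has_derivative g' x) (at x)" "\<And>v. Ck_on k S (\<lambda>x. g' x v)"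
    using Suc.prems by (metis Ck_on_SucE)
  have g: "Ck_on k S g" using Suc.prems Ck_on_Suc_D by blast
  show ?case
  proof (rule Ck_on_SucI[OF assms(1), where f'="\<lambda>x v. f' (g x) (g' x v)"])
    fix x assume "x \<in> S"
    then show "((\<lambda>x. f (g x)) has_derivative (\<lambda>v. f' (g x) (g' x v))) (at x)"
      using assms(3) by (intro has_derivative_compose[where g=f, OF *(3) *(1)]) blast+
  next
    fix v
    \<comment> \<open>\<open>Ck_on\<close> controls \<open>f'\<close> only along a fixed direction,
      but \<open>g' x v\<close> moves with \<open>x\<close>. Expanding it in \<open>Basis\<close>
      leaves fixed directions \<open>b\<close>, to which the induction hypothesis applies.\<close>
    have "Ck_on k S (\<lambda>x. \<Sum>b\<in>Basis. (g' x v \<bullet> b) *\<^sub>R f' (g x) b)"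
      using *(2,4) Suc.IH g by (intro Ck_on_sum[OF assms(1)] Ck_on_bilinear[OF assms(1) bounded_bilinear_scaleR]
          Ck_on_bounded_linear[OF assms(1) bounded_linear_inner_left]) blast+
    then show "Ck_on k S (\<lambda>x. f' (g x) (g' x v))"
    proof (rule Ck_on_cong[OF assms(1), rotated])
      fix x assume "x \<in> S"
      then have "linear (f' (g x))" using *(1) assms(3) has_derivative_linear by blast
      then show "(\<Sum>b\<in>Basis. (g' x v \<bullet> b) *\<^sub>R f' (g x) b) = f' (g x) (g' x v)"
        using linear_sum[of "f' (g x)" "\<lambda>b. (g' x v \<bullet> b) *\<^sub>R b" Basis]
        by (simp only: linear_scale euclidean_representation)
    qed
  qed
qed

section \<open>Closure properties of \<open>smooth_on\<close>\<close>

lemma smooth_on_cong: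
  "open S \<Longrightarrow> (\<And>x. x \<in> S \<Longrightarrow> f x = g x) \<Longrightarrow> smooth_on S f \<Longrightarrow> smooth_on S g"
  unfolding smooth_on_def using Ck_on_cong by blast

lemma smooth_on_subset: "smooth_on S f \<Longrightarrow> T \<subseteq> S \<Longrightarrow> smooth_on T f"
  unfolding smooth_on_def using Ck_on_subset by blast

lemma smooth_onI:
  assumes "open S" "\<And>x. x \<in> S \<Longrightarrow> (f has_derivative f' x) (at x)"
    "\<And>v. smooth_on S (\<lambda>x. f' x v)"
  shows "smooth_on S f"
  unfolding smooth_on_def
proof
  fix k show "Ck_on k S f"
    using assms Ck_on_SucI[OF assms(1,2)] Ck_on_Suc_D smooth_on_def by blast
qed

lemma smooth_on_has_derivative:
  "smooth_on S f \<Longrightarrow> x \<in> S \<Longrightarrow> (f has_derivative frechet_derivative f (at x)) (at x)"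
  unfolding smooth_on_def by (metis Ck_on.simps(2) frechet_derivative_works)

lemma smooth_on_frechet_derivative:
  "smooth_on S f \<Longrightarrow> smooth_on S (\<lambda>x. frechet_derivative f (at x) v)"
  unfolding smooth_on_def by (metis Ck_on.simps(2))

lemma smooth_on_imp_continuous_on: "smooth_on S f \<Longrightarrow> continuous_on S f"
  unfolding smooth_on_def by (metis Ck_on.simps(1))

lemma smooth_on_const: "smooth_on S (\<lambda>x. c)"
  and smooth_on_id: "open S \<Longrightarrow> smooth_on S (\<lambda>x. x)"
  and smooth_on_add: "open S \<Longrightarrow> smooth_on S f \<Longrightarrow> smooth_on S g \<Longrightarrow> smooth_on S (\<lambda>x. f x + g x)"
  and smooth_on_sum: "open S \<Longrightarrow> (\<And>i. i \<in> I \<Longrightarrow> smooth_on S (h i)) \<Longrightarrow> smooth_on S (\<lambda>x. \<Sum>i\<in>I. h i x)"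
  unfolding smooth_on_def
  by (auto intro: Ck_on_const Ck_on_id Ck_on_add Ck_on_sum)

lemma smooth_on_bounded_linear:
  "open S \<Longrightarrow> bounded_linear L \<Longrightarrow> smooth_on S f \<Longrightarrow> smooth_on S (\<lambda>x. L (f x))"
  unfolding smooth_on_def using Ck_on_bounded_linear by blast

lemma smooth_on_bilinear:
  "open S \<Longrightarrow> bounded_bilinear B \<Longrightarrow> smooth_on S f \<Longrightarrow> smooth_on S g \<Longrightarrow> smooth_on S (\<lambda>x. B (f x) (g x))"
  unfolding smooth_on_def using Ck_on_bilinear by blast

lemma smooth_on_compose:
  "open S \<Longrightarrow> open T \<Longrightarrow> smooth_on T f \<Longrightarrow> smooth_on S g \<Longrightarrow> g ` S \<subseteq> T \<Longrightarrow> smooth_on S (\<lambda>x. f (g x))"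
  unfolding smooth_on_def using Ck_on_compose by blast

lemma smooth_on_minus: "open S \<Longrightarrow> smooth_on S f \<Longrightarrow> smooth_on S (\<lambda>x. - f x)"
  by (rule smooth_on_bounded_linear[of S uminus]) (auto simp: bounded_linear_minus bounded_linear_ident)

lemma smooth_on_diff:
  "open S \<Longrightarrow> smooth_on S f \<Longrightarrow> smooth_on S g \<Longrightarrow> smooth_on S (\<lambda>x. f x - g x)"
  using smooth_on_add[of S f "\<lambda>x. - g x"] smooth_on_minus[of S g] by simp

lemma smooth_on_mult:
  fixes f g :: "'a::euclidean_space \<Rightarrow> 'b::{euclidean_space,real_normed_algebra}"
  shows "open S \<Longrightarrow> smooth_on S f \<Longrightarrow> smooth_on S g \<Longrightarrow> smooth_on S (\<lambda>x. f x * g x)"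
  by (rule smooth_on_bilinear[OF _ bounded_bilinear_mult])

lemma smooth_on_scaleR:
  "open S \<Longrightarrow> smooth_on S f \<Longrightarrow> smooth_on S g \<Longrightarrow> smooth_on S (\<lambda>x. f x *\<^sub>R g x)"
  by (rule smooth_on_bilinear[OF _ bounded_bilinear_scaleR])

lemma smooth_on_power:
  fixes f :: "'a::euclidean_space \<Rightarrow> 'b::{euclidean_space,real_normed_algebra_1}"
  shows "open S \<Longrightarrow> smooth_on S f \<Longrightarrow> smooth_on S (\<lambda>x. f x ^ n)"
  by (induction n) (auto intro: smooth_on_const smooth_on_mult)

lemma smooth_on_Pair:
  assumes "open S" "smooth_on S f" "smooth_on S g"
  shows "smooth_on S (\<lambda>x. (f x, g x))"
proof -
  have b1: "bounded_linear (\<lambda>x::'b. (x, 0::'c))" and b2: "bounded_linear (\<lambda>x::'c. (0::'b, x))"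
    by (auto intro!: bounded_linear_Pair bounded_linear_ident bounded_linear_zero)
  show ?thesis
    using smooth_on_add[OF assms(1) smooth_on_bounded_linear[OF assms(1) b1 assms(2)]
        smooth_on_bounded_linear[OF assms(1) b2 assms(3)]] by simp
qed

lemma smooth_on_fst: "open S \<Longrightarrow> smooth_on S f \<Longrightarrow> smooth_on S (\<lambda>x. fst (f x))"
  and smooth_on_snd: "open S \<Longrightarrow> smooth_on S f \<Longrightarrow> smooth_on S (\<lambda>x. snd (f x))"
  and smooth_on_Re: "open S \<Longrightarrow> smooth_on S g \<Longrightarrow> smooth_on S (\<lambda>x. Re (g x))"
  and smooth_on_Im: "open S \<Longrightarrow> smooth_on S g \<Longrightarrow> smooth_on S (\<lambda>x. Im (g x))"
  and smooth_on_cnj: "open S \<Longrightarrow> smooth_on S g \<Longrightarrow> smooth_on S (\<lambda>x. cnj (g x))"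
  and smooth_on_of_real: "open S \<Longrightarrow> smooth_on S h \<Longrightarrow> smooth_on S (\<lambda>x. complex_of_real (h x))"
  by (rule smooth_on_bounded_linear; (assumption | rule bounded_linear_fst bounded_linear_snd
      bounded_linear_Re bounded_linear_Im bounded_linear_cnj bounded_linear_of_real))+

text \<open>The derivative is polynomial in \<open>inverse\<close> itself, so each order of
  differentiability yields the next; \<open>exp\<close> and \<open>sqrt\<close> below bootstrap in
  the same way.\<close>

lemma smooth_on_inverse_id:
  "smooth_on (- {0}) (inverse :: 'a::{euclidean_space,real_normed_field} \<Rightarrow> 'a)"
  unfolding smooth_on_def
proof
  fix k
  have o: "open (- {0::'a})" by auto
  show "Ck_on k (- {0}) (inverse :: 'a \<Rightarrow> 'a)"
  proof (induction k)
    case 0 then show ?case by (auto intro!: continuous_intros)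
  next
    case (Suc k)
    show ?case
      by (rule Ck_on_SucI[OF o, where f'="\<lambda>x v. - (inverse x * v * inverse x)"])
       (auto intro!: derivative_eq_intros Ck_on_bounded_linear[OF o, of uminus] bounded_linear_minus bounded_linear_ident
         Ck_on_bilinear[OF o bounded_bilinear_mult] Ck_on_const Suc)
  qed
qed

lemma smooth_on_inverse:
  fixes f :: "'a::euclidean_space \<Rightarrow> 'b::{euclidean_space,real_normed_field}"
  assumes "open S" "smooth_on S f" "\<And>x. x \<in> S \<Longrightarrow> f x \<noteq> 0"
  shows "smooth_on S (\<lambda>x. inverse (f x))"
  by (rule smooth_on_compose[OF assms(1) _ smooth_on_inverse_id assms(2)]) (use assms(3) in auto)

lemma smooth_on_divide:
  fixes f g :: "'a::euclidean_space \<Rightarrow> 'b::{euclidean_space,real_normed_field}"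
  assumes "open S" "smooth_on S f" "smooth_on S g" "\<And>x. x \<in> S \<Longrightarrow> g x \<noteq> 0"
  shows "smooth_on S (\<lambda>x. f x / g x)"
  unfolding divide_inverse by (intro smooth_on_mult smooth_on_inverse assms)

lemma smooth_on_exp_id:
  "smooth_on UNIV (exp :: 'a::{euclidean_space,real_normed_field,banach} \<Rightarrow> 'a)"
  unfolding smooth_on_def
proof
  fix k
  show "Ck_on k UNIV (exp :: 'a \<Rightarrow> 'a)"
  proof (induction k)
    case 0 then show ?case by (auto intro!: continuous_intros)
  next
    case (Suc k)
    show ?case
      by (rule Ck_on_SucI[where f'="\<lambda>x v. v * exp x"])
       (auto intro!: derivative_eq_intros Ck_on_bilinear[OF _ bounded_bilinear_mult] Ck_on_const Suc)
  qed
qed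

lemma smooth_on_exp:
  fixes f :: "'a::euclidean_space \<Rightarrow> 'b::{euclidean_space,real_normed_field,banach}"
  assumes "open S" "smooth_on S f"
  shows "smooth_on S (\<lambda>x. exp (f x))"
  by (rule smooth_on_compose[OF assms(1) _ smooth_on_exp_id assms(2)]) auto

lemma smooth_on_cis:
  assumes "open S" "smooth_on S f"
  shows "smooth_on S (\<lambda>x. cis (f x))"
  unfolding cis_conv_exp
  by (intro smooth_on_exp smooth_on_mult smooth_on_const smooth_on_of_real assms)

lemma smooth_on_cos:
  fixes f :: "'a::euclidean_space \<Rightarrow> real"
  assumes "open S" "smooth_on S f"
  shows "smooth_on S (\<lambda>x. cos (f x))"
  using smooth_on_Re[OF assms(1) smooth_on_cis[OF assms]] by simp

lemma smooth_on_sin: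
  fixes f :: "'a::euclidean_space \<Rightarrow> real"
  assumes "open S" "smooth_on S f"
  shows "smooth_on S (\<lambda>x. sin (f x))"
  using smooth_on_Im[OF assms(1) smooth_on_cis[OF assms]] by simp

lemma smooth_on_sqrt_id: "smooth_on {0<..} sqrt"
  unfolding smooth_on_def
proof
  fix k
  have o: "open {0::real<..}" by auto
  show "Ck_on k {0<..} sqrt"
  proof (induction k)
    case 0 then show ?case by (auto intro!: continuous_intros)
  next
    case (Suc k)
    show ?case
    proof (rule Ck_on_SucI[OF o, where f'="\<lambda>x v. inverse (sqrt x) * (v/2)"])
      fix v
      have "Ck_on k {0<..} (\<lambda>x. inverse (sqrt x))"
        by (rule Ck_on_compose[OF o _ _ _ Suc, of "-{0}"])
          (use smooth_on_inverse_id[where 'a=real] in \<open>auto simp: smooth_on_def\<close>)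
      then show "Ck_on k {0<..} (\<lambda>x. inverse (sqrt x) * (v/2))"
        by (intro Ck_on_bilinear[OF o bounded_bilinear_mult] Ck_on_const)
    qed (auto intro!: derivative_eq_intros simp: field_simps)
  qed
qed

lemma smooth_on_sqrt:
  assumes "open S" "smooth_on S f" "\<And>x. x \<in> S \<Longrightarrow> f x > 0"
  shows "smooth_on S (\<lambda>x. sqrt (f x))"
  by (rule smooth_on_compose[OF assms(1) _ smooth_on_sqrt_id assms(2)]) (use assms(3) in auto)

lemma smooth_on_Ln_id: "smooth_on (- \<real>\<^sub>\<le>\<^sub>0) Ln"
proof (rule smooth_onI[where f'="\<lambda>x v. v * inverse x"])
  show o: "open (- \<real>\<^sub>\<le>\<^sub>0 :: complex set)" by (simp add: closed_nonpos_Reals_complex open_Compl)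
  show "(Ln has_derivative (\<lambda>v. v * inverse x)) (at x)" if "x \<in> - \<real>\<^sub>\<le>\<^sub>0" for x
    by (rule has_derivative_eq_rhs[OF has_field_derivative_Ln[unfolded has_field_derivative_def]])
      (use that in \<open>auto simp: fun_eq_iff\<close>)
  fix v :: complex show "smooth_on (- \<real>\<^sub>\<le>\<^sub>0) (\<lambda>x. v * inverse x)"
    by (intro smooth_on_mult o smooth_on_const smooth_on_inverse smooth_on_id) auto
qed

lemma smooth_on_Ln:
  assumes "open S" "smooth_on S f" "\<And>x. x \<in> S \<Longrightarrow> f x \<notin> \<real>\<^sub>\<le>\<^sub>0"
  shows "smooth_on S (\<lambda>x. Ln (f x))"
  by (rule smooth_on_compose[OF assms(1) _ smooth_on_Ln_id assms(2)])
    (use assms(3) in \<open>auto simp: closed_nonpos_Reals_complex open_Compl\<close>)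

lemma smooth_on_norm:
  fixes f :: "'a::euclidean_space \<Rightarrow> 'b::euclidean_space"
  assumes "open S" "smooth_on S f" "\<And>x. x \<in> S \<Longrightarrow> f x \<noteq> 0"
  shows "smooth_on S (\<lambda>x. norm (f x))"
  unfolding norm_eq_sqrt_inner
  by (intro smooth_on_sqrt smooth_on_bilinear[OF _ bounded_bilinear_inner] assms) (simp add: assms)

lemma smooth_on_cmod_sq:
  assumes "open S" "smooth_on S f"
  shows "smooth_on S (\<lambda>x. (cmod (f x))\<^sup>2)"
  unfolding cmod_power2 by (intro smooth_on_add smooth_on_power smooth_on_Re smooth_on_Im assms)

lemma smooth_on_arg:
  assumes "open S" "smooth_on S f" "smooth_on UNIV g"
  shows "smooth_on S (\<lambda>x. g (f x))"
  using smooth_on_compose[OF assms(1) _ assms(3,2)] by auto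

lemma smooth_on_open_local:
  assumes "open S" "\<And>x. x \<in> S \<Longrightarrow> \<exists>T. open T \<and> x \<in> T \<and> smooth_on T f"
  shows "smooth_on S f"
  unfolding smooth_on_def
proof
  have "Ck_on k S f" if "\<And>x. x \<in> S \<Longrightarrow> \<exists>T. open T \<and> x \<in> T \<and> Ck_on k T f" for k 
    using that
  proof (induction k arbitrary: f)
    case 0
    then show ?case
      by (auto simp: continuous_on_eq_continuous_at assms(1))
        (metis continuous_on_eq_continuous_at)
  next
    case (Suc k)
    then show ?case by (fastforce)
  qed
  then show "Ck_on k S f" for k using assms(2) smooth_on_def by metis
qed

lemmas smooth_intros = smooth_on_const smooth_on_id smooth_on_add smooth_on_sum smooth_on_minus
  smooth_on_diff smooth_on_mult smooth_on_scaleR smooth_on_power smooth_on_Pair smooth_on_fst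
  smooth_on_snd smooth_on_Re smooth_on_Im smooth_on_cnj smooth_on_of_real smooth_on_exp smooth_on_cis
  smooth_on_cos smooth_on_sin smooth_on_divide smooth_on_inverse smooth_on_cmod_sq

subsection \<open>A smooth step function\<close>

text \<open>The powers of \<open>inverse x\<close> make the family closed under differentiation up
  to linear combinations, so that smoothness of all members at 0 is a single induction.\<close>

definition flat_fun :: "nat \<Rightarrow> real \<Rightarrow> real" where
  "flat_fun n x = (if x > 0 then inverse x ^ n * exp (- inverse x) else 0)"

lemma flat_fun_tendsto: "(flat_fun n \<longlongrightarrow> 0) (at 0)"
proof -
  have l: "(flat_fun n \<longlongrightarrow> 0) (at_left 0)"
    by (rule Lim_transform_eventually[OF tendsto_const])
      (auto simp: eventually_at_filter flat_fun_def)
  have "((\<lambda>x::real. inverse x ^ n / exp (inverse x)) \<longlongrightarrow> 0) (at_right 0)"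
    by (rule filterlim_compose[OF tendsto_power_div_exp_0 filterlim_inverse_at_top_right])
  then have r: "(flat_fun n \<longlongrightarrow> 0) (at_right 0)"
    by (rule Lim_transform_eventually)
      (auto simp: eventually_at_filter flat_fun_def exp_minus divide_inverse)
  show ?thesis using l r filterlim_split_at by blast
qed

lemma flat_fun_deriv:
  "(flat_fun n has_derivative (\<lambda>v. v * (flat_fun (n+2) x - real n * flat_fun (n+1) x))) (at x)"
proof -
  have "(flat_fun n has_real_derivative flat_fun (n+2) x - real n * flat_fun (n+1) x) (at x)"
  proof (cases x "0::real" rule: linorder_cases)
    case less
    have "((\<lambda>x. 0) has_real_derivative flat_fun (n+2) x - real n * flat_fun (n+1) x) (at x)"
      using less by (simp add: flat_fun_def)
    then show ?thesis
      by (rule has_field_derivative_transform_within_open[where S="{..<0}"])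
        (use less in \<open>auto simp: flat_fun_def\<close>)
  next
    case greater
    have "((\<lambda>x. inverse x ^ n * exp (- inverse x)) has_real_derivative
        (inverse x ^ (n+2) * exp (- inverse x) - real n * (inverse x ^ (n+1) * exp (- inverse x)))) (at x)"
    proof -
      have "((\<lambda>y. y ^ n * exp (- y)) has_real_derivative
          real n * inverse x ^ (n - 1) * exp (- inverse x) - inverse x ^ n * exp (- inverse x)) (at (inverse x))"
        by (auto intro!: derivative_eq_intros)
      from DERIV_chain2[OF this DERIV_inverse[of x UNIV]] greater
      have "((\<lambda>x. inverse x ^ n * exp (- inverse x)) has_real_derivative
         (real n * inverse x ^ (n - 1) * exp (- inverse x) - inverse x ^ n * exp (- inverse x)) *
           - (inverse x ^ Suc (Suc 0))) (at x)" by simp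
      moreover have "(real n * inverse x ^ (n - 1) * exp (- inverse x) - inverse x ^ n * exp (- inverse x)) *
           - (inverse x ^ Suc (Suc 0)) = inverse x ^ (n+2) * exp (- inverse x) - real n * (inverse x ^ (n+1) * exp (- inverse x))"
        by (cases n) (simp_all add: algebra_simps)
      ultimately show ?thesis by simp
    qed
    moreover have "flat_fun m x = inverse x ^ m * exp (- inverse x)" for m
      using greater by (simp add: flat_fun_def)
    ultimately have "((\<lambda>x. inverse x ^ n * exp (- inverse x)) has_real_derivative
       flat_fun (n+2) x - real n * flat_fun (n+1) x) (at x)" by presburger
    then show ?thesis
      by (rule has_field_derivative_transform_within_open[where S="{0<..}"])
        (use greater in \<open>auto simp: flat_fun_def\<close>)
  next
    case equal
    \<comment> \<open>The difference quotient at 0 is the next member of the family, so its limit is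
      \<open>flat_fun_tendsto\<close>.\<close>
    have "(\<lambda>h. (flat_fun n h - flat_fun n 0) / h) = flat_fun (n+1)"
      by (auto simp: flat_fun_def fun_eq_iff divide_inverse)
    then show ?thesis
      using flat_fun_tendsto[of "n+1"] equal
      by (simp add: DERIV_def flat_fun_def)
  qed
  from this[unfolded has_field_derivative_def] show ?thesis
    by (rule has_derivative_eq_rhs) auto
qed

lemma smooth_on_flat_fun: "smooth_on UNIV (flat_fun n)"
  unfolding smooth_on_def
proof
  fix k
  show "Ck_on k UNIV (flat_fun n)"
  proof (induction k arbitrary: n)
    case 0
    show ?case using has_derivative_continuous[OF flat_fun_deriv[of n]]
      by (auto simp: continuous_on_eq_continuous_at)
  next
    case (Suc k)
    show ?case
    proof (rule Ck_on_SucI[OF _ flat_fun_deriv])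
      fix v
      have "Ck_on k UNIV (\<lambda>x. v * (flat_fun (n+2) x + (- real n) * flat_fun (n+1) x))"
        by (intro Ck_on_bilinear[OF _ bounded_bilinear_mult] Ck_on_add Ck_on_const Suc) auto
      then show "Ck_on k UNIV (\<lambda>x. v * (flat_fun (n+2) x - real n * flat_fun (n+1) x))"
        by simp
    qed auto
  qed
qed

definition step_fun :: "real \<Rightarrow> real" where
  "step_fun x = flat_fun 0 x / (flat_fun 0 x + flat_fun 0 (1 - x))"

lemma step_fun_denom_pos: "flat_fun 0 x + flat_fun 0 (1 - x) > 0"
  by (auto simp: flat_fun_def add_pos_pos)

lemma smooth_on_step_fun_id: "smooth_on UNIV step_fun"
proof -
  have "smooth_on UNIV (\<lambda>x. flat_fun 0 x / (flat_fun 0 x + flat_fun 0 (1 - x)))"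
    by (intro smooth_intros smooth_on_arg[OF _ _ smooth_on_flat_fun])
      (use step_fun_denom_pos in \<open>auto simp: less_imp_neq[symmetric]\<close>)
  then show ?thesis by (simp add: step_fun_def[abs_def])
qed

lemmas smooth_on_step_fun = smooth_on_arg[OF _ _ smooth_on_step_fun_id]

lemma step_fun_0: "x \<le> 0 \<Longrightarrow> step_fun x = 0"
  and step_fun_1: "x \<ge> 1 \<Longrightarrow> step_fun x = 1"
  and step_fun_nonneg: "0 \<le> step_fun x"
  and step_fun_le_1: "step_fun x \<le> 1"
  and step_fun_pos: "x > 0 \<Longrightarrow> step_fun x > 0"
  using step_fun_denom_pos[of x] by (auto simp: step_fun_def flat_fun_def field_simps add_pos_pos)

subsection \<open>Smooth local inverses in the complex plane\<close>

text \<open>Cramer's rule: \<open>Im (cnj (A 1) * A \<i>)\<close> is the determinant of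
  \<open>A\<close> in the real basis 1, \<open>\<i>\<close>, and the two quotients are the
  coordinates of the preimage.\<close>

lemma complex_linear_solve:
  fixes A :: "complex \<Rightarrow> complex"
  assumes "linear A" "Im (cnj (A 1) * A \<i>) \<noteq> 0"
  shows "A (Complex (Im (cnj v * A \<i>) / Im (cnj (A 1) * A \<i>)) (Im (cnj (A 1) * v) / Im (cnj (A 1) * A \<i>))) = v"
proof -
  let ?d = "Im (cnj (A 1) * A \<i>)"
  let ?x = "Im (cnj v * A \<i>) / ?d" and ?y = "Im (cnj (A 1) * v) / ?d"
  have "A (Complex ?x ?y) = A (?x *\<^sub>R 1 + ?y *\<^sub>R \<i>)" by (rule arg_cong[of _ _ A]) (simp add: complex_eq_iff)
  also have "\<dots> = ?x *\<^sub>R A 1 + ?y *\<^sub>R A \<i>"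
    by (simp only: linear_add[OF assms(1)] linear_scale[OF assms(1)])
  also have "\<dots> = v"
  proof -
    define a b c e p q D where "a = Re (A 1)" and "b = Im (A 1)" and "c = Re (A \<i>)" and "e = Im (A \<i>)"
      and "p = Re v" and "q = Im v" and "D = a * e - b * c"
    have D: "?d = D" "D \<noteq> 0" using assms(2) by (simp_all add: a_def b_def c_def e_def D_def)
    have x: "?x = (p * e - q * c) / D" and y: "?y = (a * q - b * p) / D"
      unfolding D(1) by (simp_all add: a_def b_def c_def e_def p_def q_def)
    have "?x * a + ?y * c = p * D / D" "?x * b + ?y * e = q * D / D"
      unfolding x y D_def by (simp_all add: add_divide_distrib[symmetric] algebra_simps)
    then show ?thesis using D(2)
      by (simp add: complex_eq_iff a_def b_def c_def e_def p_def q_def)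
  qed
  finally show ?thesis .
qed

lemma complex_linear_inj_iff:
  fixes A :: "complex \<Rightarrow> complex"
  assumes "linear A"
  shows "inj A \<longleftrightarrow> Im (cnj (A 1) * A \<i>) \<noteq> 0"
proof
  assume "inj A"
  show "Im (cnj (A 1) * A \<i>) \<noteq> 0"
  proof
    assume d: "Im (cnj (A 1) * A \<i>) = 0"
    have lin: "A (of_real x + of_real y * \<i>) = of_real x * A 1 + of_real y * A \<i>" for x y
    proof -
      have "A (x *\<^sub>R 1 + y *\<^sub>R \<i>) = x *\<^sub>R A 1 + y *\<^sub>R A \<i>"
        by (simp only: linear_add[OF assms(1)] linear_scale[OF assms(1)])
      then show ?thesis by (simp add: scaleR_conv_of_real)
    qed
    have inj0: "v = 0" if "A v = 0" for v using \<open>inj A\<close> that assms linear_injective_0 by blast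
    have nz: "A 1 \<noteq> 0" using inj0 by force
    \<comment> \<open>The linear relation between the columns when the determinant vanishes: x is
      the inner product of \<open>A 1\<close> and \<open>A \<i>\<close>, and y is minus the squared
      length of \<open>A 1\<close>. Injectivity then forces y = 0, so \<open>A 1\<close> =
      0.\<close>
    define x y where "x = Re (cnj (A 1) * A \<i>)" and "y = - ((Re (A 1))\<^sup>2 + (Im (A 1))\<^sup>2)"
    have "cnj (A 1) * (of_real x * A 1 + of_real y * A \<i>) = 0"
    proof -
      have "cnj (A 1) * A \<i> = of_real x" using d by (simp add: complex_eq_iff x_def)
      moreover have "cnj (A 1) * A 1 = of_real (- y)"
        by (simp add: complex_eq_iff y_def power2_eq_square)
      ultimately show ?thesis by (simp add: distrib_left mult.left_commute[of "cnj (A 1)"])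
    qed
    then have "A (of_real x + of_real y * \<i>) = 0" using nz lin by simp
    then have "of_real x + of_real y * \<i> = (0::complex)" by (rule inj0)
    then have "y = 0" by (simp add: complex_eq_iff)
    then have "(Re (A 1))\<^sup>2 + (Im (A 1))\<^sup>2 = 0" unfolding y_def by linarith
    then have "Re (A 1) = 0 \<and> Im (A 1) = 0" by (simp only: sum_power2_eq_zero_iff)
    then show False using nz by (simp add: complex_eq_iff)
  qed
next
  assume d: "Im (cnj (A 1) * A \<i>) \<noteq> 0"
  have "surj A" using complex_linear_solve[OF assms d] unfolding surj_def by metis
  then show "inj A" using assms linear_surjective_imp_injective by blast
qed

text \<open>The derivative of the inverse \<open>g\<close> at \<open>y\<close> is the inverse matrix
  of the derivative of \<open>f\<close> at \<open>g y\<close>. That matrix is rational in the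
  partial derivatives of \<open>f\<close>, so \<open>g\<close> gains one order of differentiability
  at a time. \<open>U\<close> lies in the open set where the determinant does not vanish.\<close>

lemma smooth_local_inverse:
  fixes f :: "complex \<Rightarrow> complex"
  assumes "open S" "smooth_on S f" "x0 \<in> S" "inj (frechet_derivative f (at x0))"
  obtains U V g where "open U" "open V" "x0 \<in> U" "f x0 \<in> V" "U \<subseteq> S" "homeomorphism U V f g"
    "smooth_on V g" "\<And>x. x \<in> U \<Longrightarrow> inj (frechet_derivative f (at x))"
proof -
  define f' where "f' x = frechet_derivative f (at x)" for x
  have df: "(f has_derivative f' x) (at x)" if "x \<in> S" for x
    unfolding f'_def using smooth_on_has_derivative[OF assms(2) that] .
  have lin: "linear (f' x)" and bl: "bounded_linear (f' x)" if "x \<in> S" for x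
    using has_derivative_linear[OF df[OF that]] has_derivative_bounded_linear[OF df[OF that]] by auto
  have sm: "smooth_on S (\<lambda>x. f' x v)" for v
    unfolding f'_def by (rule smooth_on_frechet_derivative[OF assms(2)])
  define d where "d x = Im (cnj (f' x 1) * f' x \<i>)" for x
  have smd: "smooth_on S d"
    unfolding d_def[abs_def] by (intro smooth_intros sm assms)
  define S1 where "S1 = {x \<in> S. d x \<noteq> 0}"
  have "S1 = S \<inter> d -` (-{0})" by (auto simp: S1_def)
  then have oS1: "open S1"
    using continuous_open_preimage[OF smooth_on_imp_continuous_on[OF smd] assms(1), of "-{0}"]
    by (metis open_delete open_UNIV Compl_eq_Diff_UNIV)
  have S1: "S1 \<subseteq> S" by (auto simp: S1_def)
  have x0: "x0 \<in> S1"
    using assms(3,4) complex_linear_inj_iff[OF lin[OF assms(3)]] by (auto simp: S1_def d_def f'_def)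
  define bf where "bf x = Blinfun (f' x)" for x
  have bf: "blinfun_apply (bf x) = f' x" if "x \<in> S" for x
    unfolding bf_def using bl[OF that] by (simp add: bounded_linear_Blinfun_apply)
  have contbf: "continuous_on S1 bf"
  proof (rule continuous_on_blinfun_componentwise)
    fix i :: complex assume "i \<in> Basis"
    have "continuous_on S1 (\<lambda>x. f' x i)"
      using smooth_on_imp_continuous_on[OF sm] S1 continuous_on_subset by blast
    then show "continuous_on S1 (\<lambda>x. blinfun_apply (bf x) i)"
      by (rule continuous_on_eq) (use bf S1 in auto)
  qed
  have inj0: "inj (f' x0)" using assms(4) f'_def by auto
  obtain h where h: "linear h" "h \<circ> f' x0 = id"
    using linear_injective_left_inverse[OF lin[OF assms(3)] inj0] by blast
  have inv: "Blinfun h o\<^sub>L bf x0 = id_blinfun"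
    by (rule blinfun_eqI) (use h bf[OF assms(3)] in \<open>auto simp: bounded_linear_Blinfun_apply
      linear_conv_bounded_linear fun_eq_iff\<close>)
  have derb: "(f has_derivative blinfun_apply (bf x)) (at x)" if "x \<in> S1" for x
    using bf[of x] df[of x] S1 that by auto
  obtain U V g g' where *: "open U" "U \<subseteq> S1" "x0 \<in> U" "open V" "f x0 \<in> V" "homeomorphism U V f g"
    "\<And>y. y \<in> V \<Longrightarrow> (g has_derivative (g' y)) (at y)"
    "\<And>y. y \<in> V \<Longrightarrow> g' y = inv (blinfun_apply (bf (g y)))"
    "\<And>y. y \<in> V \<Longrightarrow> bij (blinfun_apply (bf (g y)))"
    by (rule inverse_function_theorem[OF oS1 derb contbf x0 inv], assumption, rule that) auto
  have gS: "g y \<in> S1" if "y \<in> V" for y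
    using *(2) homeomorphism_image2[OF *(6)] that by auto
  \<comment> \<open>Cramer's formula for the inverse of \<open>f' x\<close>, explicit so that its
    smoothness in \<open>x\<close> is visible.\<close>
  define E where "E x v = Complex (Im (cnj v * f' x \<i>) / d x) (Im (cnj (f' x 1) * v) / d x)" for x v
  have smE: "smooth_on S1 (\<lambda>x. E x v)" for v
  proof -
    have "smooth_on S1 (\<lambda>x. complex_of_real (Im (cnj v * f' x \<i>) / d x) +
       \<i> * complex_of_real (Im (cnj (f' x 1) * v) / d x))"
      by (intro smooth_intros oS1 smooth_on_subset[OF sm S1] smooth_on_subset[OF smd S1])
        (auto simp: S1_def)
    then show ?thesis by (simp add: E_def Complex_eq)
  qed
  have g'E: "g' y v = E (g y) v" if "y \<in> V" for y v
  proof -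
    have "g y \<in> S" "d (g y) \<noteq> 0" using gS[OF that] S1_def by auto
    then have "f' (g y) (E (g y) v) = v"
      using complex_linear_solve[OF lin, of "g y" v] by (auto simp: d_def E_def)
    moreover have "g' y = inv (f' (g y))" "inj (f' (g y))"
      using *(8,9)[OF that] bf[OF \<open>g y \<in> S\<close>] by (auto simp: bij_is_inj)
    ultimately show ?thesis by (metis inv_f_f)
  qed
  have "smooth_on V g"
    unfolding smooth_on_def
  proof
    fix k show "Ck_on k V g"
    proof (induction k)
      case 0
      then show ?case using *(6) by (simp add: homeomorphism_def)
    next
      case (Suc k)
      show ?case
      proof (rule Ck_on_SucI[OF *(4,7)])
        fix v
        have "Ck_on k V (\<lambda>y. E (g y) v)"
          by (rule Ck_on_compose[OF *(4) oS1 _ _ Suc]) (use smE[of v] gS in \<open>auto simp: smooth_on_def\<close>)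
        then show "Ck_on k V (\<lambda>y. g' y v)"
          by (rule Ck_on_cong[OF *(4), rotated]) (simp add: g'E)
      qed
    qed
  qed
  moreover have "inj (f' x)" if "x \<in> U" for x
    using that *(2) complex_linear_inj_iff[OF lin, of x] by (auto simp: S1_def d_def)
  moreover have "U \<subseteq> S" using *(2) S1 by simp
  ultimately show ?thesis
    using that[OF *(1,4,3,5) _ *(6)] unfolding f'_def by simp
qed

subsection \<open>Smooth maps on arbitrary subsets\<close>

lemma smooth_mapI_smooth_on: "open U \<Longrightarrow> A \<subseteq> U \<Longrightarrow> smooth_on U f \<Longrightarrow> smooth_map A f"
  unfolding smooth_map_def by blast

lemma smooth_mapE:
  assumes "smooth_map A f" "x \<in> A"
  obtains U g where "open U" "x \<in> U" "smooth_on U g" "\<And>y. y \<in> A \<Longrightarrow> y \<in> U \<Longrightarrow> g y = f y"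
proof -
  from assms obtain U g where "open U" "x \<in> U" "smooth_on U g" "\<forall>y\<in>A \<inter> U. g y = f y"
    unfolding smooth_map_def by metis
  then show ?thesis using that[of U g] by auto
qed

lemma smooth_mapI:
  assumes "\<And>x. x \<in> A \<Longrightarrow> \<exists>U g. open U \<and> x \<in> U \<and> smooth_on U g \<and> (\<forall>y\<in>A. y \<in> U \<longrightarrow> g y = f y)"
  shows "smooth_map A f"
  unfolding smooth_map_def
proof
  fix x assume "x \<in> A"
  from assms[OF this] obtain U g where "open U" "x \<in> U" "smooth_on U g" "\<forall>y\<in>A. y \<in> U \<longrightarrow> g y = f y"
    by metis
  then show "\<exists>U g. open U \<and> x \<in> U \<and> smooth_on U g \<and> (\<forall>y\<in>A \<inter> U. g y = f y)"
    by (intro exI[of _ U] exI[of _ g]) auto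
qed

lemma smooth_map_imp_continuous_on:
  assumes "smooth_map A f" shows "continuous_on A f"
proof -
  have "\<exists>U. open U \<and> x \<in> U \<and> continuous_on (A \<inter> U) f" if x: "x \<in> A" for x
  proof -
    obtain U g where U: "open U" "x \<in> U" "smooth_on U g" "\<And>y. y \<in> A \<Longrightarrow> y \<in> U \<Longrightarrow> g y = f y"
      using smooth_mapE[OF assms x] by metis
    have "continuous_on (A \<inter> U) g"
      using smooth_on_imp_continuous_on[OF U(3)] continuous_on_subset by blast
    then have "continuous_on (A \<inter> U) f" by (rule continuous_on_eq) (use U(4) in auto)
    then show ?thesis using U by blast
  qed
  then obtain W where W: "\<And>x. x \<in> A \<Longrightarrow> open (W x) \<and> x \<in> W x \<and> continuous_on (A \<inter> W x) f" by metis
  show ?thesis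
    unfolding continuous_on_eq_continuous_within
  proof
    fix x assume x: "x \<in> A"
    have "continuous (at x within A \<inter> W x) f"
      using W[OF x] x by (simp add: continuous_on_eq_continuous_within)
    then show "continuous (at x within A) f"
      using W[OF x] at_within_nhd[of x "W x" A "A \<inter> W x"] by auto
  qed
qed

lemma smooth_map_compose:
  assumes "smooth_map A f" "smooth_map B g" "f ` A \<subseteq> B"
  shows "smooth_map A (\<lambda>x. g (f x))"
proof (rule smooth_mapI)
  fix x assume x: "x \<in> A"
  then have fx: "f x \<in> B" using assms(3) by auto
  obtain U f' where U: "open U" "x \<in> U" "smooth_on U f'" "\<And>y. y \<in> A \<Longrightarrow> y \<in> U \<Longrightarrow> f' y = f y"
    using smooth_mapE[OF assms(1) x] by metis
  obtain V g' where V: "open V" "f x \<in> V" "smooth_on V g'" "\<And>y. y \<in> B \<Longrightarrow> y \<in> V \<Longrightarrow> g' y = g y"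
    using smooth_mapE[OF assms(2) fx] by metis
  let ?W = "U \<inter> f' -` V"
  have o: "open ?W"
    using continuous_open_preimage[OF smooth_on_imp_continuous_on[OF U(3)] U(1) V(1)] .
  have "smooth_on ?W (\<lambda>x. g' (f' x))"
    by (rule smooth_on_compose[OF o V(1,3) smooth_on_subset[OF U(3)]]) auto
  moreover have "x \<in> ?W" using U(2) U(4)[OF x] V(2) by auto
  moreover have "g' (f' y) = g (f y)" if "y \<in> A" "y \<in> ?W" for y
    using U(4)[of y] V(4)[of "f y"] assms(3) that by auto
  ultimately show "\<exists>U h. open U \<and> x \<in> U \<and> smooth_on U h \<and> (\<forall>y\<in>A. y \<in> U \<longrightarrow> h y = g (f y))"
    using o by blast
qed

section \<open>Symplectic charts\<close>

definition sigma :: "C2 \<Rightarrow> C2 \<Rightarrow> real" where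
  "sigma u v = Im (fst u * snd v - fst v * snd u)"

lemma omega_eq_sigma: "omega u v = - complex_of_real (sigma (rot u) (rot v))"
proof -
  have *: "\<i> / 2 * (W - cnj W) = - complex_of_real (Im W)" for W
    by (simp add: complex_eq_iff)
  show ?thesis
    using *[of "wedge (fst \<circ> rot) (snd \<circ> rot) u v"]
    by (simp add: omega_rot sigma_def wedge_def)
qed

definition symp_chart :: "C2 set \<Rightarrow> C2 set \<Rightarrow> (C2 \<Rightarrow> C2) \<Rightarrow> (C2 \<Rightarrow> C2) \<Rightarrow> bool" where
  "symp_chart U V \<Phi> \<Psi> \<longleftrightarrow> open U \<and> open V \<and> homeomorphism U V \<Phi> \<Psi> \<and> smooth_on U \<Phi> \<and> smooth_on V \<Psi> \<and>
     (\<forall>x\<in>U. \<forall>u v. sigma (frechet_derivative \<Phi> (at x) u) (frechet_derivative \<Phi> (at x) v) = sigma u v)"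

lemma symp_chartI:
  assumes "open U" "open V" "smooth_on U \<Phi>" "smooth_on V \<Psi>"
    "\<And>x. x \<in> U \<Longrightarrow> \<Phi> x \<in> V \<and> \<Psi> (\<Phi> x) = x" "\<And>y. y \<in> V \<Longrightarrow> \<Psi> y \<in> U \<and> \<Phi> (\<Psi> y) = y"
    "\<And>x. x \<in> U \<Longrightarrow> (\<Phi> has_derivative \<Phi>' x) (at x)"
    "\<And>x u v. x \<in> U \<Longrightarrow> sigma (\<Phi>' x u) (\<Phi>' x v) = sigma u v"
  shows "symp_chart U V \<Phi> \<Psi>"
proof -
  have "homeomorphism U V \<Phi> \<Psi>"
    by (rule homeomorphismI) (use assms smooth_on_imp_continuous_on in auto)
  moreover have "frechet_derivative \<Phi> (at x) = \<Phi>' x" if "x \<in> U" for x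
    using assms(7)[OF that] frechet_derivative_at by metis
  ultimately show ?thesis unfolding symp_chart_def using assms by auto
qed

lemma symp_chartD:
  assumes "symp_chart U V \<Phi> \<Psi>"
  shows "open U" "open V" "homeomorphism U V \<Phi> \<Psi>" "smooth_on U \<Phi>" "smooth_on V \<Psi>"
    "x \<in> U \<Longrightarrow> \<Phi> x \<in> V" "x \<in> U \<Longrightarrow> \<Psi> (\<Phi> x) = x" "y \<in> V \<Longrightarrow> \<Psi> y \<in> U" "y \<in> V \<Longrightarrow> \<Phi> (\<Psi> y) = y"
    "x \<in> U \<Longrightarrow> (\<Phi> has_derivative frechet_derivative \<Phi> (at x)) (at x)"
    "x \<in> U \<Longrightarrow> sigma (frechet_derivative \<Phi> (at x) u) (frechet_derivative \<Phi> (at x) v) = sigma u v"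
  using assms smooth_on_has_derivative unfolding symp_chart_def homeomorphism_def
  by (auto simp del: split_paired_All)

lemma symp_chart_compose:
  assumes 1: "symp_chart U V \<Phi> \<Psi>" and 2: "symp_chart V W \<Phi>2 \<Psi>2"
  shows "symp_chart U W (\<lambda>x. \<Phi>2 (\<Phi> x)) (\<lambda>y. \<Psi> (\<Psi>2 y))"
proof (rule symp_chartI[where \<Phi>'="\<lambda>x v. frechet_derivative \<Phi>2 (at (\<Phi> x)) (frechet_derivative \<Phi> (at x) v)"])
  note D1 = symp_chartD[OF 1] and D2 = symp_chartD[OF 2]
  show "open U" "open W" using D1 D2 by auto
  show "smooth_on U (\<lambda>x. \<Phi>2 (\<Phi> x))"
    by (rule smooth_on_compose[OF D1(1) D2(1) D2(4) D1(4)]) (use D1 in auto)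
  show "smooth_on W (\<lambda>x. \<Psi> (\<Psi>2 x))"
    by (rule smooth_on_compose[OF D2(2) D1(2) D1(5) D2(5)]) (use D2 in auto)
  fix x assume x: "x \<in> U"
  show "\<Phi>2 (\<Phi> x) \<in> W \<and> \<Psi> (\<Psi>2 (\<Phi>2 (\<Phi> x))) = x" using x D1 D2 by auto
  show "((\<lambda>x. \<Phi>2 (\<Phi> x)) has_derivative
      (\<lambda>v. frechet_derivative \<Phi>2 (at (\<Phi> x)) (frechet_derivative \<Phi> (at x) v))) (at x)"
    by (rule has_derivative_compose[OF D1(10)[OF x] D2(10)[OF D1(6)[OF x]]])
  fix u v
  show "sigma (frechet_derivative \<Phi>2 (at (\<Phi> x)) (frechet_derivative \<Phi> (at x) u))
      (frechet_derivative \<Phi>2 (at (\<Phi> x)) (frechet_derivative \<Phi> (at x) v)) = sigma u v"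
    using D2(11)[OF D1(6)[OF x]] D1(11)[OF x] by simp
next
  note D1 = symp_chartD[OF 1] and D2 = symp_chartD[OF 2]
  fix y assume "y \<in> W" then show "\<Psi> (\<Psi>2 y) \<in> U \<and> \<Phi>2 (\<Phi> (\<Psi> (\<Psi>2 y))) = y"
    using D1 D2 by auto
qed

lemma symp_chart_restrict:
  assumes 1: "symp_chart U V \<Phi> \<Psi>" and "open U'" "open V'"
  shows "symp_chart {x \<in> U. x \<in> U' \<and> \<Phi> x \<in> V'} {y \<in> V. \<Psi> y \<in> U' \<and> y \<in> V'} \<Phi> \<Psi>"
proof (rule symp_chartI[where \<Phi>'="\<lambda>x. frechet_derivative \<Phi> (at x)"])
  note D1 = symp_chartD[OF 1]
  have e1: "{x \<in> U. x \<in> U' \<and> \<Phi> x \<in> V'} = (U \<inter> \<Phi> -` V') \<inter> U'" by auto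
  show "open {x \<in> U. x \<in> U' \<and> \<Phi> x \<in> V'}"
    unfolding e1 by (rule open_Int[OF continuous_open_preimage[OF smooth_on_imp_continuous_on[OF D1(4)] D1(1) assms(3)] assms(2)])
  have e2: "{y \<in> V. \<Psi> y \<in> U' \<and> y \<in> V'} = (V \<inter> \<Psi> -` U') \<inter> V'" by auto
  show "open {y \<in> V. \<Psi> y \<in> U' \<and> y \<in> V'}"
    unfolding e2 by (rule open_Int[OF continuous_open_preimage[OF smooth_on_imp_continuous_on[OF D1(5)] D1(2) assms(2)] assms(3)])
  show "smooth_on {x \<in> U. x \<in> U' \<and> \<Phi> x \<in> V'} \<Phi>" by (rule smooth_on_subset[OF D1(4)]) auto
  show "smooth_on {y \<in> V. \<Psi> y \<in> U' \<and> y \<in> V'} \<Psi>" by (rule smooth_on_subset[OF D1(5)]) auto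
qed (use symp_chartD[OF 1] in auto)

text \<open>Closedness of the real 1-form sending \<open>v\<close> to \<open>Im (f x * v)\<close>;
  equivalently, the graph of \<open>f\<close> is Lagrangian for \<open>sigma\<close>.\<close>

definition symmetric_deriv :: "complex set \<Rightarrow> (complex \<Rightarrow> complex) \<Rightarrow> bool" where
  "symmetric_deriv D f \<longleftrightarrow> open D \<and> smooth_on D f \<and>
     (\<forall>x\<in>D. \<forall>u v. Im (u * frechet_derivative f (at x) v) = Im (v * frechet_derivative f (at x) u))"

lemma symmetric_derivI:
  assumes "open D" "smooth_on D f" "\<And>x. x \<in> D \<Longrightarrow> (f has_derivative f' x) (at x)"
    "\<And>x u v. x \<in> D \<Longrightarrow> Im (u * f' x v) = Im (v * f' x u)"
  shows "symmetric_deriv D f"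
  unfolding symmetric_deriv_def using assms frechet_derivative_at by metis

lemma symmetric_derivD:
  assumes "symmetric_deriv D f"
  shows "open D" "smooth_on D f" "x \<in> D \<Longrightarrow> (f has_derivative frechet_derivative f (at x)) (at x)"
    "x \<in> D \<Longrightarrow> Im (u * frechet_derivative f (at x) v) = Im (v * frechet_derivative f (at x) u)"
  using assms smooth_on_has_derivative unfolding symmetric_deriv_def by auto

text \<open>Subtracting \<open>f\<close> flattens its graph. The terms of \<open>sigma\<close> that
  contain the derivative of \<open>f\<close> cancel precisely because that derivative is
  symmetric.\<close>

lemma symp_chart_shear_snd:
  assumes "symmetric_deriv D f"
  shows "symp_chart (D \<times> UNIV) (D \<times> UNIV) (\<lambda>x. (fst x, snd x - f (fst x))) (\<lambda>x. (fst x, snd x + f (fst x)))"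
proof (rule symp_chartI[where \<Phi>'="\<lambda>x v. (fst v, snd v - frechet_derivative f (at (fst x)) (fst v))"])
  note D = symmetric_derivD[OF assms]
  show o: "open (D \<times> (UNIV::complex set))" "open (D \<times> (UNIV::complex set))" using D(1) by (auto simp: open_Times)
  have c: "smooth_on (D \<times> (UNIV::complex set)) (\<lambda>x. f (fst x))"
    by (rule smooth_on_compose[OF o(1) D(1,2) smooth_on_fst[OF o(1) smooth_on_id[OF o(1)]]]) auto
  show "smooth_on (D \<times> UNIV) (\<lambda>x. (fst x, snd x - f (fst x)))"
    "smooth_on (D \<times> UNIV) (\<lambda>x. (fst x, snd x + f (fst x)))"
    by (intro smooth_intros c o)+
  fix x :: C2 assume x: "x \<in> D \<times> UNIV"
  have d: "((\<lambda>x. f (fst x)) has_derivative (\<lambda>v. frechet_derivative f (at (fst x)) (fst v))) (at x)"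
    by (rule has_derivative_compose[where f=fst and g=f]) (use D(3)[of "fst x"] x in \<open>auto intro!: derivative_intros\<close>)
  show "((\<lambda>x. (fst x, snd x - f (fst x))) has_derivative
      (\<lambda>v. (fst v, snd v - frechet_derivative f (at (fst x)) (fst v)))) (at x)"
    by (intro has_derivative_Pair has_derivative_diff d) (auto intro!: derivative_intros)
  fix u v
  show "sigma (fst u, snd u - frechet_derivative f (at (fst x)) (fst u))
      (fst v, snd v - frechet_derivative f (at (fst x)) (fst v)) = sigma u v"
    using D(4)[of "fst x" "fst u" "fst v"] x by (auto simp: sigma_def algebra_simps)
qed auto

lemma symp_chart_swap: "symp_chart UNIV UNIV (\<lambda>x. (snd x, - fst x)) (\<lambda>x. (- snd x, fst x))"
proof (rule symp_chartI[where \<Phi>'="\<lambda>x v. (snd v, - fst v)"])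
  show "((\<lambda>x. (snd x, - fst x)) has_derivative (\<lambda>v. (snd v, - fst v))) (at x)" for x :: C2
    by (auto intro!: derivative_eq_intros)
qed (auto intro!: smooth_intros simp: sigma_def)

lemma symp_chart_shear_fst:
  assumes "symmetric_deriv D f"
  shows "symp_chart (UNIV \<times> D) (UNIV \<times> D) (\<lambda>x. (fst x - f (snd x), snd x)) (\<lambda>x. (fst x + f (snd x), snd x))"
proof (rule symp_chartI[where \<Phi>'="\<lambda>x v. (fst v - frechet_derivative f (at (snd x)) (snd v), snd v)"])
  note D = symmetric_derivD[OF assms]
  show o: "open ((UNIV::complex set) \<times> D)" "open ((UNIV::complex set) \<times> D)" using D(1) by (auto simp: open_Times)
  have c: "smooth_on ((UNIV::complex set) \<times> D) (\<lambda>x. f (snd x))"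
    by (rule smooth_on_compose[OF o(1) D(1,2) smooth_on_snd[OF o(1) smooth_on_id[OF o(1)]]]) auto
  show "smooth_on (UNIV \<times> D) (\<lambda>x. (fst x - f (snd x), snd x))"
    "smooth_on (UNIV \<times> D) (\<lambda>x. (fst x + f (snd x), snd x))"
    by (intro smooth_intros c o)+
  fix x :: C2 assume x: "x \<in> UNIV \<times> D"
  have d: "((\<lambda>x. f (snd x)) has_derivative (\<lambda>v. frechet_derivative f (at (snd x)) (snd v))) (at x)"
    by (rule has_derivative_compose[where f=snd and g=f]) (use D(3)[of "snd x"] x in \<open>auto intro!: derivative_intros\<close>)
  show "((\<lambda>x. (fst x - f (snd x), snd x)) has_derivative
      (\<lambda>v. (fst v - frechet_derivative f (at (snd x)) (snd v), snd v))) (at x)"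
    by (intro has_derivative_Pair has_derivative_diff d) (auto intro!: derivative_intros)
  fix u v
  show "sigma (fst u - frechet_derivative f (at (snd x)) (snd u), snd u)
      (fst v - frechet_derivative f (at (snd x)) (snd v), snd v) = sigma u v"
    using D(4)[of "snd x" "snd u" "snd v"] x by (auto simp: sigma_def algebra_simps)
qed auto

text \<open>Since \<open>d\<xi> \<and> d(e\<^sup>\<xi> a\<^sub>2) = e\<^sup>\<xi> d\<xi> \<and> da\<^sub>2 = da\<^sub>1 \<and> da\<^sub>2\<close> for \<open>a\<^sub>1 = e\<^sup>\<xi>\<close>, the pair
  \<open>(log a\<^sub>1, a\<^sub>1 a\<^sub>2)\<close> is again symplectic.\<close>

lemma symp_chart_log:
  "symp_chart {x. fst x / exp \<xi> \<notin> \<real>\<^sub>\<le>\<^sub>0} {y. \<bar>Im (fst y - \<xi>)\<bar> < pi}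
     (\<lambda>x. (\<xi> + Ln (fst x / exp \<xi>), fst x * snd x)) (\<lambda>y. (exp (fst y), exp (- fst y) * snd y))"
  (is "symp_chart ?U ?V ?\<Phi> ?\<Psi>")
proof (rule symp_chartI[where \<Phi>'="\<lambda>x v. (fst v / fst x, fst x * snd v + fst v * snd x)"])
  have "?U = (\<lambda>x. fst x / exp \<xi>) -` (- \<real>\<^sub>\<le>\<^sub>0)" by auto
  then show oU: "open ?U"
    by (auto intro!: open_vimage continuous_intros simp: closed_nonpos_Reals_complex open_Compl)
  have "?V = (\<lambda>y. \<bar>Im (fst y - \<xi>)\<bar>) -` {..<pi}" by auto
  then show oV: "open ?V" by (auto intro!: open_vimage continuous_intros)
  have sU: "smooth_on ?U (\<lambda>x. fst x / exp \<xi>)" by (intro smooth_intros oU) auto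
  show "smooth_on ?U ?\<Phi>"
    by (intro smooth_intros smooth_on_Ln sU oU) auto
  show "smooth_on ?V ?\<Psi>" by (intro smooth_intros oV)
  fix x :: C2 assume x: "x \<in> ?U"
  then have nz: "fst x \<noteq> 0" by auto
  have e: "exp (\<xi> + Ln (fst x / exp \<xi>)) = fst x" using nz by (simp add: exp_add)
  have "\<bar>Im (Ln (fst x / exp \<xi>))\<bar> < pi"
    using x mpi_less_Im_Ln[of "fst x / exp \<xi>"] Im_Ln_less_pi[of "fst x / exp \<xi>"] nz
    by (auto simp: abs_less_iff complex_nonpos_Reals_iff)
  moreover have "exp (- (\<xi> + Ln (fst x / exp \<xi>))) = inverse (fst x)" unfolding exp_minus e ..
  ultimately show "?\<Phi> x \<in> ?V \<and> ?\<Psi> (?\<Phi> x) = x" using e nz by (auto simp: prod_eq_iff)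
  have d1: "((\<lambda>x. fst x / exp \<xi>) has_derivative (\<lambda>v. fst v / exp \<xi>)) (at x)"
    by (auto intro!: derivative_eq_intros)
  have d2: "((\<lambda>x. Ln (fst x / exp \<xi>)) has_derivative (\<lambda>v. inverse (fst x / exp \<xi>) * (fst v / exp \<xi>))) (at x)"
    by (rule has_derivative_compose[OF d1 has_field_derivative_Ln[unfolded has_field_derivative_def]]) (use x in auto)
  show "(?\<Phi> has_derivative (\<lambda>v. (fst v / fst x, fst x * snd v + fst v * snd x))) (at x)"
    by (rule has_derivative_eq_rhs[OF has_derivative_Pair[OF has_derivative_add[OF has_derivative_const d2]
      has_derivative_mult[OF has_derivative_fst[OF has_derivative_ident] has_derivative_snd[OF has_derivative_ident]]]])
      (auto simp: fun_eq_iff divide_simps)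
  fix u v
  show "sigma (fst u / fst x, fst x * snd u + fst u * snd x) (fst v / fst x, fst x * snd v + fst v * snd x) = sigma u v"
  proof -
    have "fst u / fst x * (fst x * snd v + fst v * snd x) - fst v / fst x * (fst x * snd u + fst u * snd x) =
      fst u * snd v - fst v * snd u"
      using nz by (simp add: field_simps)
    then show ?thesis by (simp only: sigma_def fst_conv snd_conv)
  qed
next
  fix y :: C2 assume y: "y \<in> ?V"
  have e: "exp (fst y) / exp \<xi> = exp (fst y - \<xi>)" by (simp add: exp_diff)
  have L: "Ln (exp (fst y - \<xi>)) = fst y - \<xi>" using y by (intro Ln_exp) auto
  have "exp (fst y - \<xi>) \<notin> \<real>\<^sub>\<le>\<^sub>0"
  proof
    assume "exp (fst y - \<xi>) \<in> \<real>\<^sub>\<le>\<^sub>0"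
    then have "sin (Im (fst y - \<xi>)) = 0" "cos (Im (fst y - \<xi>)) \<le> 0"
      by (auto simp: complex_nonpos_Reals_iff Re_exp Im_exp mult_le_0_iff)
    moreover have "Im (fst y - \<xi>) = 0"
      using y sin_eq_0_pi[OF _ _ \<open>sin (Im (fst y - \<xi>)) = 0\<close>] by auto
    ultimately show False by simp
  qed
  then show "?\<Psi> y \<in> ?U \<and> ?\<Phi> (?\<Psi> y) = y" using e L by (auto simp: exp_minus prod_eq_iff)
qed

subsection \<open>Smooth points and transverse double points\<close>

text \<open>A local normal form: one symplectic chart straightens \<open>L\<close> to a coordinate
  plane. It yields both a slice chart and the vanishing of \<open>omega\<close>, and it is stable
  under symplectic changes of coordinates, which is how every piece of the surface is
  checked.\<close>

definition nice :: "C2 set \<Rightarrow> C2 \<Rightarrow> bool" where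
  "nice L x \<longleftrightarrow> (\<exists>U V \<Phi> \<Psi>. symp_chart U V \<Phi> \<Psi> \<and> x \<in> U \<and> (\<forall>y\<in>U. y \<in> L \<longleftrightarrow> snd (\<Phi> y) = 0))"

text \<open>Both branches are straightened by the same symplectic chart, so that a standard handle
  can be inserted in it.\<close>

definition node :: "C2 set \<Rightarrow> C2 \<Rightarrow> bool" where
  "node L x \<longleftrightarrow> (\<exists>U V \<Phi> \<Psi>. symp_chart U V \<Phi> \<Psi> \<and> x \<in> U \<and> \<Phi> x = 0 \<and>
     (\<forall>y\<in>U. y \<in> L \<longleftrightarrow> fst (\<Phi> y) = 0 \<or> snd (\<Phi> y) = 0))"

lemma nice_local:
  assumes "nice L x" "open W" "x \<in> W" "\<And>y. y \<in> W \<Longrightarrow> y \<in> L \<longleftrightarrow> y \<in> L'"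
  shows "nice L' x"
proof -
  obtain U V \<Phi> \<Psi> where *: "symp_chart U V \<Phi> \<Psi>" "x \<in> U" "\<forall>y\<in>U. y \<in> L \<longleftrightarrow> snd (\<Phi> y) = 0"
    using assms(1) unfolding nice_def by metis
  show ?thesis
    unfolding nice_def
    by (rule exI, rule exI, rule exI[of _ \<Phi>], rule exI, rule conjI, rule symp_chart_restrict[OF *(1) assms(2) open_UNIV])
      (use * assms in auto)
qed

lemma node_local:
  assumes "node L x" "open W" "x \<in> W" "\<And>y. y \<in> W \<Longrightarrow> y \<in> L \<longleftrightarrow> y \<in> L'"
  shows "node L' x"
proof -
  obtain U V \<Phi> \<Psi> where *: "symp_chart U V \<Phi> \<Psi>" "x \<in> U" "\<Phi> x = 0" "\<forall>y\<in>U. y \<in> L \<longleftrightarrow> fst (\<Phi> y) = 0 \<or> snd (\<Phi> y) = 0"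
    using assms(1) unfolding node_def by metis
  show ?thesis
    unfolding node_def
    by (rule exI, rule exI, rule exI[of _ \<Phi>], rule exI, rule conjI, rule symp_chart_restrict[OF *(1) assms(2) open_UNIV])
      (use * assms in auto)
qed

lemma nice_symp_chart:
  assumes "symp_chart U V \<Phi> \<Psi>" "x \<in> U" "nice M (\<Phi> x)" "\<And>y. y \<in> U \<Longrightarrow> y \<in> L \<longleftrightarrow> \<Phi> y \<in> M"
  shows "nice L x"
proof -
  note D = symp_chartD[OF assms(1)]
  obtain U2 V2 \<Phi>2 \<Psi>2 where *: "symp_chart U2 V2 \<Phi>2 \<Psi>2" "\<Phi> x \<in> U2" "\<forall>y\<in>U2. y \<in> M \<longleftrightarrow> snd (\<Phi>2 y) = 0"
    using assms(3) unfolding nice_def by metis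
  note D2 = symp_chartD[OF *(1)]
  let ?I = "V \<inter> U2"
  have 1: "symp_chart {y \<in> U. y \<in> UNIV \<and> \<Phi> y \<in> ?I} {z \<in> V. \<Psi> z \<in> UNIV \<and> z \<in> ?I} \<Phi> \<Psi>"
    by (rule symp_chart_restrict[OF assms(1)]) (use D D2 in auto)
  have 2: "symp_chart {y \<in> U2. y \<in> ?I \<and> \<Phi>2 y \<in> UNIV} {z \<in> V2. \<Psi>2 z \<in> ?I \<and> z \<in> UNIV} \<Phi>2 \<Psi>2"
    by (rule symp_chart_restrict[OF *(1)]) (use D D2 in auto)
  have eq: "{z \<in> V. \<Psi> z \<in> UNIV \<and> z \<in> ?I} = {y \<in> U2. y \<in> ?I \<and> \<Phi>2 y \<in> UNIV}" by auto
  show ?thesis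
    unfolding nice_def
    by (rule exI, rule exI, rule exI[of _ "\<lambda>x. \<Phi>2 (\<Phi> x)"], rule exI, rule conjI, rule symp_chart_compose[OF 1 2[folded eq]])
      (use * assms D in auto)
qed

lemma nice_snd_zero: "nice {y. snd y = 0} x"
  unfolding nice_def
  by (rule exI[of _ UNIV], rule exI[of _ UNIV], rule exI[of _ "\<lambda>x. x"], rule exI[of _ "\<lambda>x. x"])
    (auto intro!: symp_chartI[where \<Phi>'="\<lambda>x v. v"] smooth_intros)

lemma nice_fst_zero: "nice {y. fst y = 0} x"
  by (rule nice_symp_chart[OF symp_chart_swap _ nice_snd_zero]) auto

lemma nice_graph:
  assumes "symmetric_deriv D f" "fst x \<in> D" "\<And>y. fst y \<in> D \<Longrightarrow> y \<in> L \<longleftrightarrow> snd y = f (fst y)"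
  shows "nice L x"
  by (rule nice_symp_chart[OF symp_chart_shear_snd[OF assms(1)] _ nice_snd_zero])
    (use assms in \<open>auto simp: mem_Times_iff\<close>)

lemma nice_cograph:
  assumes "symmetric_deriv D f" "snd x \<in> D" "\<And>y. snd y \<in> D \<Longrightarrow> y \<in> L \<longleftrightarrow> fst y = f (snd y)"
  shows "nice L x"
  by (rule nice_symp_chart[OF symp_chart_shear_fst[OF assms(1)] _ nice_fst_zero])
    (use assms in \<open>auto simp: mem_Times_iff\<close>)

subsection \<open>Resolution of transverse double points\<close>

text \<open>Constant up to 2 \<delta>, so that near the circle where the two halves of
  \<open>handle\<close> meet both equations read X Y = \<open>\<i>\<close> \<delta>; zero from 3
  \<delta> on, where the handle has merged with the axes.\<close>

definition handle_profile :: "real \<Rightarrow> real \<Rightarrow> real" where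
  "handle_profile \<delta> t = \<delta> * (1 - step_fun (t / \<delta> - 2))"

text \<open>The level set \<open>X Y = \<i> \<delta>\<close> is a Lagrangian annulus asymptotic to the two axes; the cut-off
  keeps the product \<open>X Y\<close> imaginary, so the set stays Lagrangian by rotational symmetry,
  and makes it agree with the axes away from the origin.\<close>

definition handle :: "real \<Rightarrow> C2 set" where
  "handle \<delta> = {x. (cmod (fst x))\<^sup>2 \<ge> \<delta> \<and> fst x * snd x = \<i> * handle_profile \<delta> ((cmod (fst x))\<^sup>2)}
     \<union> {x. (cmod (snd x))\<^sup>2 \<ge> \<delta> \<and> fst x * snd x = \<i> * handle_profile \<delta> ((cmod (snd x))\<^sup>2)}"

lemma handle_profile_eq:
  assumes "\<delta> > 0"
  shows "t \<le> 2 * \<delta> \<Longrightarrow> handle_profile \<delta> t = \<delta>" "t \<ge> 3 * \<delta> \<Longrightarrow> handle_profile \<delta> t = 0"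
    "0 \<le> handle_profile \<delta> t" "handle_profile \<delta> t \<le> \<delta>"
proof -
  show "t \<le> 2 * \<delta> \<Longrightarrow> handle_profile \<delta> t = \<delta>" "t \<ge> 3 * \<delta> \<Longrightarrow> handle_profile \<delta> t = 0"
    using assms step_fun_0[of "t/\<delta> - 2"] step_fun_1[of "t/\<delta> - 2"]
    by (auto simp: handle_profile_def field_simps)
  show "0 \<le> handle_profile \<delta> t" "handle_profile \<delta> t \<le> \<delta>"
    using assms step_fun_nonneg step_fun_le_1 by (auto simp: handle_profile_def mult_le_cancel_left1)
qed

lemma smooth_on_handle_profile: "smooth_on UNIV (handle_profile \<delta>)"
  unfolding handle_profile_def[abs_def] divide_inverse
  by (intro smooth_intros smooth_on_step_fun) auto

text \<open>The derivative has two symmetric parts. Differentiating the radial profile contributes,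
  thanks to the factor \<open>\<i>\<close>, a real multiple of the product of the inner products of
  X with u and with v; differentiating 1/X is complex linear.\<close>

lemma symmetric_deriv_handle:
  assumes "\<delta> > 0"
  shows "symmetric_deriv {X. (cmod X)\<^sup>2 > \<delta> / 2} (\<lambda>X. \<i> * handle_profile \<delta> ((cmod X)\<^sup>2) / X)"
proof (rule symmetric_derivI)
  let ?D = "{X. (cmod X)\<^sup>2 > \<delta> / 2}"
  have nz: "X \<noteq> 0" if "X \<in> ?D" for X using that assms by auto
  have "?D = (\<lambda>X. (cmod X)\<^sup>2) -` {\<delta>/2<..}" by auto
  then show o: "open ?D" by (auto intro!: open_vimage continuous_intros)
  show "smooth_on ?D (\<lambda>X. \<i> * handle_profile \<delta> ((cmod X)\<^sup>2) / X)"
    by (intro smooth_intros smooth_on_arg[OF _ _ smooth_on_handle_profile] o nz)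
  fix X assume X: "X \<in> ?D"
  define k where "k = handle_profile \<delta> ((cmod X)\<^sup>2)"
  define k' where "k' = frechet_derivative (handle_profile \<delta>) (at ((cmod X)\<^sup>2))"
  have dk: "(handle_profile \<delta> has_derivative k') (at ((cmod X)\<^sup>2))"
    unfolding k'_def using smooth_on_has_derivative[OF smooth_on_handle_profile] by auto
  have lk: "k' t = t * k' 1" for t
    using linear_scale[OF has_derivative_linear[OF dk], of t 1] by simp
  have "((\<lambda>X. (cmod X)\<^sup>2) has_derivative (\<lambda>v. 2 * (X \<bullet> v))) (at X)"
    unfolding power2_norm_eq_inner by (auto intro!: derivative_eq_intros simp: inner_commute)
  from has_derivative_compose[OF this dk]
  have d1: "((\<lambda>X. handle_profile \<delta> ((cmod X)\<^sup>2)) has_derivative (\<lambda>v. (2 * (X \<bullet> v)) * k' 1)) (at X)"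
    by (subst (asm) lk)
  show "((\<lambda>X. \<i> * handle_profile \<delta> ((cmod X)\<^sup>2) / X) has_derivative
      (\<lambda>v. \<i> * of_real (2 * (X \<bullet> v) * k' 1) / X - \<i> * of_real k * v / (X * X))) (at X)"
    by (rule has_derivative_eq_rhs[OF has_derivative_divide'[OF has_derivative_mult_right[OF has_derivative_of_real[OF d1]]
       has_derivative_ident]])
      (use nz[OF X] in \<open>auto simp: fun_eq_iff k_def field_simps\<close>)
  fix u v
  have *: "Im (a * (\<i> * of_real (2 * (X \<bullet> b) * k' 1) / X)) = 2 * (X \<bullet> b) * k' 1 * (X \<bullet> a) / (cmod X)\<^sup>2" for a b
  proof -
    have "Im (a * (\<i> * of_real (2 * (X \<bullet> b) * k' 1) / X)) = Re (a / X) * (2 * (X \<bullet> b) * k' 1)"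
      by (simp add: Im_divide Re_divide algebra_simps add_divide_distrib[symmetric] diff_divide_distrib[symmetric])
    also have "Re (a / X) = (X \<bullet> a) / (cmod X)\<^sup>2"
      by (simp add: Re_divide inner_complex_def cmod_power2 algebra_simps)
    finally show ?thesis by simp
  qed
  have "Im (u * (\<i> * of_real k * v / (X * X))) = Im (v * (\<i> * of_real k * u / (X * X)))"
    by (simp add: algebra_simps)
  then show "Im (u * (\<i> * of_real (2 * (X \<bullet> v) * k' 1) / X - \<i> * of_real k * v / (X * X))) =
      Im (v * (\<i> * of_real (2 * (X \<bullet> u) * k' 1) / X - \<i> * of_real k * u / (X * X)))"
    unfolding right_diff_distrib minus_complex.simps * by (simp add: mult_ac)
qed

lemma handle_swap: "(x, y) \<in> handle \<delta> \<longleftrightarrow> (y, x) \<in> handle \<delta>"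
  by (auto simp: handle_def mult.commute)

text \<open>Near the waist both halves of \<open>handle\<close> obey the same equation. For a point
  of the half over \<open>Y\<close>, the bound on \<open>Y\<close> makes the profile equal to
  \<delta>; then |X|^2 |Y|^2 = \<delta>^2 bounds |X|^2, so the profile at \<open>X\<close> is
  \<delta> too. The converse is the same computation.\<close>

lemma handle_graph:
  assumes "\<delta> > 0" "(cmod X)\<^sup>2 > \<delta> / 2" "(cmod Y)\<^sup>2 < 2 * \<delta>"
  shows "(X, Y) \<in> handle \<delta> \<longleftrightarrow> Y = \<i> * handle_profile \<delta> ((cmod X)\<^sup>2) / X"
proof -
  note k = handle_profile_eq[OF assms(1)]
  have nz: "X \<noteq> 0" using assms by auto
  have sq: "(cmod A)\<^sup>2 * (cmod B)\<^sup>2 = \<delta>\<^sup>2" if "A * B = \<i> * of_real \<delta>" for A B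
    using arg_cong[OF that, of "\<lambda>z. (cmod z)\<^sup>2"] assms(1) by (simp add: norm_mult power_mult_distrib)
  have "(X, Y) \<in> handle \<delta> \<longleftrightarrow> X * Y = \<i> * handle_profile \<delta> ((cmod X)\<^sup>2)"
  proof
    assume "(X, Y) \<in> handle \<delta>"
    then consider "X * Y = \<i> * handle_profile \<delta> ((cmod X)\<^sup>2)"
      | "(cmod Y)\<^sup>2 \<ge> \<delta>" "X * Y = \<i> * handle_profile \<delta> ((cmod Y)\<^sup>2)"
      by (auto simp: handle_def)
    then show "X * Y = \<i> * handle_profile \<delta> ((cmod X)\<^sup>2)"
    proof cases
      case 2
      then have XY: "X * Y = \<i> * \<delta>" using k(1) assms(3) by simp
      have "(cmod X)\<^sup>2 * \<delta> \<le> (cmod X)\<^sup>2 * (cmod Y)\<^sup>2" using 2 by (intro mult_left_mono) auto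
      also have "\<dots> = \<delta> * \<delta>" using sq[OF XY] by (simp add: power2_eq_square)
      finally have "(cmod X)\<^sup>2 \<le> 2 * \<delta>" using assms(1) by simp
      then show ?thesis using XY k(1) by simp
    qed auto
  next
    assume XY: "X * Y = \<i> * handle_profile \<delta> ((cmod X)\<^sup>2)"
    show "(X, Y) \<in> handle \<delta>"
    proof (cases "(cmod X)\<^sup>2 \<ge> \<delta>")
      case True then show ?thesis using XY by (simp add: handle_def)
    next
      case False
      then have XY: "X * Y = \<i> * \<delta>" using XY k(1) assms(1) by simp
      have "\<delta> * \<delta> = (cmod X)\<^sup>2 * (cmod Y)\<^sup>2" using sq[OF XY] by (simp add: power2_eq_square)
      also have "\<dots> \<le> \<delta> * (cmod Y)\<^sup>2" using False by (intro mult_right_mono) auto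
      finally have "(cmod Y)\<^sup>2 \<ge> \<delta>" using assms(1) by simp
      then show ?thesis using XY k(1)[of "(cmod Y)\<^sup>2"] assms(3) by (simp add: handle_def)
    qed
  qed
  also have "\<dots> \<longleftrightarrow> Y = \<i> * handle_profile \<delta> ((cmod X)\<^sup>2) / X"
    using nz by (auto simp: field_simps)
  finally show ?thesis .
qed

lemma handle_small_side:
  assumes "\<delta> > 0" "(cmod X)\<^sup>2 \<ge> \<delta>" "X * Y = \<i> * handle_profile \<delta> ((cmod X)\<^sup>2)"
  shows "(cmod Y)\<^sup>2 \<le> \<delta>"
proof -
  note k = handle_profile_eq[OF assms(1)]
  have "(cmod X)\<^sup>2 * (cmod Y)\<^sup>2 = (handle_profile \<delta> ((cmod X)\<^sup>2))\<^sup>2"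
    using arg_cong[OF assms(3), of "\<lambda>z. (cmod z)\<^sup>2"] by (simp add: norm_mult power_mult_distrib)
  also have "\<dots> \<le> \<delta>\<^sup>2" using k(3,4) by (intro power_mono) auto
  finally have "\<delta> * (cmod Y)\<^sup>2 \<le> \<delta> * \<delta>"
    using mult_right_mono[OF assms(2), of "(cmod Y)\<^sup>2"] by (simp add: power2_eq_square)
  then show ?thesis using assms(1) by simp
qed

text \<open>On the half over A the other coordinate satisfies |B|^2 \<le> \<delta>, so a large total
  forces |A|^2 \<ge> 3 \<delta>, where the profile is zero.\<close>

lemma handle_far:
  assumes "\<delta> > 0" "(cmod X)\<^sup>2 + (cmod Y)\<^sup>2 \<ge> 4 * \<delta>"
  shows "(X, Y) \<in> handle \<delta> \<longleftrightarrow> X = 0 \<or> Y = 0"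
proof -
  note k = handle_profile_eq[OF assms(1)]
  have *: "A = 0 \<or> B = 0" if "(cmod A)\<^sup>2 \<ge> \<delta>" "A * B = \<i> * handle_profile \<delta> ((cmod A)\<^sup>2)"
    "(cmod A)\<^sup>2 + (cmod B)\<^sup>2 \<ge> 4 * \<delta>" for A B
    using handle_small_side[OF assms(1) that(1,2)] that k(2)[of "(cmod A)\<^sup>2"] by auto
  show ?thesis
  proof
    assume "(X, Y) \<in> handle \<delta>" then show "X = 0 \<or> Y = 0"
      using *[of X Y] *[of Y X] assms(2) by (auto simp: handle_def mult.commute add.commute)
  next
    assume "X = 0 \<or> Y = 0" then show "(X, Y) \<in> handle \<delta>"
      using assms k(2) by (auto simp: handle_def)
  qed
qed

lemma closed_handle: "closed (handle \<delta>)"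
proof -
  have c: "continuous_on UNIV (\<lambda>x. handle_profile \<delta> ((cmod (f x))\<^sup>2))" if "continuous_on UNIV f" for f :: "C2 \<Rightarrow> complex"
    by (rule continuous_on_compose2[OF smooth_on_imp_continuous_on[OF smooth_on_handle_profile]])
      (auto intro!: continuous_intros that)
  show ?thesis
    unfolding handle_def
    by (intro closed_Un closed_Collect_conj closed_Collect_le closed_Collect_eq continuous_intros c)
qed

lemma nice_handle:
  assumes "\<delta> > 0" "x \<in> handle \<delta>"
  shows "nice (handle \<delta>) x"
proof -
  let ?f = "\<lambda>X. \<i> * handle_profile \<delta> ((cmod X)\<^sup>2) / X"
  let ?D = "{X. (cmod X)\<^sup>2 > \<delta> / 2}"
  have oD: "open (?D \<times> {X. (cmod X)\<^sup>2 < 2 * \<delta>})" "open ({X. (cmod X)\<^sup>2 < 2 * \<delta>} \<times> ?D)"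
    by (auto intro!: open_Times open_Collect_less continuous_intros)
  obtain X Y where x: "x = (X, Y)" by force
  from assms(2) x consider "(cmod X)\<^sup>2 \<ge> \<delta>" "X * Y = \<i> * handle_profile \<delta> ((cmod X)\<^sup>2)"
     | "(cmod Y)\<^sup>2 \<ge> \<delta>" "Y * X = \<i> * handle_profile \<delta> ((cmod Y)\<^sup>2)"
    by (auto simp: handle_def mult.commute)
  then show ?thesis
  proof cases
    case 1
    show ?thesis
    proof (rule nice_local[OF nice_graph[OF symmetric_deriv_handle[OF assms(1)], where L="{y. snd y = ?f (fst y)}"] oD(1)])
      show "x \<in> ?D \<times> {X. (cmod X)\<^sup>2 < 2 * \<delta>}" "fst x \<in> ?D"
        using 1 handle_small_side[OF assms(1) 1] assms(1) x by auto
    qed (use handle_graph[OF assms(1)] in \<open>auto simp: mem_Times_iff\<close>)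
  next
    case 2
    show ?thesis
    proof (rule nice_local[OF nice_cograph[OF symmetric_deriv_handle[OF assms(1)], where L="{y. fst y = ?f (snd y)}"] oD(2)])
      show "x \<in> {X. (cmod X)\<^sup>2 < 2 * \<delta>} \<times> ?D" "snd x \<in> ?D"
        using 2 handle_small_side[OF assms(1) 2] assms(1) x by auto
      fix y assume "y \<in> {X. (cmod X)\<^sup>2 < 2 * \<delta>} \<times> ?D"
      then show "y \<in> {y. fst y = ?f (snd y)} \<longleftrightarrow> y \<in> handle \<delta>"
        using handle_graph[OF assms(1), of "snd y" "fst y"] handle_swap[of "fst y" "snd y" \<delta>]
        by (auto simp: mem_Times_iff)
    qed simp
  qed
qed

text \<open>The handle is inserted in a ball of the chart. As it agrees with the axes outside that
  ball, it continues \<open>L\<close>; the compact set \<open>C\<close> is where \<open>L\<close>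
  has been changed.\<close>

lemma resolve_node:
  assumes "closed L" "node L x" "open W" "x \<in> W"
  obtains L' C where "closed L'" "compact C" "C \<subseteq> W" "x \<in> C" "\<And>y. y \<notin> C \<Longrightarrow> y \<in> L' \<longleftrightarrow> y \<in> L"
    "\<And>y. y \<in> L' \<Longrightarrow> y \<in> C \<Longrightarrow> nice L' y"
proof -
  obtain U V \<Phi> \<Psi> where ch: "symp_chart U V \<Phi> \<Psi>" and x: "x \<in> U" "\<Phi> x = 0"
    and L: "\<And>y. y \<in> U \<Longrightarrow> y \<in> L \<longleftrightarrow> fst (\<Phi> y) = 0 \<or> snd (\<Phi> y) = 0"
    using assms(2) unfolding node_def by metis
  note D = symp_chartD[OF ch]
  have oV: "open (V \<inter> \<Psi> -` W)"
    by (rule continuous_open_preimage[OF smooth_on_imp_continuous_on[OF D(5)] D(2) assms(3)])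
  have "0 \<in> V \<inter> \<Psi> -` W" using D(6)[OF x(1)] D(7)[OF x(1)] x assms(4) by auto
  then obtain e where e: "e > 0" "cball 0 e \<subseteq> V \<inter> \<Psi> -` W"
    using oV open_contains_cball_eq by metis
  define c where "c = e / 2"
  \<comment> \<open>Then 4 \<delta> = c^2, so \<open>handle_far\<close> applies outside the ball of
    radius \<open>c\<close>.\<close>
  define \<delta> where "\<delta> = c\<^sup>2 / 4"
  have c: "c > 0" "c < e" "\<delta> > 0" using e by (auto simp: c_def \<delta>_def)
  define C where "C = \<Psi> ` cball 0 c"
  have cV: "cball 0 c \<subseteq> V" "cball 0 c \<subseteq> \<Psi> -` W" using e c by auto
  have far: "z \<in> handle \<delta> \<longleftrightarrow> fst z = 0 \<or> snd z = 0" if "norm z > c" for z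
  proof -
    have "c\<^sup>2 \<le> (norm z)\<^sup>2" using that c by (intro power_mono) auto
    then have "(cmod (fst z))\<^sup>2 + (cmod (snd z))\<^sup>2 \<ge> 4 * \<delta>"
      by (simp add: norm_prod_def \<delta>_def)
    then show ?thesis using handle_far[OF c(3), of "fst z" "snd z"] by simp
  qed
  define L' where "L' = (L - C) \<union> {y \<in> C. \<Phi> y \<in> handle \<delta>}"
  have inC: "y \<in> C \<longleftrightarrow> norm (\<Phi> y) \<le> c" if "y \<in> U" for y
  proof
    assume "y \<in> C" then show "norm (\<Phi> y) \<le> c" unfolding C_def using D(9) cV by auto
  next
    assume "norm (\<Phi> y) \<le> c" then show "y \<in> C" unfolding C_def using D(7)[OF that]
      by (metis image_eqI mem_cball_0)
  qed
  have CU: "C \<subseteq> U" unfolding C_def using D(8) cV by auto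
  have L': "y \<in> L' \<longleftrightarrow> \<Phi> y \<in> handle \<delta>" if "y \<in> U" for y
    \<comment> \<open>Outside radius \<open>c\<close> the handle coincides with the axes, so
      \<open>handle\<close> describes the new set in the whole chart and not only in
      \<open>C\<close>.\<close>
    using inC[OF that] L[OF that] far[of "\<Phi> y"] by (auto simp: L'_def not_le)
  have off: "y \<in> L' \<longleftrightarrow> y \<in> L" if "y \<notin> C" for y using that by (auto simp: L'_def)
  have compC: "compact C" unfolding C_def
    by (rule compact_continuous_image[OF continuous_on_subset[OF smooth_on_imp_continuous_on[OF D(5)] cV(1)] compact_cball])
  have "open (- L')"
  proof (rule openI)
    fix y assume y: "y \<in> - L'"
    show "\<exists>e>0. ball y e \<subseteq> - L'"
    proof (cases "y \<in> C")
      case True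
      have "open (U \<inter> \<Phi> -` (- handle \<delta>))"
        by (rule continuous_open_preimage[OF smooth_on_imp_continuous_on[OF D(4)] D(1)]) (simp add: closed_handle open_Compl)
      moreover have "y \<in> U \<inter> \<Phi> -` (- handle \<delta>)" using True CU L'[of y] y by auto
      moreover have "U \<inter> \<Phi> -` (- handle \<delta>) \<subseteq> - L'" using L' by auto
      ultimately show ?thesis by (meson openE subset_trans)
    next
      case False
      have "open (- C \<inter> - L)" using compC assms(1) by (simp add: compact_imp_closed open_Compl open_Int)
      moreover have "y \<in> - C \<inter> - L" using False y off by auto
      moreover have "- C \<inter> - L \<subseteq> - L'" using off by auto
      ultimately show ?thesis by (meson openE subset_trans)
    qed
  qed
  then have "closed L'" by (simp add: closed_open)
  moreover have "C \<subseteq> W" using cV by (auto simp: C_def)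
  moreover have "x \<in> C" using inC[OF x(1)] x c by simp
  moreover have "nice L' y" if "y \<in> L'" "y \<in> C" for y
  proof (rule nice_symp_chart[OF ch _ nice_handle[OF c(3)]])
    show "y \<in> U" using that CU by auto
    show "\<Phi> y \<in> handle \<delta>" using that L'[of y] CU by auto
  qed (use L' in auto)
  ultimately show ?thesis using that[of L' C] compC off by blast
qed

lemma resolve_nodes:
  assumes "finite D" "closed L" "\<And>x. x \<in> D \<Longrightarrow> node L x" "\<And>x. x \<in> L \<Longrightarrow> x \<notin> D \<Longrightarrow> nice L x"
    "open W" "D \<subseteq> W"
  obtains L' where "closed L'" "\<And>x. x \<in> L' \<Longrightarrow> nice L' x" "\<And>x. x \<notin> W \<Longrightarrow> x \<in> L' \<longleftrightarrow> x \<in> L"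
proof -
  have "\<exists>L'. closed L' \<and> (\<forall>x\<in>L'. nice L' x) \<and> (\<forall>x. x \<notin> W \<longrightarrow> (x \<in> L' \<longleftrightarrow> x \<in> L))"
    using assms(1-4,6)
  proof (induction D arbitrary: L rule: finite_induct)
    case empty then show ?case by blast
  next
    case (insert d D)
    \<comment> \<open>Removing the remaining nodes from the allowed region keeps this handle away
      from them, so they are nodes of the new set as well.\<close>
    have "open (W - D)" "d \<in> W - D" using insert assms(5) by (auto simp: open_Diff finite_imp_closed)
    from resolve_node[OF insert.prems(1) insert.prems(2)[of d] this]
    obtain L' C where *: "closed L'" "compact C" "C \<subseteq> W - D" "d \<in> C" "\<And>y. y \<notin> C \<Longrightarrow> y \<in> L' \<longleftrightarrow> y \<in> L"
      "\<And>y. y \<in> L' \<Longrightarrow> y \<in> C \<Longrightarrow> nice L' y" by auto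
    have oC: "open (- C)" using *(2) by (simp add: compact_imp_closed open_Compl)
    have 1: "node L' x" if "x \<in> D" for x
      by (rule node_local[OF insert.prems(2) oC]) (use that *(3,5) in auto)
    have 2: "nice L' x" if "x \<in> L'" "x \<notin> D" for x
    proof (cases "x \<in> C")
      case False
      then have "nice L x" using that * insert.prems(3)[of x] by auto
      then show ?thesis by (rule nice_local[OF _ oC]) (use False *(5) in auto)
    qed (use that * in auto)
    have "\<exists>L''. closed L'' \<and> (\<forall>x\<in>L''. nice L'' x) \<and> (\<forall>x. x \<notin> W \<longrightarrow> (x \<in> L'' \<longleftrightarrow> x \<in> L'))"
      by (rule insert.IH[OF *(1) 1 2]) (use insert.prems in auto)
    then obtain L'' where **: "closed L''" "\<forall>x\<in>L''. nice L'' x" "\<forall>x. x \<notin> W \<longrightarrow> (x \<in> L'' \<longleftrightarrow> x \<in> L')"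
      by blast
    have "x \<in> L'' \<longleftrightarrow> x \<in> L" if "x \<notin> W" for x
      using **(3) that *(3) *(5)[of x] by blast
    then show ?case using ** by blast
  qed
  then show ?thesis using that by blast
qed

subsection \<open>Passing to the coordinates \<open>z\<^sub>1, z\<^sub>2\<close>\<close>

definition unrot :: "C2 \<Rightarrow> C2" where
  "unrot x = ((fst x + cnj (snd x)) / sqrt 2, (snd x - cnj (fst x)) / sqrt 2)"

lemma rot_eq: "rot x = ((fst x - cnj (snd x)) / sqrt 2, (snd x + cnj (fst x)) / sqrt 2)"
  by (simp add: rot_def split_beta)

lemma unrot_rot [simp]: "unrot (rot x) = x" and rot_unrot [simp]: "rot (unrot x) = x"
proof -
  have s: "complex_of_real (sqrt 2) * complex_of_real (sqrt 2) = 2"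
    by (simp flip: of_real_mult)
  show "unrot (rot x) = x" "rot (unrot x) = x"
    by (simp_all add: unrot_def rot_eq prod_eq_iff s add_divide_distrib[symmetric] diff_divide_distrib[symmetric])
qed

lemma bounded_linear_rot: "bounded_linear rot" and bounded_linear_unrot: "bounded_linear unrot"
  unfolding linear_conv_bounded_linear[symmetric]
  by (auto intro!: linearI simp: rot_eq unrot_def scaleR_conv_of_real algebra_simps add_divide_distrib diff_divide_distrib)

lemma inner_rot: "rot u \<bullet> rot v = u \<bullet> v"
  unfolding dot_norm by (simp add: norm_rot bounded_linear.linear[OF bounded_linear_rot] linear_add[symmetric])

lemma smooth_on_rot: "open S \<Longrightarrow> smooth_on S rot" and smooth_on_unrot: "open S \<Longrightarrow> smooth_on S unrot"
  using smooth_on_bounded_linear[OF _ bounded_linear_rot smooth_on_id]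
    smooth_on_bounded_linear[OF _ bounded_linear_unrot smooth_on_id] by auto

lemma nice_imp_properly_embedded:
  assumes "closed L" "\<And>x. x \<in> L \<Longrightarrow> nice L x"
  shows "properly_embedded_submanifold 2 (rot -` L)"
  unfolding properly_embedded_submanifold_def
proof
  show "embedded_submanifold 2 (rot -` L)"
    unfolding embedded_submanifold_def
  proof
    fix p assume "p \<in> rot -` L"
    then have "nice L (rot p)" using assms(2) by auto
    then obtain U V \<Phi> \<Psi> where ch: "symp_chart U V \<Phi> \<Psi>" "rot p \<in> U" "\<And>y. y \<in> U \<Longrightarrow> y \<in> L \<longleftrightarrow> snd (\<Phi> y) = 0"
      unfolding nice_def by metis
    note D = symp_chartD[OF ch(1)]
    define T where "T = {y::C2. snd y = 0}"
    have oU: "open (rot -` U)"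
      using D(1) by (intro open_vimage) (auto intro: linear_continuous_on bounded_linear_rot)
    have s1: "smooth_on (rot -` U) (\<lambda>x. \<Phi> (rot x))"
      by (rule smooth_on_compose[OF oU D(1,4) smooth_on_rot[OF oU]]) auto
    have s2: "smooth_on V (\<lambda>x. unrot (\<Psi> x))"
      by (rule smooth_on_bounded_linear[OF D(2) bounded_linear_unrot D(5)])
    have "diffeomorphism (rot -` U) V (\<lambda>x. \<Phi> (rot x)) (\<lambda>x. unrot (\<Psi> x))"
      unfolding diffeomorphism_def
    proof (intro conjI homeomorphismI smooth_mapI_smooth_on[OF oU order_refl s1] smooth_mapI_smooth_on[OF D(2) order_refl s2]
        smooth_on_imp_continuous_on[OF s1] smooth_on_imp_continuous_on[OF s2])
    qed (use D in auto)
    moreover have "subspace T" unfolding T_def by (auto intro!: subspaceI)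
    moreover have "dim T = 2"
    proof -
      have T: "T = (\<lambda>x::complex. (x, 0::complex)) ` UNIV" by (auto simp: T_def)
      have "dim T = dim (UNIV :: complex set)"
        unfolding T by (rule dim_image_eq) (auto intro!: linearI inj_onI)
      then show ?thesis by simp
    qed
    moreover have "(\<lambda>x. \<Phi> (rot x)) ` (rot -` L \<inter> rot -` U) = T \<inter> V"
    proof
      show "(\<lambda>x. \<Phi> (rot x)) ` (rot -` L \<inter> rot -` U) \<subseteq> T \<inter> V" using ch(3) D(6) by (auto simp: T_def)
      show "T \<inter> V \<subseteq> (\<lambda>x. \<Phi> (rot x)) ` (rot -` L \<inter> rot -` U)"
      proof
        fix y assume y: "y \<in> T \<inter> V"
        then have "y = \<Phi> (rot (unrot (\<Psi> y)))" "unrot (\<Psi> y) \<in> rot -` L \<inter> rot -` U"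
          using D(8,9)[of y] ch(3)[of "\<Psi> y"] by (auto simp: T_def)
        then show "y \<in> (\<lambda>x. \<Phi> (rot x)) ` (rot -` L \<inter> rot -` U)" by (rule image_eqI)
      qed
    qed
    ultimately show "\<exists>U V \<phi> \<psi> (T :: C2 set). open U \<and> p \<in> U \<and> open V \<and> diffeomorphism U V \<phi> \<psi> \<and>
        subspace T \<and> dim T = 2 \<and> \<phi> ` (rot -` L \<inter> U) = T \<inter> V"
      using oU D(2) ch(2)
      by (intro exI[of _ "rot -` U"] exI[of _ V] exI[of _ "\<lambda>x. \<Phi> (rot x)"] exI[of _ "\<lambda>x. unrot (\<Psi> x)"] exI[of _ T]) auto
  qed
  have "closed (rot -` L)"
    using assms(1) by (intro closed_vimage) (auto intro: linear_continuous_on bounded_linear_rot)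
  then show "proper_map (top_of_set (rot -` L)) euclidean (\<lambda>x. x)"
    using proper_map_inclusion[of "rot -` L" euclidean]
    by (auto simp: id_def closed_Int_compact)
qed

text \<open>Along a curve in \<open>L\<close> the second chart coordinate stays zero, so the chart
  carries its velocity into the plane \<open>snd = 0\<close>, on which \<open>sigma\<close>
  vanishes.\<close>

lemma nice_imp_Lagrangian:
  assumes "\<And>x. x \<in> L \<Longrightarrow> nice L x"
  shows "Lagrangian (rot -` L)"
  unfolding Lagrangian_def
proof (intro ballI)
  fix p u v assume p: "p \<in> rot -` L" and u: "u \<in> tangent_space (rot -` L) p" and v: "v \<in> tangent_space (rot -` L) p"
  then have "nice L (rot p)" using assms(1) by auto
  then obtain U V \<Phi> \<Psi> where ch: "symp_chart U V \<Phi> \<Psi>" "rot p \<in> U" "\<And>y. y \<in> U \<Longrightarrow> y \<in> L \<longleftrightarrow> snd (\<Phi> y) = 0"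
    unfolding nice_def by metis
  note D = symp_chartD[OF ch(1)]
  define \<Phi>' where "\<Phi>' = frechet_derivative \<Phi> (at (rot p))"
  have *: "snd (\<Phi>' (rot u)) = 0" if u: "u \<in> tangent_space (rot -` L) p" for u
  proof -
    obtain e \<gamma> where e: "e > 0" and \<gamma>: "smooth_on {-e<..<e::real} \<gamma>" "\<gamma> ` {-e<..<e} \<subseteq> rot -` L" "\<gamma> 0 = p"
      "(\<gamma> has_vector_derivative u) (at 0)"
      using u unfolding tangent_space_def by auto
    have "((\<lambda>t. rot (\<gamma> t)) has_derivative (\<lambda>t. rot (t *\<^sub>R u))) (at 0)"
      using \<gamma>(4) unfolding has_vector_derivative_def by (rule bounded_linear.has_derivative[OF bounded_linear_rot])
    moreover have "(\<Phi> has_derivative \<Phi>') (at (rot (\<gamma> 0)))"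
      unfolding \<Phi>'_def \<gamma>(3) by (rule D(10)[OF ch(2)])
    ultimately have "((\<lambda>t. \<Phi> (rot (\<gamma> t))) has_derivative (\<lambda>t. \<Phi>' (rot (t *\<^sub>R u)))) (at 0)"
      by (rule has_derivative_compose)
    then have d: "((\<lambda>t. snd (\<Phi> (rot (\<gamma> t)))) has_derivative (\<lambda>t. snd (\<Phi>' (rot (t *\<^sub>R u))))) (at 0)"
      by (rule has_derivative_snd)
    have c: "continuous_on {-e<..<e} (\<lambda>t. rot (\<gamma> t))"
      using linear_continuous_on_compose[OF smooth_on_imp_continuous_on[OF \<gamma>(1)] bounded_linear.linear[OF bounded_linear_rot]] .
    have "open ({-e<..<e} \<inter> (\<lambda>t. rot (\<gamma> t)) -` U)"
      by (rule continuous_open_preimage[OF c _ D(1)]) auto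
    moreover have "0 \<in> {-e<..<e} \<inter> (\<lambda>t. rot (\<gamma> t)) -` U" using e \<gamma>(3) ch(2) by auto
    moreover have "snd (\<Phi> (rot (\<gamma> t))) = 0" if "t \<in> {-e<..<e} \<inter> (\<lambda>t. rot (\<gamma> t)) -` U" for t
    proof -
      have "\<gamma> t \<in> rot -` L" using that \<gamma>(2) by blast
      then show ?thesis using that ch(3)[of "rot (\<gamma> t)"] by auto
    qed
    ultimately have "((\<lambda>t. 0) has_derivative (\<lambda>t. snd (\<Phi>' (rot (t *\<^sub>R u))))) (at 0)"
      by (rule has_derivative_transform_within_open[OF d])
    then have "(\<lambda>t. snd (\<Phi>' (rot (t *\<^sub>R u)))) = (\<lambda>t. 0)"
      using has_derivative_unique[OF _ has_derivative_const] by blast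
    from fun_cong[OF this, of 1] show ?thesis by simp
  qed
  have "sigma (rot u) (rot v) = sigma (\<Phi>' (rot u)) (\<Phi>' (rot v))"
    using D(11)[OF ch(2)] by (simp add: \<Phi>'_def)
  also have "\<dots> = 0" using *[OF u] *[OF v] by (simp add: sigma_def)
  finally show "omega u v = 0" by (simp add: omega_eq_sigma)
qed

section \<open>Tangent vectors and transversality to round spheres\<close>

lemma tangent_space_sphere:
  fixes p :: "'a::euclidean_space"
  assumes "norm p = r" "r > 0" "v \<bullet> p = 0"
  shows "v \<in> tangent_space (sphere 0 r) p"
proof (cases "v = 0")
  case True
  have "((\<lambda>t::real. p) has_vector_derivative v) (at 0)" using True by simp
  then show ?thesis unfolding tangent_space_def using assms
    by (auto intro!: exI[of _ 1] exI[of _ "\<lambda>t::real. p"] smooth_on_const)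
next
  case False
  \<comment> \<open>The angular speed of the great circle through \<open>p\<close> with velocity
    \<open>v\<close>; it is divided by below, hence the separate case of
    \<open>v = 0\<close>.\<close>
  define a where "a = norm v / r"
  have a: "a > 0" using False assms by (simp add: a_def)
  define \<gamma> where "\<gamma> t = cos (a * t) *\<^sub>R p + (sin (a * t) / a) *\<^sub>R v" for t
  have "smooth_on {-1<..<1} \<gamma>" unfolding \<gamma>_def[abs_def] divide_inverse
    by (intro smooth_intros) auto
  moreover have "norm (\<gamma> t) = r" for t
  proof -
    have "(norm (\<gamma> t))\<^sup>2 = (cos (a*t))\<^sup>2 * (norm p)\<^sup>2 + (sin (a*t) / a)\<^sup>2 * (norm v)\<^sup>2"
      unfolding \<gamma>_def power2_norm_eq_inner using assms(3)
      by (simp add: inner_add_left inner_add_right inner_commute power2_eq_square)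
    also have "\<dots> = ((cos (a*t))\<^sup>2 + (sin (a*t))\<^sup>2) * r\<^sup>2"
    proof -
      have "norm v = a * r" using assms(2) by (simp add: a_def)
      then have "(sin (a*t) / a)\<^sup>2 * (norm v)\<^sup>2 = (sin (a*t))\<^sup>2 * r\<^sup>2"
        using a by (simp add: power_divide power_mult_distrib)
      then show ?thesis by (simp only: assms(1) distrib_right)
    qed
    also have "\<dots> = r\<^sup>2" by (simp only: sin_cos_squared_add2 mult_1)
    finally show ?thesis using assms(2) by (simp add: power2_eq_iff_nonneg)
  qed
  moreover have "(\<gamma> has_vector_derivative v) (at 0)"
    unfolding \<gamma>_def[abs_def] using a
    by (auto intro!: derivative_eq_intros)
  ultimately show ?thesis unfolding tangent_space_def
    by (auto intro!: exI[of _ "1::real"] exI[of _ \<gamma>] simp: \<gamma>_def)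
qed

lemma tangent_space_scaleR:
  assumes "v \<in> tangent_space S p"
  shows "c *\<^sub>R v \<in> tangent_space S p"
proof -
  obtain e \<gamma> where e: "e > 0" and \<gamma>: "smooth_on {-e<..<e::real} \<gamma>" "\<gamma> ` {-e<..<e} \<subseteq> S" "\<gamma> 0 = p"
    "(\<gamma> has_vector_derivative v) (at 0)"
    using assms unfolding tangent_space_def by auto
  \<comment> \<open>The added 1 avoids a division by zero when \<open>c\<close> is 0.\<close>
  define d where "d = e / (\<bar>c\<bar> + 1)"
  have d: "d > 0" using e by (auto simp: d_def)
  have ct: "c * t \<in> {-e<..<e}" if "t \<in> {-d<..<d}" for t
  proof -
    have "\<bar>c * t\<bar> \<le> (\<bar>c\<bar> + 1) * \<bar>t\<bar>" by (simp add: abs_mult mult_right_mono)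
    also have "\<dots> < (\<bar>c\<bar> + 1) * d" using that by (intro mult_strict_left_mono) auto
    finally show ?thesis by (auto simp: d_def)
  qed
  have "smooth_on {-d<..<d} (\<lambda>t. \<gamma> (c * t))"
    by (rule smooth_on_compose[OF _ _ \<gamma>(1)]) (use ct in \<open>auto intro!: smooth_intros\<close>)
  moreover have "((\<lambda>t. \<gamma> (c * t)) has_vector_derivative c *\<^sub>R v) (at 0)"
  proof -
    have "((\<lambda>t. c * t) has_vector_derivative c) (at 0)" by (auto intro!: derivative_eq_intros)
    from vector_diff_chain_at[OF this, of \<gamma> v] show ?thesis using \<gamma>(4) by (simp add: o_def)
  qed
  ultimately show ?thesis unfolding tangent_space_def
    using d ct \<gamma>(2,3) by (intro CollectI exI[of _ d] conjI exI[of _ "\<lambda>t. \<gamma> (c * t)"]) auto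
qed

text \<open>The tangent space of the sphere contains the hyperplane orthogonal to \<open>p\<close>,
  so a single tangent vector of \<open>L\<close> off that hyperplane completes it.\<close>

lemma transverse_sphereI:
  fixes L :: "'a::euclidean_space set"
  assumes "r > 0" "\<And>p. p \<in> L \<Longrightarrow> norm p = r \<Longrightarrow> \<exists>w\<in>tangent_space L p. w \<bullet> p \<noteq> 0"
  shows "transverse L (sphere 0 r)"
  unfolding transverse_def
proof
  fix p assume "p \<in> L \<inter> sphere 0 r"
  then have p: "p \<in> L" "norm p = r" by auto
  from assms(2)[OF this] obtain w where w: "w \<in> tangent_space L p" "w \<bullet> p \<noteq> 0" by auto
  have "u \<in> {u + v |u v. u \<in> tangent_space L p \<and> v \<in> tangent_space (sphere 0 r) p}" for u
  proof -
    define c where "c = (u \<bullet> p) / (w \<bullet> p)"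
    have "(u - c *\<^sub>R w) \<bullet> p = 0" using w by (simp add: c_def inner_diff_left)
    then have "u - c *\<^sub>R w \<in> tangent_space (sphere 0 r) p"
      using tangent_space_sphere[OF p(2) assms(1)] by auto
    moreover have "u = c *\<^sub>R w + (u - c *\<^sub>R w)" by simp
    ultimately show ?thesis using tangent_space_scaleR[OF w(1), of c] by blast
  qed
  then show "{u + v |u v. u \<in> tangent_space L p \<and> v \<in> tangent_space (sphere 0 r) p} = UNIV" by blast
qed

lemma tangent_space_unrot:
  assumes "w \<in> tangent_space L x"
  shows "unrot w \<in> tangent_space (rot -` L) (unrot x)"
proof -
  obtain e \<gamma> where e: "e > 0" and \<gamma>: "smooth_on {-e<..<e::real} \<gamma>" "\<gamma> ` {-e<..<e} \<subseteq> L" "\<gamma> 0 = x"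
    "(\<gamma> has_vector_derivative w) (at 0)"
    using assms unfolding tangent_space_def by auto
  have "((\<lambda>t. unrot (\<gamma> t)) has_vector_derivative unrot w) (at 0)"
    using bounded_linear.has_vector_derivative[OF bounded_linear_unrot \<gamma>(4)] .
  moreover have "smooth_on {-e<..<e} (\<lambda>t. unrot (\<gamma> t))"
    by (rule smooth_on_bounded_linear[OF _ bounded_linear_unrot \<gamma>(1)]) auto
  ultimately show ?thesis
    unfolding tangent_space_def using e \<gamma>(2,3) by (intro CollectI exI[of _ e] conjI exI[of _ "\<lambda>t. unrot (\<gamma> t)"]) auto
qed

lemma transverse_rot_sphereI:
  assumes "r > 0" "\<And>x. x \<in> L \<Longrightarrow> norm x = r \<Longrightarrow> \<exists>w\<in>tangent_space L x. w \<bullet> x \<noteq> 0"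
  shows "transverse (rot -` L) (sphere 0 r)"
proof (rule transverse_sphereI[OF assms(1)])
  fix p assume p: "p \<in> rot -` L" "norm p = r"
  then obtain w where w: "w \<in> tangent_space L (rot p)" "w \<bullet> rot p \<noteq> 0"
    using assms(2)[of "rot p"] by (auto simp: norm_rot)
  then show "\<exists>w\<in>tangent_space (rot -` L) p. w \<bullet> p \<noteq> 0"
    using tangent_space_unrot[OF w(1)] inner_rot[of "unrot w" p] by (intro bexI[of _ "unrot w"]) auto
qed

lemma diffeomorphismI:
  assumes "open U" "open V" "smooth_on U f" "smooth_on V g"
    "\<And>x. x \<in> U \<Longrightarrow> f x \<in> V \<and> g (f x) = x" "\<And>y. y \<in> V \<Longrightarrow> g y \<in> U \<and> f (g y) = y"
  shows "diffeomorphism U V f g"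
  unfolding diffeomorphism_def
  by (intro conjI homeomorphismI smooth_mapI_smooth_on[OF assms(1) order_refl assms(3)]
      smooth_mapI_smooth_on[OF assms(2) order_refl assms(4)] smooth_on_imp_continuous_on assms(3,4))
    (use assms(5,6) in auto)

section \<open>Braids as families of strands\<close>

text \<open>The new label depends on \<open>p\<close> and \<open>k\<close> only, so one
  \<open>q\<close> serves all \<open>x\<close>. Negative \<open>k\<close> takes preimages under
  \<open>\<pi>\<close>, hence the bijection.\<close>

lemma equivariant_shift:
  fixes F :: "'p \<Rightarrow> 'a::real_vector \<Rightarrow> 'b"
  assumes "bij_betw \<pi> P P" "\<And>p x. p \<in> P \<Longrightarrow> F p (x + w) = F (\<pi> p) x" "p \<in> P"
  shows "\<exists>q\<in>P. \<forall>x. F p (x + of_int k *\<^sub>R w) = F q x"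
proof -
  have 1: "\<exists>q\<in>P. \<forall>x. F p (x + real n *\<^sub>R w) = F q x" if "p \<in> P" for n p
    using that
  proof (induction n arbitrary: p)
    case (Suc n)
    have "\<pi> p \<in> P" using assms(1) Suc.prems bij_betwE by metis
    then obtain q where q: "q \<in> P" "\<And>x. F (\<pi> p) (x + real n *\<^sub>R w) = F q x" using Suc.IH by metis
    have "F p (x + real (Suc n) *\<^sub>R w) = F q x" for x
      using assms(2)[OF Suc.prems, of "x + real n *\<^sub>R w"] q(2)[of x] by (simp add: algebra_simps)
    then show ?case using q(1) by blast
  qed auto
  have 2: "\<exists>q\<in>P. \<forall>x. F p (x - real n *\<^sub>R w) = F q x" if "p \<in> P" for n p
    using that
  proof (induction n arbitrary: p)
    case (Suc n)
    obtain p' where p': "p' \<in> P" "p = \<pi> p'" using assms(1) Suc.prems by (metis bij_betw_imp_surj_on imageE)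
    then obtain q where q: "q \<in> P" "\<And>x. F p' (x - real n *\<^sub>R w) = F q x" using Suc.IH by metis
    have "F p (x - real (Suc n) *\<^sub>R w) = F q x" for x
      using assms(2)[OF p'(1), of "x - real (Suc n) *\<^sub>R w"] q(2)[of x] p'(2) by (simp add: algebra_simps)
    then show ?case using q(1) by blast
  qed auto
  show ?thesis
  proof (cases "k \<ge> 0")
    case True
    then show ?thesis using 1[OF assms(3), of "nat k"] by simp
  next
    case False
    then show ?thesis using 2[OF assms(3), of "nat (-k)"] by simp
  qed
qed

text \<open>A closed braid unrolled over the universal cover of the circle, with monodromy
  \<open>\<pi>\<close>. Labels are complex numbers because \<open>braid_strands\<close> takes the
  fibre over 1 itself as \<open>P\<close>.\<close>

definition strands :: "complex set \<Rightarrow> (complex \<Rightarrow> complex) \<Rightarrow> (complex \<Rightarrow> real \<Rightarrow> complex) \<Rightarrow> bool" where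
  "strands P \<pi> \<gamma> \<longleftrightarrow> finite P \<and> bij_betw \<pi> P P \<and> (\<forall>p\<in>P. smooth_on UNIV (\<gamma> p)) \<and>
     (\<forall>p\<in>P. \<forall>\<theta>. \<gamma> p (\<theta> + 2 * pi) = \<gamma> (\<pi> p) \<theta>) \<and> (\<forall>p\<in>P. \<forall>q\<in>P. \<forall>\<theta>. \<gamma> p \<theta> = \<gamma> q \<theta> \<longrightarrow> p = q)"

definition braid_of :: "complex set \<Rightarrow> (complex \<Rightarrow> real \<Rightarrow> complex) \<Rightarrow> C2 set" where
  "braid_of P \<gamma> = {(cis \<theta>, \<gamma> p \<theta>) |p \<theta>. p \<in> P}"

text \<open>The plane cut along the ray opposite to \<open>cis \<theta>\<^sub>0\<close>; on it
  \<open>ang\<close> is a smooth branch of the argument around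
  \<open>\<theta>\<^sub>0\<close>.\<close>

definition slit :: "real \<Rightarrow> complex set" where
  "slit \<theta>\<^sub>0 = {\<zeta>. \<zeta> / cis \<theta>\<^sub>0 \<notin> \<real>\<^sub>\<le>\<^sub>0}"

definition ang :: "real \<Rightarrow> complex \<Rightarrow> real" where
  "ang \<theta>\<^sub>0 \<zeta> = \<theta>\<^sub>0 + Im (Ln (\<zeta> / cis \<theta>\<^sub>0))"

lemma open_slit: "open (slit \<theta>)"
proof -
  have "slit \<theta> = (\<lambda>\<zeta>. \<zeta> / cis \<theta>) -` (- \<real>\<^sub>\<le>\<^sub>0)" by (auto simp: slit_def)
  then show ?thesis
    by (auto intro!: open_vimage continuous_intros simp: closed_nonpos_Reals_complex open_Compl)
qed

lemma smooth_on_ang: "smooth_on (slit \<theta>) (ang \<theta>)"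
proof -
  have "smooth_on (slit \<theta>) (\<lambda>\<zeta>. \<zeta> / cis \<theta>)"
    by (intro smooth_intros open_slit) auto
  then have "smooth_on (slit \<theta>) (\<lambda>\<zeta>. \<theta> + Im (Ln (\<zeta> / cis \<theta>)))"
    by (intro smooth_intros smooth_on_Ln open_slit) (auto simp: slit_def)
  then show ?thesis by (simp add: ang_def[abs_def])
qed

lemma cis_slit:
  assumes "\<bar>\<theta> - \<theta>\<^sub>0\<bar> < pi"
  shows "cis \<theta> \<in> slit \<theta>\<^sub>0" "ang \<theta>\<^sub>0 (cis \<theta>) = \<theta>"
proof -
  have e: "cis \<theta> / cis \<theta>\<^sub>0 = cis (\<theta> - \<theta>\<^sub>0)" by (simp add: cis_divide)
  have L: "Ln (cis (\<theta> - \<theta>\<^sub>0)) = \<i> * (\<theta> - \<theta>\<^sub>0)"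
    unfolding cis_conv_exp by (rule Ln_exp) (use assms in auto)
  show "ang \<theta>\<^sub>0 (cis \<theta>) = \<theta>" by (simp add: ang_def e L)
  show "cis \<theta> \<in> slit \<theta>\<^sub>0"
  proof (rule ccontr)
    assume "cis \<theta> \<notin> slit \<theta>\<^sub>0"
    then have s: "sin (\<theta> - \<theta>\<^sub>0) = 0" "cos (\<theta> - \<theta>\<^sub>0) \<le> 0"
      by (auto simp: slit_def e complex_nonpos_Reals_iff)
    then have "\<theta> - \<theta>\<^sub>0 = 0" using sin_eq_0_pi[of "\<theta> - \<theta>\<^sub>0"] assms by auto
    then show False using s by simp
  qed
qed

lemma ang_slit:
  assumes "\<zeta> \<in> slit \<theta>\<^sub>0"
  shows "\<bar>ang \<theta>\<^sub>0 \<zeta> - \<theta>\<^sub>0\<bar> < pi" "cis (ang \<theta>\<^sub>0 \<zeta>) * cmod \<zeta> = \<zeta>"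
proof -
  have nz: "\<zeta> \<noteq> 0" using assms by (auto simp: slit_def)
  have "Im (Ln (\<zeta> / cis \<theta>\<^sub>0)) < pi" "- pi < Im (Ln (\<zeta> / cis \<theta>\<^sub>0))"
    using assms mpi_less_Im_Ln[of "\<zeta> / cis \<theta>\<^sub>0"] Im_Ln_less_pi[of "\<zeta> / cis \<theta>\<^sub>0"] nz
    by (auto simp: slit_def)
  then show "\<bar>ang \<theta>\<^sub>0 \<zeta> - \<theta>\<^sub>0\<bar> < pi" by (auto simp: ang_def)
  have "exp (Ln (\<zeta> / cis \<theta>\<^sub>0)) = \<zeta> / cis \<theta>\<^sub>0" using nz by simp
  moreover have "exp (Ln (\<zeta> / cis \<theta>\<^sub>0)) = exp (Re (Ln (\<zeta> / cis \<theta>\<^sub>0))) * cis (Im (Ln (\<zeta> / cis \<theta>\<^sub>0)))"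
    by (rule exp_eq_polar)
  moreover have "exp (Re (Ln (\<zeta> / cis \<theta>\<^sub>0))) = cmod \<zeta>"
    using nz by (simp add: norm_divide)
  ultimately have "\<zeta> / cis \<theta>\<^sub>0 = cmod \<zeta> * cis (Im (Ln (\<zeta> / cis \<theta>\<^sub>0)))"
    by (metis of_real_exp)
  then show "cis (ang \<theta>\<^sub>0 \<zeta>) * cmod \<zeta> = \<zeta>"
    by (simp add: ang_def cis_mult[symmetric] field_simps)
qed

lemma strandsD:
  assumes "strands P \<pi> \<gamma>"
  shows "finite P" "bij_betw \<pi> P P" "p \<in> P \<Longrightarrow> smooth_on UNIV (\<gamma> p)"
    "p \<in> P \<Longrightarrow> \<gamma> p (\<theta> + 2 * pi) = \<gamma> (\<pi> p) \<theta>" "p \<in> P \<Longrightarrow> q \<in> P \<Longrightarrow> \<gamma> p \<theta> = \<gamma> q \<theta> \<Longrightarrow> p = q"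
  using assms unfolding strands_def by blast+

lemma strands_shift:
  fixes F :: "complex \<Rightarrow> real \<Rightarrow> 'b"
  assumes "bij_betw \<pi> P P" "\<And>p \<theta>. p \<in> P \<Longrightarrow> F p (\<theta> + 2 * pi) = F (\<pi> p) \<theta>" "p \<in> P" "cis \<theta> = cis \<theta>'"
  shows "\<exists>q\<in>P. F p \<theta> = F q \<theta>'"
proof -
  have "exp (\<i> * of_real \<theta>) = exp (\<i> * of_real \<theta>')" using assms(4) by (simp add: cis_conv_exp)
  then obtain k :: int where "\<i> * of_real \<theta> = \<i> * of_real \<theta>' + of_real (real_of_int (2 * k) * pi) * \<i>"
    unfolding exp_eq by blast
  from arg_cong[OF this, of Im] have "\<theta> = \<theta>' + of_int k * (2 * pi)" by simp
  then show ?thesis using equivariant_shift[of \<pi> P F "2*pi" p k] assms(1-3) by auto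
qed

lemma braid_of_slit:
  assumes "strands P \<pi> \<gamma>" "fst x \<in> slit \<theta>\<^sub>0"
  shows "x \<in> braid_of P \<gamma> \<longleftrightarrow> cmod (fst x) = 1 \<and> (\<exists>p\<in>P. snd x = \<gamma> p (ang \<theta>\<^sub>0 (fst x)))"
proof
  assume "x \<in> braid_of P \<gamma>"
  then obtain p \<theta> where p: "p \<in> P" "x = (cis \<theta>, \<gamma> p \<theta>)" by (auto simp: braid_of_def)
  have "cis \<theta> = cis (ang \<theta>\<^sub>0 (cis \<theta>))" using ang_slit(2)[OF assms(2)] p by simp
  from strands_shift[where F=\<gamma>, OF strandsD(2)[OF assms(1)] strandsD(4)[OF assms(1)] p(1) this] p
  show "cmod (fst x) = 1 \<and> (\<exists>p\<in>P. snd x = \<gamma> p (ang \<theta>\<^sub>0 (fst x)))" by auto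
next
  assume "cmod (fst x) = 1 \<and> (\<exists>p\<in>P. snd x = \<gamma> p (ang \<theta>\<^sub>0 (fst x)))"
  then show "x \<in> braid_of P \<gamma>" using ang_slit(2)[OF assms(2)]
    by (auto simp: braid_of_def prod_eq_iff intro!: exI[of _ "ang \<theta>\<^sub>0 (fst x)"])
qed

text \<open>Over a slit plane the strands are disjoint graphs; removing all but one leaves an open
  set in which the braid is the graph of strand \<open>p\<close> alone.\<close>

definition strand_nbhd :: "complex set \<Rightarrow> (complex \<Rightarrow> real \<Rightarrow> complex) \<Rightarrow> real \<Rightarrow> complex \<Rightarrow> C2 set" where
  "strand_nbhd P \<gamma> \<theta>\<^sub>0 p = {x. fst x \<in> slit \<theta>\<^sub>0 \<and> (\<forall>q\<in>P - {p}. snd x \<noteq> \<gamma> q (ang \<theta>\<^sub>0 (fst x)))}"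

lemma smooth_on_strand_ang:
  assumes "strands P \<pi> \<gamma>" "p \<in> P" "open S" "smooth_on S f" "f ` S \<subseteq> slit \<theta>\<^sub>0"
  shows "smooth_on S (\<lambda>x. \<gamma> p (ang \<theta>\<^sub>0 (f x)))"
  by (rule smooth_on_arg[OF assms(3) smooth_on_compose[OF assms(3) open_slit smooth_on_ang assms(4,5)] strandsD(3)[OF assms(1,2)]])

lemma open_strand_nbhd:
  assumes "strands P \<pi> \<gamma>"
  shows "open (strand_nbhd P \<gamma> \<theta>\<^sub>0 p)"
proof -
  let ?S = "slit \<theta>\<^sub>0 \<times> (UNIV::complex set)"
  have o: "open ?S" by (intro open_Times open_slit) auto
  have eq: "strand_nbhd P \<gamma> \<theta>\<^sub>0 p = (\<Inter>q\<in>P - {p}. ?S \<inter> (\<lambda>x. snd x - \<gamma> q (ang \<theta>\<^sub>0 (fst x))) -` (-{0})) \<inter> ?S"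
    by (auto simp: strand_nbhd_def)
  have "open (?S \<inter> (\<lambda>x. snd x - \<gamma> q (ang \<theta>\<^sub>0 (fst x))) -` (-{0}))" if "q \<in> P" for q
    by (rule continuous_open_preimage[OF smooth_on_imp_continuous_on o])
      (auto intro!: smooth_intros smooth_on_strand_ang[OF assms that] simp: o)
  then show ?thesis unfolding eq
    by (intro open_Int open_INT o) (use strandsD(1)[OF assms] in auto)
qed

lemma braid_of_strand_nbhd:
  assumes "strands P \<pi> \<gamma>" "p \<in> P" "x \<in> strand_nbhd P \<gamma> \<theta>\<^sub>0 p"
  shows "x \<in> braid_of P \<gamma> \<longleftrightarrow> cmod (fst x) = 1 \<and> snd x = \<gamma> p (ang \<theta>\<^sub>0 (fst x))"
  using braid_of_slit[OF assms(1), of x \<theta>\<^sub>0] assms(2,3) by (auto simp: strand_nbhd_def)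

lemma mem_strand_nbhd:
  assumes "strands P \<pi> \<gamma>" "p \<in> P" "\<bar>\<theta> - \<theta>\<^sub>0\<bar> < pi"
  shows "(cis \<theta>, \<gamma> p \<theta>) \<in> strand_nbhd P \<gamma> \<theta>\<^sub>0 p"
  using cis_slit[OF assms(3)] strandsD(5)[OF assms(1,2)] by (auto simp: strand_nbhd_def)

lemma braid_of_eq_image:
  assumes "strands P \<pi> \<gamma>"
  shows "braid_of P \<gamma> = (\<Union>p\<in>P. (\<lambda>\<theta>. (cis \<theta>, \<gamma> p \<theta>)) ` {0..2*pi})"
proof
  show "braid_of P \<gamma> \<subseteq> (\<Union>p\<in>P. (\<lambda>\<theta>. (cis \<theta>, \<gamma> p \<theta>)) ` {0..2*pi})"
  proof
    fix x assume "x \<in> braid_of P \<gamma>"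
    then obtain p \<theta> where p: "p \<in> P" "x = (cis \<theta>, \<gamma> p \<theta>)" by (auto simp: braid_of_def)
    obtain \<theta>' where \<theta>': "0 \<le> \<theta>'" "\<theta>' < 2*pi" "cis \<theta> = cis \<theta>'"
    proof -
      have *: "cis \<theta> = cis (Arg2pi (cis \<theta>))" using Arg2pi[of "cis \<theta>"] by (simp add: cis_conv_exp is_Arg_def)
      show ?thesis by (rule that[OF Arg2pi_ge_0 Arg2pi_lt_2pi *])
    qed
    from strands_shift[where F=\<gamma>, OF strandsD(2)[OF assms(1)] strandsD(4)[OF assms(1)] p(1) \<theta>'(3)]
    obtain q where q: "q \<in> P" "\<gamma> p \<theta> = \<gamma> q \<theta>'" by auto
    then have "x = (cis \<theta>', \<gamma> q \<theta>')" using p \<theta>' by simp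
    then show "x \<in> (\<Union>p\<in>P. (\<lambda>\<theta>. (cis \<theta>, \<gamma> p \<theta>)) ` {0..2*pi})" using q \<theta>' by force
  qed
qed (auto simp: braid_of_def)

lemma compact_braid_of:
  assumes "strands P \<pi> \<gamma>"
  shows "compact (braid_of P \<gamma>)"
  unfolding braid_of_eq_image[OF assms]
proof (intro compact_UN strandsD(1)[OF assms] compact_continuous_image compact_Icc)
  fix p assume "p \<in> P"
  then have "continuous_on {0..2*pi} (\<gamma> p)"
    using smooth_on_imp_continuous_on[OF strandsD(3)[OF assms]] continuous_on_subset by blast
  then show "continuous_on {0..2*pi} (\<lambda>\<theta>. (cis \<theta>, \<gamma> p \<theta>))" by (intro continuous_intros)
qed

text \<open>The sets \<open>strand_nbhd\<close> carry the slice charts, and their intersections with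
  the braid are the sheets of the covering over a slit circle.\<close>

lemma braid_braid_of:
  assumes "strands P \<pi> \<gamma>" "P \<noteq> {}"
  shows "braid (card P) (braid_of P \<gamma>)"
  unfolding braid_def
proof (intro conjI ballI)
  note D = strandsD[OF assms(1)]
  have unit: "\<exists>\<theta>. \<zeta> = cis \<theta>" if "cmod \<zeta> = 1" for \<zeta>
    using that by (metis cis_Arg_unique is_Arg_def mult_1 norm_eq_zero of_real_1 rcis_cmod_Arg rcis_def zero_neq_one)
  show "braid_of P \<gamma> \<subseteq> sphere 0 1 \<times> UNIV" by (auto simp: braid_of_def)
  show "compact (braid_of P \<gamma>)" by (rule compact_braid_of[OF assms(1)])
  show "card {x \<in> braid_of P \<gamma>. fst x = \<zeta>} = card P" if z: "\<zeta> \<in> sphere 0 1" for \<zeta>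
  proof -
    obtain \<theta> where \<theta>: "\<zeta> = cis \<theta>" using unit[of \<zeta>] z by auto
    have "{x \<in> braid_of P \<gamma>. fst x = \<zeta>} = (\<lambda>p. (\<zeta>, \<gamma> p \<theta>)) ` P"
    proof
      show "{x \<in> braid_of P \<gamma>. fst x = \<zeta>} \<subseteq> (\<lambda>p. (\<zeta>, \<gamma> p \<theta>)) ` P"
        using strands_shift[where F=\<gamma>, OF D(2) D(4), of _ _ \<theta>] \<theta> by (fastforce simp: braid_of_def)
    qed (auto simp: braid_of_def \<theta>)
    moreover have "inj_on (\<lambda>p. (\<zeta>, \<gamma> p \<theta>)) P" using D(5) by (auto intro!: inj_onI)
    ultimately show ?thesis by (simp add: card_image)
  qed
  show "embedded_submanifold 1 (braid_of P \<gamma>)"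
    unfolding embedded_submanifold_def
  proof
    fix x assume "x \<in> braid_of P \<gamma>"
    then obtain p \<theta>\<^sub>0 where p: "p \<in> P" "x = (cis \<theta>\<^sub>0, \<gamma> p \<theta>\<^sub>0)" by (auto simp: braid_of_def)
    let ?U = "strand_nbhd P \<gamma> \<theta>\<^sub>0 p"
    let ?V = "{y. \<bar>Im (fst y)\<bar> < pi \<and> (\<forall>q\<in>P - {p}. snd y + \<gamma> p (\<theta>\<^sub>0 + Im (fst y)) \<noteq> \<gamma> q (\<theta>\<^sub>0 + Im (fst y)))}"
    \<comment> \<open>The logarithm turns the unit circle into a segment of the imaginary axis, and
      subtracting strand \<open>p\<close> flattens the braid onto it.\<close>
    let ?\<phi> = "\<lambda>x. (Ln (fst x / cis \<theta>\<^sub>0), snd x - \<gamma> p (ang \<theta>\<^sub>0 (fst x)))"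
    let ?\<psi> = "\<lambda>y. (cis \<theta>\<^sub>0 * exp (fst y), snd y + \<gamma> p (\<theta>\<^sub>0 + Im (fst y)))"
    let ?T = "{y::C2. Re (fst y) = 0 \<and> snd y = 0}"
    have oU: "open ?U" by (rule open_strand_nbhd[OF assms(1)])
    have cq: "continuous_on UNIV (\<gamma> q)" if "q \<in> P" for q
      using smooth_on_imp_continuous_on[OF D(3)[OF that]] .
    have cq': "continuous_on UNIV (\<lambda>y::C2. \<gamma> q (\<theta>\<^sub>0 + Im (fst y)))" if "q \<in> P" for q
      by (rule continuous_on_compose2[OF cq[OF that]]) (auto intro!: continuous_intros)
    have eqV: "?V = {y. \<bar>Im (fst y)\<bar> < pi} \<inter> (\<Inter>q\<in>P - {p}. {y. snd y + \<gamma> p (\<theta>\<^sub>0 + Im (fst y)) \<noteq> \<gamma> q (\<theta>\<^sub>0 + Im (fst y))})"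
      by auto
    have oI: "open {y::C2. \<bar>Im (fst y)\<bar> < pi}"
      by (intro open_Collect_less continuous_intros)
    have oq: "open {y. snd y + \<gamma> p (\<theta>\<^sub>0 + Im (fst y)) \<noteq> \<gamma> q (\<theta>\<^sub>0 + Im (fst y))}" if "q \<in> P" for q
      by (intro open_Collect_neq continuous_intros cq' p that)
    have oV: "open ?V" unfolding eqV by (intro open_Int open_INT oI) (use D(1) oq in auto)
    have sl: "fst x \<in> slit \<theta>\<^sub>0" if "x \<in> ?U" for x using that by (auto simp: strand_nbhd_def)
    have s1: "smooth_on ?U ?\<phi>"
    proof -
      have f: "smooth_on ?U (\<lambda>x. fst x)" by (intro smooth_intros oU)
      have "smooth_on ?U (\<lambda>x. fst x / cis \<theta>\<^sub>0)" by (intro smooth_intros oU) auto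
      then have "smooth_on ?U (\<lambda>x. Ln (fst x / cis \<theta>\<^sub>0))"
        by (rule smooth_on_Ln[OF oU]) (use sl in \<open>auto simp: slit_def\<close>)
      moreover have "smooth_on ?U (\<lambda>x. \<gamma> p (ang \<theta>\<^sub>0 (fst x)))"
        by (rule smooth_on_strand_ang[OF assms(1) p(1) oU f]) (use sl in auto)
      ultimately show ?thesis by (intro smooth_intros oU)
    qed
    have s2: "smooth_on ?V ?\<psi>"
      by (intro smooth_intros smooth_on_arg[OF _ _ D(3)[OF p(1)]] oV)
    have ex: "exp (Ln (fst x / cis \<theta>\<^sub>0)) = fst x / cis \<theta>\<^sub>0" if "x \<in> ?U" for x
      using sl[OF that] by (intro exp_Ln) (auto simp: slit_def)
    have LnV: "Ln (exp (fst y)) = fst y" "cis \<theta>\<^sub>0 * exp (fst y) \<in> slit \<theta>\<^sub>0" "ang \<theta>\<^sub>0 (cis \<theta>\<^sub>0 * exp (fst y)) = \<theta>\<^sub>0 + Im (fst y)"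
      if "y \<in> ?V" for y :: C2
    proof -
      show L: "Ln (exp (fst y)) = fst y" using that by (intro Ln_exp) auto
      have "exp (fst y) \<notin> \<real>\<^sub>\<le>\<^sub>0"
      proof
        assume "exp (fst y) \<in> \<real>\<^sub>\<le>\<^sub>0"
        then have s: "sin (Im (fst y)) = 0" "cos (Im (fst y)) \<le> 0"
          by (auto simp: complex_nonpos_Reals_iff Re_exp Im_exp mult_le_0_iff)
        then have "Im (fst y) = 0" using that sin_eq_0_pi[of "Im (fst y)"] by auto
        then show False using s by simp
      qed
      then show "cis \<theta>\<^sub>0 * exp (fst y) \<in> slit \<theta>\<^sub>0" by (auto simp: slit_def)
      show "ang \<theta>\<^sub>0 (cis \<theta>\<^sub>0 * exp (fst y)) = \<theta>\<^sub>0 + Im (fst y)" by (simp add: ang_def L)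
    qed
    have angU: "Im (Ln (fst x / cis \<theta>\<^sub>0)) = ang \<theta>\<^sub>0 (fst x) - \<theta>\<^sub>0" for x :: C2 by (simp add: ang_def)
    have 1: "?\<phi> x \<in> ?V \<and> ?\<psi> (?\<phi> x) = x" if "x \<in> ?U" for x
      using ang_slit(1)[OF sl[OF that]] ex[OF that] that
      by (auto simp: angU prod_eq_iff strand_nbhd_def)
    have 2: "?\<psi> y \<in> ?U \<and> ?\<phi> (?\<psi> y) = y" if "y \<in> ?V" for y
      using LnV[OF that] that by (auto simp: strand_nbhd_def prod_eq_iff)
    have "diffeomorphism ?U ?V ?\<phi> ?\<psi>"
      by (rule diffeomorphismI[OF oU oV s1 s2 1 2])
    moreover have "subspace ?T" by (auto intro!: subspaceI)
    moreover have "dim ?T = 1"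
    proof -
      have T: "?T = (\<lambda>t::real. (\<i> * of_real t, 0::complex)) ` UNIV"
        by (force simp: complex_eq_iff image_iff)
      have "dim ?T = dim (UNIV :: real set)"
        unfolding T by (rule dim_image_eq) (auto intro!: linearI inj_onI simp: algebra_simps scaleR_conv_of_real)
      then show ?thesis by simp
    qed
    moreover have "?\<phi> ` (braid_of P \<gamma> \<inter> ?U) = ?T \<inter> ?V"
    proof -
      have key: "x \<in> braid_of P \<gamma> \<longleftrightarrow> ?\<phi> x \<in> ?T" if "x \<in> ?U" for x
      proof -
        have "fst x \<noteq> 0" using sl[OF that] by (auto simp: slit_def)
        then have "Re (Ln (fst x / cis \<theta>\<^sub>0)) = ln (cmod (fst x))" by (simp add: norm_divide)
        then show ?thesis using braid_of_strand_nbhd[OF assms(1) p(1) that] \<open>fst x \<noteq> 0\<close> by auto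
      qed
      show ?thesis
      proof
        show "?\<phi> ` (braid_of P \<gamma> \<inter> ?U) \<subseteq> ?T \<inter> ?V" using key 1 by blast
        show "?T \<inter> ?V \<subseteq> ?\<phi> ` (braid_of P \<gamma> \<inter> ?U)"
        proof
          fix y assume y: "y \<in> ?T \<inter> ?V"
          then have yV: "y \<in> ?V" and yT: "y \<in> ?T" by auto
          note y2 = 2[OF yV]
          then have "?\<phi> (?\<psi> y) \<in> ?T" using yT by (simp only:)
          then have "?\<psi> y \<in> braid_of P \<gamma>" using key[OF conjunct1[OF y2]] by (simp only:)
          then show "y \<in> ?\<phi> ` (braid_of P \<gamma> \<inter> ?U)"
            by (intro image_eqI[where f="?\<phi>" and x="?\<psi> y", OF conjunct2[OF y2, symmetric]] IntI conjunct1[OF y2])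
        qed
      qed
    qed
    moreover have "x \<in> ?U" unfolding p(2) by (rule mem_strand_nbhd[OF assms(1) p(1)]) simp
    ultimately show "\<exists>U V \<phi> \<psi> (T :: C2 set). open U \<and> x \<in> U \<and> open V \<and> diffeomorphism U V \<phi> \<psi> \<and>
        subspace T \<and> dim T = 1 \<and> \<phi> ` (braid_of P \<gamma> \<inter> U) = T \<inter> V"
      using oU oV by blast
  qed
  show "smooth_covering (braid_of P \<gamma>) fst (sphere 0 1)"
    unfolding smooth_covering_def
  proof (intro conjI ballI)
    have sf: "smooth_on UNIV (fst :: C2 \<Rightarrow> complex)" using smooth_on_fst[OF _ smooth_on_id, of UNIV] by simp
    show "smooth_map (braid_of P \<gamma>) fst" by (rule smooth_mapI_smooth_on[OF _ _ sf]) auto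
    obtain p\<^sub>0 where p0: "p\<^sub>0 \<in> P" using assms(2) by auto
    show "fst ` braid_of P \<gamma> = sphere 0 1"
    proof
      show "sphere 0 1 \<subseteq> fst ` braid_of P \<gamma>"
      proof
        fix \<zeta> :: complex assume "\<zeta> \<in> sphere 0 1"
        then have "cmod \<zeta> = 1" by simp
        then obtain \<theta> where "\<zeta> = cis \<theta>" using unit by blast
        then have "\<zeta> = fst (cis \<theta>, \<gamma> p\<^sub>0 \<theta>)" "(cis \<theta>, \<gamma> p\<^sub>0 \<theta>) \<in> braid_of P \<gamma>"
          using p0 by (auto simp: braid_of_def)
        then show "\<zeta> \<in> fst ` braid_of P \<gamma>" by (rule image_eqI)
      qed
    qed (auto simp: braid_of_def)
    fix \<zeta> :: complex assume "\<zeta> \<in> sphere 0 1"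
    then have "cmod \<zeta> = 1" by simp
    then obtain \<theta>\<^sub>0 where \<theta>: "\<zeta> = cis \<theta>\<^sub>0" using unit by blast
    let ?T = "sphere 0 1 \<inter> slit \<theta>\<^sub>0"
    define S where "S p = braid_of P \<gamma> \<inter> strand_nbhd P \<gamma> \<theta>\<^sub>0 p" for p
    have S: "x \<in> S p \<longleftrightarrow> fst x \<in> ?T \<and> snd x = \<gamma> p (ang \<theta>\<^sub>0 (fst x))" if "p \<in> P" for x p
    proof
      assume "x \<in> S p" then show "fst x \<in> ?T \<and> snd x = \<gamma> p (ang \<theta>\<^sub>0 (fst x))"
        using braid_of_strand_nbhd[OF assms(1) that, of x \<theta>\<^sub>0] by (auto simp: S_def strand_nbhd_def)
    next
      assume x: "fst x \<in> ?T \<and> snd x = \<gamma> p (ang \<theta>\<^sub>0 (fst x))"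
      then have "x = (cis (ang \<theta>\<^sub>0 (fst x)), \<gamma> p (ang \<theta>\<^sub>0 (fst x)))"
        using ang_slit(2)[of "fst x" \<theta>\<^sub>0] by (auto simp: prod_eq_iff)
      then have "x \<in> strand_nbhd P \<gamma> \<theta>\<^sub>0 p"
        using mem_strand_nbhd[OF assms(1) that ang_slit(1)[of "fst x" \<theta>\<^sub>0]] x by auto
      then show "x \<in> S p" using braid_of_strand_nbhd[OF assms(1) that, of x \<theta>\<^sub>0] x by (auto simp: S_def)
    qed
    show "\<exists>T. \<zeta> \<in> T \<and> openin (top_of_set (sphere 0 1)) T \<and>
        (\<exists>\<V>. \<Union>\<V> = braid_of P \<gamma> \<inter> fst -` T \<and> (\<forall>U\<in>\<V>. openin (top_of_set (braid_of P \<gamma>)) U) \<and>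
             pairwise disjnt \<V> \<and> (\<forall>U\<in>\<V>. \<exists>q. diffeomorphism U T fst q))"
    proof (intro exI[of _ ?T] conjI exI[of _ "S ` P"] ballI)
      show "\<zeta> \<in> ?T" using cis_slit[of \<theta>\<^sub>0 \<theta>\<^sub>0] \<theta> by simp
      show "openin (top_of_set (sphere 0 1)) ?T" using open_slit by (intro openin_open_Int)
      show "\<Union> (S ` P) = braid_of P \<gamma> \<inter> fst -` ?T"
        using braid_of_slit[OF assms(1), of _ \<theta>\<^sub>0] S by (auto simp del: split_paired_All) 
      show "pairwise disjnt (S ` P)"
        using S D(5) by (fastforce simp: pairwise_def disjnt_iff)
      fix U assume "U \<in> S ` P"
      then obtain p where p: "p \<in> P" "U = S p" by auto
      show "openin (top_of_set (braid_of P \<gamma>)) U"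
        unfolding p S_def using open_strand_nbhd[OF assms(1)] by (intro openin_open_Int)
      let ?q = "\<lambda>\<zeta>. (\<zeta>, \<gamma> p (ang \<theta>\<^sub>0 \<zeta>))"
      have sq: "smooth_map ?T ?q"
        by (rule smooth_mapI_smooth_on[OF open_slit])
          (auto intro!: smooth_on_Pair smooth_on_id open_slit smooth_on_strand_ang[OF assms(1) p(1)])
      have sf': "smooth_map U fst" by (rule smooth_mapI_smooth_on[OF _ _ sf]) auto
      have "diffeomorphism U ?T fst ?q"
        unfolding diffeomorphism_def
        by (intro conjI sq sf' homeomorphismI smooth_map_imp_continuous_on[OF sq] smooth_map_imp_continuous_on[OF sf'])
          (use S[OF p(1)] p(2) in \<open>auto simp: prod_eq_iff\<close>)
      then show "\<exists>q. diffeomorphism U ?T fst q" by blast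
    qed
  qed
qed

subsection \<open>Isotopies\<close>

definition from_S3 :: "C2 \<Rightarrow> C2" where
  "from_S3 x = (fst x / cmod (fst x), snd x / cmod (fst x))"

lemma to_S3_eq: "to_S3 x = (1 / sqrt (1 + (cmod (snd x))\<^sup>2)) *\<^sub>R x"
  by (simp add: to_S3_def split_beta prod_eq_iff)

lemma from_to_S3: "cmod (fst x) = 1 \<Longrightarrow> from_S3 (to_S3 x) = x"
proof -
  assume 1: "cmod (fst x) = 1"
  define s where "s = 1 / sqrt (1 + (cmod (snd x))\<^sup>2)"
  have s: "s > 0" by (auto simp: s_def add_pos_nonneg)
  show ?thesis using 1 s unfolding to_S3_eq s_def[symmetric]
    by (simp add: from_S3_def scaleR_conv_of_real norm_mult prod_eq_iff)
qed

lemma fst_to_S3_nz: "cmod (fst x) = 1 \<Longrightarrow> fst (to_S3 x) \<noteq> 0"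
  by (auto simp: to_S3_eq add_nonneg_eq_0_iff)

lemma sqrt_denom_pos: "1 + (cmod z)\<^sup>2 > 0" by (simp add: add_pos_nonneg)

lemma smooth_on_to_S3:
  assumes "open S" "smooth_on S f"
  shows "smooth_on S (\<lambda>x. to_S3 (f x))"
  unfolding to_S3_eq
  by (intro smooth_intros smooth_on_sqrt assms) (use sqrt_denom_pos in \<open>auto simp: less_imp_neq[symmetric]\<close>)

lemma smooth_on_from_S3:
  assumes "open S" "smooth_on S f" "\<And>x. x \<in> S \<Longrightarrow> fst (f x) \<noteq> 0"
  shows "smooth_on S (\<lambda>x. from_S3 (f x))"
  unfolding from_S3_def by (intro smooth_intros smooth_on_norm assms) (use assms(3) in auto)

text \<open>The pair picked by \<open>SOME\<close> is unique only up to whole turns of the angle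
  combined with the monodromy on labels; the value does not depend on it when
  \<open>\<gamma>'\<close> has the same monodromy as \<open>\<gamma>\<close>.\<close>

definition strand_map ::
  "complex set \<Rightarrow> (complex \<Rightarrow> real \<Rightarrow> complex) \<Rightarrow> (complex \<Rightarrow> real \<Rightarrow> complex) \<Rightarrow> C2 \<Rightarrow> C2" where
  "strand_map P \<gamma> \<gamma>' y = (let (p, \<theta>) = SOME (p, \<theta>). p \<in> P \<and> y = (cis \<theta>, \<gamma> p \<theta>) in (cis \<theta>, \<gamma>' p \<theta>))"

lemma strand_map_eq:
  assumes "strands P \<pi> \<gamma>" "\<And>p \<theta>. p \<in> P \<Longrightarrow> \<gamma>' p (\<theta> + 2 * pi) = \<gamma>' (\<pi> p) \<theta>" "p \<in> P"
  shows "strand_map P \<gamma> \<gamma>' (cis \<theta>, \<gamma> p \<theta>) = (cis \<theta>, \<gamma>' p \<theta>)"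
proof -
  define R where "R = (\<lambda>(q, \<phi>). q \<in> P \<and> (cis \<theta>, \<gamma> p \<theta>) = (cis \<phi>, \<gamma> q \<phi>))"
  have "R (p, \<theta>)" using assms(3) by (simp add: R_def)
  then have "R (SOME x. R x)" by (rule someI)
  moreover obtain q \<phi> where q: "(SOME x. R x) = (q, \<phi>)" by force
  ultimately have qP: "q \<in> P" and c: "cis \<theta> = cis \<phi>" "\<gamma> p \<theta> = \<gamma> q \<phi>" by (auto simp: R_def)
  \<comment> \<open>Shifting both families as one pair guarantees that they receive the same new
    label.\<close>
  define F where "F p \<theta> = (\<gamma> p \<theta>, \<gamma>' p \<theta>)" for p \<theta>
  obtain q' where q': "q' \<in> P" "F q \<phi> = F q' \<theta>"
    using strands_shift[where F=F, OF strandsD(2)[OF assms(1)] _ qP c(1)[symmetric]]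
      strandsD(4)[OF assms(1)] assms(2) by (auto simp: F_def)
  then have "p = q'" using strandsD(5)[OF assms(1,3) q'(1)] c(2) by (auto simp: F_def)
  then have "\<gamma>' q \<phi> = \<gamma>' p \<theta>" using q'(2) by (simp add: F_def)
  then show ?thesis using q c(1) by (simp add: strand_map_def R_def)
qed

text \<open>Near a point of strand \<open>p\<close> the angle is read off by \<open>ang\<close>,
  which replaces the choice in \<open>strand_map\<close> by a smooth formula.\<close>

lemma smooth_map_strand_map:
  fixes Z :: "'t::euclidean_space \<Rightarrow> complex \<Rightarrow> real \<Rightarrow> complex"
  assumes "strands P \<pi> \<gamma>" "\<And>t p \<theta>. p \<in> P \<Longrightarrow> Z t p (\<theta> + 2 * pi) = Z t (\<pi> p) \<theta>"
    "\<And>p. p \<in> P \<Longrightarrow> smooth_on UNIV (\<lambda>x. Z (fst x) p (snd x))"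
  shows "smooth_map (A \<times> to_S3 ` braid_of P \<gamma>) (\<lambda>x. to_S3 (strand_map P \<gamma> (Z (fst x)) (from_S3 (snd x))))"
proof (rule smooth_mapI)
  fix x assume "x \<in> A \<times> to_S3 ` braid_of P \<gamma>"
  then obtain p \<theta>\<^sub>0 where p: "p \<in> P" "snd x = to_S3 (cis \<theta>\<^sub>0, \<gamma> p \<theta>\<^sub>0)" by (auto simp: braid_of_def)
  let ?N = "strand_nbhd P \<gamma> \<theta>\<^sub>0 p"
  let ?C = "(UNIV :: 't set) \<times> ((- {0 :: complex}) \<times> (UNIV :: complex set))"
  have oC: "open ?C" by (intro open_Times) auto
  have sC: "smooth_on ?C (\<lambda>x. from_S3 (snd x))"
    by (intro smooth_on_from_S3 smooth_intros oC) auto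
  let ?U = "?C \<inter> (\<lambda>x. from_S3 (snd x)) -` ?N"
  have oU: "open ?U"
    by (rule continuous_open_preimage[OF smooth_on_imp_continuous_on[OF sC] oC open_strand_nbhd[OF assms(1)]])
  have sU: "smooth_on ?U (\<lambda>x. from_S3 (snd x))" by (rule smooth_on_subset[OF sC]) auto
  let ?g = "\<lambda>x. to_S3 (fst (from_S3 (snd x)), Z (fst x) p (ang \<theta>\<^sub>0 (fst (from_S3 (snd x)))))"
  have a: "smooth_on ?U (\<lambda>x. ang \<theta>\<^sub>0 (fst (from_S3 (snd x))))"
    by (rule smooth_on_compose[OF oU open_slit smooth_on_ang smooth_on_fst[OF oU sU]]) (auto simp: strand_nbhd_def)
  have "smooth_on ?U (\<lambda>x. Z (fst x) p (ang \<theta>\<^sub>0 (fst (from_S3 (snd x)))))"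
    using smooth_on_arg[OF oU _ assms(3)[OF p(1)], of "\<lambda>x. (fst x, ang \<theta>\<^sub>0 (fst (from_S3 (snd x))))"]
      smooth_on_Pair[OF oU smooth_on_fst[OF oU smooth_on_id[OF oU]] a] by simp
  then have "smooth_on ?U ?g"
    by (intro smooth_on_to_S3 smooth_on_Pair smooth_on_fst oU sU)
  moreover have "x \<in> ?U"
    using p mem_strand_nbhd[OF assms(1) p(1), of \<theta>\<^sub>0 \<theta>\<^sub>0] fst_to_S3_nz[of "(cis \<theta>\<^sub>0, \<gamma> p \<theta>\<^sub>0)"]
    by (auto simp: from_to_S3 mem_Times_iff)
  moreover have "?g y = to_S3 (strand_map P \<gamma> (Z (fst y)) (from_S3 (snd y)))"
    if "y \<in> A \<times> to_S3 ` braid_of P \<gamma>" "y \<in> ?U" for y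
  proof -
    define w where "w = from_S3 (snd y)"
    from that(1) obtain b where b: "b \<in> braid_of P \<gamma>" "snd y = to_S3 b" by auto
    then have "cmod (fst b) = 1" by (auto simp: braid_of_def)
    then have "w = b" using b by (simp add: w_def from_to_S3)
    then have w: "w \<in> braid_of P \<gamma>" "w \<in> ?N" using b that(2) by (auto simp: w_def)
    then have w1: "cmod (fst w) = 1" "snd w = \<gamma> p (ang \<theta>\<^sub>0 (fst w))"
      using braid_of_strand_nbhd[OF assms(1) p(1)] by auto
    define \<theta> where "\<theta> = ang \<theta>\<^sub>0 (fst w)"
    have "fst w = cis \<theta>" using ang_slit(2)[of "fst w" \<theta>\<^sub>0] w w1 by (simp add: \<theta>_def strand_nbhd_def)
    then have "w = (cis \<theta>, \<gamma> p \<theta>)" using w1 by (simp add: prod_eq_iff \<theta>_def)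
    then have "strand_map P \<gamma> (Z (fst y)) w = (cis \<theta>, Z (fst y) p \<theta>)"
      using strand_map_eq[where \<gamma>'="Z (fst y)", OF assms(1,2) p(1)] by simp
    then show ?thesis unfolding w_def[symmetric] \<theta>_def[symmetric] using \<open>fst w = cis \<theta>\<close> by simp
  qed
  ultimately show "\<exists>U g. open U \<and> x \<in> U \<and> smooth_on U g \<and>
      (\<forall>y\<in>A \<times> to_S3 ` braid_of P \<gamma>. y \<in> U \<longrightarrow> g y = to_S3 (strand_map P \<gamma> (Z (fst y)) (from_S3 (snd y))))"
    using oU by (intro exI[of _ ?U] exI[of _ ?g]) blast
qed

text \<open>Each point moves with its label and its angle fixed, so the motion from one time to
  another is undone by the motion back.\<close>

lemma braid_isotopic_strands:
  assumes "\<And>t. t \<in> {0..1} \<Longrightarrow> strands P \<pi> (Z t)" "P \<noteq> {}"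
    "\<And>t p \<theta>. p \<in> P \<Longrightarrow> Z t p (\<theta> + 2 * pi) = Z t (\<pi> p) \<theta>"
    "\<And>p. p \<in> P \<Longrightarrow> smooth_on UNIV (\<lambda>x::real\<times>real. Z (fst x) p (snd x))"
  shows "braid_isotopic (card P) (to_S3 ` braid_of P (Z 0)) (to_S3 ` braid_of P (Z 1))"
proof -
  define K where "K t = to_S3 ` braid_of P (Z t)" for t
  \<comment> \<open>Arbitrary starting times \<open>s\<close> are allowed because the inverse
    diffeomorphism is \<open>h t 0\<close>.\<close>
  define h where "h s t x = to_S3 (strand_map P (Z s) (Z t) (from_S3 x))" for s t x
  have 0: "strands P \<pi> (Z 0)" using assms(1) by auto
  have hval: "h s t (to_S3 (cis \<theta>, Z s p \<theta>)) = to_S3 (cis \<theta>, Z t p \<theta>)" if "s \<in> {0..1}" "p \<in> P" for s t p \<theta>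
    using strand_map_eq[where \<gamma>'="Z t", OF assms(1)[OF that(1)] assms(3) that(2)] by (simp add: h_def from_to_S3)
  have hK: "h s t ` K s = K t" if "s \<in> {0..1}" for s t
  proof -
    have K': "K t = (\<lambda>(p, \<theta>). to_S3 (cis \<theta>, Z t p \<theta>)) ` (P \<times> UNIV)" for t
      by (force simp: K_def braid_of_def)
    have "h s t ` K s = (\<lambda>(p, \<theta>). h s t (to_S3 (cis \<theta>, Z s p \<theta>))) ` (P \<times> UNIV)"
      unfolding K' image_image by (simp add: split_beta)
    also have "\<dots> = K t" unfolding K' by (intro image_cong) (auto simp: hval[OF that])
    finally show ?thesis .
  qed
  have hh: "h t s (h s t x) = x" if "s \<in> {0..1}" "t \<in> {0..1}" "x \<in> K s" for s t x
    using that hval by (auto simp: K_def braid_of_def)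
  have sm: "smooth_map (A \<times> K s) (\<lambda>x. h s (fst x) (snd x))" if "s \<in> {0..1}" for s and A :: "real set"
    unfolding K_def h_def by (rule smooth_map_strand_map[where Z=Z, OF assms(1)[OF that] assms(3,4)])
  have smt: "smooth_map (K s) (h s t)" if "s \<in> {0..1}" for s t
  proof -
    have "smooth_map (K s) (\<lambda>x. (t, x))"
      by (rule smooth_mapI_smooth_on[OF open_UNIV]) (auto intro!: smooth_intros)
    from smooth_map_compose[OF this sm[OF that, of UNIV]] show ?thesis by auto
  qed
  have dif: "diffeomorphism (K 0) (K t) (h 0 t) (h t 0)" if "t \<in> {0..1}" for t
    unfolding diffeomorphism_def
  proof (intro conjI smt homeomorphismI)
    show "continuous_on (K 0) (h 0 t)" "continuous_on (K t) (h t 0)"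
      using smooth_map_imp_continuous_on[OF smt] that by auto
    show "h 0 t ` K 0 \<subseteq> K t" "h t 0 ` K t \<subseteq> K 0" using hK that by auto
  qed (use hh that in auto)
  show ?thesis
    unfolding braid_isotopic_def K_def[symmetric]
  proof (intro exI[of _ "\<lambda>x. h 0 (fst x) (snd x)"] conjI ballI)
    show "smooth_map ({0..1} \<times> K 0) (\<lambda>x. h 0 (fst x) (snd x))" by (rule sm) auto
    show "h 0 (fst (0, x)) (snd (0, x)) = x" if "x \<in> K 0" for x
      using that hval by (auto simp: K_def braid_of_def)
    show "(\<lambda>x. h 0 (fst (1, x)) (snd (1, x))) ` K 0 = K 1" using hK[of 0 1] by simp
    fix t :: real assume t: "t \<in> {0..1}"
    have eq: "(\<lambda>x. h 0 (fst (t, x)) (snd (t, x))) ` K 0 = K t" using hK[of 0 t] by simp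
    show "braid_S3 (card P) ((\<lambda>x. h 0 (fst (t, x)) (snd (t, x))) ` K 0)"
      unfolding eq braid_S3_def using braid_braid_of[OF assms(1)[OF t] assms(2)]
      by (intro exI[of _ "braid_of P (Z t)"]) (simp add: K_def)
    show "\<exists>G. diffeomorphism (K 0) ((\<lambda>x. h 0 (fst (t, x)) (snd (t, x))) ` K 0) (\<lambda>x. h 0 (fst (t, x)) (snd (t, x))) G"
      unfolding eq using dif[OF t] by auto
  qed
qed

subsection \<open>The strands of a braid\<close>

lemma smooth_covering_imp_covering_space:
  assumes "smooth_covering C p S"
  shows "covering_space C p S"
  unfolding covering_space_def
proof (intro conjI ballI)
  show "continuous_on C p" "p ` C = S"
    using assms smooth_map_imp_continuous_on unfolding smooth_covering_def by auto
  fix x assume "x \<in> S"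
  then obtain T \<V> where T: "x \<in> T" "openin (top_of_set S) T" "\<Union>\<V> = C \<inter> p -` T"
      "\<forall>U\<in>\<V>. openin (top_of_set C) U" "pairwise disjnt \<V>" "\<forall>U\<in>\<V>. \<exists>q. diffeomorphism U T p q"
    using assms unfolding smooth_covering_def by meson
  have "\<forall>U\<in>\<V>. \<exists>q. homeomorphism U T p q" using T(6) unfolding diffeomorphism_def by meson
  then show "\<exists>T. x \<in> T \<and> openin (top_of_set S) T \<and> (\<exists>\<V>. \<Union>\<V> = C \<inter> p -` T \<and>
      (\<forall>U\<in>\<V>. openin (top_of_set C) U) \<and> pairwise disjnt \<V> \<and> (\<forall>U\<in>\<V>. \<exists>q. homeomorphism U T p q))"
    using T by (intro exI[of _ T] conjI exI[of _ \<V>])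
qed

text \<open>The strands are the lifts of \<open>cis\<close> through the covering, one for each point
  of the fibre over 1. Uniqueness of lifts makes them disjoint and yields the monodromy.\<close>

lemma braid_strands:
  assumes "braid N K" "N \<ge> 1"
  obtains P \<pi> \<gamma> where "strands P \<pi> \<gamma>" "card P = N" "K = braid_of P \<gamma>"
proof -
  have cov': "smooth_covering K fst (sphere 0 1)" and KS: "K \<subseteq> sphere 0 1 \<times> UNIV"
    and cd: "\<And>\<zeta>. \<zeta> \<in> sphere 0 1 \<Longrightarrow> card {x \<in> K. fst x = \<zeta>} = N"
    using assms(1) by (auto simp: braid_def)
  note cov = smooth_covering_imp_covering_space[OF cov']
  define P where "P = {z. (1, z) \<in> K}"
  have fib1: "{x \<in> K. fst x = 1} = Pair 1 ` P" by (auto simp: P_def)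
  have cardP: "card P = N"
    using cd[of 1] card_image[of "Pair (1::complex)" P] unfolding fib1 by (simp add: inj_on_def)
  \<comment> \<open>The cardinality of an infinite set is 0, so a positive N gives
    finiteness.\<close>
  then have finP: "finite P" using assms(2) card.infinite by fastforce
  have ccis: "continuous_on UNIV cis" by (intro continuous_intros)
  have "\<exists>g. continuous_on UNIV g \<and> range g \<subseteq> K \<and> g 0 = (1, p) \<and> (\<forall>\<theta>. fst (g \<theta>) = cis \<theta>)" if "p \<in> P" for p
  proof -
    have 1: "(1, p) \<in> K" using that by (simp add: P_def)
    obtain g where "continuous_on (UNIV::real set) g" "g \<in> UNIV \<rightarrow> K" "g 0 = (1, p)" "\<And>y. y \<in> UNIV \<Longrightarrow> fst (g y) = cis y"
      by (rule covering_space_lift_strong[OF cov 1, of "0::real" UNIV cis])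
        (auto simp: ccis convex_imp_simply_connected convex_imp_locally_path_connected)
    then show ?thesis by (intro exI[of _ g]) auto
  qed
  then obtain g where g: "\<And>p. p \<in> P \<Longrightarrow> continuous_on UNIV (g p)" "\<And>p \<theta>. p \<in> P \<Longrightarrow> g p \<theta> \<in> K"
    "\<And>p. p \<in> P \<Longrightarrow> g p 0 = (1, p)" "\<And>p \<theta>. p \<in> P \<Longrightarrow> fst (g p \<theta>) = cis \<theta>"
    by (metis range_subsetD)
  have uniq: "g1 \<theta> = g2 \<theta>" if "continuous_on UNIV g1" "continuous_on UNIV g2" "\<And>\<theta>. g1 \<theta> \<in> K" "\<And>\<theta>. g2 \<theta> \<in> K"
    "\<And>\<theta>. fst (g1 \<theta>) = cis (\<theta>::real)" "\<And>\<theta>. fst (g2 \<theta>) = cis \<theta>" "g1 a = g2 a" for g1 g2 a \<theta>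
    by (rule covering_space_lift_unique[OF cov that(7) ccis _ that(1) _ _ that(2)]) (use that in auto)
  define \<gamma> where "\<gamma> p \<theta> = snd (g p \<theta>)" for p \<theta>
  have g\<gamma>: "g p \<theta> = (cis \<theta>, \<gamma> p \<theta>)" if "p \<in> P" for p \<theta> using g(4)[OF that] by (simp add: \<gamma>_def prod_eq_iff)
  \<comment> \<open>The monodromy: after one turn the lift from \<open>p\<close> ends in the fibre
    over 1 again.\<close>
  define \<pi> where "\<pi> p = \<gamma> p (2 * pi)" for p
  have dist: "p = q" if "p \<in> P" "q \<in> P" "\<gamma> p \<theta> = \<gamma> q \<theta>" for p q \<theta>
  proof -
    have "g p 0 = g q 0" by (rule uniq[of _ _ \<theta>]) (use that g g\<gamma> in auto)
    then show ?thesis using g(3) that by auto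
  qed
  have \<pi>P: "\<pi> p \<in> P" if "p \<in> P" for p
    using g(2)[OF that, of "2*pi"] g\<gamma>[OF that, of "2*pi"] by (simp add: P_def \<pi>_def)
  have shift: "\<gamma> p (\<theta> + 2 * pi) = \<gamma> (\<pi> p) \<theta>" if "p \<in> P" for p \<theta>
  proof -
    have c: "continuous_on UNIV (\<lambda>\<theta>. g p (\<theta> + 2 * pi))"
      by (rule continuous_on_compose2[OF g(1)[OF that]]) (auto intro!: continuous_intros)
    have "g p (\<theta> + 2 * pi) = g (\<pi> p) \<theta>"
    proof (rule uniq[OF c g(1)[OF \<pi>P[OF that]], of 0])
      have cp: "cis (\<theta> + 2 * pi) = cis \<theta>" for \<theta> by (simp add: cis.ctr)
      show "fst (g p (\<theta> + 2 * pi)) = cis \<theta>" for \<theta> using g(4)[OF that] cp by simp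
      show "g p (0 + 2 * pi) = g (\<pi> p) 0"
        using g(3)[OF \<pi>P[OF that]] g\<gamma>[OF that, of "2*pi"] by (simp add: \<pi>_def)
    qed (use g(2,4) that \<pi>P[OF that] in auto)
    then show ?thesis by (simp add: \<gamma>_def)
  qed
  have "inj_on \<pi> P" by (intro inj_onI) (use dist \<pi>_def in auto)
  then have bij: "bij_betw \<pi> P P" using \<pi>P finP by (simp add: bij_betw_def endo_inj_surj image_subsetI)
  have smooth: "smooth_on UNIV (\<gamma> p)" if p: "p \<in> P" for p
  proof (rule smooth_on_open_local)
    fix \<theta>\<^sub>0 :: real
    have "cis \<theta>\<^sub>0 \<in> sphere 0 1" by simp
    then obtain T \<V> where T: "cis \<theta>\<^sub>0 \<in> T" "openin (top_of_set (sphere 0 1)) T" "\<Union>\<V> = K \<inter> fst -` T"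
      "\<forall>U\<in>\<V>. openin (top_of_set K) U" "\<forall>U\<in>\<V>. \<exists>q. diffeomorphism U T fst q"
      using cov' unfolding smooth_covering_def by meson
    have "g p \<theta>\<^sub>0 \<in> \<Union>\<V>" unfolding T(3) using g(2,4)[OF p] T(1) by auto
    then obtain U where U: "g p \<theta>\<^sub>0 \<in> U" "U \<in> \<V>" by auto
    obtain U' where U': "open U'" "U = K \<inter> U'" using T(4) U(2) by (metis openin_open)
    obtain q where q: "diffeomorphism U T fst q" using T(5) U(2) by auto
    obtain B q' where B: "open B" "cis \<theta>\<^sub>0 \<in> B" "smooth_on B q'" "\<And>y. y \<in> T \<Longrightarrow> y \<in> B \<Longrightarrow> q' y = q y"
      using q T(1) unfolding diffeomorphism_def by (metis smooth_mapE)
    let ?W = "(g p -` U') \<inter> (cis -` B)"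
    have oW: "open ?W"
      by (intro open_Int open_vimage U'(1) B(1) g(1)[OF p] ccis)
    \<comment> \<open>Near the given angle the lift stays in one sheet \<open>U\<close>, where it is
      the smooth local section composed with \<open>cis\<close>.\<close>
    have "g p \<theta> = q' (cis \<theta>)" if "\<theta> \<in> ?W" for \<theta>
    proof -
      have "g p \<theta> \<in> U" using that g(2)[OF p] U' by auto
      then have "q (fst (g p \<theta>)) = g p \<theta>" "fst (g p \<theta>) \<in> T"
        using q unfolding diffeomorphism_def homeomorphism_def by auto
      then show ?thesis using B(4)[of "cis \<theta>"] g(4)[OF p] that by auto
    qed
    then have eq: "snd (q' (cis \<theta>)) = \<gamma> p \<theta>" if "\<theta> \<in> ?W" for \<theta> using that by (simp add: \<gamma>_def)
    have sq: "smooth_on ?W (\<lambda>\<theta>. q' (cis \<theta>))"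
      by (rule smooth_on_compose[OF oW B(1,3)]) (auto intro!: smooth_on_cis smooth_on_id oW)
    have "smooth_on ?W (\<gamma> p)" by (rule smooth_on_cong[OF oW eq smooth_on_snd[OF oW sq]])
    moreover have "\<theta>\<^sub>0 \<in> ?W" using U U' B by auto
    ultimately show "\<exists>T. open T \<and> \<theta>\<^sub>0 \<in> T \<and> smooth_on T (\<gamma> p)" using oW by blast
  qed auto
  have str: "strands P \<pi> \<gamma>"
    unfolding strands_def using finP bij smooth shift dist by blast
  have "K = braid_of P \<gamma>"
  proof
    show "braid_of P \<gamma> \<subseteq> K" using g(2) g\<gamma> by (force simp: braid_of_def)
    show "K \<subseteq> braid_of P \<gamma>"
    proof
      fix x assume x: "x \<in> K"
      then have "cmod (fst x) = 1" using KS by auto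
      then obtain \<theta> where \<theta>: "fst x = cis \<theta>"
        by (metis cis_Arg_unique is_Arg_def mult_1 norm_eq_zero of_real_1 rcis_cmod_Arg rcis_def zero_neq_one)
      \<comment> \<open>The lifts give N distinct points of a fibre with N elements, hence all of
        it.\<close>
      have sub: "(\<lambda>p. g p \<theta>) ` P \<subseteq> {x \<in> K. fst x = cis \<theta>}" using g by auto
      have "inj_on (\<lambda>p. g p \<theta>) P" by (rule inj_onI, rule dist[where \<theta>=\<theta>]) (auto simp: \<gamma>_def)
      then have "card ((\<lambda>p. g p \<theta>) ` P) = N" using cardP by (simp add: card_image)
      moreover have "card {x \<in> K. fst x = cis \<theta>} = N" by (rule cd) simp
      moreover from this have "finite {x \<in> K. fst x = cis \<theta>}" using assms(2)
        by (intro card_ge_0_finite) simp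
      ultimately have "(\<lambda>p. g p \<theta>) ` P = {x \<in> K. fst x = cis \<theta>}"
        by (intro card_subset_eq[OF _ sub]) simp_all
      moreover have "x \<in> {x \<in> K. fst x = cis \<theta>}" using x \<theta> by simp
      ultimately have "x \<in> (\<lambda>p. g p \<theta>) ` P" by simp
      then obtain p where "p \<in> P" "x = g p \<theta>" by (rule imageE)
      then show "x \<in> braid_of P \<gamma>" using g\<gamma> by (auto simp: braid_of_def)
    qed
  qed
  then show ?thesis using that str cardP by blast
qed

section \<open>Surfaces with several sheets\<close>

text \<open>An accumulation point \<open>x\<close> of zeros is itself a zero. There the injective
  derivative bounds |f y| below by a multiple of |y - x|, which excludes other zeros nearby.\<close>

lemma finite_zeros:
  fixes f :: "complex \<Rightarrow> complex"
  assumes "smooth_on S f" "open S" "compact K" "K \<subseteq> S"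
    "\<And>x. x \<in> K \<Longrightarrow> f x = 0 \<Longrightarrow> inj (frechet_derivative f (at x))"
  shows "finite {x \<in> K. f x = 0}"
proof (rule ccontr)
  let ?Z = "{x \<in> K. f x = 0}"
  assume "infinite ?Z"
  then obtain x where x: "x \<in> K" "x islimpt ?Z"
    using assms(3) compact_eq_Bolzano_Weierstrass[of K] by auto
  have cf: "continuous_on S f" by (rule smooth_on_imp_continuous_on[OF assms(1)])
  have "?Z = K \<inter> f -` {0}" by auto
  moreover have "closed (K \<inter> f -` {0})"
    by (rule continuous_closed_preimage[OF continuous_on_subset[OF cf assms(4)] compact_imp_closed[OF assms(3)]]) simp
  ultimately have "closed ?Z" by simp
  then have fx: "f x = 0" using x closed_limpt by blast
  define A where "A = frechet_derivative f (at x)"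
  have dA: "(f has_derivative A) (at x)"
    unfolding A_def by (rule smooth_on_has_derivative[OF assms(1)]) (use x assms in auto)
  have "inj A" unfolding A_def using assms(5)[OF x(1) fx] .
  then obtain B where B: "B > 0" "\<And>v. B * norm v \<le> norm (A v)"
    using linear_inj_bounded_below_pos[OF has_derivative_linear[OF dA]] by metis
  obtain d where d: "d > 0" "\<And>y. norm (y - x) < d \<Longrightarrow> norm (f y - f x - A (y - x)) \<le> B / 2 * norm (y - x)"
    using dA B(1) unfolding has_derivative_at_alt by (meson half_gt_zero)
  obtain y where y: "y \<in> ?Z" "y \<noteq> x" "dist y x < d"
    using x(2) d(1) unfolding islimpt_approachable by metis
  have "B * norm (y - x) \<le> norm (A (y - x))" by (rule B)
  also have "\<dots> \<le> B / 2 * norm (y - x)"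
    using d(2)[of y] y fx by (simp add: dist_norm)
  finally show False using B(1) y(2) by simp
qed

text \<open>A complex linear derivative is symmetric because multiplication commutes; this is why
  holomorphic graphs are Lagrangian here.\<close>

lemma symmetric_deriv_holomorphic:
  fixes f :: "complex \<Rightarrow> complex"
  assumes "open D" "smooth_on D f" "\<And>x. x \<in> D \<Longrightarrow> (f has_field_derivative f' x) (at x)"
  shows "symmetric_deriv D f"
  by (rule symmetric_derivI[OF assms(1,2) assms(3)[unfolded has_field_derivative_def]]) (auto simp: mult_ac)

lemma node_symp_chart:
  assumes "symp_chart U V \<Phi> \<Psi>" "x \<in> U" "node M (\<Phi> x)" "\<And>y. y \<in> U \<Longrightarrow> y \<in> L \<longleftrightarrow> \<Phi> y \<in> M"
  shows "node L x"
proof -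
  note D = symp_chartD[OF assms(1)]
  obtain U2 V2 \<Phi>2 \<Psi>2 where *: "symp_chart U2 V2 \<Phi>2 \<Psi>2" "\<Phi> x \<in> U2" "\<Phi>2 (\<Phi> x) = 0"
     "\<forall>y\<in>U2. y \<in> M \<longleftrightarrow> fst (\<Phi>2 y) = 0 \<or> snd (\<Phi>2 y) = 0"
    using assms(3) unfolding node_def by metis
  note D2 = symp_chartD[OF *(1)]
  let ?I = "V \<inter> U2"
  have 1: "symp_chart {y \<in> U. y \<in> UNIV \<and> \<Phi> y \<in> ?I} {z \<in> V. \<Psi> z \<in> UNIV \<and> z \<in> ?I} \<Phi> \<Psi>"
    by (rule symp_chart_restrict[OF assms(1)]) (use D D2 in auto)
  have 2: "symp_chart {y \<in> U2. y \<in> ?I \<and> \<Phi>2 y \<in> UNIV} {z \<in> V2. \<Psi>2 z \<in> ?I \<and> z \<in> UNIV} \<Phi>2 \<Psi>2"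
    by (rule symp_chart_restrict[OF *(1)]) (use D D2 in auto)
  have eq: "{z \<in> V. \<Psi> z \<in> UNIV \<and> z \<in> ?I} = {y \<in> U2. y \<in> ?I \<and> \<Phi>2 y \<in> UNIV}" by auto
  show ?thesis
    unfolding node_def
    by (rule exI, rule exI, rule exI[of _ "\<lambda>x. \<Phi>2 (\<Phi> x)"], rule exI, rule conjI, rule symp_chart_compose[OF 1 2[folded eq]])
      (use * assms D in auto)
qed

lemma node_axes: "node {y. fst y = 0 \<or> snd y = 0} 0"
  unfolding node_def
  by (rule exI[of _ UNIV], rule exI[of _ UNIV], rule exI[of _ "\<lambda>x. x"], rule exI[of _ "\<lambda>x. x"])
    (auto intro!: symp_chartI[where \<Phi>'="\<lambda>x v. v"] smooth_intros)

text \<open>The sheets are eta = \<open>g p \<xi>\<close> with \<xi> = log a1. By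
  \<open>centre\<close> they are, for |a1| < 1, the branches of discs that fill in the puncture a1 =
  0, and \<open>sep\<close> keeps the discs apart. \<open>double\<close> confines the double points
  to a bounded range of Re \<xi> and makes them transverse: the two tangent planes meet only in 0
  when the difference of the sheets has injective derivative.\<close>

locale sheet_system =
  fixes P :: "complex set" and \<pi> :: "complex \<Rightarrow> complex" and g :: "complex \<Rightarrow> complex \<Rightarrow> complex"
    and R :: "complex set" and n :: "complex \<Rightarrow> nat" and c :: real
  assumes finP: "finite P" and bij\<pi>: "bij_betw \<pi> P P"
    and sym: "p \<in> P \<Longrightarrow> symmetric_deriv UNIV (g p)"
    and equiv: "p \<in> P \<Longrightarrow> g p (\<xi> + 2 * pi * \<i>) = g (\<pi> p) \<xi>"
    and finR: "finite R" and c_pos: "c > 0" and n_pos: "r \<in> R \<Longrightarrow> n r > 0"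
    and sep: "r \<in> R \<Longrightarrow> r' \<in> R \<Longrightarrow> r \<noteq> r' \<Longrightarrow> cmod (r - r') \<ge> 3 * c"
    and centre: "Re \<xi> < 0 \<Longrightarrow> (\<exists>p\<in>P. exp \<xi> * a = g p \<xi>) \<longleftrightarrow> (\<exists>r\<in>R. exp \<xi> = ((a - r) / c) ^ n r)"
    and double: "p \<in> P \<Longrightarrow> q \<in> P \<Longrightarrow> p \<noteq> q \<Longrightarrow> g p \<xi> = g q \<xi> \<Longrightarrow>
        0 \<le> Re \<xi> \<and> Re \<xi> \<le> 3 \<and> inj (frechet_derivative (\<lambda>\<xi>. g p \<xi> - g q \<xi>) (at \<xi>))"
    and no_triple: "p \<in> P \<Longrightarrow> q \<in> P \<Longrightarrow> r \<in> P \<Longrightarrow> g p \<xi> = g q \<xi> \<Longrightarrow> g p \<xi> = g r \<xi> \<Longrightarrow> p = q \<or> p = r \<or> q = r"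
begin

definition surf :: "C2 set" where
  "surf = {(exp \<xi>, exp (- \<xi>) * g p \<xi>) |\<xi> p. p \<in> P} \<union> {0} \<times> R"

lemma smooth_g: "p \<in> P \<Longrightarrow> smooth_on UNIV (g p)"
  using symmetric_derivD(2)[OF sym] .

lemma cont_g: "p \<in> P \<Longrightarrow> continuous_on S f \<Longrightarrow> continuous_on S (\<lambda>x. g p (f x))"
  by (rule continuous_on_compose2[OF smooth_on_imp_continuous_on[OF smooth_g]]) auto

lemma g_shift:
  assumes "p \<in> P" "exp \<xi> = exp \<xi>'"
  shows "\<exists>q\<in>P. g p \<xi> = g q \<xi>'"
proof -
  obtain k :: int where k: "\<xi> = \<xi>' + of_real (real_of_int (2 * k) * pi) * \<i>"
    using assms(2) unfolding exp_eq by blast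
  then have "\<xi> = \<xi>' + real_of_int k *\<^sub>R (2 * pi * \<i>)" by (simp add: scaleR_conv_of_real)
  then show ?thesis using equivariant_shift[where F=g and w="2 * pi * \<i>", OF bij\<pi> equiv assms(1)] by metis
qed

lemma mem_surf:
  assumes "exp \<xi> = fst x"
  shows "x \<in> surf \<longleftrightarrow> (\<exists>p\<in>P. fst x * snd x = g p \<xi>)"
proof
  assume "x \<in> surf"
  then obtain \<xi>' p where p: "p \<in> P" "x = (exp \<xi>', exp (- \<xi>') * g p \<xi>')"
    using assms by (force simp: surf_def)
  then have "fst x * snd x = g p \<xi>'" by (simp add: exp_minus)
  moreover obtain q where "q \<in> P" "g p \<xi>' = g q \<xi>" using g_shift[OF p(1), of \<xi>' \<xi>] p assms by auto
  ultimately show "\<exists>p\<in>P. fst x * snd x = g p \<xi>" by auto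
next
  assume "\<exists>p\<in>P. fst x * snd x = g p \<xi>"
  then obtain p where p: "p \<in> P" "fst x * snd x = g p \<xi>" by auto
  then have "x = (exp \<xi>, exp (- \<xi>) * g p \<xi>)"
    unfolding p(2)[symmetric] assms[symmetric] by (simp add: prod_eq_iff exp_minus assms[symmetric])
  then show "x \<in> surf" using p by (auto simp: surf_def)
qed

text \<open>At a1 = 0 the equation reduces to a2 = r because the exponent is positive; elsewhere it
  is \<open>centre\<close> at the logarithm of a1, whose real part is negative.\<close>

lemma mem_surf_centre:
  assumes "cmod (fst x) < 1"
  shows "x \<in> surf \<longleftrightarrow> (\<exists>r\<in>R. fst x = ((snd x - r) / c) ^ n r)"
proof (cases "fst x = 0")
  case True
  have "0 = ((snd x - r) / c) ^ n r \<longleftrightarrow> snd x = r" if "r \<in> R" for r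
    using n_pos[OF that] c_pos by (auto simp: power_0_left)
  then show ?thesis using True by (force simp: surf_def mem_Times_iff)
next
  case False
  have "Re (Ln (fst x)) < 0" using False assms by simp
  from centre[OF this, of "snd x"] mem_surf[of "Ln (fst x)" x] False show ?thesis by simp
qed

lemma surf_log_chart:
  assumes "fst x / exp \<xi> \<notin> \<real>\<^sub>\<le>\<^sub>0"
  shows "x \<in> surf \<longleftrightarrow> (\<exists>p\<in>P. fst x * snd x = g p (\<xi> + Ln (fst x / exp \<xi>)))"
proof -
  have "fst x \<noteq> 0" using assms by auto
  then show ?thesis by (intro mem_surf) (simp add: exp_add)
qed

text \<open>Near a point of the complement the surface is a finite union of closed pieces: discs if
  a1 = 0 there, sheets of a logarithmic chart otherwise.\<close>

lemma closed_surf: "closed surf"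
proof -
  have "open (- surf)"
  proof (rule openI)
    fix x assume x: "x \<in> - surf"
    have "\<exists>W. open W \<and> x \<in> W \<and> W \<subseteq> - surf"
    proof (cases "fst x = 0")
      case True
      let ?W = "{y. cmod (fst y) < 1} \<inter> (\<Inter>r\<in>R. {y. fst y \<noteq> ((snd y - r) / c) ^ n r})"
      have "open ?W"
        by (intro open_Int open_INT finR ballI open_Collect_less open_Collect_neq continuous_intros) (use c_pos in auto)
      moreover have "x \<in> ?W" using True x mem_surf_centre[of x] by auto
      moreover have "?W \<subseteq> - surf" using mem_surf_centre by (auto simp del: split_paired_All)
      ultimately show ?thesis by blast
    next
      case False
      define \<xi> where "\<xi> = Ln (fst x)"
      note ch = symp_chartD[OF symp_chart_log[of \<xi>]]
      let ?U = "{x. fst x / exp \<xi> \<notin> \<real>\<^sub>\<le>\<^sub>0}"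
      let ?f = "\<lambda>p y. fst y * snd y - g p (\<xi> + Ln (fst y / exp \<xi>))"
      let ?W = "?U \<inter> (\<Inter>p\<in>P. ?U \<inter> ?f p -` (- {0}))"
      have "open (?U \<inter> ?f p -` (- {0}))" if "p \<in> P" for p
        by (rule continuous_open_preimage[OF _ ch(1)])
          (intro continuous_intros cont_g[OF that] continuous_on_Ln, auto)
      then have "open ?W" using ch(1) finP by (intro open_Int open_INT) auto
      moreover have "x \<in> ?W" using False x surf_log_chart[of x \<xi>] by (auto simp: \<xi>_def)
      moreover have "?W \<subseteq> - surf" using surf_log_chart[of _ \<xi>] by (auto simp del: split_paired_All)
      ultimately show ?thesis by blast
    qed
    then show "\<exists>e>0. ball x e \<subseteq> - surf" by (meson openE subset_trans)
  qed
  then show ?thesis by (simp add: closed_open)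
qed

definition sheets :: "C2 set" where "sheets = {y. \<exists>p\<in>P. snd y = g p (fst y)}"

lemma surf_sheets:
  assumes "fst x \<noteq> 0" "exp \<xi> = fst x"
  shows "nice sheets (\<xi>, fst x * snd x) \<Longrightarrow> nice surf x" "node sheets (\<xi>, fst x * snd x) \<Longrightarrow> node surf x"
proof -
  let ?U = "{x. fst x / exp \<xi> \<notin> \<real>\<^sub>\<le>\<^sub>0}" and ?\<Phi> = "\<lambda>x. (\<xi> + Ln (fst x / exp \<xi>), fst x * snd x)"
  have x: "x \<in> ?U" "?\<Phi> x = (\<xi>, fst x * snd x)" using assms by auto
  have m: "y \<in> surf \<longleftrightarrow> ?\<Phi> y \<in> sheets" if "y \<in> ?U" for y
    using surf_log_chart[of y \<xi>] that by (simp add: sheets_def)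
  show "nice sheets (\<xi>, fst x * snd x) \<Longrightarrow> nice surf x"
    by (rule nice_symp_chart[OF symp_chart_log x(1) _ m]) (simp add: x(2))
  show "node sheets (\<xi>, fst x * snd x) \<Longrightarrow> node surf x"
    by (rule node_symp_chart[OF symp_chart_log x(1) _ m]) (simp add: x(2))
qed

lemma open_avoid_sheets:
  assumes "Q \<subseteq> P"
  shows "open {y. \<forall>q\<in>Q. snd y \<noteq> g q (fst y)}"
proof -
  have "{y. \<forall>q\<in>Q. snd y \<noteq> g q (fst y)} = (\<Inter>q\<in>Q. {y. snd y \<noteq> g q (fst y)})" by auto
  also have "open \<dots>"
    by (intro open_INT ballI open_Collect_neq continuous_intros cont_g) (use assms finP finite_subset in auto)
  finally show ?thesis .
qed

lemma nice_sheets: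
  assumes "p \<in> P" "\<And>q. q \<in> P \<Longrightarrow> q \<noteq> p \<Longrightarrow> g q \<xi> \<noteq> g p \<xi>"
  shows "nice sheets (\<xi>, g p \<xi>)"
proof (rule nice_local[OF nice_graph[OF sym[OF assms(1)], where L="{y. snd y = g p (fst y)}"] open_avoid_sheets[of "P - {p}"]])
  show "(\<xi>, g p \<xi>) \<in> {y. \<forall>q\<in>P - {p}. snd y \<noteq> g q (fst y)}" using assms by force
qed (use assms in \<open>auto simp: sheets_def\<close>)

text \<open>Subtracting \<open>g p\<close> turns the two sheets into the zero section and the graph
  of the difference \<Delta>. As the derivative of \<Delta> is injective, this graph is locally also
  a graph over the second coordinate, namely of the inverse \<open>G\<close>. A shear of the first
  coordinate by \<open>G\<close> moves it to the axis and preserves the zero section.\<close>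

lemma node_sheets:
  assumes pq: "p \<in> P" "q \<in> P" "p \<noteq> q" "g p \<xi> = g q \<xi>"
  shows "node sheets (\<xi>, g p \<xi>)"
proof -
  define \<Delta> where "\<Delta> x = g q x - g p x" for x
  have s\<Delta>: "smooth_on UNIV \<Delta>" unfolding \<Delta>_def[abs_def] by (intro smooth_intros smooth_g pq) auto
  have "inj (frechet_derivative \<Delta> (at \<xi>))" using double[of q p \<xi>] pq by (simp add: \<Delta>_def[abs_def])
  from smooth_local_inverse[OF open_UNIV s\<Delta> UNIV_I this]
  obtain U V G where UV: "open U" "open V" "\<xi> \<in> U" "\<Delta> \<xi> \<in> V" "homeomorphism U V \<Delta> G" "smooth_on V G"
    "\<And>x. x \<in> U \<Longrightarrow> inj (frechet_derivative \<Delta> (at x))" by metis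
  have GV: "y \<in> V \<Longrightarrow> G y \<in> U" "y \<in> V \<Longrightarrow> \<Delta> (G y) = y" "x \<in> U \<Longrightarrow> G (\<Delta> x) = x" for x y
    using UV(5) unfolding homeomorphism_def by auto
  have sym\<Delta>: "Im (u * frechet_derivative \<Delta> (at x) v) = Im (v * frechet_derivative \<Delta> (at x) u)" for x u v
  proof -
    have "(\<Delta> has_derivative (\<lambda>v. frechet_derivative (g q) (at x) v - frechet_derivative (g p) (at x) v)) (at x)"
      unfolding \<Delta>_def[abs_def] by (intro has_derivative_diff symmetric_derivD(3)[OF sym] pq) auto
    then have "frechet_derivative \<Delta> (at x) = (\<lambda>v. frechet_derivative (g q) (at x) v - frechet_derivative (g p) (at x) v)"
      using frechet_derivative_at by metis
    then show ?thesis
      using symmetric_derivD(4)[OF sym[OF pq(1)], of x u v] symmetric_derivD(4)[OF sym[OF pq(2)], of x u v]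
      by (simp add: right_diff_distrib)
  qed
  have symG: "symmetric_deriv V G"
    unfolding symmetric_deriv_def
  proof (intro conjI ballI allI UV(2,6))
    fix y u v assume y: "y \<in> V"
    let ?G' = "frechet_derivative G (at y)" and ?D = "frechet_derivative \<Delta> (at (G y))"
    have "((\<lambda>y. \<Delta> (G y)) has_derivative (\<lambda>v. ?D (?G' v))) (at y)"
      by (rule has_derivative_compose[OF smooth_on_has_derivative[OF UV(6) y] smooth_on_has_derivative[OF s\<Delta> UNIV_I]])
    then have "((\<lambda>y. y) has_derivative (\<lambda>v. ?D (?G' v))) (at y)"
      by (rule has_derivative_transform_within_open[OF _ UV(2) y]) (use GV in auto)
    then have "(\<lambda>v. ?D (?G' v)) = (\<lambda>v. v)" by (rule has_derivative_unique[OF _ has_derivative_ident])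
    then have DG: "?D (?G' v) = v" for v by metis
    \<comment> \<open>The inverse of a symmetric map is symmetric: the symmetry of \<open>?D\<close>
      is applied to \<open>?G' u\<close> and \<open>?G' v\<close>.\<close>
    show "Im (u * ?G' v) = Im (v * ?G' u)"
      using sym\<Delta>[of "?G' u" "G y" "?G' v"] DG by (simp add: mult.commute)
  qed
  have \<Delta>0: "\<Delta> \<xi> = 0" using pq by (simp add: \<Delta>_def)
  have G0: "G 0 = \<xi>" "0 \<in> V" using GV(3)[OF UV(3)] UV(4) \<Delta>0 by auto
  have node1: "node {y. fst y = G (snd y) \<or> snd y = 0} (\<xi>, 0)"
  proof (rule node_local[where L="{y. snd y \<in> V \<and> (fst y = G (snd y) \<or> snd y = 0)}"])
    show "node {y. snd y \<in> V \<and> (fst y = G (snd y) \<or> snd y = 0)} (\<xi>, 0)"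
      by (rule node_symp_chart[OF symp_chart_shear_fst[OF symG], where M="{y. fst y = 0 \<or> snd y = 0}"])
        (use G0 node_axes in \<open>auto simp: zero_prod_def\<close>)
    show "open (UNIV \<times> V)" using UV(2) by (intro open_Times) auto
  qed (use G0 in auto)
  let ?M = "{y. snd y = \<Delta> (fst y) \<or> snd y = 0}"
  have "node ?M (\<xi>, 0)"
  proof (rule node_local[OF node1])
    show "open (U \<times> V)" using UV by (intro open_Times)
    show "(\<xi>, 0) \<in> U \<times> V" using UV G0 by auto
    fix y assume "y \<in> U \<times> V"
    then show "y \<in> {y. fst y = G (snd y) \<or> snd y = 0} \<longleftrightarrow> y \<in> ?M"
      using GV(2)[of "snd y"] GV(3)[of "fst y"] by (auto simp: mem_Times_iff)
  qed
  then have nM: "node ?M ((\<lambda>y. (fst y, snd y - g p (fst y))) (\<xi>, g p \<xi>))" by simp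
  have "node {y. snd y = g q (fst y) \<or> snd y = g p (fst y)} (\<xi>, g p \<xi>)"
    by (rule node_symp_chart[OF symp_chart_shear_snd[OF sym[OF pq(1)]] _ nM])
      (auto simp: \<Delta>_def algebra_simps)
  then show ?thesis
  \<comment> \<open>By \<open>no_triple\<close> no third sheet passes through the point, so a
    neighbourhood misses all of them.\<close>
  proof (rule node_local[OF _ open_avoid_sheets[of "P - {p, q}"]])
    show "(\<xi>, g p \<xi>) \<in> {y. \<forall>r\<in>P - {p, q}. snd y \<noteq> g r (fst y)}"
      using no_triple[OF pq(1,2), of _ \<xi>] pq by auto
  qed (use pq in \<open>auto simp: sheets_def\<close>)
qed

lemma nice_surf_centre:
  assumes "x \<in> surf" "fst x = 0"
  shows "nice surf x"
proof -
  let ?f = "\<lambda>(r :: complex) (a :: complex). ((a - r) / complex_of_real c) ^ n r"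
  obtain r where r: "r \<in> R" "x = (0, r)"
    using assms unfolding surf_def by (auto simp: prod_eq_iff)
  have s: "smooth_on UNIV (?f r)" using c_pos by (intro smooth_intros) auto
  have "\<exists>f'. (?f r has_field_derivative f') (at a)" for a
    using c_pos by (intro exI) (auto intro!: derivative_eq_intros)
  then obtain f' where f': "\<And>a. (?f r has_field_derivative f' a) (at a)" by metis
  let ?W = "{y. cmod (fst y) < 1 \<and> cmod (snd y - r) < c}"
  show ?thesis
  proof (rule nice_local[OF nice_cograph[OF symmetric_deriv_holomorphic[OF open_UNIV s f'], where L="{y. fst y = ?f r (snd y)}"]])
    show "open ?W" by (intro open_Collect_conj open_Collect_less continuous_intros)
    show "x \<in> ?W" using r c_pos by simp
    fix y assume y: "y \<in> ?W"
    \<comment> \<open>In \<open>?W\<close> the value a2 is closer than \<open>c\<close> to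
      \<open>r\<close>, hence at distance at least \<open>c\<close> from every other centre, where
      that disc would have |a1| \<ge> 1.\<close>
    have "fst y \<noteq> ?f r' (snd y)" if "r' \<in> R" "r' \<noteq> r" for r'
    proof
      assume e: "fst y = ?f r' (snd y)"
      have "cmod (snd y - r') \<ge> c"
        using sep[OF r(1) that(1)] that(2) y norm_triangle_ineq[of "r - snd y" "snd y - r'"] c_pos
        by (auto simp: norm_minus_commute)
      then have "cmod ((snd y - r') / c) \<ge> 1" using c_pos by (simp add: norm_divide)
      then have "cmod (?f r' (snd y)) \<ge> 1" by (simp only: norm_power one_le_power)
      then show False using e y by simp
    qed
    then show "y \<in> {y. fst y = ?f r (snd y)} \<longleftrightarrow> y \<in> surf"
      using mem_surf_centre[of y] y r(1) by auto
  qed auto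
qed

definition double_points :: "C2 set" where
  "double_points = {(exp \<xi>, exp (- \<xi>) * g p \<xi>) |\<xi> p q. p \<in> P \<and> q \<in> P \<and> p \<noteq> q \<and> g p \<xi> = g q \<xi>}"

text \<open>Whole turns move a double point into 0 \<le> Im \<xi> \<le> 2 pi at the price of
  relabelling its sheets, and \<open>double\<close> bounds Re \<xi>; on this compact box each pair
  of sheets has finitely many coincidences.\<close>

lemma finite_double_points: "finite double_points"
proof -
  let ?K = "cbox 0 (Complex 3 (2 * pi))"
  let ?Z = "\<lambda>p q. {\<xi> \<in> ?K. g p \<xi> - g q \<xi> = 0}"
  have fin: "finite (?Z p q)" if "p \<in> P" "q \<in> P" "p \<noteq> q" for p q
    by (rule finite_zeros[OF _ open_UNIV compact_cbox subset_UNIV])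
      (use double[OF that] smooth_g that in \<open>auto intro!: smooth_on_diff\<close>)
  have "double_points \<subseteq> (\<Union>p\<in>P. \<Union>q\<in>P - {p}. (\<lambda>\<xi>. (exp \<xi>, exp (- \<xi>) * g p \<xi>)) ` ?Z p q)"
  proof
    fix x assume "x \<in> double_points"
    then obtain \<xi> p q where x: "x = (exp \<xi>, exp (- \<xi>) * g p \<xi>)" "p \<in> P" "q \<in> P" "p \<noteq> q" "g p \<xi> = g q \<xi>"
      by (auto simp: double_points_def)
    define k where "k = \<lfloor>Im \<xi> / (2 * pi)\<rfloor>"
    define \<xi>' where "\<xi>' = \<xi> - of_int k *\<^sub>R (2 * pi * \<i>)"
    have "0 \<le> Im \<xi>'" "Im \<xi>' \<le> 2 * pi"
      using floor_divide_lower[of "2*pi" "Im \<xi>"] floor_divide_upper[of "2*pi" "Im \<xi>"]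
      by (auto simp: \<xi>'_def k_def algebra_simps)
    moreover have "Re \<xi>' = Re \<xi>" by (simp add: \<xi>'_def)
    ultimately have K: "\<xi>' \<in> ?K" using double[OF x(2-5)] by (auto simp: in_cbox_complex_iff)
    have e: "exp \<xi>' = exp \<xi>"
      unfolding exp_eq \<xi>'_def by (intro exI[of _ "- k"]) (simp add: scaleR_conv_of_real)
    have e': "exp (- \<xi>') = exp (- \<xi>)" unfolding exp_minus e ..
    have "\<exists>p'\<in>P. \<forall>z. g p (z + of_int k *\<^sub>R (2 * pi * \<i>)) = g p' z" "\<exists>q'\<in>P. \<forall>z. g q (z + of_int k *\<^sub>R (2 * pi * \<i>)) = g q' z"
      using equivariant_shift[where F=g and w="2 * pi * \<i>", OF bij\<pi> equiv] x by auto
    then obtain p' q' where p': "p' \<in> P" "\<And>z. g p (z + of_int k *\<^sub>R (2 * pi * \<i>)) = g p' z"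
      and q': "q' \<in> P" "\<And>z. g q (z + of_int k *\<^sub>R (2 * pi * \<i>)) = g q' z" by metis
    have v: "g p \<xi> = g p' \<xi>'" "g q \<xi> = g q' \<xi>'" using p'(2)[of \<xi>'] q'(2)[of \<xi>'] by (auto simp: \<xi>'_def)
    have "p' \<noteq> q'"
    proof
      assume "p' = q'"
      then have "g p z = g q z" for z
        using p'(2)[of "z - of_int k *\<^sub>R (2 * pi * \<i>)"] q'(2)[of "z - of_int k *\<^sub>R (2 * pi * \<i>)"] by simp
      \<comment> \<open>Equal functions would coincide at -1, outside the range that
        \<open>double\<close> allows.\<close>
      then show False using double[OF x(2-4), of "-1"] by simp
    qed
    moreover have "x = (exp \<xi>', exp (- \<xi>') * g p' \<xi>')" using x(1) e e' v by simp
    moreover have "\<xi>' \<in> ?Z p' q'" using K v x(5) by simp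
    ultimately show "x \<in> (\<Union>p\<in>P. \<Union>q\<in>P - {p}. (\<lambda>\<xi>. (exp \<xi>, exp (- \<xi>) * g p \<xi>)) ` ?Z p q)"
      using p'(1) q'(1) by blast
  qed
  moreover have "finite (\<Union>p\<in>P. \<Union>q\<in>P - {p}. (\<lambda>\<xi>. (exp \<xi>, exp (- \<xi>) * g p \<xi>)) ` ?Z p q)"
    using fin finP by (intro finite_UN_I finite_imageI) auto
  ultimately show ?thesis by (rule finite_subset)
qed

text \<open>All handles are placed in a ball around the finitely many double points, so the surface
  is unchanged far out.\<close>

lemma resolved_surface:
  obtains L B where "closed L" "\<And>x. x \<in> L \<Longrightarrow> nice L x" "\<And>x. norm x \<ge> B \<Longrightarrow> x \<in> L \<longleftrightarrow> x \<in> surf"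
proof -
  obtain B where B: "\<And>x. x \<in> double_points \<Longrightarrow> norm x \<le> B"
    using finite_imp_bounded[OF finite_double_points] unfolding bounded_iff by auto
  have 1: "node surf x" if x: "x \<in> double_points" for x
  proof -
    obtain \<xi> p q where x: "x = (exp \<xi>, exp (- \<xi>) * g p \<xi>)" "p \<in> P" "q \<in> P" "p \<noteq> q" "g p \<xi> = g q \<xi>"
      using x by (auto simp: double_points_def)
    have e: "fst x * snd x = g p \<xi>" unfolding x(1) by (simp add: exp_minus)
    show ?thesis
      by (rule surf_sheets(2)[of x \<xi>, unfolded e, OF _ _ node_sheets[OF x(2-5)]]) (simp_all add: x(1))
  qed
  have 2: "nice surf x" if x: "x \<in> surf" "x \<notin> double_points" for x
  proof (cases "fst x = 0")
    case False
    then obtain \<xi> p where p: "p \<in> P" "x = (exp \<xi>, exp (- \<xi>) * g p \<xi>)"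
      using x(1) unfolding surf_def by force
    then have e: "fst x * snd x = g p \<xi>" by (simp add: exp_minus)
    have "g q \<xi> \<noteq> g p \<xi>" if "q \<in> P" "q \<noteq> p" for q
    proof
      assume "g q \<xi> = g p \<xi>"
      then have "x \<in> double_points" unfolding double_points_def using p that by force
      then show False using x by simp
    qed
    from nice_sheets[OF p(1) this] show ?thesis
      by (intro surf_sheets(1)[of x \<xi>, unfolded e]) (simp_all add: p(2))
  qed (use nice_surf_centre x in auto)
  obtain L where "closed L" "\<And>x. x \<in> L \<Longrightarrow> nice L x" "\<And>x. x \<notin> ball 0 (B + 1) \<Longrightarrow> x \<in> L \<longleftrightarrow> x \<in> surf"
    by (rule resolve_nodes[OF finite_double_points closed_surf 1 2, where W="ball 0 (B + 1)"])
      (use B in force)+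
  then show ?thesis using that[of L "B + 1"] by auto
qed

end

subsection \<open>Generic parameters\<close>

text \<open>Sard's theorem in equal dimensions. \<open>\<phi>\<close> and \<open>\<psi>\<close>
  identify the plane with \<open>real^2\<close>, where a noninjective derivative is a matrix of rank
  below 2.\<close>

lemma negligible_critical_values:
  fixes f :: "complex \<Rightarrow> complex"
  assumes "smooth_on S f"
  shows "negligible (f ` {x \<in> S. \<not> inj (frechet_derivative f (at x))})"
proof -
  define \<phi> :: "real^2 \<Rightarrow> complex" where "\<phi> v = Complex (v $ 1) (v $ 2)" for v
  define \<psi> :: "complex \<Rightarrow> real^2" where "\<psi> z = (\<chi> i. if i = 1 then Re z else Im z)" for z
  have inv: "\<phi> (\<psi> z) = z" "\<psi> (\<phi> v) = v" for z v
    by (auto simp: \<phi>_def \<psi>_def vec_eq_iff complex_eq_iff forall_2)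
  have lin: "linear \<phi>" "linear \<psi>"
    by (auto intro!: linearI simp: \<phi>_def \<psi>_def vec_eq_iff complex_eq_iff)
  define Z where "Z = {x \<in> S. \<not> inj (frechet_derivative f (at x))}"
  define F where "F v = \<psi> (f (\<phi> v))" for v
  define F' where "F' v h = \<psi> (frechet_derivative f (at (\<phi> v)) (\<phi> h))" for v h
  have dF: "(F has_derivative F' v) (at v)" if "\<phi> v \<in> S" for v
    unfolding F_def[abs_def] F'_def[abs_def]
    by (rule bounded_linear.has_derivative[OF lin(2)[unfolded linear_conv_bounded_linear]],
        rule has_derivative_compose[OF linear_imp_has_derivative[OF lin(1)] smooth_on_has_derivative[OF assms that]])
  have "negligible (F ` (\<phi> -` Z))"
  proof (rule baby_Sard[where f'=F'])
    fix v assume v: "v \<in> \<phi> -` Z"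
    then have vS: "\<phi> v \<in> S" "\<not> inj (frechet_derivative f (at (\<phi> v)))" by (auto simp: Z_def)
    show "(F has_derivative F' v) (at v within \<phi> -` Z)" using dF[OF vS(1)] by (rule has_derivative_at_withinI)
    have lF: "linear (F' v)" using dF[OF vS(1)] by (rule has_derivative_linear)
    have "\<not> inj (F' v)"
    proof
      assume i: "inj (F' v)"
      have "inj (frechet_derivative f (at (\<phi> v)))"
      proof (rule injI)
        fix x y assume e: "frechet_derivative f (at (\<phi> v)) x = frechet_derivative f (at (\<phi> v)) y"
        have "F' v (\<psi> x) = F' v (\<psi> y)" unfolding F'_def inv by (simp only: e)
        then have "\<psi> x = \<psi> y" using i by (simp add: inj_def)
        then show "x = y" by (metis inv(1))
      qed
      then show False using vS by simp
    qed
    then show "rank (matrix (F' v)) < CARD(2)"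
      unfolding less_rank_noninjective matrix_vector_mul(2)[OF lF] .
  qed simp
  then have "negligible (\<phi> ` F ` (\<phi> -` Z))"
    by (rule negligible_differentiable_image_negligible[rotated])
      (use linear_imp_differentiable_on[OF lin(1)] in auto)
  moreover have "\<phi> ` F ` (\<phi> -` Z) = f ` Z"
  proof -
    have "\<phi> ` (\<phi> -` Z) = Z" using inv(1) by (metis surj_def surj_image_vimage_eq)
    then show ?thesis unfolding F_def[abs_def] image_image inv by (metis image_image)
  qed
  ultimately show ?thesis by (simp add: Z_def)
qed

lemma exists_small_non_negligible:
  assumes "negligible (B :: complex set)" "\<tau> > 0"
  obtains z where "cmod z < \<tau>" "z \<notin> B"
proof -
  have "ball (0::complex) \<tau> \<noteq> {}" using assms(2) by simp
  then have "\<not> negligible (ball (0::complex) \<tau>)" by (intro open_not_negligible open_ball)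
  then have "\<not> ball 0 \<tau> \<subseteq> B" using negligible_subset[OF assms(1)] by metis
  then obtain z where "z \<in> ball 0 \<tau>" "z \<notin> B" by blast
  then show ?thesis using that[of z] by simp
qed

text \<open>For distinct sheets, G p - G q is the nonvanishing factor exp \<xi> (b p - b q) times l
  - H p q. Hence double points form the level set H p q = l and are transverse if l is a regular
  value. At a triple point H p q = H p r as well, which solves to T p q r = \<mu>; for a regular
  value \<mu> this leaves finitely many points of \<open>M\<close>, and l avoids the values of H
  there. \<open>G\<close> is required to have the perturbed form on \<open>S\<close> only, so that a
  cut-off perturbation can be used.\<close>

lemma generic_parameters:
  fixes F b :: "complex \<Rightarrow> complex \<Rightarrow> complex"
  assumes fin: "finite P" and sF: "\<And>p. p \<in> P \<Longrightarrow> smooth_on S (F p)" and sb: "\<And>p. p \<in> P \<Longrightarrow> smooth_on S (b p)"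
    and S: "open S" "compact M" "M \<subseteq> S"
    and b: "\<And>p q \<xi>. p \<in> P \<Longrightarrow> q \<in> P \<Longrightarrow> p \<noteq> q \<Longrightarrow> \<xi> \<in> S \<Longrightarrow> b p \<xi> \<noteq> b q \<xi>" and "\<tau> > 0"
  obtains l \<mu> where "cmod l < \<tau>" "cmod \<mu> < \<tau>"
    "\<And>p q \<xi> G. p \<in> P \<Longrightarrow> q \<in> P \<Longrightarrow> p \<noteq> q \<Longrightarrow> \<xi> \<in> M \<Longrightarrow>
       (\<And>p \<xi>. p \<in> P \<Longrightarrow> \<xi> \<in> S \<Longrightarrow> G p \<xi> = F p \<xi> + exp \<xi> * (l * b p \<xi> + \<mu> * (b p \<xi>)\<^sup>2)) \<Longrightarrow>
       G p \<xi> = G q \<xi> \<Longrightarrow> inj (frechet_derivative (\<lambda>\<xi>. G p \<xi> - G q \<xi>) (at \<xi>))"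
    "\<And>p q r \<xi> G. p \<in> P \<Longrightarrow> q \<in> P \<Longrightarrow> r \<in> P \<Longrightarrow> \<xi> \<in> M \<Longrightarrow>
       (\<And>p \<xi>. p \<in> P \<Longrightarrow> \<xi> \<in> S \<Longrightarrow> G p \<xi> = F p \<xi> + exp \<xi> * (l * b p \<xi> + \<mu> * (b p \<xi>)\<^sup>2)) \<Longrightarrow>
       G p \<xi> = G q \<xi> \<Longrightarrow> G p \<xi> = G r \<xi> \<Longrightarrow> p = q \<or> p = r \<or> q = r"
proof -
  define Q where "Q p q \<xi> = exp (- \<xi>) * (F p \<xi> - F q \<xi>) / (b p \<xi> - b q \<xi>)" for p q \<xi>
  define T where "T p q r \<xi> = - (Q p q \<xi> - Q p r \<xi>) / (b q \<xi> - b r \<xi>)" for p q r \<xi>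
  have sQ: "smooth_on S (Q p q)" if "p \<in> P" "q \<in> P" "p \<noteq> q" for p q
    unfolding Q_def[abs_def] by (intro smooth_intros S sF sb that) (use b[OF that] in auto)
  have sT: "smooth_on S (T p q r)" if "p \<in> P" "q \<in> P" "r \<in> P" "p \<noteq> q" "p \<noteq> r" "q \<noteq> r" for p q r
    unfolding T_def[abs_def] by (intro smooth_intros S sQ sb that) (use b[OF that(2,3,6)] in auto)
  let ?crit = "\<lambda>f. f ` {x \<in> S. \<not> inj (frechet_derivative f (at x))}"
  define triples where "triples = {(p, q, r). p \<in> P \<and> q \<in> P \<and> r \<in> P \<and> p \<noteq> q \<and> p \<noteq> r \<and> q \<noteq> r}"
  have "triples \<subseteq> P \<times> P \<times> P" by (auto simp: triples_def)
  then have ft: "finite triples" using fin finite_subset by blast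
  \<comment> \<open>\<mu> is fixed before l, since H and the finite exceptional set for l depend on
    it.\<close>
  have "negligible (\<Union>(p, q, r)\<in>triples. ?crit (T p q r))"
    by (rule negligible_Union) (use ft in \<open>auto simp: triples_def intro!: negligible_critical_values sT\<close>)
  from exists_small_non_negligible[OF this \<open>\<tau> > 0\<close>] obtain \<mu> where \<mu>: "cmod \<mu> < \<tau>"
    "\<mu> \<notin> (\<Union>(p, q, r)\<in>triples. ?crit (T p q r))" by auto
  define H where "H p q \<xi> = - (Q p q \<xi> + \<mu> * (b p \<xi> + b q \<xi>))" for p q \<xi>
  have sH: "smooth_on S (H p q)" if "p \<in> P" "q \<in> P" "p \<noteq> q" for p q
    unfolding H_def[abs_def] by (intro smooth_intros S sQ sb that)
  have finT: "finite {\<xi> \<in> M. T p q r \<xi> - \<mu> = 0}" if t: "(p, q, r) \<in> triples" for p q r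
  proof (rule finite_zeros[OF _ S])
    have s: "smooth_on S (T p q r)" using t sT by (auto simp: triples_def)
    show "smooth_on S (\<lambda>\<xi>. T p q r \<xi> - \<mu>)" by (intro smooth_intros S s)
    fix \<xi> assume \<xi>: "\<xi> \<in> M" "T p q r \<xi> - \<mu> = 0"
    have "((\<lambda>\<xi>. T p q r \<xi> - \<mu>) has_derivative (\<lambda>v. frechet_derivative (T p q r) (at \<xi>) v - 0)) (at \<xi>)"
      by (intro has_derivative_diff smooth_on_has_derivative[OF s] has_derivative_const) (use \<xi> S in auto)
    then have "frechet_derivative (\<lambda>\<xi>. T p q r \<xi> - \<mu>) (at \<xi>) = frechet_derivative (T p q r) (at \<xi>)"
      using frechet_derivative_at by force
    moreover have "inj (frechet_derivative (T p q r) (at \<xi>))" using \<mu>(2) t \<xi> S by fastforce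
    ultimately show "inj (frechet_derivative (\<lambda>\<xi>. T p q r \<xi> - \<mu>) (at \<xi>))" by simp
  qed
  define pairs where "pairs = {(p, q). p \<in> P \<and> q \<in> P \<and> p \<noteq> q}"
  have "pairs \<subseteq> P \<times> P" by (auto simp: pairs_def)
  then have fp: "finite pairs" using fin finite_subset by blast
  have n1: "negligible (\<Union>(p, q)\<in>pairs. ?crit (H p q))"
    by (rule negligible_Union) (use fp in \<open>auto simp: pairs_def intro!: negligible_critical_values sH\<close>)
  have "finite (\<Union>(p, q, r)\<in>triples. H p q ` {\<xi> \<in> M. T p q r \<xi> - \<mu> = 0})"
    using ft finT by (intro finite_UN_I) auto
  note N = negligible_Un[OF n1 negligible_finite[OF this]]
  obtain l where l: "cmod l < \<tau>" "l \<notin> (\<Union>(p, q)\<in>pairs. ?crit (H p q))"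
    "l \<notin> (\<Union>(p, q, r)\<in>triples. H p q ` {\<xi> \<in> M. T p q r \<xi> - \<mu> = 0})"
    by (rule exists_small_non_negligible[OF N \<open>\<tau> > 0\<close>]) (rule that, assumption, (erule contrapos_nn, erule UnI1 UnI2)+)
  have ident: "F p \<xi> + exp \<xi> * (l * b p \<xi> + \<mu> * (b p \<xi>)\<^sup>2) - (F q \<xi> + exp \<xi> * (l * b q \<xi> + \<mu> * (b q \<xi>)\<^sup>2))
      = (exp \<xi> * (b p \<xi> - b q \<xi>)) * (l - H p q \<xi>)" if "p \<in> P" "q \<in> P" "p \<noteq> q" "\<xi> \<in> S" for p q \<xi>
  proof -
    have nz: "b p \<xi> - b q \<xi> \<noteq> 0" using b[OF that] by simp
    have "exp \<xi> * (b p \<xi> - b q \<xi>) * Q p q \<xi> = (exp \<xi> * exp (- \<xi>)) * (F p \<xi> - F q \<xi>)"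
      using nz by (simp add: Q_def)
    also have "exp \<xi> * exp (- \<xi>) = 1" by (simp add: exp_minus)
    finally have "exp \<xi> * (b p \<xi> - b q \<xi>) * Q p q \<xi> = F p \<xi> - F q \<xi>" by simp
    then show ?thesis by (simp add: H_def algebra_simps power2_eq_square)
  qed
  show ?thesis
  proof (rule that[OF l(1) \<mu>(1)])
    fix p q \<xi> and G :: "complex \<Rightarrow> complex \<Rightarrow> complex"
    assume pq: "p \<in> P" "q \<in> P" "p \<noteq> q" and \<xi>: "\<xi> \<in> M" and
      G: "\<And>p \<xi>. p \<in> P \<Longrightarrow> \<xi> \<in> S \<Longrightarrow> G p \<xi> = F p \<xi> + exp \<xi> * (l * b p \<xi> + \<mu> * (b p \<xi>)\<^sup>2)" and e: "G p \<xi> = G q \<xi>"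
    have \<xi>S: "\<xi> \<in> S" using \<xi> S by auto
    define k where "k \<xi> = exp \<xi> * (b p \<xi> - b q \<xi>)" for \<xi>
    have k: "k \<xi> \<noteq> 0" using b[OF pq \<xi>S] by (simp add: k_def)
    have sk: "smooth_on S k" unfolding k_def[abs_def] by (intro smooth_intros S sb pq)
    have GG: "G p x - G q x = k x * (l - H p q x)" if "x \<in> S" for x
      using ident[OF pq that] G[OF pq(1) that] G[OF pq(2) that] by (simp add: k_def)
    then have lH: "l = H p q \<xi>" using e k \<xi>S by (metis diff_self mult_eq_0_iff right_minus_eq)
    then have inj: "inj (frechet_derivative (H p q) (at \<xi>))" using l(2) pq \<xi>S by (fastforce simp: pairs_def)
    let ?k' = "frechet_derivative k (at \<xi>)" and ?H' = "frechet_derivative (H p q) (at \<xi>)"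
    have "((\<lambda>x. k x * (l - H p q x)) has_derivative (\<lambda>v. k \<xi> * (0 - ?H' v) + ?k' v * (l - H p q \<xi>))) (at \<xi>)"
      by (intro has_derivative_mult has_derivative_diff has_derivative_const
        smooth_on_has_derivative[OF sk \<xi>S] smooth_on_has_derivative[OF sH[OF pq] \<xi>S])
    then have "((\<lambda>x. G p x - G q x) has_derivative (\<lambda>v. k \<xi> * (0 - ?H' v) + ?k' v * (l - H p q \<xi>))) (at \<xi>)"
      by (rule has_derivative_transform_within_open[OF _ S(1) \<xi>S]) (simp add: GG)
    \<comment> \<open>At the double point l = H p q, so the term with the derivative of
      \<open>k\<close> drops out.\<close>
    then have "frechet_derivative (\<lambda>x. G p x - G q x) (at \<xi>) = (\<lambda>v. - k \<xi> * ?H' v)"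
      using frechet_derivative_at lH by force
    then show "inj (frechet_derivative (\<lambda>x. G p x - G q x) (at \<xi>))" using inj k by (simp add: inj_def)
  next
    fix p q r \<xi> and G :: "complex \<Rightarrow> complex \<Rightarrow> complex"
    assume pqr: "p \<in> P" "q \<in> P" "r \<in> P" and \<xi>: "\<xi> \<in> M" and
      G: "\<And>p \<xi>. p \<in> P \<Longrightarrow> \<xi> \<in> S \<Longrightarrow> G p \<xi> = F p \<xi> + exp \<xi> * (l * b p \<xi> + \<mu> * (b p \<xi>)\<^sup>2)" and
      e: "G p \<xi> = G q \<xi>" "G p \<xi> = G r \<xi>"
    have \<xi>S: "\<xi> \<in> S" using \<xi> S by auto
    show "p = q \<or> p = r \<or> q = r"
    proof (rule ccontr)
      assume "\<not> ?thesis"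
      then have ne: "p \<noteq> q" "p \<noteq> r" "q \<noteq> r" by auto
      have lH: "l = H p s \<xi>" if "s \<in> P" "p \<noteq> s" "G p \<xi> = G s \<xi>" for s
      proof -
        have "exp \<xi> * (b p \<xi> - b s \<xi>) * (l - H p s \<xi>) = 0"
          using ident[OF pqr(1) that(1,2) \<xi>S] G[OF pqr(1) \<xi>S] G[OF that(1) \<xi>S] that(3) by simp
        then show ?thesis using b[OF pqr(1) that(1,2) \<xi>S] by simp
      qed
      note H = lH[OF pqr(2) ne(1) e(1)] lH[OF pqr(3) ne(2) e(2)]
      have "Q p q \<xi> - Q p r \<xi> = - \<mu> * (b q \<xi> - b r \<xi>)" using H by (simp add: H_def algebra_simps)
      then have "T p q r \<xi> - \<mu> = 0" using b[OF pqr(2,3) ne(3) \<xi>S] by (simp add: T_def)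
      moreover have "(p, q, r) \<in> triples" using pqr ne by (simp add: triples_def)
      ultimately show False using l(3) H(1) \<xi> by force
    qed
  qed
qed

subsection \<open>A model near \<open>a\<^sub>1 = 0\<close>\<close>

lemma bij_betw_period:
  assumes "finite P" "bij_betw \<pi> P P" "p \<in> P"
  shows "\<exists>m. m > 0 \<and> (\<pi> ^^ m) p = p"
proof -
  have bijk: "bij_betw (\<pi> ^^ k) P P" for k using bij_betw_funpow[OF assms(2)] .
  have inP: "(\<pi> ^^ k) p \<in> P" for k using bijk[of k] assms(3) bij_betwE by blast
  have "\<not> inj_on (\<lambda>k. (\<pi> ^^ k) p) UNIV"
    using inP assms(1) by (metis finite_imageD finite_subset image_subsetI infinite_UNIV_nat)
  then obtain i j where "i < j" "(\<pi> ^^ i) p = (\<pi> ^^ j) p"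
    unfolding inj_on_def by (metis linorder_neqE_nat)
  then have "(\<pi> ^^ i) p = (\<pi> ^^ i) ((\<pi> ^^ (j - i)) p)"
    by (metis add_diff_inverse_nat comp_apply funpow_add less_imp_le_nat not_less)
  then have "p = (\<pi> ^^ (j - i)) p"
    using bijk[of i] assms(3) inP unfolding bij_betw_def inj_on_def by blast
  then show ?thesis using \<open>i < j\<close> by (intro exI[of _ "j - i"]) auto
qed

text \<open>Every cycle of \<open>\<pi>\<close> of length \<open>n\<close> is realised by the \<open>n\<close> branches over \<open>a\<^sub>1 \<noteq> 0\<close> of one disc
  \<open>a\<^sub>1 = ((a\<^sub>2 - r) / c)\<^sup>n\<close>.\<close>

lemma central_sheets:
  fixes P :: "complex set"
  assumes "finite P" "bij_betw \<pi> P P"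
  obtains R :: "complex set" and n :: "complex \<Rightarrow> nat" and c :: real and rr kk where "finite R" "c > 0"
    "\<And>r. r \<in> R \<Longrightarrow> n r > 0" "\<And>r r'. r \<in> R \<Longrightarrow> r' \<in> R \<Longrightarrow> r \<noteq> r' \<Longrightarrow> cmod (r - r') \<ge> 3 * c"
    "\<And>p. p \<in> P \<Longrightarrow> rr p \<in> R" "\<And>p. p \<in> P \<Longrightarrow> rr (\<pi> p) = rr p"
    "\<And>p. p \<in> P \<Longrightarrow> kk (\<pi> p) = kk p * exp (2 * of_real pi * \<i> / of_nat (n (rr p)))"
    "\<And>p q \<xi>. p \<in> P \<Longrightarrow> q \<in> P \<Longrightarrow> p \<noteq> q \<Longrightarrow> Re \<xi> < 3 \<Longrightarrow>
        rr p + of_real c * kk p * exp (\<xi> / of_nat (n (rr p))) \<noteq> rr q + of_real c * kk q * exp (\<xi> / of_nat (n (rr q)))"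
    "\<And>\<xi> a. (\<exists>p\<in>P. a = rr p + of_real c * kk p * exp (\<xi> / of_nat (n (rr p)))) \<longleftrightarrow>
        (\<exists>r\<in>R. exp \<xi> = ((a - r) / of_real c) ^ n r)"
proof -
  have bijk: "bij_betw (\<pi> ^^ k) P P" for k using bij_betw_funpow[OF assms(2)] .
  have inP: "(\<pi> ^^ k) p \<in> P" if "p \<in> P" for k p using bijk[of k] that bij_betwE by blast
  have cancel: "x = y" if "(\<pi> ^^ k) x = (\<pi> ^^ k) y" "x \<in> P" "y \<in> P" for k x y
    using bijk[of k] that unfolding bij_betw_def inj_on_def by blast
  have per: "\<exists>m. m > 0 \<and> (\<pi> ^^ m) p = p" if "p \<in> P" for p
    by (rule bij_betw_period[OF assms that])
  define n where "n p = (LEAST m. m > 0 \<and> (\<pi> ^^ m) p = p)" for p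
  have n: "n p > 0" "(\<pi> ^^ n p) p = p" if "p \<in> P" for p
    using LeastI_ex[OF per[OF that]] by (auto simp: n_def)
  have nleast: "m = 0" if "p \<in> P" "m < n p" "(\<pi> ^^ m) p = p" for m p
    using not_less_Least[of m "\<lambda>m. m > 0 \<and> (\<pi> ^^ m) p = p"] that by (auto simp: n_def)
  have modeq: "a mod n p = b mod n p" if p: "p \<in> P" and e: "(\<pi> ^^ a) p = (\<pi> ^^ b) p" for a b p
  proof -
    have *: "a = b" if "a \<le> b" "b < n p" "(\<pi> ^^ a) p = (\<pi> ^^ b) p" for a b
    proof -
      have "(\<pi> ^^ a) p = (\<pi> ^^ a) ((\<pi> ^^ (b - a)) p)"
        using that by (metis add_diff_inverse_nat comp_apply funpow_add not_less)
      then have "p = (\<pi> ^^ (b - a)) p" using cancel p inP[OF p] by blast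
      then have "b - a = 0" by (intro nleast[OF p]) (use that in auto)
      then show ?thesis using that by simp
    qed
    have "(\<pi> ^^ (a mod n p)) p = (\<pi> ^^ (b mod n p)) p"
      using e funpow_mod_eq[OF n(2)[OF p]] by simp
    then show ?thesis
      using *[of "a mod n p" "b mod n p"] *[of "b mod n p" "a mod n p"] n(1)[OF p]
      by (metis linear mod_less_divisor)
  qed
  define orb where "orb p = {(\<pi> ^^ k) p |k. True}" for p
  \<comment> \<open>\<open>SOME\<close> depends on the set \<open>orb p\<close> only, so
    \<open>rr\<close> is constant on cycles. The chosen label, being a complex number, also serves
    as the centre of the disc.\<close>
  define rr where "rr p = (SOME x. x \<in> orb p)" for p
  have rr_orb: "rr p \<in> orb p" for p
    unfolding rr_def by (rule someI[of _ p]) (auto simp: orb_def intro!: exI[of _ 0])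
  have rrP: "rr p \<in> P" if "p \<in> P" for p using rr_orb[of p] inP[OF that] by (auto simp: orb_def)
  have orb_\<pi>: "orb (\<pi> p) = orb p" if p: "p \<in> P" for p
  proof
    show "orb (\<pi> p) \<subseteq> orb p"
    proof
      fix x assume "x \<in> orb (\<pi> p)"
      then obtain k where "x = (\<pi> ^^ k) (\<pi> p)" by (auto simp: orb_def)
      then have "x = (\<pi> ^^ Suc k) p" by (simp add: funpow_swap1)
      then show "x \<in> orb p" unfolding orb_def by blast
    qed
    show "orb p \<subseteq> orb (\<pi> p)"
    proof
      fix x assume "x \<in> orb p"
      then obtain k where "x = (\<pi> ^^ k) p" by (auto simp: orb_def)
      then have "x = (\<pi> ^^ (k + n p)) p" using n(2)[OF p] by (simp add: funpow_add)
      moreover have "k + n p = Suc (k + n p - 1)" using n(1)[OF p] by simp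
      ultimately have "x = (\<pi> ^^ (k + n p - 1)) (\<pi> p)" by (metis comp_apply funpow_Suc_right)
      then show "x \<in> orb (\<pi> p)" by (auto simp: orb_def)
    qed
  qed
  have rr_\<pi>: "rr (\<pi> p) = rr p" if "p \<in> P" for p using orb_\<pi>[OF that] by (simp add: rr_def)
  have rr_\<pi>k: "rr ((\<pi> ^^ k) p) = rr p" if "p \<in> P" for k p
    using that by (induction k) (auto simp: rr_\<pi>[OF inP])
  have orb_rr: "\<exists>k. p = (\<pi> ^^ k) (rr p)" if p: "p \<in> P" for p
  proof -
    obtain j where j: "rr p = (\<pi> ^^ j) p" using rr_orb[of p] by (auto simp: orb_def)
    have "(\<pi> ^^ (n p - j mod n p)) (rr p) = (\<pi> ^^ (n p - j mod n p + j mod n p)) p"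
      unfolding j funpow_add by (simp add: funpow_mod_eq[OF n(2)[OF p]])
    also have "\<dots> = p" using n[OF p] by (simp add: less_imp_le)
    finally show ?thesis by metis
  qed
  define kn where "kn p = (SOME k. p = (\<pi> ^^ k) (rr p))" for p
  have kn: "p = (\<pi> ^^ kn p) (rr p)" if "p \<in> P" for p
    unfolding kn_def by (rule someI_ex[OF orb_rr[OF that]])
  define rt where "rt m j = exp (2 * of_real pi * \<i> * of_nat j / of_nat m)" for m j :: nat
  \<comment> \<open>The position along the cycle becomes a root of unity, so that one step of
    \<open>\<pi>\<close> has the effect of adding 2 pi \<open>\<i>\<close> to \<xi> in exp (\<xi> /
    n).\<close>
  define kk where "kk p = rt (n (rr p)) (kn p)" for p
  have rt_eq: "rt m i = rt m j \<longleftrightarrow> i mod m = j mod m" if "m > 0" for m i j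
    unfolding rt_def using complex_root_unity_eq[of m i j] that by simp
  have kk_\<pi>: "kk (\<pi> p) = kk p * exp (2 * of_real pi * \<i> / of_nat (n (rr p)))" if p: "p \<in> P" for p
  proof -
    have pP: "\<pi> p \<in> P" using inP[OF p, of 1] by simp
    have "(\<pi> ^^ kn (\<pi> p)) (rr p) = \<pi> p" using kn[OF pP] rr_\<pi>[OF p] by simp
    also have "\<dots> = (\<pi> ^^ Suc (kn p)) (rr p)" using kn[OF p] by simp
    finally have "kn (\<pi> p) mod n (rr p) = Suc (kn p) mod n (rr p)" by (rule modeq[OF rrP[OF p]])
    then have "kk (\<pi> p) = rt (n (rr p)) (Suc (kn p))"
      using rt_eq[OF n(1)[OF rrP[OF p]]] rr_\<pi>[OF p] by (simp add: kk_def)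
    also have "\<dots> = kk p * exp (2 * of_real pi * \<i> / of_nat (n (rr p)))"
      unfolding kk_def rt_def exp_add[symmetric] by (simp add: algebra_simps add_divide_distrib)
    finally show ?thesis .
  qed
  define R where "R = rr ` P"
  have finR: "finite R" using assms(1) by (simp add: R_def)
  obtain s where s: "s > 0" "\<And>r r'. r \<in> R \<Longrightarrow> r' \<in> R \<Longrightarrow> r \<noteq> r' \<Longrightarrow> s \<le> cmod (r - r')"
  proof -
    let ?D = "(\<lambda>(r, r'). cmod (r - r')) ` {x \<in> R \<times> R. fst x \<noteq> snd x}"
    have f: "finite (insert 1 ?D)" using finR by (auto intro!: finite_imageI finite_Collect_conjI)
    show ?thesis
      by (rule that[of "Min (insert 1 ?D)"]) (use f in \<open>force intro!: Min_le simp: Min_gr_iff\<close>)+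
  qed
  \<comment> \<open>For Re \<xi> < 3 each branch stays within c exp 3 of its centre, so 2 c exp 3 <
    s keeps branches of different discs apart.\<close>
  define c where "c = s / (3 * exp 3)"
  have c: "c > 0" "2 * c * exp 3 < s" "3 * c \<le> s"
    using s(1) by (auto simp: c_def divide_simps)
  have nR: "n r > 0" if "r \<in> R" for r using that n(1)[OF rrP] by (auto simp: R_def)
  have kk1: "cmod (kk p) = 1" for p by (simp add: kk_def rt_def norm_exp_eq_Re)
  let ?b = "\<lambda>p \<xi>. rr p + of_real c * kk p * exp (\<xi> / of_nat (n (rr p)))"
  have dist: "?b p \<xi> \<noteq> ?b q \<xi>" if pq: "p \<in> P" "q \<in> P" "p \<noteq> q" "Re \<xi> < 3" for p q \<xi>
  proof
    assume e: "?b p \<xi> = ?b q \<xi>"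
    have small: "cmod (of_real c * kk x * exp (\<xi> / of_nat (n (rr x)))) \<le> c * exp 3" if "x \<in> P" for x
    proof -
      have "Re \<xi> / real (n (rr x)) \<le> 3"
        using n(1)[OF rrP[OF that]] pq(4) by (cases "Re \<xi> \<ge> 0") (auto simp: divide_simps)
      then show ?thesis using c(1) kk1 by (simp add: norm_mult norm_exp_eq_Re)
    qed
    show False
    proof (cases "rr p = rr q")
      case True
      then have "kk p = kk q" using e c(1) by simp
      then have "kn p mod n (rr p) = kn q mod n (rr p)"
        using rt_eq[OF n(1)[OF rrP[OF pq(1)]]] True by (simp add: kk_def)
      then have "(\<pi> ^^ kn p) (rr p) = (\<pi> ^^ kn q) (rr p)"
        using funpow_mod_eq[OF n(2)[OF rrP[OF pq(1)]]] by metis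
      then show False using kn[OF pq(1)] kn[OF pq(2)] True pq(3) by simp
    next
      case False
      have "s \<le> cmod (rr p - rr q)" using s(2) False pq by (auto simp: R_def)
      also have "rr p - rr q = of_real c * kk q * exp (\<xi> / of_nat (n (rr q))) - of_real c * kk p * exp (\<xi> / of_nat (n (rr p)))"
        using e by (simp add: algebra_simps)
      also have "cmod \<dots> \<le> c * exp 3 + c * exp 3"
        by (intro order_trans[OF norm_triangle_ineq4] add_mono small pq)
      finally show False using c by simp
    qed
  qed
  have cen: "(\<exists>p\<in>P. a = ?b p \<xi>) \<longleftrightarrow> (\<exists>r\<in>R. exp \<xi> = ((a - r) / of_real c) ^ n r)" for \<xi> a
  proof
    assume "\<exists>p\<in>P. a = ?b p \<xi>"
    then obtain p where p: "p \<in> P" "a = ?b p \<xi>" by auto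
    have np: "n (rr p) > 0" using n(1) rrP p by auto
    have "rt m j ^ m = 1" if "m > 0" for m j
      unfolding rt_def exp_of_nat_mult[symmetric] using that
      by (simp add: exp_eq_1) (auto intro!: exI[of _ "int j"])
    then have k: "kk p ^ n (rr p) = 1" using np by (simp add: kk_def)
    have "((a - rr p) / of_real c) ^ n (rr p) = kk p ^ n (rr p) * exp (\<xi> / of_nat (n (rr p))) ^ n (rr p)"
      using c(1) by (simp add: p(2) power_mult_distrib)
    also have "\<dots> = exp \<xi>" using np k by (simp flip: exp_of_nat_mult)
    finally have "exp \<xi> = ((a - rr p) / of_real c) ^ n (rr p)" by simp
    then show "\<exists>r\<in>R. exp \<xi> = ((a - r) / of_real c) ^ n r"
      using p(1) unfolding R_def by blast
  next
    assume "\<exists>r\<in>R. exp \<xi> = ((a - r) / of_real c) ^ n r"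
    then obtain r where r: "r \<in> R" "exp \<xi> = ((a - r) / of_real c) ^ n r" by auto
    have nr: "n r > 0" using nR r by auto
    \<comment> \<open>Dividing (a - r)/c by one n-th root of exp \<xi> leaves an n-th root of unity,
      whose exponent names the sheet.\<close>
    define y where "y = (a - r) / of_real c / exp (\<xi> / of_nat (n r))"
    have "y ^ n r = 1"
    proof -
      have "exp (\<xi> / of_nat (n r)) ^ n r = exp \<xi>" using nr by (simp flip: exp_of_nat_mult)
      then have "y ^ n r = ((a - r) / of_real c) ^ n r / exp \<xi>"
        by (simp only: y_def power_divide[of "(a - r) / of_real c"])
      then show ?thesis using r(2) by (metis divide_self exp_not_eq_zero)
    qed
    then obtain j where j: "y = rt (n r) j"
      using complex_roots_unity[of "n r"] nr by (auto simp: rt_def)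
    obtain q where q: "q \<in> P" "r = rr q" using r(1) by (auto simp: R_def)
    define p where "p = (\<pi> ^^ j) r"
    have rP: "r \<in> P" using q rrP by auto
    have rrr: "rr r = r"
      using q rr_orb[of q] rr_\<pi>k[OF q(1)] by (auto simp: orb_def)
    have p: "p \<in> P" "rr p = r" using inP[OF rP] rr_\<pi>k[OF rP] rrr by (auto simp: p_def)
    have "(\<pi> ^^ kn p) r = (\<pi> ^^ j) r" using kn[OF p(1)] p(2) by (simp add: p_def)
    from modeq[OF rP this] have "kk p = rt (n r) j" using rt_eq[OF nr] p(2) by (simp add: kk_def)
    moreover have "a = r + of_real c * y * exp (\<xi> / of_nat (n r))" using c(1) by (simp add: y_def)
    ultimately show "\<exists>p\<in>P. a = ?b p \<xi>" using p j by (intro bexI[of _ p]) auto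
  qed
  show ?thesis
    by (rule that[OF finR c(1) nR _ _ rr_\<pi> kk_\<pi> dist cen]) (use s(2) c(3) in \<open>force simp: R_def\<close>)+
qed

subsection \<open>Potentials\<close>

definition der :: "(real \<Rightarrow> 'b::euclidean_space) \<Rightarrow> real \<Rightarrow> 'b" where
  "der f x = frechet_derivative f (at x) 1"

lemma der:
  assumes "smooth_on UNIV f"
  shows "(f has_derivative (\<lambda>v. v *\<^sub>R der f x)) (at x)" "smooth_on UNIV (der f)"
    "(f has_vector_derivative der f x) (at x)"
proof -
  have d: "(f has_derivative frechet_derivative f (at x)) (at x)"
    using smooth_on_has_derivative[OF assms] by simp
  have "frechet_derivative f (at x) = (\<lambda>v. v *\<^sub>R der f x)"
  proof
    fix v show "frechet_derivative f (at x) v = v *\<^sub>R der f x"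
      using linear_scale[OF has_derivative_linear[OF d], of v 1] by (simp add: der_def)
  qed
  then show 1: "(f has_derivative (\<lambda>v. v *\<^sub>R der f x)) (at x)" using d by simp
  then show "(f has_vector_derivative der f x) (at x)" by (simp add: has_vector_derivative_def)
  show "smooth_on UNIV (der f)" unfolding der_def[abs_def] by (rule smooth_on_frechet_derivative[OF assms])
qed

lemma der_real:
  fixes f :: "real \<Rightarrow> real"
  assumes "smooth_on UNIV f"
  shows "(f has_real_derivative der f x) (at x)"
  using der(3)[OF assms] by (simp add: has_real_derivative_iff_has_vector_derivative)

lemma der_eqI: "(f has_vector_derivative f') (at x) \<Longrightarrow> der f x = f'"
  unfolding der_def has_vector_derivative_def by (metis frechet_derivative_at scaleR_one)

lemma der_cong_open:
  assumes "open S" "x \<in> S" "\<And>y. y \<in> S \<Longrightarrow> f y = g y" "smooth_on UNIV g"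
  shows "der f x = der g x"
proof (rule der_eqI)
  show "(f has_vector_derivative der g x) (at x)"
    by (rule has_vector_derivative_transform_within_open[OF der(3)[OF assms(4)] assms(1,2)]) (simp add: assms(3))
qed

text \<open>A closed 1-form \<open>dh\<close> in the coordinate \<open>\<xi> = u + \<i>\<theta>\<close>, written as the complex function
  \<open>g = h\<^sub>\<theta> + \<i> h\<^sub>u\<close>, so that the graph \<open>\<eta> = g \<xi>\<close> is Lagrangian for \<open>Im (d\<xi> \<and> d\<eta>)\<close>.\<close>

definition potential :: "(complex \<Rightarrow> real) \<Rightarrow> (complex \<Rightarrow> complex) \<Rightarrow> bool" where
  "potential h g \<longleftrightarrow> smooth_on UNIV h \<and> (\<forall>\<xi>. (h has_derivative (\<lambda>v. Im (g \<xi> * v))) (at \<xi>)) \<and> symmetric_deriv UNIV g"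

lemma potentialD:
  assumes "potential h g"
  shows "smooth_on UNIV h" "(h has_derivative (\<lambda>v. Im (g \<xi> * v))) (at \<xi>)" "symmetric_deriv UNIV g"
    "smooth_on UNIV g" "(g has_derivative frechet_derivative g (at \<xi>)) (at \<xi>)"
    "Im (u * frechet_derivative g (at \<xi>) v) = Im (v * frechet_derivative g (at \<xi>) u)"
  using assms symmetric_derivD[of UNIV g] unfolding potential_def by auto

lemma potential_add:
  assumes "potential h g" "potential h' g'"
  shows "potential (\<lambda>\<xi>. h \<xi> + h' \<xi>) (\<lambda>\<xi>. g \<xi> + g' \<xi>)"
proof -
  note D = potentialD[OF assms(1)] and D' = potentialD[OF assms(2)]
  have "symmetric_deriv UNIV (\<lambda>\<xi>. g \<xi> + g' \<xi>)"
  proof (rule symmetric_derivI[OF _ smooth_on_add[OF _ D(4) D'(4)] has_derivative_add[OF D(5) D'(5)]])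
    fix \<xi> u v
    show "Im (u * (frechet_derivative g (at \<xi>) v + frechet_derivative g' (at \<xi>) v)) =
        Im (v * (frechet_derivative g (at \<xi>) u + frechet_derivative g' (at \<xi>) u))"
      using D(6)[of u \<xi> v] D'(6)[of u \<xi> v] by (simp add: distrib_left)
  qed auto
  moreover have "((\<lambda>\<xi>. h \<xi> + h' \<xi>) has_derivative (\<lambda>v. Im ((g \<xi> + g' \<xi>) * v))) (at \<xi>)" for \<xi>
    using has_derivative_add[OF D(2) D'(2), of \<xi>] by (simp add: distrib_right)
  ultimately show ?thesis unfolding potential_def using smooth_on_add[OF _ D(1) D'(1)] by auto
qed

text \<open>The function that belongs to the potential \<open>w h\<close> when \<open>w\<close>
  depends on u only; the last term is the product rule. Cutting off the potential and not the form
  is what keeps the form closed.\<close>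

definition cut :: "(real \<Rightarrow> real) \<Rightarrow> (complex \<Rightarrow> real) \<Rightarrow> (complex \<Rightarrow> complex) \<Rightarrow> complex \<Rightarrow> complex" where
  "cut w h g \<xi> = of_real (w (Re \<xi>)) * g \<xi> + \<i> * of_real (der w (Re \<xi>) * h \<xi>)"

lemma smooth_on_Re_id: "smooth_on UNIV Re" and smooth_on_Im_id: "smooth_on UNIV Im"
  using smooth_on_Re[OF _ smooth_on_id, of UNIV] smooth_on_Im[OF _ smooth_on_id, of UNIV] by auto

lemma has_derivative_Re_comp:
  "smooth_on UNIV w \<Longrightarrow> ((\<lambda>\<xi>. w (Re \<xi>)) has_derivative (\<lambda>v. Re v *\<^sub>R der w (Re \<xi>))) (at \<xi>)"
  and has_derivative_Im_comp:
  "smooth_on UNIV w \<Longrightarrow> ((\<lambda>\<xi>. w (Im \<xi>)) has_derivative (\<lambda>v. Im v *\<^sub>R der w (Im \<xi>))) (at \<xi>)"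
  by (rule has_derivative_compose[OF _ der(1)]; (simp add: bounded_linear_Re bounded_linear_Im bounded_linear_imp_has_derivative)?)+

lemma potential_cut:
  assumes "smooth_on UNIV w" "potential h g"
  shows "potential (\<lambda>\<xi>. w (Re \<xi>) * h \<xi>) (cut w h g)"
proof -
  note D = potentialD[OF assms(2)]
  let ?d = "\<lambda>\<xi>. der w (Re \<xi>)" and ?g' = "\<lambda>\<xi>. frechet_derivative g (at \<xi>)"
  note dR = has_derivative_Re_comp[OF assms(1)] and dd = has_derivative_Re_comp[OF der(2)[OF assms(1)]]
  note sR = smooth_on_arg[OF open_UNIV smooth_on_Re_id assms(1)] and sd = smooth_on_arg[OF open_UNIV smooth_on_Re_id der(2)[OF assms(1)]]
  have s: "smooth_on UNIV (cut w h g)" unfolding cut_def[abs_def] by (intro smooth_intros sR sd D open_UNIV)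
  define c' where "c' \<xi> v = of_real (w (Re \<xi>)) * ?g' \<xi> v + of_real (Re v * ?d \<xi>) * g \<xi> +
     \<i> * of_real (?d \<xi> * Im (g \<xi> * v) + Re v * der (der w) (Re \<xi>) * h \<xi>)" for \<xi> v
  have "(cut w h g has_derivative c' \<xi>) (at \<xi>)" for \<xi>
    unfolding cut_def[abs_def] c'_def[abs_def]
    by (intro has_derivative_add has_derivative_mult_right has_derivative_of_real
       has_derivative_eq_rhs[OF has_derivative_mult[OF has_derivative_of_real[OF dR] D(5)]]
       has_derivative_eq_rhs[OF has_derivative_mult[OF dd D(2)]]) (auto simp: fun_eq_iff)
  moreover have "Im (u * c' \<xi> v) = Im (v * c' \<xi> u)" for \<xi> u v
  proof -
    \<comment> \<open>All terms but the first are visibly symmetric in u and v, and the first is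
      symmetric because \<open>g\<close> has a symmetric derivative.\<close>
    have e: "Im (u * c' \<xi> v) = w (Re \<xi>) * Im (u * ?g' \<xi> v) + ?d \<xi> * (Re v * Im (g \<xi> * u) + Re u * Im (g \<xi> * v))
       + Re u * Re v * der (der w) (Re \<xi>) * h \<xi>" for u v
      by (simp add: c'_def algebra_simps)
    show ?thesis unfolding e using D(6)[of u \<xi> v] by (simp add: algebra_simps)
  qed
  ultimately have "symmetric_deriv UNIV (cut w h g)" by (intro symmetric_derivI[OF open_UNIV s]) auto
  moreover have "((\<lambda>\<xi>. w (Re \<xi>) * h \<xi>) has_derivative (\<lambda>v. Im (cut w h g \<xi> * v))) (at \<xi>)" for \<xi>
    by (rule has_derivative_eq_rhs[OF has_derivative_mult[OF dR D(2)]]) (auto simp: fun_eq_iff cut_def algebra_simps)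
  moreover have "smooth_on UNIV (\<lambda>\<xi>. w (Re \<xi>) * h \<xi>)" by (intro smooth_intros sR D open_UNIV)
  ultimately show ?thesis by (simp add: potential_def)
qed

lemma potential_theta:
  assumes "smooth_on UNIV A"
  shows "potential (\<lambda>\<xi>. A (Im \<xi>)) (\<lambda>\<xi>. of_real (der A (Im \<xi>)))"
proof -
  note dA = has_derivative_Im_comp[OF assms] and dA' = has_derivative_Im_comp[OF der(2)[OF assms]]
  have s: "smooth_on UNIV (\<lambda>\<xi>. complex_of_real (der A (Im \<xi>)))"
    by (intro smooth_intros smooth_on_arg[OF open_UNIV smooth_on_Im_id der(2)[OF assms]]) auto
  have "symmetric_deriv UNIV (\<lambda>\<xi>. complex_of_real (der A (Im \<xi>)))"
    by (rule symmetric_derivI[OF open_UNIV s has_derivative_of_real[OF dA']]) simp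
  then show ?thesis unfolding potential_def
    using dA smooth_on_arg[OF open_UNIV smooth_on_Im_id assms] by (auto simp: mult.commute)
qed

lemma potential_holomorphic:
  assumes "smooth_on UNIV G" "smooth_on UNIV g" "\<And>\<xi>. (G has_field_derivative g \<xi>) (at \<xi>)"
    "\<And>\<xi>. (g has_field_derivative g' \<xi>) (at \<xi>)"
  shows "potential (\<lambda>\<xi>. Im (G \<xi>)) g"
  unfolding potential_def
  using smooth_on_Im[OF open_UNIV assms(1)] symmetric_deriv_holomorphic[OF open_UNIV assms(2,4)]
    has_derivative_Im[OF assms(3)[unfolded has_field_derivative_def]] by auto

subsection \<open>Making the strands exact\<close>

lemma strands_shift_pair:
  assumes "strands P \<pi> z" "p \<in> P" "q \<in> P" "p \<noteq> q" "cis \<theta> = cis \<theta>'"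
  obtains p' q' where "p' \<in> P" "q' \<in> P" "p' \<noteq> q'" "z p \<theta> = z p' \<theta>'" "z q \<theta> = z q' \<theta>'"
proof -
  note D = strandsD[OF assms(1)]
  obtain p' where p': "p' \<in> P" "z p \<theta> = z p' \<theta>'"
    using strands_shift[where F=z, OF D(2) D(4) assms(2,5)] by auto
  obtain q' where q': "q' \<in> P" "z q \<theta> = z q' \<theta>'"
    using strands_shift[where F=z, OF D(2) D(4) assms(3,5)] by auto
  have "p' \<noteq> q'" using D(5)[OF assms(2,3), of \<theta>] assms(4) p' q' by auto
  then show ?thesis using that p' q' by blast
qed

lemma cis_reduce:
  obtains \<theta>' where "- pi \<le> \<theta>'" "\<theta>' \<le> pi" "cis \<theta>' = cis \<theta>"
proof -
  have "cis (Arg (cis \<theta>)) = cis \<theta>" using cis_Arg[of "cis \<theta>"] by (simp add: sgn_div_norm)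
  then show ?thesis using that[of "Arg (cis \<theta>)"] Arg_bounded[of "cis \<theta>"] by auto
qed

text \<open>The differences of strands at angle 0 have finitely many slopes, so some slope
  \<open>k\<close> differs from all of them, and by continuity this persists nearby. The condition
  \<open>cos d < cos \<theta>\<close> expresses nearness to 0 modulo whole turns.\<close>

lemma separating_direction:
  assumes "strands P \<pi> z"
  obtains e d where "Re e = 1" "0 < d" "d < pi / 2"
    "\<And>p q \<theta>. p \<in> P \<Longrightarrow> q \<in> P \<Longrightarrow> p \<noteq> q \<Longrightarrow> cos d < cos \<theta> \<Longrightarrow> Im ((z p \<theta> - z q \<theta>) * cnj e) \<noteq> 0"
proof -
  note D = strandsD[OF assms]
  let ?bad = "(\<lambda>(p, q). Im (z p 0 - z q 0) / Re (z p 0 - z q 0)) ` (P \<times> P)"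
  have "finite ?bad" using D(1) by auto
  from ex_new_if_finite[OF infinite_UNIV_char_0 this] obtain k :: real where k: "k \<notin> ?bad" ..
  \<comment> \<open>With real part 1, a displacement by a real multiple of \<open>e\<close> changes
    the real part by exactly that multiple, so means can be prescribed.\<close>
  define e where "e = Complex 1 k"
  have im: "Im (w * cnj e) = Im w - k * Re w" for w by (simp add: e_def)
  have e0: "Im ((z p 0 - z q 0) * cnj e) \<noteq> 0" if "p \<in> P" "q \<in> P" "p \<noteq> q" for p q
  proof
    assume 0: "Im ((z p 0 - z q 0) * cnj e) = 0"
    have "z p 0 - z q 0 \<noteq> 0" using D(5)[OF that(1,2)] that(3) by auto
    then have "Re (z p 0 - z q 0) \<noteq> 0" using 0 unfolding im by (auto simp: complex_eq_iff)
    then have "k = Im (z p 0 - z q 0) / Re (z p 0 - z q 0)" using 0 unfolding im by (simp add: field_simps)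
    then show False using k that by force
  qed
  have cz: "continuous_on UNIV (z p)" if "p \<in> P" for p
    using smooth_on_imp_continuous_on[OF D(3)[OF that]] .
  let ?O = "\<Inter>p\<in>P. \<Inter>q\<in>P - {p}. {\<theta>. Im ((z p \<theta> - z q \<theta>) * cnj e) \<noteq> 0}"
  have "open ?O"
    by (intro open_INT ballI open_Collect_neq continuous_intros cz) (use D(1) in auto)
  moreover have "0 \<in> ?O" using e0 by auto
  ultimately obtain d0 where d0: "d0 > 0" "ball 0 d0 \<subseteq> ?O" using openE by blast
  define d where "d = min (d0 / 2) (pi / 3)"
  have d: "0 < d" "d < d0" "d < pi / 2" using d0 pi_gt_zero by (auto simp: d_def min_def)
  show ?thesis
  proof (rule that[of e d])
    fix p q \<theta> assume pq: "p \<in> P" "q \<in> P" "p \<noteq> q" and c: "cos d < cos \<theta>"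
    obtain \<theta>' where \<theta>': "- pi \<le> \<theta>'" "\<theta>' \<le> pi" "cis \<theta>' = cis \<theta>" by (rule cis_reduce)
    have "cos \<bar>\<theta>'\<bar> = cos \<theta>" using arg_cong[OF \<theta>'(3), of Re] by (simp add: abs_if)
    moreover have "\<bar>\<theta>'\<bar> \<le> pi" using \<theta>' by (simp add: abs_le_iff)
    ultimately have "\<not> d \<le> \<bar>\<theta>'\<bar>" using c \<theta>' d cos_monotone_0_pi_le[of d "\<bar>\<theta>'\<bar>"] by auto
    then have "\<bar>\<theta>'\<bar> < d" by simp
    then have "\<theta>' \<in> ball 0 d0" using d by auto
    moreover obtain p' q' where "p' \<in> P" "q' \<in> P" "p' \<noteq> q'" "z p \<theta> = z p' \<theta>'" "z q \<theta> = z q' \<theta>'"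
      using strands_shift_pair[OF assms pq \<theta>'(3)[symmetric]] by metis
    ultimately show "Im ((z p \<theta> - z q \<theta>) * cnj e) \<noteq> 0" using d0(2) by auto
  qed (use d in \<open>auto simp: e_def\<close>)
qed

lemma antiderivative_real:
  assumes "smooth_on UNIV (f :: real \<Rightarrow> real)"
  obtains F where "smooth_on UNIV F" "F 0 = 0" "\<And>x. (F has_real_derivative f x) (at x)"
proof -
  have "isCont f x" for x
    using smooth_on_imp_continuous_on[OF assms] by (simp add: continuous_on_eq_continuous_at)
  then obtain F where "\<And>x. (F has_vector_derivative f x) (at x)"
    using einterval_antiderivative[of "-\<infinity>" "\<infinity>" f] by auto
  then have F: "(F has_real_derivative f x) (at x)" for x
    by (simp add: has_real_derivative_iff_has_vector_derivative)
  have F0: "((\<lambda>x. F x - F 0) has_real_derivative f x) (at x)" for x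
    using DERIV_diff[OF F[of x] DERIV_const[of "F 0"]] by simp
  have "smooth_on UNIV (\<lambda>x. F x - F 0)"
    by (rule smooth_onI[OF open_UNIV F0[unfolded has_field_derivative_def]])
      (auto intro!: smooth_on_mult smooth_on_const assms)
  then show ?thesis using that F0 by auto
qed

lemma DERIV_eq_imp_diff_eq:
  assumes "\<And>x. (F has_real_derivative f x) (at x)" "\<And>x. (G has_real_derivative f x) (at x)"
  shows "F x - G x = F y - G y"
  using DERIV_isconst_all[of "\<lambda>x. F x - G x"] DERIV_diff[OF assms] by (metis (no_types, lifting) cancel_comm_monoid_add_class.diff_cancel)

text \<open>The real parts have to integrate to periodic functions. For \<open>\<theta>\<close> near \<open>0\<close> the strands are
  separated by a linear functional with kernel spanned by \<open>e\<close>, so a bump in direction \<open>e\<close>, constant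
  on each component of the braid, corrects the means without any crossing.\<close>

lemma exact_strands:
  assumes "strands P \<pi> z"
  obtains e \<beta> m A where "smooth_on UNIV \<beta>" "\<And>\<theta>. \<beta> (\<theta> + 2 * pi) = \<beta> \<theta>"
    "\<And>p. p \<in> P \<Longrightarrow> m (\<pi> p) = m p"
    "\<And>p q \<theta> t. p \<in> P \<Longrightarrow> q \<in> P \<Longrightarrow> z p \<theta> + of_real (t * \<beta> \<theta> * m p) * e = z q \<theta> + of_real (t * \<beta> \<theta> * m q) * e \<Longrightarrow> p = q"
    "\<And>p. p \<in> P \<Longrightarrow> smooth_on UNIV (A p)" "\<And>p \<theta>. p \<in> P \<Longrightarrow> A p (\<theta> + 2 * pi) = A (\<pi> p) \<theta>"
    "\<And>p \<theta>. p \<in> P \<Longrightarrow> (A p has_real_derivative Re (z p \<theta> + of_real (\<beta> \<theta> * m p) * e)) (at \<theta>)"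
proof -
  note D = strandsD[OF assms]
  obtain e d where e: "Re e = 1" "0 < d" "d < pi / 2"
    "\<And>p q \<theta>. p \<in> P \<Longrightarrow> q \<in> P \<Longrightarrow> p \<noteq> q \<Longrightarrow> cos d < cos \<theta> \<Longrightarrow> Im ((z p \<theta> - z q \<theta>) * cnj e) \<noteq> 0"
    using separating_direction[OF assms] by metis
  \<comment> \<open>A periodic bump that is nonzero only where the strands are separated.\<close>
  define \<beta> where "\<beta> \<theta> = step_fun (cos \<theta> - cos d)" for \<theta>
  have s\<beta>: "smooth_on UNIV \<beta>" unfolding \<beta>_def[abs_def] by (intro smooth_intros smooth_on_step_fun) auto
  have per\<beta>: "\<beta> (\<theta> + 2 * pi) = \<beta> \<theta>" for \<theta> by (simp add: \<beta>_def)
  have \<beta>nz: "cos d < cos \<theta>" if "\<beta> \<theta> \<noteq> 0" for \<theta>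
    using that step_fun_0[of "cos \<theta> - cos d"] by (force simp: \<beta>_def)
  obtain Bt where Bt: "Bt 0 = 0" "\<And>x. (Bt has_real_derivative \<beta> x) (at x)"
    using antiderivative_real[OF s\<beta>] by metis
  have Bt_pos: "Bt (2 * pi) > 0"
  proof -
    have "Bt 0 < Bt (d / 2)"
    proof (rule DERIV_pos_imp_increasing[OF _ exI, OF _ conjI[OF Bt(2)]])
      fix x assume x: "0 \<le> x" "x \<le> d / 2"
      have "cos d < cos x" using x e by (intro cos_monotone_0_pi) auto
      then show "\<beta> x > 0" by (simp add: \<beta>_def step_fun_pos)
    qed (use e in auto)
    also have "Bt (d / 2) \<le> Bt (2 * pi)"
      by (rule DERIV_nonneg_imp_nondecreasing[OF _ exI, OF _ conjI[OF Bt(2)]])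
        (use e step_fun_nonneg in \<open>auto simp: \<beta>_def\<close>)
    finally show ?thesis using Bt by simp
  qed
  have "\<exists>X. X 0 = 0 \<and> (\<forall>x. (X has_real_derivative Re (z p x)) (at x))" if "p \<in> P" for p
    using antiderivative_real[OF smooth_on_Re[OF open_UNIV D(3)[OF that]]] by metis
  then obtain X where X: "\<And>p. p \<in> P \<Longrightarrow> X p 0 = 0" "\<And>p x. p \<in> P \<Longrightarrow> (X p has_real_derivative Re (z p x)) (at x)"
    by metis
  have \<pi>P: "\<pi> p \<in> P" if "p \<in> P" for p using D(2) that bij_betwE by blast
  have shiftD: "((\<lambda>x. F (x + a)) has_real_derivative F' (x + a)) (at x)"
    if "\<And>x. (F has_real_derivative F' x) (at x)" for F F' a and x :: real
    using DERIV_shift[of F "F' (x + a)" x a] that by simp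
  obtain M where M: "M > 0" "\<And>p. p \<in> P \<Longrightarrow> (\<pi> ^^ M) p = p"
  proof -
    obtain k where k: "\<And>p. p \<in> P \<Longrightarrow> k p > 0 \<and> (\<pi> ^^ k p) p = p" using bij_betw_period[OF D(1,2)] by metis
    show ?thesis
    \<comment> \<open>A common multiple of the periods of all labels, so that the same number of
      turns closes up every component.\<close>
    proof (rule that[of "\<Prod>p\<in>P. k p"])
      show "0 < (\<Prod>p\<in>P. k p)" using k by (intro prod_pos) auto
      fix p assume p: "p \<in> P"
      have "(\<Prod>p\<in>P. k p) mod k p = 0" using D(1) p by (intro dvd_imp_mod_0 dvd_prodI)
      then show "(\<pi> ^^ (\<Prod>p\<in>P. k p)) p = p" using funpow_mod_eq[of "k p" \<pi> p "\<Prod>p\<in>P. k p"] k[OF p] by simp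
    qed
  qed
  have zshift: "z p (\<theta> + 2 * pi * k) = z ((\<pi> ^^ k) p) \<theta>" if "p \<in> P" for p k \<theta>
    using that
  proof (induction k arbitrary: p)
    case (Suc k)
    have "z p (\<theta> + 2 * pi * Suc k) = z p ((\<theta> + 2 * pi * k) + 2 * pi)" by (simp add: algebra_simps)
    also have "\<dots> = z (\<pi> p) (\<theta> + 2 * pi * k)" by (rule D(4)[OF Suc.prems])
    also have "\<dots> = z ((\<pi> ^^ Suc k) p) \<theta>" using Suc.IH[OF \<pi>P[OF Suc.prems]] by (simp add: funpow_swap1)
    finally show ?case .
  qed auto
  have Xs: "X p (\<theta> + 2 * pi) = X p (2 * pi) + X (\<pi> p) \<theta>" if "p \<in> P" for p \<theta>
    using DERIV_eq_imp_diff_eq[OF shiftD[OF X(2)[OF that], of "2*pi", unfolded D(4)[OF that]] X(2)[OF \<pi>P[OF that]], of \<theta> 0]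
      X(1)[OF \<pi>P[OF that]] by simp
  have XM: "X p (\<theta> + 2 * pi * M) = X p (2 * pi * M) + X p \<theta>" if "p \<in> P" for p \<theta>
    using DERIV_eq_imp_diff_eq[OF shiftD[OF X(2)[OF that], of "2*pi*M", unfolded zshift[OF that] M(2)[OF that]] X(2)[OF that], of \<theta> 0]
      X(1)[OF that] by simp
  have Bs: "Bt (\<theta> + 2 * pi) = Bt (2 * pi) + Bt \<theta>" for \<theta>
    using DERIV_eq_imp_diff_eq[OF shiftD[OF Bt(2), of "2*pi", unfolded per\<beta>] Bt(2), of \<theta> 0] Bt(1) by simp
  have Bk: "Bt (2 * pi * k) = k * Bt (2 * pi)" for k :: nat
  proof (induction k)
    case (Suc k) then show ?case using Bs[of "2 * pi * k"] by (simp add: algebra_simps)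
  qed (simp add: Bt)
  \<comment> \<open>Chosen so that the corrected primitive \<open>X'\<close> returns to 0 after
    \<open>M\<close> turns.\<close>
  define m where "m p = - X p (2 * pi * M) / (M * Bt (2 * pi))" for p
  have m\<pi>: "m (\<pi> p) = m p" if "p \<in> P" for p
    using Xs[OF that, of "2 * pi * M"] XM[OF that, of "2 * pi"] by (simp add: m_def add.commute)
  define X' where "X' p \<theta> = X p \<theta> + m p * Bt \<theta>" for p \<theta>
  have X's: "X' p (\<theta> + 2 * pi) = X' p (2 * pi) + X' (\<pi> p) \<theta>" if "p \<in> P" for p \<theta>
    using Xs[OF that, of \<theta>] Bs[of \<theta>] m\<pi>[OF that] by (simp add: X'_def algebra_simps)
  have X'M: "X' p (2 * pi * M) = 0" for p
    using M(1) Bt_pos by (simp add: X'_def m_def Bk)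
  have X'0: "X' p 0 = 0" if "p \<in> P" for p using X(1)[OF that] Bt by (simp add: X'_def)
  \<comment> \<open>The primitives are equivariant only up to constants. Subtracting the mean over
    \<open>M\<close> successive turns adjusts the constants so that \<open>A\<close> is exactly
    equivariant.\<close>
  define S where "S p = (\<Sum>k<M. X' p (2 * pi * k))" for p
  have S\<pi>: "S (\<pi> p) = S p - M * X' p (2 * pi)" if "p \<in> P" for p
  proof -
    have "X' (\<pi> p) (2 * pi * k) = X' p (2 * pi * Suc k) - X' p (2 * pi)" for k :: nat
      using X's[OF that, of "2 * pi * k"] by (simp add: algebra_simps)
    then have "S (\<pi> p) = (\<Sum>k<M. X' p (2 * pi * Suc k)) - M * X' p (2 * pi)"
      by (simp add: S_def sum_subtractf del: of_nat_Suc)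
    also have "(\<Sum>k<M. X' p (2 * pi * Suc k)) = S p"
    proof -
      have "(\<Sum>k<Suc M. X' p (2 * pi * k)) = X' p (2 * pi * (0::nat)) + (\<Sum>k<M. X' p (2 * pi * Suc k))"
        by (rule sum.lessThan_Suc_shift)
      then show ?thesis using X'M[of p] X'0[OF that] by (simp add: S_def del: of_nat_Suc)
    qed
    finally show ?thesis .
  qed
  define A where "A p \<theta> = X' p \<theta> - S p / M" for p \<theta>
  have dA: "(A p has_real_derivative Re (z p \<theta> + of_real (\<beta> \<theta> * m p) * e)) (at \<theta>)" if "p \<in> P" for p \<theta>
    unfolding A_def[abs_def] X'_def
    using DERIV_diff[OF DERIV_add[OF X(2)[OF that] DERIV_cmult[OF Bt(2), of "m p"]] DERIV_const] e(1)
    by (simp add: mult.commute)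
  have sA: "smooth_on UNIV (A p)" if "p \<in> P" for p
    by (rule smooth_onI[OF open_UNIV dA[OF that, unfolded has_field_derivative_def]])
      (intro smooth_intros D(3)[OF that] s\<beta> open_UNIV)
  show ?thesis
  proof (rule that[of \<beta> m e A, OF s\<beta> per\<beta> m\<pi> _ sA _ dA])
    show "A p (\<theta> + 2 * pi) = A (\<pi> p) \<theta>" if "p \<in> P" for p \<theta>
      using X's[OF that, of \<theta>] S\<pi>[OF that] M(1) by (simp add: A_def field_simps)
    fix p q \<theta> and t :: real
    assume pq: "p \<in> P" "q \<in> P" and eq: "z p \<theta> + of_real (t * \<beta> \<theta> * m p) * e = z q \<theta> + of_real (t * \<beta> \<theta> * m q) * e"
    show "p = q"
    proof (rule ccontr)
      assume ne: "p \<noteq> q"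
      have "\<beta> \<theta> \<noteq> 0" using eq D(5)[OF pq] ne by auto
      then have "Im ((z p \<theta> - z q \<theta>) * cnj e) \<noteq> 0" using e(4)[OF pq ne] \<beta>nz by auto
      \<comment> \<open>A coincidence makes the difference of the strands a real multiple of
        \<open>e\<close>, which the separating functional annihilates.\<close>
      moreover have "z p \<theta> - z q \<theta> = of_real (t * \<beta> \<theta> * (m q - m p)) * e"
        using eq by (simp add: algebra_simps)
      ultimately show False by (simp add: mult.assoc complex_mult_cnj)
    qed
  qed
qed

section \<open>Uniform gaps and bounds for finite families over compact sets\<close>

lemma uniform_gap:
  fixes f :: "'p \<Rightarrow> 'a::topological_space \<Rightarrow> 'b::real_normed_vector"
  assumes "finite P" "compact K" "\<And>p. p \<in> P \<Longrightarrow> continuous_on K (f p)"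
    "\<And>p q x. p \<in> P \<Longrightarrow> q \<in> P \<Longrightarrow> p \<noteq> q \<Longrightarrow> x \<in> K \<Longrightarrow> f p x \<noteq> f q x"
  obtains \<delta> where "\<delta> > 0" "\<And>p q x. p \<in> P \<Longrightarrow> q \<in> P \<Longrightarrow> p \<noteq> q \<Longrightarrow> x \<in> K \<Longrightarrow> \<delta> \<le> norm (f p x - f q x)"
proof -
  have 1: "\<exists>d>0. \<forall>x\<in>K. d \<le> norm (f p x - f q x)" if pq: "p \<in> P" "q \<in> P" "p \<noteq> q" for p q
  proof (cases "K = {}")
    case False
    have "continuous_on K (\<lambda>x. norm (f p x - f q x))" by (intro continuous_intros assms pq)
    from continuous_attains_inf[OF assms(2) False this]
    obtain x where "x \<in> K" "\<forall>y\<in>K. norm (f p x - f q x) \<le> norm (f p y - f q y)" ..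
    then show ?thesis using assms(4)[OF pq] by (intro exI[of _ "norm (f p x - f q x)"]) auto
  qed (auto intro: exI[of _ 1])
  then obtain d where d: "\<And>p q. p \<in> P \<Longrightarrow> q \<in> P \<Longrightarrow> p \<noteq> q \<Longrightarrow> d p q > 0 \<and> (\<forall>x\<in>K. d p q \<le> norm (f p x - f q x))"
    by metis
  \<comment> \<open>The 1 keeps the set nonempty when there are no pairs.\<close>
  let ?D = "insert 1 ((\<lambda>(p, q). d p q) ` {x \<in> P \<times> P. fst x \<noteq> snd x})"
  have fin: "finite ?D" using assms(1) by auto
  show ?thesis
  proof (rule that[of "Min ?D"])
    show "0 < Min ?D" using fin d by (subst Min_gr_iff) auto
    fix p q x assume pq: "p \<in> P" "q \<in> P" "p \<noteq> q" "x \<in> K"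
    have "Min ?D \<le> d p q" using fin pq by (intro Min_le) (auto intro!: image_eqI[of _ _ "(p, q)"])
    then show "Min ?D \<le> norm (f p x - f q x)" using d[OF pq(1-3)] pq(4) by force
  qed
qed

lemma uniform_bound:
  fixes f :: "'p \<Rightarrow> 'a::topological_space \<Rightarrow> 'b::real_normed_vector"
  assumes "finite P" "compact K" "\<And>p. p \<in> P \<Longrightarrow> continuous_on K (f p)"
  obtains C where "C > 0" "\<And>p x. p \<in> P \<Longrightarrow> x \<in> K \<Longrightarrow> norm (f p x) \<le> C"
proof -
  have "\<exists>C. \<forall>x\<in>K. norm (f p x) \<le> C" if "p \<in> P" for p
    using compact_imp_bounded[OF compact_continuous_image[OF assms(3)[OF that] assms(2)]]
    by (auto simp: bounded_iff)
  then obtain c where c: "\<And>p x. p \<in> P \<Longrightarrow> x \<in> K \<Longrightarrow> norm (f p x) \<le> c p" by metis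
  show ?thesis
  proof (rule that[of "1 + (\<Sum>p\<in>P. \<bar>c p\<bar>)"])
    show "0 < 1 + (\<Sum>p\<in>P. \<bar>c p\<bar>)" by (simp add: add_pos_nonneg sum_nonneg)
    fix p x assume "p \<in> P" "x \<in> K"
    then have "norm (f p x) \<le> \<bar>c p\<bar>" using c by force
    also have "\<dots> \<le> (\<Sum>p\<in>P. \<bar>c p\<bar>)" using \<open>p \<in> P\<close> assms(1) by (intro member_le_sum) auto
    finally show "norm (f p x) \<le> 1 + (\<Sum>p\<in>P. \<bar>c p\<bar>)" by simp
  qed
qed

subsection \<open>Construction of the sheets\<close>

lemma der_const_on:
  assumes "open S" "x \<in> S" "\<And>y. y \<in> S \<Longrightarrow> f y = (c :: real)"
  shows "der f x = 0"
  using der_cong_open[OF assms(1,2), of f "\<lambda>y. c"] assms(3) smooth_on_const[of UNIV c] der_eqI[of "\<lambda>y. c" 0 x]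
  by (simp add: has_vector_derivative_const)

lemma cut_eq_of_const:
  assumes "open S" "Re \<xi> \<in> S" "\<And>y. y \<in> S \<Longrightarrow> f y = (c :: real)"
  shows "cut f h g \<xi> = of_real c * g \<xi>"
  using der_const_on[OF assms] assms(2,3) by (simp add: cut_def)

text \<open>The sheet of the 1-form \<open>d(A(\<theta>) - \<epsilon> e\<^sup>-\<^sup>u Im z(\<theta>))\<close> where \<open>A' = Re z\<close>.\<close>

definition exact_sheet :: "real \<Rightarrow> (real \<Rightarrow> complex) \<Rightarrow> complex \<Rightarrow> complex" where
  "exact_sheet \<epsilon> z \<xi> = of_real (Re (z (Im \<xi>)) - \<epsilon> * exp (- Re \<xi>) * der (\<lambda>\<theta>. Im (z \<theta>)) (Im \<xi>))
     + \<i> * of_real (\<epsilon> * exp (- Re \<xi>) * Im (z (Im \<xi>)))"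

lemma der_Im_strand_shift:
  assumes "strands P \<pi> z" "p \<in> P"
  shows "der (\<lambda>\<theta>. Im (z p \<theta>)) (\<theta> + 2 * pi) = der (\<lambda>\<theta>. Im (z (\<pi> p) \<theta>)) \<theta>"
proof -
  note D = strandsD[OF assms(1)]
  have "\<pi> p \<in> P" using D(2) assms(2) bij_betwE by blast
  then have s: "smooth_on UNIV (\<lambda>\<theta>. Im (z p \<theta>))" "smooth_on UNIV (\<lambda>\<theta>. Im (z (\<pi> p) \<theta>))"
    by (intro smooth_intros D(3) assms(2) open_UNIV; simp)+
  have "((\<lambda>\<theta>. Im (z p (\<theta> + 2 * pi))) has_real_derivative der (\<lambda>\<theta>. Im (z p \<theta>)) (\<theta> + 2 * pi)) (at \<theta>)"
    using DERIV_shift[of "\<lambda>\<theta>. Im (z p \<theta>)" _ \<theta> "2 * pi"] der_real[OF s(1)] by blast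
  then show ?thesis
    unfolding D(4)[OF assms(2)] using der_real[OF s(2)] DERIV_unique by blast
qed

text \<open>Equal imaginary parts of two sheets mean equal imaginary parts of the strands, whose
  real parts then differ by at least \<delta>. The correction terms containing the derivatives
  amount to at most 2 \<epsilon> C = \<delta>/2 for every u \<ge> 0, so they cannot bridge the
  gap.\<close>

lemma exact_sheets_distinct:
  assumes "strands P \<pi> z"
  obtains \<epsilon> where "\<epsilon> > 0" "\<And>p q \<xi>. p \<in> P \<Longrightarrow> q \<in> P \<Longrightarrow> p \<noteq> q \<Longrightarrow> Re \<xi> \<ge> 0 \<Longrightarrow> exact_sheet \<epsilon> (z p) \<xi> \<noteq> exact_sheet \<epsilon> (z q) \<xi>"
proof -
  note D = strandsD[OF assms]
  define y' where "y' p = der (\<lambda>\<theta>. Im (z p \<theta>))" for p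
  have sy: "smooth_on UNIV (y' p)" if "p \<in> P" for p
    unfolding y'_def by (intro der(2) smooth_intros D(3) that open_UNIV)
  have cz: "continuous_on {-pi..pi} (z p)" "continuous_on {-pi..pi} (y' p)" if "p \<in> P" for p
    using smooth_on_imp_continuous_on[OF D(3)[OF that]] smooth_on_imp_continuous_on[OF sy[OF that]] continuous_on_subset by blast+
  obtain \<delta> where \<delta>: "\<delta> > 0" "\<And>p q x. p \<in> P \<Longrightarrow> q \<in> P \<Longrightarrow> p \<noteq> q \<Longrightarrow> x \<in> {-pi..pi} \<Longrightarrow> \<delta> \<le> norm (z p x - z q x)"
    by (rule uniform_gap[OF D(1) compact_Icc, of "-pi" pi z]) (use cz D(5) in blast)+
  obtain C where C: "C > 0" "\<And>p x. p \<in> P \<Longrightarrow> x \<in> {-pi..pi} \<Longrightarrow> norm (y' p x) \<le> C"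
    by (rule uniform_bound[OF D(1) compact_Icc, of "-pi" pi y']) (use cz in blast)+
  define \<epsilon> where "\<epsilon> = \<delta> / (4 * C)"
  show ?thesis
  proof (rule that[of \<epsilon>])
    show "\<epsilon> > 0" using \<delta> C by (simp add: \<epsilon>_def)
    fix p q \<xi> assume pq: "p \<in> P" "q \<in> P" "p \<noteq> q" and \<xi>: "Re \<xi> \<ge> 0"
    show "exact_sheet \<epsilon> (z p) \<xi> \<noteq> exact_sheet \<epsilon> (z q) \<xi>"
    proof
      assume e: "exact_sheet \<epsilon> (z p) \<xi> = exact_sheet \<epsilon> (z q) \<xi>"
      obtain \<theta> where \<theta>: "- pi \<le> \<theta>" "\<theta> \<le> pi" "cis \<theta> = cis (Im \<xi>)" by (rule cis_reduce)
      \<comment> \<open>Paired so that one relabelling serves the strand and its derivative.\<close>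
      define F where "F p x = (z p x, y' p x)" for p x
      have Fs: "F p (x + 2 * pi) = F (\<pi> p) x" if "p \<in> P" for p x
        using D(4)[OF that] der_Im_strand_shift[OF assms that] by (simp add: F_def y'_def)
      obtain p' where p': "p' \<in> P" "F p (Im \<xi>) = F p' \<theta>"
        using strands_shift[where F=F, OF D(2) Fs pq(1) \<theta>(3)[symmetric]] by auto
      obtain q' where q': "q' \<in> P" "F q (Im \<xi>) = F q' \<theta>"
        using strands_shift[where F=F, OF D(2) Fs pq(2) \<theta>(3)[symmetric]] by auto
      have "p' \<noteq> q'" using D(5)[OF pq(1,2), of "Im \<xi>"] pq(3) p' q' by (auto simp: F_def)
      then have gap: "\<delta> \<le> norm (z p' \<theta> - z q' \<theta>)" using \<delta>(2) p' q' \<theta> by auto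
      define s where "s = \<epsilon> * exp (- Re \<xi>)"
      have "\<epsilon> > 0" using \<delta> C by (simp add: \<epsilon>_def)
      then have s: "s > 0" "s \<le> \<epsilon>" using \<xi> by (auto simp: s_def mult_le_cancel_left1)
      have "Re (z p' \<theta>) - s * y' p' \<theta> = Re (z q' \<theta>) - s * y' q' \<theta>" "Im (z p' \<theta>) = Im (z q' \<theta>)"
        using arg_cong[OF e, of Re] arg_cong[OF e, of Im] p' q' s
        by (auto simp: exact_sheet_def F_def s_def[symmetric] y'_def[symmetric])
      then have "z p' \<theta> - z q' \<theta> = of_real (s * y' p' \<theta> - s * y' q' \<theta>)" by (simp add: complex_eq_iff)
      then have "norm (z p' \<theta> - z q' \<theta>) \<le> \<bar>s * y' p' \<theta>\<bar> + \<bar>s * y' q' \<theta>\<bar>"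
        by (simp only: norm_of_real abs_triangle_ineq4)
      also have "\<dots> \<le> s * C + s * C"
        unfolding abs_mult abs_of_pos[OF s(1)]
        by (intro add_mono mult_left_mono) (use C(2)[OF p'(1), of \<theta>] C(2)[OF q'(1), of \<theta>] \<theta> s in auto)
      also have "\<dots> \<le> 2 * (\<epsilon> * C)" using s C by (simp add: mult_right_mono)
      also have "\<dots> = \<delta> / 2" using C by (simp add: \<epsilon>_def)
      finally show False using gap \<delta> by simp
    qed
  qed
qed

lemma Im_reduce:
  fixes \<xi> :: complex
  obtains k :: int where "0 \<le> Im (\<xi> - of_int k *\<^sub>R (2 * pi * \<i>))" "Im (\<xi> - of_int k *\<^sub>R (2 * pi * \<i>)) \<le> 2 * pi"
proof -
  show ?thesis
    by (rule that[of "\<lfloor>Im \<xi> / (2 * pi)\<rfloor>"])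
      (use floor_divide_lower[of "2*pi" "Im \<xi>"] floor_divide_upper[of "2*pi" "Im \<xi>"] in \<open>auto simp: algebra_simps\<close>)
qed

lemma frechet_derivative_translate:
  assumes "smooth_on UNIV f"
  shows "frechet_derivative (\<lambda>x. f (x - w)) (at x) = frechet_derivative f (at (x - w))"
proof -
  have "((\<lambda>x. x - w) has_derivative (\<lambda>v. v)) (at x)" by (auto intro!: derivative_eq_intros)
  from has_derivative_compose[OF this smooth_on_has_derivative[OF assms UNIV_I]]
  show ?thesis using frechet_derivative_at by metis
qed

text \<open>Cut-offs in u = Re \<xi> glue the central potential, alone for u < 4/3, to the exact
  one, alone for u > 5/3, and add a perturbation on 0 \<le> u \<le> 3. Before the perturbation the
  sheets are distinct for u \<le> 1 and u \<ge> 2, so a small one creates no double points there;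
  for 1 \<le> u \<le> 2 its parameters are generic.\<close>

lemma sheets_of_strands:
  assumes str: "strands P \<pi> z" and sA: "\<And>p. p \<in> P \<Longrightarrow> smooth_on UNIV (A p)"
    and shA: "\<And>p \<theta>. p \<in> P \<Longrightarrow> A p (\<theta> + 2 * pi) = A (\<pi> p) \<theta>"
    and dA: "\<And>p \<theta>. p \<in> P \<Longrightarrow> (A p has_real_derivative Re (z p \<theta>)) (at \<theta>)"
  obtains \<epsilon> R n c g where "\<epsilon> > 0" "sheet_system P \<pi> g R n c"
    "\<And>p \<xi>. p \<in> P \<Longrightarrow> Re \<xi> > 3 \<Longrightarrow> g p \<xi> = exact_sheet \<epsilon> (z p) \<xi>"
proof -
  note D = strandsD[OF str]
  have \<pi>P: "\<pi> p \<in> P" if "p \<in> P" for p using D(2) that bij_betwE by blast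
  obtain \<epsilon> where \<epsilon>: "\<epsilon> > 0" "\<And>p q \<xi>. p \<in> P \<Longrightarrow> q \<in> P \<Longrightarrow> p \<noteq> q \<Longrightarrow> Re \<xi> \<ge> 0 \<Longrightarrow> exact_sheet \<epsilon> (z p) \<xi> \<noteq> exact_sheet \<epsilon> (z q) \<xi>"
    using exact_sheets_distinct[OF str] by metis
  obtain R n c rr kk where R: "finite R" "c > 0" "\<And>r. r \<in> R \<Longrightarrow> n r > (0::nat)"
    "\<And>r r'. r \<in> R \<Longrightarrow> r' \<in> R \<Longrightarrow> r \<noteq> r' \<Longrightarrow> cmod (r - r') \<ge> 3 * c"
    and rrR: "\<And>p. p \<in> P \<Longrightarrow> rr p \<in> R" and rr\<pi>: "\<And>p. p \<in> P \<Longrightarrow> rr (\<pi> p) = rr p"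
    and kk\<pi>: "\<And>p. p \<in> P \<Longrightarrow> kk (\<pi> p) = kk p * exp (2 * of_real pi * \<i> / of_nat (n (rr p)))"
    and bdist: "\<And>p q \<xi>. p \<in> P \<Longrightarrow> q \<in> P \<Longrightarrow> p \<noteq> q \<Longrightarrow> Re \<xi> < 3 \<Longrightarrow>
        rr p + of_real c * kk p * exp (\<xi> / of_nat (n (rr p))) \<noteq> rr q + of_real c * kk q * exp (\<xi> / of_nat (n (rr q)))"
    and cen: "\<And>\<xi> a. (\<exists>p\<in>P. a = rr p + of_real c * kk p * exp (\<xi> / of_nat (n (rr p)))) \<longleftrightarrow>
        (\<exists>r\<in>R. exp \<xi> = ((a - r) / of_real c) ^ n r)"
    by (rule central_sheets[OF D(1,2)], rule that) (assumption | simp)+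
  define b where "b p \<xi> = rr p + of_real c * kk p * exp (\<xi> / of_nat (n (rr p)))" for p \<xi>
  \<comment> \<open>exp \<xi> times the j-th power of the branch term is an exponential with rate
    \<alpha> = 1 + j/n. As \<alpha> is nonzero, it has the explicit primitive
    \<open>IEx\<close>.\<close>
  define \<alpha> where "\<alpha> p j = (1::complex) + of_nat j / of_nat (n (rr p))" for p and j :: nat
  define Ex where "Ex p j \<xi> = (of_real c * kk p) ^ j * exp (\<alpha> p j * \<xi>)" for p j \<xi>
  define IEx where "IEx p j \<xi> = (of_real c * kk p) ^ j * exp (\<alpha> p j * \<xi>) / \<alpha> p j" for p j \<xi>
  have np: "n (rr p) > 0" if "p \<in> P" for p using R(3) rrR[OF that] by auto
  have \<alpha>0: "\<alpha> p j \<noteq> 0" for p j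
  proof -
    have "Re (\<alpha> p j) > 0" by (simp add: \<alpha>_def Re_divide_of_nat add_pos_nonneg)
    then show ?thesis by auto
  qed
  have sEx: "smooth_on UNIV (Ex p j)" "smooth_on UNIV (IEx p j)" for p j
    unfolding Ex_def[abs_def] IEx_def[abs_def] by (intro smooth_intros open_UNIV; simp add: \<alpha>0)+
  have dEx: "(Ex p j has_field_derivative \<alpha> p j * Ex p j \<xi>) (at \<xi>)" "(IEx p j has_field_derivative Ex p j \<xi>) (at \<xi>)" for p j \<xi>
    unfolding Ex_def[abs_def] IEx_def[abs_def] using \<alpha>0[of p j] by (auto intro!: derivative_eq_intros)
  have exp_shift: "exp (\<alpha> p j * (\<xi> + 2 * pi * \<i>)) = exp (\<alpha> p j * \<xi>) * exp (2 * of_real pi * \<i> / of_nat (n (rr p))) ^ j" for p j \<xi>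
  proof -
    define w where "w = 2 * of_real pi * \<i> / of_nat (n (rr p))"
    have "\<alpha> p j * (\<xi> + 2 * pi * \<i>) = \<alpha> p j * \<xi> + (of_nat j * w + 2 * of_real pi * \<i>)"
      by (simp add: \<alpha>_def w_def algebra_simps)
    then have "exp (\<alpha> p j * (\<xi> + 2 * pi * \<i>)) = exp (\<alpha> p j * \<xi>) * (exp w ^ j * exp (2 * of_real pi * \<i>))"
      by (simp only: exp_add exp_of_nat_mult)
    then show ?thesis unfolding w_def by simp
  qed
  have Exs: "Ex p j (\<xi> + 2 * pi * \<i>) = Ex (\<pi> p) j \<xi>" "IEx p j (\<xi> + 2 * pi * \<i>) = IEx (\<pi> p) j \<xi>" if "p \<in> P" for p j \<xi>
  proof -
    have "\<alpha> (\<pi> p) j = \<alpha> p j" using rr\<pi>[OF that] by (simp add: \<alpha>_def)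
    then show "Ex p j (\<xi> + 2 * pi * \<i>) = Ex (\<pi> p) j \<xi>" "IEx p j (\<xi> + 2 * pi * \<i>) = IEx (\<pi> p) j \<xi>"
      unfolding Ex_def IEx_def exp_shift kk\<pi>[OF that] by (simp_all add: power_mult_distrib mult_ac)
  qed
  \<comment> \<open>\<open>g1\<close> and \<open>g2\<close> are exp \<xi> times b and b^2, expanded
    into exponentials; their holomorphic primitives supply the potentials that the cut-offs act
    on.\<close>
  define g1 G1 g2 G2 where "g1 p \<xi> = rr p * Ex p 0 \<xi> + Ex p 1 \<xi>" and "G1 p \<xi> = rr p * IEx p 0 \<xi> + IEx p 1 \<xi>"
    and "g2 p \<xi> = (rr p)\<^sup>2 * Ex p 0 \<xi> + 2 * rr p * Ex p 1 \<xi> + Ex p 2 \<xi>"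
    and "G2 p \<xi> = (rr p)\<^sup>2 * IEx p 0 \<xi> + 2 * rr p * IEx p 1 \<xi> + IEx p 2 \<xi>" for p \<xi>
  have Exb: "Ex p j \<xi> = exp \<xi> * (of_real c * kk p * exp (\<xi> / of_nat (n (rr p)))) ^ j" for p j \<xi>
  proof -
    define w where "w = \<xi> / of_nat (n (rr p))"
    have "\<alpha> p j * \<xi> = \<xi> + of_nat j * w" by (simp add: \<alpha>_def w_def algebra_simps)
    then have "exp (\<alpha> p j * \<xi>) = exp \<xi> * exp w ^ j" by (simp only: exp_add exp_of_nat_mult)
    then show ?thesis unfolding w_def[symmetric] by (simp add: Ex_def power_mult_distrib)
  qed
  have g12: "g1 p \<xi> = exp \<xi> * b p \<xi>" "g2 p \<xi> = exp \<xi> * (b p \<xi>)\<^sup>2" for p \<xi>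
    by (simp_all add: g1_def g2_def Exb b_def algebra_simps power2_eq_square)
  have sg: "smooth_on UNIV (g1 p)" "smooth_on UNIV (G1 p)" "smooth_on UNIV (g2 p)" "smooth_on UNIV (G2 p)" for p
    unfolding g1_def[abs_def] G1_def[abs_def] g2_def[abs_def] G2_def[abs_def] by (intro smooth_intros sEx open_UNIV)+
  have pot: "potential (\<lambda>\<xi>. Im (l * G1 p \<xi> + \<mu> * G2 p \<xi>)) (\<lambda>\<xi>. l * g1 p \<xi> + \<mu> * g2 p \<xi>)" for l \<mu> p
  proof (rule potential_holomorphic)
    show "((\<lambda>\<xi>. l * G1 p \<xi> + \<mu> * G2 p \<xi>) has_field_derivative l * g1 p \<xi> + \<mu> * g2 p \<xi>) (at \<xi>)" for \<xi>
      unfolding g1_def G1_def g2_def G2_def by (intro DERIV_add DERIV_cmult dEx)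
    show "((\<lambda>\<xi>. l * g1 p \<xi> + \<mu> * g2 p \<xi>) has_field_derivative
       l * (rr p * (\<alpha> p 0 * Ex p 0 \<xi>) + \<alpha> p 1 * Ex p 1 \<xi>) + \<mu> * ((rr p)\<^sup>2 * (\<alpha> p 0 * Ex p 0 \<xi>) + 2 * rr p * (\<alpha> p 1 * Ex p 1 \<xi>) + \<alpha> p 2 * Ex p 2 \<xi>)) (at \<xi>)" for \<xi>
      unfolding g1_def g2_def by (intro DERIV_add DERIV_cmult dEx)
  qed (intro smooth_intros sg open_UNIV)+
  \<comment> \<open>The transition takes place on [4/3, 5/3]. \<open>w2\<close> is 1 on [1/2, 5/2],
    a margin around [1, 2], and vanishes outside [0, 3]. The decaying factor belongs to
    \<open>ws\<close> because the potential is differentiated as a whole.\<close>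
  define w1 ws w0 w2 where "w1 u = step_fun (3 * u - 4)" and "ws u = step_fun (3 * u - 4) * (\<epsilon> * exp (- u))"
    and "w0 u = 1 - step_fun (3 * u - 4)" and "w2 u = step_fun (2 * u) * step_fun (6 - 2 * u)" for u
  have sw: "smooth_on UNIV w1" "smooth_on UNIV ws" "smooth_on UNIV w0" "smooth_on UNIV w2"
    unfolding w1_def[abs_def] ws_def[abs_def] w0_def[abs_def] w2_def[abs_def]
    by (intro smooth_intros smooth_on_step_fun open_UNIV)+
  \<comment> \<open>The sign makes the u-derivative of \<epsilon> exp (- u) B equal to \<epsilon>
    exp (- u) Im z, the imaginary part of \<open>exact_sheet\<close>.\<close>
  define B where "B p \<theta> = - Im (z p \<theta>)" for p \<theta>
  have sB: "smooth_on UNIV (B p)" "smooth_on UNIV (\<lambda>\<theta>. Im (z p \<theta>))" if "p \<in> P" for p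
    unfolding B_def[abs_def] by (intro smooth_intros D(3) that open_UNIV)+
  have derA: "der (A p) \<theta> = Re (z p \<theta>)" if "p \<in> P" for p \<theta>
    using dA[OF that] by (intro der_eqI) (simp add: has_real_derivative_iff_has_vector_derivative)
  have derB: "der (B p) \<theta> = - der (\<lambda>\<theta>. Im (z p \<theta>)) \<theta>" if "p \<in> P" for p \<theta>
    unfolding B_def[abs_def] using der(3)[OF sB(2)[OF that]] by (intro der_eqI has_vector_derivative_minus)
  define gA where "gA p \<xi> = cut w1 (\<lambda>\<xi>. A p (Im \<xi>)) (\<lambda>\<xi>. of_real (der (A p) (Im \<xi>))) \<xi>" for p \<xi>
  define gB where "gB p \<xi> = cut ws (\<lambda>\<xi>. B p (Im \<xi>)) (\<lambda>\<xi>. of_real (der (B p) (Im \<xi>))) \<xi>" for p \<xi>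
  \<comment> \<open>Written with coefficients 1 and 0 to be an instance of
    \<open>pot\<close>.\<close>
  define g0 where "g0 p \<xi> = cut w0 (\<lambda>\<xi>. Im (1 * G1 p \<xi> + 0 * G2 p \<xi>)) (\<lambda>\<xi>. 1 * g1 p \<xi> + 0 * g2 p \<xi>) \<xi>" for p \<xi>
  define pert where "pert l \<mu> p \<xi> = cut w2 (\<lambda>\<xi>. Im (l * G1 p \<xi> + \<mu> * G2 p \<xi>)) (\<lambda>\<xi>. l * g1 p \<xi> + \<mu> * g2 p \<xi>) \<xi>" for l \<mu> p \<xi>
  define F where "F p \<xi> = gA p \<xi> + gB p \<xi> + g0 p \<xi>" for p \<xi>
  have symg: "symmetric_deriv UNIV (\<lambda>\<xi>. F p \<xi> + pert l \<mu> p \<xi>)" if "p \<in> P" for l \<mu> p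
    unfolding F_def gA_def gB_def g0_def pert_def
    by (rule potentialD(3)[OF potential_add[OF potential_add[OF potential_add[OF potential_cut[OF sw(1) potential_theta[OF sA[OF that]]]
      potential_cut[OF sw(2) potential_theta[OF sB(1)[OF that]]]] potential_cut[OF sw(3) pot]] potential_cut[OF sw(4) pot]]])
  have smF: "smooth_on UNIV (F p)" if "p \<in> P" for p
    unfolding F_def[abs_def] gA_def gB_def g0_def
    by (rule potentialD(4)[OF potential_add[OF potential_add[OF potential_cut[OF sw(1) potential_theta[OF sA[OF that]]]
      potential_cut[OF sw(2) potential_theta[OF sB(1)[OF that]]]] potential_cut[OF sw(3) pot]]])
  have equiv: "F p (\<xi> + 2 * pi * \<i>) + pert l \<mu> p (\<xi> + 2 * pi * \<i>) = F (\<pi> p) \<xi> + pert l \<mu> (\<pi> p) \<xi>" if p: "p \<in> P" for l \<mu> p \<xi>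
  proof -
    have "B p (\<theta> + 2 * pi) = B (\<pi> p) \<theta>" "der (A p) (\<theta> + 2 * pi) = der (A (\<pi> p)) \<theta>"
      "der (B p) (\<theta> + 2 * pi) = der (B (\<pi> p)) \<theta>" for \<theta>
      using D(4)[OF p] derA[OF p] derA[OF \<pi>P[OF p]] derB[OF p] derB[OF \<pi>P[OF p]] der_Im_strand_shift[OF str p]
      by (simp_all add: B_def)
    then show ?thesis
      unfolding F_def gA_def gB_def g0_def pert_def cut_def g1_def G1_def g2_def G2_def Exs[OF p]
      by (simp add: shA[OF p] rr\<pi>[OF p])
  qed
  have F_inner: "F p \<xi> = g1 p \<xi>" if "Re \<xi> < 4/3" for p \<xi>
  proof -
    have "gA p \<xi> = of_real 0 * of_real (der (A p) (Im \<xi>))"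
      unfolding gA_def by (rule cut_eq_of_const[of "{..<4/3}"]) (use that step_fun_0 in \<open>auto simp: w1_def\<close>)
    moreover have "gB p \<xi> = of_real 0 * of_real (der (B p) (Im \<xi>))"
      unfolding gB_def by (rule cut_eq_of_const[of "{..<4/3}"]) (use that step_fun_0 in \<open>auto simp: ws_def\<close>)
    moreover have "g0 p \<xi> = of_real 1 * (1 * g1 p \<xi> + 0 * g2 p \<xi>)"
      unfolding g0_def by (rule cut_eq_of_const[of "{..<4/3}"]) (use that step_fun_0 in \<open>auto simp: w0_def\<close>)
    ultimately show ?thesis by (simp add: F_def)
  qed
  have F_outer: "F p \<xi> = exact_sheet \<epsilon> (z p) \<xi>" if "Re \<xi> > 5/3" and p: "p \<in> P" for p \<xi>
  proof -
    have "gA p \<xi> = of_real 1 * of_real (der (A p) (Im \<xi>))"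
      unfolding gA_def by (rule cut_eq_of_const[of "{5/3<..}"]) (use that step_fun_1 in \<open>auto simp: w1_def\<close>)
    moreover have "g0 p \<xi> = of_real 0 * (1 * g1 p \<xi> + 0 * g2 p \<xi>)"
      unfolding g0_def by (rule cut_eq_of_const[of "{5/3<..}"]) (use that step_fun_1 in \<open>auto simp: w0_def\<close>)
    moreover have "gB p \<xi> = of_real (\<epsilon> * exp (- Re \<xi>)) * of_real (der (B p) (Im \<xi>)) + \<i> * of_real (- \<epsilon> * exp (- Re \<xi>) * B p (Im \<xi>))"
    proof -
      have se: "smooth_on UNIV (\<lambda>u::real. \<epsilon> * exp (- u))" by (intro smooth_intros open_UNIV)
      have "der ws (Re \<xi>) = der (\<lambda>u. \<epsilon> * exp (- u)) (Re \<xi>)"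
        by (rule der_cong_open[of "{5/3<..}", OF _ _ _ se]) (use that step_fun_1 in \<open>auto simp: ws_def\<close>)
      also have "\<dots> = - \<epsilon> * exp (- Re \<xi>)"
        by (rule der_eqI, subst has_real_derivative_iff_has_vector_derivative[symmetric])
          (auto intro!: derivative_eq_intros)
      finally have "der ws (Re \<xi>) = - \<epsilon> * exp (- Re \<xi>)" .
      moreover have "ws (Re \<xi>) = \<epsilon> * exp (- Re \<xi>)" using that step_fun_1 by (simp add: ws_def)
      ultimately show ?thesis unfolding gB_def cut_def by simp
    qed
    ultimately show ?thesis
      by (simp add: F_def exact_sheet_def derA[OF p] derB[OF p] B_def)
  qed
  have pert_mid: "pert l \<mu> p \<xi> = exp \<xi> * (l * b p \<xi> + \<mu> * (b p \<xi>)\<^sup>2)" if "1/2 < Re \<xi>" "Re \<xi> < 5/2" for l \<mu> p \<xi>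
  proof -
    have "pert l \<mu> p \<xi> = of_real 1 * (l * g1 p \<xi> + \<mu> * g2 p \<xi>)"
      unfolding pert_def by (rule cut_eq_of_const[of "{1/2<..<5/2}"]) (use that step_fun_1 in \<open>auto simp: w2_def\<close>)
    then show ?thesis by (simp add: g12 algebra_simps)
  qed
  have pert_out: "pert l \<mu> p \<xi> = 0" if "Re \<xi> < 0 \<or> 3 < Re \<xi>" for l \<mu> p \<xi>
  proof -
    have "pert l \<mu> p \<xi> = of_real 0 * (l * g1 p \<xi> + \<mu> * g2 p \<xi>)"
      unfolding pert_def by (rule cut_eq_of_const[of "{..<0} \<union> {3<..}"]) (use that step_fun_0 in \<open>auto simp: w2_def\<close>)
    then show ?thesis by simp
  qed
  let ?box = "\<lambda>x y. cbox (Complex x 0) (Complex y (2 * pi))"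
  have g1dist: "g1 p \<xi> \<noteq> g1 q \<xi>" if "p \<in> P" "q \<in> P" "p \<noteq> q" "Re \<xi> < 3" for p q \<xi>
    using bdist[OF that] by (simp add: g12 b_def)
  have cF: "continuous_on S (F p)" if "p \<in> P" for p S
    using smooth_on_imp_continuous_on[OF smF[OF that]] continuous_on_subset by blast
  have Fdist: "F p \<xi> \<noteq> F q \<xi>" if "p \<in> P" "q \<in> P" "p \<noteq> q" "Re \<xi> \<le> 1 \<or> 2 \<le> Re \<xi>" for p q \<xi>
    using that g1dist[OF that(1-3), of \<xi>] \<epsilon>(2)[OF that(1-3), of \<xi>] F_inner[of \<xi>] F_outer[of \<xi>] by auto
  \<comment> \<open>The gap between unperturbed sheets on the two boxes which the perturbation
    reaches outside the generic box 1 \<le> Re \<xi> \<le> 2.\<close>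
  obtain \<delta> where \<delta>: "\<delta> > 0" "\<And>p q x. p \<in> P \<Longrightarrow> q \<in> P \<Longrightarrow> p \<noteq> q \<Longrightarrow> x \<in> ?box 0 1 \<union> ?box 2 3 \<Longrightarrow> \<delta> \<le> norm (F p x - F q x)"
  proof (rule uniform_gap[OF D(1), of "?box 0 1 \<union> ?box 2 3" F])
    show "compact (?box 0 1 \<union> ?box 2 3)" by (intro compact_Un compact_cbox)
    show "F p x \<noteq> F q x" if "p \<in> P" "q \<in> P" "p \<noteq> q" "x \<in> ?box 0 1 \<union> ?box 2 3" for p q x
      by (rule Fdist[OF that(1-3)]) (use that(4) in \<open>auto simp: in_cbox_complex_iff\<close>)
  qed (use cF in auto)
  define Cf where "Cf p \<xi> = \<bar>w2 (Re \<xi>)\<bar> * (cmod (g1 p \<xi>) + cmod (g2 p \<xi>)) + \<bar>der w2 (Re \<xi>)\<bar> * (cmod (G1 p \<xi>) + cmod (G2 p \<xi>))" for p \<xi>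
  have "continuous_on S (Cf p)" for p S
    unfolding Cf_def[abs_def]
    by (intro continuous_intros continuous_on_compose2[OF smooth_on_imp_continuous_on[OF sw(4)]]
        continuous_on_compose2[OF smooth_on_imp_continuous_on[OF der(2)[OF sw(4)]]]
        continuous_on_subset[OF smooth_on_imp_continuous_on[OF sg(1)]] continuous_on_subset[OF smooth_on_imp_continuous_on[OF sg(2)]]
        continuous_on_subset[OF smooth_on_imp_continuous_on[OF sg(3)]] continuous_on_subset[OF smooth_on_imp_continuous_on[OF sg(4)]]) auto
  then obtain C where C: "C > 0" "\<And>p x. p \<in> P \<Longrightarrow> x \<in> ?box 0 3 \<Longrightarrow> norm (Cf p x) \<le> C"
    using uniform_bound[OF D(1) compact_cbox[of "Complex 0 0" "Complex 3 (2 * pi)"], of Cf] by metis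
  \<comment> \<open>Each perturbation is then at most 2 \<tau> C = \<delta>/4, and two of them stay
    below the gap.\<close>
  define \<tau> where "\<tau> = \<delta> / (8 * C)"
  have \<tau>: "\<tau> > 0" "\<tau> * C = \<delta> / 8" using \<delta> C by (auto simp: \<tau>_def)
  have pert_bound: "cmod (pert l \<mu> p \<xi>) \<le> \<delta> / 4" if "cmod l < \<tau>" "cmod \<mu> < \<tau>" "p \<in> P" "\<xi> \<in> ?box 0 3" for l \<mu> p \<xi>
  proof -
    have lin: "cmod (l * x + \<mu> * y) \<le> 2 * \<tau> * (cmod x + cmod y)" for x y
    proof -
      have "cmod (l * x + \<mu> * y) \<le> cmod l * cmod x + cmod \<mu> * cmod y"
        using norm_triangle_ineq[of "l * x" "\<mu> * y"] by (simp add: norm_mult)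
      also have "\<dots> \<le> \<tau> * cmod x + \<tau> * cmod y" using that by (intro add_mono mult_right_mono) auto
      also have "\<dots> \<le> 2 * \<tau> * (cmod x + cmod y)" using \<tau> by (simp add: algebra_simps)
      finally show ?thesis .
    qed
    have "cmod (pert l \<mu> p \<xi>) \<le> \<bar>w2 (Re \<xi>)\<bar> * cmod (l * g1 p \<xi> + \<mu> * g2 p \<xi>) + \<bar>der w2 (Re \<xi>)\<bar> * \<bar>Im (l * G1 p \<xi> + \<mu> * G2 p \<xi>)\<bar>"
      unfolding pert_def cut_def by (rule order_trans[OF norm_triangle_ineq]) (simp add: norm_mult abs_mult del: Im_complex_of_real plus_complex.simps times_complex.simps)
    also have "\<dots> \<le> \<bar>w2 (Re \<xi>)\<bar> * (2 * \<tau> * (cmod (g1 p \<xi>) + cmod (g2 p \<xi>))) + \<bar>der w2 (Re \<xi>)\<bar> * (2 * \<tau> * (cmod (G1 p \<xi>) + cmod (G2 p \<xi>)))"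
      by (intro add_mono mult_left_mono lin order_trans[OF abs_Im_le_cmod lin]) auto
    also have "\<dots> = 2 * \<tau> * Cf p \<xi>" by (simp add: Cf_def algebra_simps)
    also have "\<dots> \<le> 2 * \<tau> * C" using C(2)[OF that(3,4)] \<tau> by (intro mult_left_mono) auto
    finally show ?thesis using \<tau> by simp
  qed
  let ?S = "{\<xi>. 1/2 < Re \<xi> \<and> Re \<xi> < 5/2}"
  have oS: "open ?S" by (intro open_Collect_conj open_Collect_less continuous_intros)
  have sb: "smooth_on ?S (b p)" if "p \<in> P" for p
    unfolding b_def[abs_def] by (intro smooth_intros oS) (use np[OF that] in auto)
  have bd: "b p \<xi> \<noteq> b q \<xi>" if "p \<in> P" "q \<in> P" "p \<noteq> q" "\<xi> \<in> ?S" for p q \<xi>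
    using bdist[OF that(1-3), of \<xi>] that(4) by (auto simp: b_def)
  have MS: "?box 1 2 \<subseteq> ?S" by (auto simp: in_cbox_complex_iff)
  show ?thesis
  proof (rule generic_parameters[where F=F and b=b and S="?S" and M="?box 1 2" and P=P and \<tau>=\<tau>,
      OF D(1) smooth_on_subset[OF smF subset_UNIV] sb oS compact_cbox MS bd \<tau>(1)])
  fix l \<mu> assume l\<mu>: "cmod l < \<tau>" "cmod \<mu> < \<tau>" and
    gen: "\<And>p q \<xi> G. p \<in> P \<Longrightarrow> q \<in> P \<Longrightarrow> p \<noteq> q \<Longrightarrow> \<xi> \<in> ?box 1 2 \<Longrightarrow>
       (\<And>p \<xi>. p \<in> P \<Longrightarrow> \<xi> \<in> ?S \<Longrightarrow> G p \<xi> = F p \<xi> + exp \<xi> * (l * b p \<xi> + \<mu> * (b p \<xi>)\<^sup>2)) \<Longrightarrow>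
       G p \<xi> = G q \<xi> \<Longrightarrow> inj (frechet_derivative (\<lambda>\<xi>. G p \<xi> - G q \<xi>) (at \<xi>))"
    "\<And>p q r \<xi> G. p \<in> P \<Longrightarrow> q \<in> P \<Longrightarrow> r \<in> P \<Longrightarrow> \<xi> \<in> ?box 1 2 \<Longrightarrow>
       (\<And>p \<xi>. p \<in> P \<Longrightarrow> \<xi> \<in> ?S \<Longrightarrow> G p \<xi> = F p \<xi> + exp \<xi> * (l * b p \<xi> + \<mu> * (b p \<xi>)\<^sup>2)) \<Longrightarrow>
       G p \<xi> = G q \<xi> \<Longrightarrow> G p \<xi> = G r \<xi> \<Longrightarrow> p = q \<or> p = r \<or> q = r"
  define g where "g p \<xi> = F p \<xi> + pert l \<mu> p \<xi>" for p \<xi>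
  have gS: "g p \<xi> = F p \<xi> + exp \<xi> * (l * b p \<xi> + \<mu> * (b p \<xi>)\<^sup>2)" if "p \<in> P" "\<xi> \<in> ?S" for p \<xi>
    using pert_mid that by (simp add: g_def)
  have g_sym: "symmetric_deriv UNIV (g p)" if "p \<in> P" for p
    unfolding g_def[abs_def] by (rule symg[OF that])
  have g_equiv: "g p (\<xi> + 2 * pi * \<i>) = g (\<pi> p) \<xi>" if "p \<in> P" for p \<xi>
    unfolding g_def by (rule equiv[OF that])
  have g_inner: "g p \<xi> = exp \<xi> * b p \<xi>" if "Re \<xi> < 0" for p \<xi>
    using F_inner[of \<xi> p] pert_out[of \<xi>] that by (simp add: g_def g12)
  have g_dist: "g p \<xi> \<noteq> g q \<xi>" if pq: "p \<in> P" "q \<in> P" "p \<noteq> q" and \<xi>: "0 \<le> Im \<xi>" "Im \<xi> \<le> 2 * pi" "\<xi> \<notin> ?box 1 2" for p q \<xi>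
  proof (cases "\<xi> \<in> ?box 0 1 \<union> ?box 2 3")
    case True
    then have "\<xi> \<in> ?box 0 3" by (auto simp: in_cbox_complex_iff)
    then have "cmod (pert l \<mu> q \<xi> - pert l \<mu> p \<xi>) \<le> \<delta> / 4 + \<delta> / 4"
      by (intro order_trans[OF norm_triangle_ineq4] add_mono pert_bound l\<mu> pq)
    moreover have "\<delta> \<le> cmod (F p \<xi> - F q \<xi>)" using \<delta>(2)[OF pq True] .
    ultimately have "F p \<xi> - F q \<xi> \<noteq> pert l \<mu> q \<xi> - pert l \<mu> p \<xi>" using \<delta>(1) by auto
    then show ?thesis by (simp add: g_def algebra_simps)
  next
    case False
    then have "Re \<xi> < 0 \<or> 3 < Re \<xi>" using \<xi> by (auto simp: in_cbox_complex_iff)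
    then show ?thesis using pert_out[of \<xi>] Fdist[OF pq, of \<xi>] by (auto simp: g_def)
  qed
  \<comment> \<open>Whole turns move \<xi> into the strip that contains the compact boxes, at the
    price of relabelling the sheets.\<close>
  have reduce: "\<exists>k. 0 \<le> Im (\<xi> - of_int k *\<^sub>R (2 * pi * \<i>)) \<and> Im (\<xi> - of_int k *\<^sub>R (2 * pi * \<i>)) \<le> 2 * pi \<and>
      (\<forall>p\<in>P. \<exists>p'\<in>P. \<forall>x. g p x = g p' (x - of_int k *\<^sub>R (2 * pi * \<i>)))" for \<xi>
  proof -
    obtain k :: int where k: "0 \<le> Im (\<xi> - of_int k *\<^sub>R (2 * pi * \<i>))" "Im (\<xi> - of_int k *\<^sub>R (2 * pi * \<i>)) \<le> 2 * pi"
      by (rule Im_reduce)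
    have "\<exists>p'\<in>P. \<forall>x. g p x = g p' (x - of_int k *\<^sub>R (2 * pi * \<i>))" if p: "p \<in> P" for p
    proof -
      obtain p' where "p' \<in> P" "\<forall>x. g p (x + of_int k *\<^sub>R (2 * pi * \<i>)) = g p' x"
        using equivariant_shift[where F=g and w="2 * pi * \<i>", OF D(2) g_equiv p] by blast
      then show ?thesis by (metis diff_add_cancel)
    qed
    then show ?thesis using k by blast
  qed
  \<comment> \<open>Distinct labels carry distinct functions, so the relabelling keeps distinct
    labels distinct.\<close>
  have inner_ne: "\<exists>x. g p x \<noteq> g q x" if "p \<in> P" "q \<in> P" "p \<noteq> q" for p q
    using g_inner[of "-1"] bdist[OF that, of "-1"] by (intro exI[of _ "-1"]) (simp add: b_def)
  have sys: "sheet_system P \<pi> g R n c"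
  proof (unfold_locales, goal_cases)
    case (7 r) then show ?case by (rule R(3))
  next
    case (8 r r') then show ?case by (rule R(4))
  next
    case (9 \<xi> a)
    then show ?case using cen[of a \<xi>] g_inner by (simp add: b_def)
  next
    case (10 p q \<xi>)
    obtain k where k: "0 \<le> Im (\<xi> - of_int k *\<^sub>R (2 * pi * \<i>))" "Im (\<xi> - of_int k *\<^sub>R (2 * pi * \<i>)) \<le> 2 * pi"
      and kP: "\<And>p. p \<in> P \<Longrightarrow> \<exists>p'\<in>P. \<forall>x. g p x = g p' (x - of_int k *\<^sub>R (2 * pi * \<i>))" using reduce[of \<xi>] by blast
    let ?w = "of_int k *\<^sub>R (2 * pi * \<i>)"
    obtain p' q' where p': "p' \<in> P" "\<And>x. g p x = g p' (x - ?w)" and q': "q' \<in> P" "\<And>x. g q x = g q' (x - ?w)"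
      using kP[OF 10(1)] kP[OF 10(2)] by metis
    have ne: "p' \<noteq> q'" using inner_ne[OF 10(1-3)] p' q' by auto
    have e: "g p' (\<xi> - ?w) = g q' (\<xi> - ?w)" using 10 p' q' by simp
    then have M: "\<xi> - ?w \<in> ?box 1 2" using g_dist[OF p'(1) q'(1) ne k] by blast
    have "frechet_derivative (\<lambda>x. g p x - g q x) (at \<xi>) = frechet_derivative (\<lambda>x. g p' x - g q' x) (at (\<xi> - ?w))"
      unfolding p'(2) q'(2)
      by (rule frechet_derivative_translate[of "\<lambda>x. g p' x - g q' x"])
        (intro smooth_intros symmetric_derivD(2)[OF g_sym] p' q' open_UNIV)
    then show ?case using gen(1)[OF p'(1) q'(1) ne M gS e] M by (auto simp: in_cbox_complex_iff)
  next
    case (11 p q r \<xi>)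
    obtain k where k: "0 \<le> Im (\<xi> - of_int k *\<^sub>R (2 * pi * \<i>))" "Im (\<xi> - of_int k *\<^sub>R (2 * pi * \<i>)) \<le> 2 * pi"
      and kP: "\<And>p. p \<in> P \<Longrightarrow> \<exists>p'\<in>P. \<forall>x. g p x = g p' (x - of_int k *\<^sub>R (2 * pi * \<i>))" using reduce[of \<xi>] by blast
    let ?w = "of_int k *\<^sub>R (2 * pi * \<i>)"
    obtain p' q' r' where p': "p' \<in> P" "\<And>x. g p x = g p' (x - ?w)" and q': "q' \<in> P" "\<And>x. g q x = g q' (x - ?w)"
      and r': "r' \<in> P" "\<And>x. g r x = g r' (x - ?w)"
      using kP[OF 11(1)] kP[OF 11(2)] kP[OF 11(3)] by metis
    have e: "g p' (\<xi> - ?w) = g q' (\<xi> - ?w)" "g p' (\<xi> - ?w) = g r' (\<xi> - ?w)" using 11 p' q' r' by simp_all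
    show ?case
    proof (rule ccontr)
      assume "\<not> ?case"
      then have "p' \<noteq> q'" "p' \<noteq> r'" "q' \<noteq> r'"
        using inner_ne[OF 11(1,2)] inner_ne[OF 11(1,3)] inner_ne[OF 11(2,3)] p' q' r' by auto
      moreover have "\<xi> - ?w \<in> ?box 1 2" using g_dist[OF p'(1) q'(1) \<open>p' \<noteq> q'\<close> k] e by blast
      ultimately show False using gen(2)[OF p'(1) q'(1) r'(1) _ gS e] by blast
    qed
  qed (use D(1,2) g_sym g_equiv R(1,2) in auto)
  show ?thesis
    by (rule that[OF \<epsilon>(1) sys]) (use F_outer pert_out in \<open>auto simp: g_def\<close>)
  qed
qed

section \<open>Intersections with large spheres\<close>

locale exact_end =
  fixes P :: "complex set" and \<pi> :: "complex \<Rightarrow> complex" and z :: "complex \<Rightarrow> real \<Rightarrow> complex" and \<epsilon> :: real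
  assumes str: "strands P \<pi> z" and \<epsilon>_pos: "\<epsilon> > 0"
begin

definition y' :: "complex \<Rightarrow> real \<Rightarrow> real" where "y' p = der (\<lambda>\<theta>. Im (z p \<theta>))"

definition es :: "complex \<Rightarrow> real \<Rightarrow> real \<Rightarrow> complex" where
  "es p u \<theta> = of_real (Re (z p \<theta>) - \<epsilon> * exp (- u) * y' p \<theta>) + \<i> * of_real (\<epsilon> * exp (- u) * Im (z p \<theta>))"

text \<open>The squared distance from the origin of the point \<open>(e\<^sup>\<xi>, e\<^sup>-\<^sup>\<xi> \<eta>)\<close> on the sheet, \<open>\<xi> = u + \<i>\<theta>\<close>.\<close>

definition rad :: "complex \<Rightarrow> real \<Rightarrow> real \<Rightarrow> real" where
  "rad p u \<theta> = exp (2 * u) + exp (- 2 * u) * (cmod (es p u \<theta>))\<^sup>2"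

text \<open>The u-derivative of \<open>rad\<close>: at fixed angle Re es grows at the rate
  \<epsilon> exp (- u) y', while Im es decays like exp (- u).\<close>

definition rad' :: "complex \<Rightarrow> real \<Rightarrow> real \<Rightarrow> real" where
  "rad' p u \<theta> = 2 * exp (2 * u) - 2 * exp (- 2 * u) * ((Re (es p u \<theta>))\<^sup>2 + 2 * (Im (es p u \<theta>))\<^sup>2
     - Re (es p u \<theta>) * (\<epsilon> * exp (- u) * y' p \<theta>))"

lemma exact_sheet_es: "exact_sheet \<epsilon> (z p) \<xi> = es p (Re \<xi>) (Im \<xi>)"
  by (simp add: exact_sheet_def es_def y'_def)

lemma smooth_on_y': "p \<in> P \<Longrightarrow> smooth_on UNIV (y' p)"
  unfolding y'_def by (intro der(2) smooth_intros strandsD(3)[OF str] open_UNIV)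

lemma smooth_on_es:
  assumes "p \<in> P" "open S" "smooth_on S f" "smooth_on S h"
  shows "smooth_on S (\<lambda>x. es p (f x) (h x))"
  unfolding es_def
  by (intro smooth_intros assms smooth_on_arg[OF _ _ smooth_on_y'] smooth_on_arg[OF _ _ strandsD(3)[OF str]])

lemma es_shift: "p \<in> P \<Longrightarrow> es p u (\<theta> + 2 * pi) = es (\<pi> p) u \<theta>"
  using strandsD(4)[OF str] der_Im_strand_shift[OF str] by (simp add: es_def y'_def)

lemma rad_deriv:
  assumes "p \<in> P"
  shows "((\<lambda>u. rad p u \<theta>) has_real_derivative rad' p u \<theta>) (at u)"
  unfolding rad_def rad'_def cmod_power2 es_def
  by (auto intro!: derivative_eq_intros simp: algebra_simps power2_eq_square)

text \<open>Periodicity up to relabelling reduces the angle to a compact interval, and exp (- u)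
  \<le> 1 makes the bounds uniform in u \<ge> 0.\<close>

lemma bounds:
  obtains C where "C > 0" "\<And>p \<theta>. p \<in> P \<Longrightarrow> cmod (z p \<theta>) \<le> C" "\<And>p \<theta>. p \<in> P \<Longrightarrow> \<bar>y' p \<theta>\<bar> \<le> C"
    "\<And>p u \<theta>. p \<in> P \<Longrightarrow> u \<ge> 0 \<Longrightarrow> cmod (es p u \<theta>) \<le> C" "\<And>p u \<theta>. p \<in> P \<Longrightarrow> u \<ge> 0 \<Longrightarrow> \<bar>\<epsilon> * exp (- u) * y' p \<theta>\<bar> \<le> C"
proof -
  note D = strandsD[OF str]
  define F where "F p \<theta> = (z p \<theta>, y' p \<theta>)" for p \<theta>
  have Fs: "F p (\<theta> + 2 * pi) = F (\<pi> p) \<theta>" if "p \<in> P" for p \<theta>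
    using D(4)[OF that] der_Im_strand_shift[OF str that] by (simp add: F_def y'_def)
  have "continuous_on {-pi..pi} (F p)" if "p \<in> P" for p
    unfolding F_def[abs_def]
    by (intro continuous_on_Pair continuous_on_subset[OF smooth_on_imp_continuous_on[OF D(3)[OF that]]]
      continuous_on_subset[OF smooth_on_imp_continuous_on[OF smooth_on_y'[OF that]]]) auto
  then obtain C where C: "C > 0" "\<And>p \<theta>. p \<in> P \<Longrightarrow> \<theta> \<in> {-pi..pi} \<Longrightarrow> norm (F p \<theta>) \<le> C"
    using uniform_bound[OF D(1) compact_Icc, of "-pi" pi F] by metis
  have F: "norm (F p \<theta>) \<le> C" if hp: "p \<in> P" for p \<theta>
  proof -
    obtain \<theta>' where \<theta>': "- pi \<le> \<theta>'" "\<theta>' \<le> pi" "cis \<theta>' = cis \<theta>" by (rule cis_reduce)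
    obtain q where "q \<in> P" "F p \<theta> = F q \<theta>'"
      using strands_shift[where F=F, OF D(2) Fs hp \<theta>'(3)[symmetric]] by auto
    then show ?thesis using C(2)[of q \<theta>'] \<theta>' by simp
  qed
  have Fz: "cmod (z p \<theta>) \<le> C" "\<bar>y' p \<theta>\<bar> \<le> C" if "p \<in> P" for p \<theta>
    using F[OF that, of \<theta>] norm_fst_le[of "z p \<theta>" "y' p \<theta>"] norm_snd_le[of "y' p \<theta>" "z p \<theta>"] by (auto simp: F_def)
  define C1 where "C1 = C + 2 * (\<epsilon> * C)"
  have C1: "C1 > 0" "C \<le> C1" "\<epsilon> * C \<le> C1" using C \<epsilon>_pos by (auto simp: C1_def add_pos_pos)
  have sm: "\<bar>\<epsilon> * exp (- u) * a\<bar> \<le> \<epsilon> * C" if "u \<ge> 0" "\<bar>a\<bar> \<le> C" for u a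
  proof -
    have "\<bar>\<epsilon> * exp (- u) * a\<bar> = \<epsilon> * (exp (- u) * \<bar>a\<bar>)" using \<epsilon>_pos by (simp add: abs_mult)
    also have "\<dots> \<le> \<epsilon> * (1 * C)" using that \<epsilon>_pos C by (intro mult_left_mono mult_mono) auto
    finally show ?thesis by simp
  qed
  have es: "cmod (es p u \<theta>) \<le> C1" if p: "p \<in> P" "u \<ge> 0" for p u \<theta>
  proof -
    have 1: "\<bar>\<epsilon> * exp (- u) * y' p \<theta>\<bar> \<le> \<epsilon> * C" "\<bar>\<epsilon> * exp (- u) * Im (z p \<theta>)\<bar> \<le> \<epsilon> * C"
      using sm[OF p(2)] Fz[OF p(1), of \<theta>] abs_Im_le_cmod[of "z p \<theta>"] by (meson order_trans)+
    have 2: "\<bar>Re (z p \<theta>)\<bar> \<le> C" using Fz(1)[OF p(1), of \<theta>] abs_Re_le_cmod[of "z p \<theta>"] by simp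
    have "cmod (es p u \<theta>) \<le> \<bar>Re (z p \<theta>) - \<epsilon> * exp (- u) * y' p \<theta>\<bar> + \<bar>\<epsilon> * exp (- u) * Im (z p \<theta>)\<bar>"
      unfolding es_def by (rule order_trans[OF cmod_le]) simp
    then show ?thesis using 1 2 by (simp add: C1_def)
  qed
  show ?thesis
  proof (rule that[OF C1(1)])
    show "cmod (z p \<theta>) \<le> C1" "\<bar>y' p \<theta>\<bar> \<le> C1" if "p \<in> P" for p \<theta>
      using Fz[OF that, of \<theta>] C1(2) by auto
    show "\<bar>\<epsilon> * exp (- u) * y' p \<theta>\<bar> \<le> C1" if "p \<in> P" "u \<ge> 0" for p u \<theta>
      using sm[OF that(2) Fz(2)[OF that(1)]] C1(3) by (rule order_trans)
  qed (rule es)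
qed

text \<open>The bracket in \<open>rad'\<close> is at most 4 C^2, and u \<ge> 2 C^2 gives exp (2 u) >
  4 C^2.\<close>

lemma rad'_pos:
  assumes "0 \<le> C" "cmod (es p u \<theta>) \<le> C" "\<bar>\<epsilon> * exp (- u) * y' p \<theta>\<bar> \<le> C" "2 * C\<^sup>2 \<le> u"
  shows "rad' p u \<theta> > 0"
proof -
  define a b d where "a = Re (es p u \<theta>)" and "b = Im (es p u \<theta>)" and "d = \<epsilon> * exp (- u) * y' p \<theta>"
  have ab: "\<bar>a\<bar> \<le> C" "\<bar>b\<bar> \<le> C" "\<bar>d\<bar> \<le> C"
    using assms abs_Re_le_cmod[of "es p u \<theta>"] abs_Im_le_cmod[of "es p u \<theta>"] by (auto simp: a_def b_def d_def)
  have "a\<^sup>2 \<le> C\<^sup>2" "b\<^sup>2 \<le> C\<^sup>2" using ab assms(1) by (auto simp: abs_le_square_iff[symmetric])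
  moreover have "\<bar>a * d\<bar> \<le> C\<^sup>2" unfolding abs_mult power2_eq_square using ab by (intro mult_mono) auto
  ultimately have 1: "a\<^sup>2 + 2 * b\<^sup>2 - a * d \<le> 4 * C\<^sup>2" by (auto simp: abs_le_iff)
  have u: "u \<ge> 0" using assms(4) zero_le_power2[of C] by linarith
  have "exp (- 2 * u) * (a\<^sup>2 + 2 * b\<^sup>2 - a * d) \<le> exp (- 2 * u) * (4 * C\<^sup>2)"
    using 1 by (intro mult_left_mono) auto
  also have "\<dots> \<le> 1 * (4 * C\<^sup>2)" using u by (intro mult_right_mono) auto
  also have "\<dots> < exp (2 * u)" using exp_ge_add_one_self[of "2 * u"] assms(4) by linarith
  finally show ?thesis by (simp add: rad'_def a_def b_def d_def)
qed

text \<open>An implicit function argument: the map with components \<open>rad\<close> and angle has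
  injective derivative because \<open>rad\<close> increases in u, and \<open>U\<close> is the real
  part of its smooth local inverse along the line where the first component is
  \<open>s\<close>.\<close>

lemma smooth_radius:
  assumes p: "p \<in> P" and "u0 < U \<theta>\<^sub>0" "\<And>u \<theta>. u0 < u \<Longrightarrow> rad' p u \<theta> > 0"
    "\<And>\<theta> u. u0 < u \<Longrightarrow> rad p u \<theta> = s \<longleftrightarrow> u = U \<theta>"
  shows "\<exists>T. open T \<and> \<theta>\<^sub>0 \<in> T \<and> smooth_on T U"
proof -
  define Q where "Q \<xi> = Complex (rad p (Re \<xi>) (Im \<xi>)) (Im \<xi>)" for \<xi>
  have Qe: "Q \<xi> = of_real (rad p (Re \<xi>) (Im \<xi>)) + \<i> * of_real (Im \<xi>)" for \<xi> by (simp add: Q_def complex_eq_iff)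
  let ?S = "{\<xi>. u0 < Re \<xi>}"
  have oS: "open ?S" by (intro open_Collect_less continuous_intros)
  have srad: "smooth_on S (\<lambda>\<xi>. rad p (Re \<xi>) (Im \<xi>))" if "open S" for S
    unfolding rad_def by (intro smooth_intros smooth_on_es p that)
  have sQ: "smooth_on ?S Q"
    unfolding Qe[abs_def] by (intro smooth_intros srad oS)
  let ?\<xi> = "Complex (U \<theta>\<^sub>0) \<theta>\<^sub>0"
  have \<xi>S: "?\<xi> \<in> ?S" using assms(2) by simp
  define r' where "r' = frechet_derivative (\<lambda>\<xi>. rad p (Re \<xi>) (Im \<xi>)) (at ?\<xi>)"
  have dr: "((\<lambda>\<xi>. rad p (Re \<xi>) (Im \<xi>)) has_derivative r') (at ?\<xi>)"
    unfolding r'_def by (rule smooth_on_has_derivative[OF srad[OF open_UNIV]]) simp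
  have r'1: "r' 1 = rad' p (U \<theta>\<^sub>0) \<theta>\<^sub>0"
  proof -
    have "((\<lambda>u. Complex u \<theta>\<^sub>0) has_derivative (\<lambda>v. of_real v)) (at (U \<theta>\<^sub>0))"
      unfolding Complex_eq by (auto intro!: derivative_eq_intros)
    from has_derivative_compose[OF this dr]
    have "((\<lambda>u. rad p u \<theta>\<^sub>0) has_derivative (\<lambda>v. r' (of_real v))) (at (U \<theta>\<^sub>0))" by simp
    moreover have "((\<lambda>u. rad p u \<theta>\<^sub>0) has_derivative (\<lambda>v. rad' p (U \<theta>\<^sub>0) \<theta>\<^sub>0 * v)) (at (U \<theta>\<^sub>0))"
      using rad_deriv[OF p] by (simp add: has_field_derivative_def)
    ultimately have "(\<lambda>v. r' (of_real v)) = (\<lambda>v. rad' p (U \<theta>\<^sub>0) \<theta>\<^sub>0 * v)" by (rule has_derivative_unique)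
    from fun_cong[OF this, of 1] show ?thesis by simp
  qed
  have "(Q has_derivative (\<lambda>v. of_real (r' v) + \<i> * of_real (Im v))) (at ?\<xi>)"
    unfolding Qe[abs_def]
    by (intro has_derivative_add has_derivative_of_real dr has_derivative_mult_right)
      (auto intro!: derivative_eq_intros)
  then have Q': "frechet_derivative Q (at ?\<xi>) = (\<lambda>v. of_real (r' v) + \<i> * of_real (Im v))"
    using frechet_derivative_at by metis
  have linr: "linear r'" using dr by (rule has_derivative_linear)
  have "inj (frechet_derivative Q (at ?\<xi>))"
  proof -
    have lQ: "linear (frechet_derivative Q (at ?\<xi>))"
      using smooth_on_has_derivative[OF sQ \<xi>S] by (rule has_derivative_linear)
    have "v = 0" if "frechet_derivative Q (at ?\<xi>) v = 0" for v
    proof -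
      have "r' v = 0" "Im v = 0" using that unfolding Q' by (simp_all add: complex_eq_iff)
      then have "v = Re v *\<^sub>R 1" by (simp add: complex_eq_iff)
      then have "Re v * r' 1 = 0" using \<open>r' v = 0\<close> linear_scale[OF linr, of "Re v" 1] by simp
      then show ?thesis using r'1 assms(3)[OF assms(2), of \<theta>\<^sub>0] \<open>Im v = 0\<close> by (simp add: complex_eq_iff)
    qed
    then show ?thesis using linear_injective_0[OF lQ] by blast
  qed
  from smooth_local_inverse[OF oS sQ \<xi>S this]
  obtain X V H where H: "open X" "open V" "?\<xi> \<in> X" "Q ?\<xi> \<in> V" "X \<subseteq> ?S" "homeomorphism X V Q H" "smooth_on V H" by metis
  let ?T = "(\<lambda>\<theta>. Complex s \<theta>) -` V"
  have sc: "smooth_on T (\<lambda>\<theta>. Complex s \<theta>)" if "open T" for T :: "real set"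
    unfolding Complex_eq by (intro smooth_intros that)
  have oT: "open ?T"
    by (rule open_vimage[OF H(2) smooth_on_imp_continuous_on[OF sc[OF open_UNIV]]])
  have "Q ?\<xi> = Complex s \<theta>\<^sub>0" using assms(4)[OF assms(2), of \<theta>\<^sub>0] by (simp add: Q_def)
  then have "\<theta>\<^sub>0 \<in> ?T" using H(4) by simp
  moreover have "smooth_on ?T (\<lambda>\<theta>. Re (H (Complex s \<theta>)))"
    by (intro smooth_on_Re oT smooth_on_compose[OF oT H(2,7) sc[OF oT]]) auto
  moreover have "Re (H (Complex s \<theta>)) = U \<theta>" if "\<theta> \<in> ?T" for \<theta>
  proof -
    have "H (Complex s \<theta>) \<in> X" "Q (H (Complex s \<theta>)) = Complex s \<theta>"
      using H(6) that unfolding homeomorphism_def by auto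
    then have "u0 < Re (H (Complex s \<theta>))" "rad p (Re (H (Complex s \<theta>))) \<theta> = s"
      using H(5) by (auto simp: Q_def)
    then show ?thesis using assms(4) by blast
  qed
  ultimately show ?thesis using oT smooth_on_cong[OF oT, of "\<lambda>\<theta>. Re (H (Complex s \<theta>))" U] by blast
qed

end

text \<open>Meant for E = exp (- u) and \<rho> = r exp (- u) on the sphere of radius r, where \<rho>
  exceeds 1 by O(E) only. The constant depends on C and \<epsilon> alone, so the error of a section
  is O(1/r).\<close>

lemma error_estimate:
  fixes C E \<rho> \<epsilon> :: real
  assumes "0 < C" "0 < E" "E \<le> 1" "1 \<le> \<rho>" "\<rho>\<^sup>2 \<le> 1 + C\<^sup>2 * E" "\<epsilon> > 0" "\<bar>x\<bar> \<le> C" "\<bar>y\<bar> \<le> C" "\<bar>y'\<bar> \<le> C"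
  shows "\<bar>\<rho>\<^sup>2 * (x - \<epsilon> * E * y') - x\<bar> + \<bar>\<rho> ^ 3 * y - y\<bar> \<le> (C\<^sup>2 * C + (1 + C\<^sup>2) * \<epsilon> * C + (2 + C\<^sup>2) * C\<^sup>2 * C) * E"
proof -
  define \<eta> where "\<eta> = C\<^sup>2 * E"
  have \<eta>: "0 \<le> \<eta>" "\<eta> \<le> C\<^sup>2" "\<rho>\<^sup>2 \<le> 1 + \<eta>"
  proof -
    show "0 \<le> \<eta>" unfolding \<eta>_def using assms(2) by (intro mult_nonneg_nonneg) auto
    show "\<eta> \<le> C\<^sup>2" unfolding \<eta>_def using assms(3) mult_left_mono[of E 1 "C\<^sup>2"] by simp
    show "\<rho>\<^sup>2 \<le> 1 + \<eta>" unfolding \<eta>_def by (rule assms(5))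
  qed
  have r1: "1 \<le> \<rho>\<^sup>2" "1 \<le> \<rho> ^ 3" using assms(4) by (simp_all add: one_le_power)
  have "\<bar>\<rho>\<^sup>2 * (x - \<epsilon> * E * y') - x\<bar> = \<bar>(\<rho>\<^sup>2 - 1) * x - \<rho>\<^sup>2 * (\<epsilon> * E * y')\<bar>" by (simp add: algebra_simps)
  also have "\<dots> \<le> (\<rho>\<^sup>2 - 1) * \<bar>x\<bar> + \<rho>\<^sup>2 * (\<epsilon> * E * \<bar>y'\<bar>)"
    using r1 assms by (intro order_trans[OF abs_triangle_ineq4]) (simp add: abs_mult)
  also have "\<dots> \<le> \<eta> * C + (1 + C\<^sup>2) * (\<epsilon> * E * C)"
    using assms \<eta>(2,3) r1 by (intro add_mono mult_mono) (auto intro: \<eta>(1))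
  finally have 1: "\<bar>\<rho>\<^sup>2 * (x - \<epsilon> * E * y') - x\<bar> \<le> \<eta> * C + (1 + C\<^sup>2) * (\<epsilon> * E * C)" .
  \<comment> \<open>The fourth power is the square of \<rho>^2, for which a bound is
    available.\<close>
  have "\<rho> ^ 3 \<le> \<rho> ^ 4" using assms(4) by (intro power_increasing) auto
  also have "\<rho> ^ 4 = (\<rho>\<^sup>2)\<^sup>2" by (simp flip: power_mult)
  also have "\<dots> \<le> (1 + \<eta>)\<^sup>2" using \<eta>(3) by (intro power_mono) auto
  also have "\<dots> = 1 + (2 + \<eta>) * \<eta>" by (simp add: power2_eq_square algebra_simps)
  also have "\<dots> \<le> 1 + (2 + C\<^sup>2) * \<eta>" using \<eta> by (intro add_left_mono mult_right_mono) auto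
  finally have r3: "\<rho> ^ 3 - 1 \<le> (2 + C\<^sup>2) * \<eta>" by simp
  have "\<bar>\<rho> ^ 3 * y - y\<bar> = (\<rho> ^ 3 - 1) * \<bar>y\<bar>"
  proof -
    have "\<rho> ^ 3 * y - y = (\<rho> ^ 3 - 1) * y" by (simp add: left_diff_distrib)
    then show ?thesis using r1(2) by (simp only: abs_mult abs_of_nonneg diff_ge_0_iff_ge)
  qed
  also have "\<dots> \<le> (2 + C\<^sup>2) * \<eta> * C" using r3 r1 assms by (intro mult_mono) (auto intro!: mult_nonneg_nonneg \<eta>(1))
  finally have 2: "\<bar>\<rho> ^ 3 * y - y\<bar> \<le> (2 + C\<^sup>2) * \<eta> * C" .
  show ?thesis using 1 2 by (simp add: \<eta>_def algebra_simps)
qed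

context exact_end
begin

definition sheet_point :: "complex \<Rightarrow> real \<Rightarrow> real \<Rightarrow> C2" where
  "sheet_point p u \<theta> = (exp (Complex u \<theta>), exp (- Complex u \<theta>) * es p u \<theta>)"

lemma norm_sheet_point: "(norm (sheet_point p u \<theta>))\<^sup>2 = rad p u \<theta>"
proof -
  have 1: "(cmod (exp (Complex u \<theta>)))\<^sup>2 = exp (2 * u)" "(cmod (exp (- Complex u \<theta>)))\<^sup>2 = exp (- 2 * u)"
    by (simp_all add: norm_exp_eq_Re exp_double[symmetric])
  show ?thesis unfolding sheet_point_def norm_Pair rad_def
    by (simp add: norm_mult power_mult_distrib 1[simplified])
qed

lemma rad_shift: "p \<in> P \<Longrightarrow> rad p u (\<theta> + 2 * pi) = rad (\<pi> p) u \<theta>"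
  by (simp add: rad_def es_shift)

text \<open>The section of each sheet by the sphere of radius r, as a graph over the angle; only the
  end beyond \<open>u1\<close> is considered.\<close>

definition section_radius :: "real \<Rightarrow> real \<Rightarrow> (complex \<Rightarrow> real \<Rightarrow> real) \<Rightarrow> bool" where
  "section_radius u1 r U \<longleftrightarrow> (\<forall>p\<in>P. smooth_on UNIV (U p) \<and>
     (\<forall>\<theta>. U p (\<theta> + 2 * pi) = U (\<pi> p) \<theta> \<and> (\<forall>u>u1. rad p u \<theta> = r\<^sup>2 \<longleftrightarrow> u = U p \<theta>) \<and> U p \<theta> > u1))"

text \<open>Far out the squared radius increases with u. It is below r^2 at \<open>u1\<close> if r >
  exp u1 + C, and at least r^2 at ln r, so each ray crosses the sphere once; uniqueness also gives
  the equivariance of \<open>U\<close>.\<close>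

lemma section_radius_exists:
  obtains u0 where "\<And>u1. u0 \<le> u1 \<Longrightarrow> \<exists>r0. \<forall>r>r0. \<exists>U. section_radius u1 r U"
    "\<And>p u \<theta>. p \<in> P \<Longrightarrow> u0 \<le> u \<Longrightarrow> rad' p u \<theta> > 0"
proof -
  obtain C where C: "C > 0" "\<And>p u \<theta>. p \<in> P \<Longrightarrow> u \<ge> 0 \<Longrightarrow> cmod (es p u \<theta>) \<le> C"
    "\<And>p u \<theta>. p \<in> P \<Longrightarrow> u \<ge> 0 \<Longrightarrow> \<bar>\<epsilon> * exp (- u) * y' p \<theta>\<bar> \<le> C" using bounds by metis
  have pos: "rad' p u \<theta> > 0" if "p \<in> P" "2 * C\<^sup>2 \<le> u" for p u \<theta>
  proof -
    have "u \<ge> 0" using that(2) zero_le_power2[of C] by linarith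
    then show ?thesis using C that by (intro rad'_pos[of C]) auto
  qed
  show ?thesis
  proof (rule that[of "2 * C\<^sup>2"])
    fix u1 assume u1: "2 * C\<^sup>2 \<le> u1"
    have u10: "u1 \<ge> 0" using u1 zero_le_power2[of C] by linarith
    have mono: "rad p u \<theta> < rad p v \<theta>" if "p \<in> P" "u1 \<le> u" "u < v" for p u v \<theta>
      by (rule DERIV_pos_imp_increasing[OF that(3) exI, OF conjI[OF rad_deriv[OF that(1)] pos[OF that(1)]]])
        (use that u1 in auto)
    have "\<exists>U. section_radius u1 r U" if r: "r > exp u1 + C" for r
    proof -
      have rpos: "r > 0" "r > exp u1" using r C(1) exp_gt_zero[of u1] by linarith+
      have ex: "\<exists>u>u1. rad p u \<theta> = r\<^sup>2" if p: "p \<in> P" for p \<theta>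
      proof -
        have "(cmod (es p u1 \<theta>))\<^sup>2 \<le> C\<^sup>2" using C(2)[OF p u10] by (intro power_mono) auto
        then have "exp (- 2 * u1) * (cmod (es p u1 \<theta>))\<^sup>2 \<le> 1 * C\<^sup>2" using u10 by (intro mult_mono) auto
        then have "rad p u1 \<theta> \<le> (exp u1)\<^sup>2 + C\<^sup>2" by (simp add: rad_def exp_double)
        also have "\<dots> \<le> (exp u1 + C)\<^sup>2" using C(1) by (simp add: power2_eq_square algebra_simps)
        also have "\<dots> < r\<^sup>2" using r C(1) by (intro power_strict_mono) (auto simp: add_nonneg_nonneg)
        finally have lo: "rad p u1 \<theta> < r\<^sup>2" .
        have "exp (2 * ln r) = r\<^sup>2" using rpos by (simp add: exp_double)
        then have hi: "r\<^sup>2 \<le> rad p (ln r) \<theta>" by (simp add: rad_def)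
        have "u1 \<le> ln r" using rpos ln_ge_iff by auto
        moreover have "\<forall>u. u1 \<le> u \<and> u \<le> ln r \<longrightarrow> isCont (\<lambda>u. rad p u \<theta>) u"
          using DERIV_isCont[OF rad_deriv[OF p]] by blast
        ultimately obtain u where "u1 \<le> u" "rad p u \<theta> = r\<^sup>2"
          using IVT[of "\<lambda>u. rad p u \<theta>" u1 "r\<^sup>2" "ln r"] lo hi by auto
        then show ?thesis using lo by (intro exI[of _ u]) (cases "u = u1"; auto)
      qed
      define U where "U p \<theta> = (SOME u. u > u1 \<and> rad p u \<theta> = r\<^sup>2)" for p \<theta>
      have U: "U p \<theta> > u1" "rad p (U p \<theta>) \<theta> = r\<^sup>2" if "p \<in> P" for p \<theta>
        using someI_ex[OF ex[OF that, of \<theta>]] by (auto simp: U_def)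
      have uniq: "rad p u \<theta> = r\<^sup>2 \<longleftrightarrow> u = U p \<theta>" if "p \<in> P" "u > u1" for p u \<theta>
        using mono[OF that(1), of u "U p \<theta>" \<theta>] mono[OF that(1), of "U p \<theta>" u \<theta>] U[OF that(1), of \<theta>] that(2)
        by (cases u "U p \<theta>" rule: linorder_cases) auto
      have "smooth_on UNIV (U p)" if p: "p \<in> P" for p
        by (rule smooth_on_open_local[OF open_UNIV smooth_radius[OF p, of u1 _ _ "r\<^sup>2"]])
          (use U[OF p] pos[OF p] u1 uniq[OF p] in auto)
      moreover have "U p (\<theta> + 2 * pi) = U (\<pi> p) \<theta>" if p: "p \<in> P" for p \<theta>
      proof -
        have p': "\<pi> p \<in> P" using strandsD(2)[OF str] p bij_betwE by blast
        show ?thesis using uniq[OF p', of "U p (\<theta> + 2 * pi)" \<theta>] U[OF p, of "\<theta> + 2 * pi"] rad_shift[OF p] by auto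
      qed
      ultimately have "section_radius u1 r U" unfolding section_radius_def using U(1) uniq by auto
      then show ?thesis by (intro exI[of _ U])
    qed
    then show "\<exists>r0. \<forall>r>r0. \<exists>U. section_radius u1 r U" by blast
  qed (use pos in auto)
qed

text \<open>In the chart of \<open>to_S3\<close> the second coordinate is a2/|a1|, with a2 = exp (-
  \<xi>) eta and |a1| = exp u. The normalising root equals r exp (- u) because the point lies on the
  sphere.\<close>

lemma to_S3_sheet_point:
  assumes "rad p u \<theta> = r\<^sup>2" "r > 0"
  shows "(1 / r) *\<^sub>R sheet_point p u \<theta> = to_S3 (cis \<theta>, of_real (exp (- 2 * u)) * cis (- \<theta>) * es p u \<theta>)"
proof -
  have e: "exp (Complex u \<theta>) = of_real (exp u) * cis \<theta>" "exp (- Complex u \<theta>) = of_real (exp (- u)) * cis (- \<theta>)"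
    using exp_eq_polar[of "Complex u \<theta>"] exp_eq_polar[of "- Complex u \<theta>"] by auto
  have "(exp (- u) * r)\<^sup>2 = exp (- 2 * u) * rad p u \<theta>"
    using assms(1) by (simp add: power_mult_distrib exp_double[symmetric])
  also have "\<dots> = 1 + (exp (- 2 * u) * cmod (es p u \<theta>))\<^sup>2"
    by (simp add: rad_def distrib_left power_mult_distrib power2_eq_square exp_add[symmetric] mult.assoc)
  finally have "sqrt (1 + (exp (- 2 * u) * cmod (es p u \<theta>))\<^sup>2) = exp (- u) * r"
    using assms(2) by (intro real_sqrt_unique) auto
  then have s: "1 / sqrt (1 + (cmod (of_real (exp (- 2 * u)) * cis (- \<theta>) * es p u \<theta>))\<^sup>2) = 1 / (exp (- u) * r)"
    by (simp only: norm_mult norm_cis norm_of_real abs_exp_cancel mult_1_right)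
  have s': "1 / (exp (- u) * r) = exp u / r" by (simp add: exp_minus divide_simps)
  have x: "exp u * exp (- 2 * u) = exp (- u)" by (simp flip: exp_add)
  show ?thesis
    unfolding to_S3_eq snd_conv s s' sheet_point_def e
    using x by (simp add: scaleR_conv_of_real mult.assoc[symmetric] flip: of_real_mult)
qed

text \<open>The bump with its multiples by t in [0, 1] leaves a uniform gap \<delta> between
  strands. For large r each strand of the section has error at most \<delta>/4 after undoing the
  scaling, so no two strands can meet along the path.\<close>

lemma large_sections_isotopic:
  assumes str0: "strands P \<pi> z0" "P \<noteq> {}" and z: "\<And>p \<theta>. p \<in> P \<Longrightarrow> z p \<theta> = z0 p \<theta> + of_real (\<beta> \<theta> * m p) * e"
    and \<beta>: "smooth_on UNIV \<beta>" "\<And>\<theta>. \<beta> (\<theta> + 2 * pi) = \<beta> \<theta>" and m: "\<And>p. p \<in> P \<Longrightarrow> m (\<pi> p) = m p"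
    and dist: "\<And>p q \<theta> t. p \<in> P \<Longrightarrow> q \<in> P \<Longrightarrow> z0 p \<theta> + of_real (t * \<beta> \<theta> * m p) * e = z0 q \<theta> + of_real (t * \<beta> \<theta> * m q) * e \<Longrightarrow> p = q"
    and "u1 \<ge> 0"
  obtains r0 where "\<And>r U. r > r0 \<Longrightarrow> section_radius u1 r U \<Longrightarrow> braid_isotopic (card P)
     (to_S3 ` braid_of P (\<lambda>p \<theta>. of_real (exp (- 2 * U p \<theta>)) * cis (- \<theta>) * es p (U p \<theta>) \<theta>))
     (to_S3 ` braid_of P (\<lambda>p \<theta>. cis (- \<theta>) * z0 p \<theta>)) \<and>
     strands P \<pi> (\<lambda>p \<theta>. of_real (exp (- 2 * U p \<theta>)) * cis (- \<theta>) * es p (U p \<theta>) \<theta>)"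
proof -
  note D0 = strandsD[OF str0(1)] and D = strandsD[OF str]
  obtain C where C: "C > 0" "\<And>p \<theta>. p \<in> P \<Longrightarrow> cmod (z p \<theta>) \<le> C" "\<And>p \<theta>. p \<in> P \<Longrightarrow> \<bar>y' p \<theta>\<bar> \<le> C"
    "\<And>p u \<theta>. p \<in> P \<Longrightarrow> u \<ge> 0 \<Longrightarrow> cmod (es p u \<theta>) \<le> C" using bounds by metis
  define f where "f p x = z0 p (snd x) + of_real (fst x * \<beta> (snd x) * m p) * e" for p and x :: "real \<times> real"
  have cf: "continuous_on S (f p)" if "p \<in> P" for p S
    unfolding f_def[abs_def]
    by (intro continuous_intros continuous_on_compose2[OF smooth_on_imp_continuous_on[OF D0(3)[OF that]]]
      continuous_on_compose2[OF smooth_on_imp_continuous_on[OF \<beta>(1)]]) auto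
  obtain \<delta> where \<delta>: "\<delta> > 0" "\<And>p q x. p \<in> P \<Longrightarrow> q \<in> P \<Longrightarrow> p \<noteq> q \<Longrightarrow> x \<in> {0..1} \<times> {-pi..pi} \<Longrightarrow> \<delta> \<le> norm (f p x - f q x)"
  proof (rule uniform_gap[OF D(1) compact_Times[OF compact_Icc compact_Icc], of 0 1 "-pi" pi f])
    show "continuous_on ({0..1} \<times> {-pi..pi}) (f p)" if "p \<in> P" for p by (rule cf[OF that])
    show "f p x \<noteq> f q x" if "p \<in> P" "q \<in> P" "p \<noteq> q" for p q x
      using dist[OF that(1,2), of "snd x" "fst x"] that(3) unfolding f_def by blast
  qed (rule that; blast)
  have gap: "\<delta> \<le> norm (f p (t, \<theta>) - f q (t, \<theta>))" if pq: "p \<in> P" "q \<in> P" "p \<noteq> q" "t \<in> {0..1}" for p q t \<theta>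
  proof -
    obtain \<theta>' where \<theta>': "- pi \<le> \<theta>'" "\<theta>' \<le> pi" "cis \<theta>' = cis \<theta>" by (rule cis_reduce)
    have fs: "f p (t, \<theta> + 2 * pi) = f (\<pi> p) (t, \<theta>)" if "p \<in> P" for p \<theta>
      using D0(4)[OF that] \<beta>(2) m[OF that] by (simp add: f_def)
    obtain p' where p': "p' \<in> P" "f p (t, \<theta>) = f p' (t, \<theta>')"
      using strands_shift[where F="\<lambda>p \<theta>. f p (t, \<theta>)", OF D(2) fs pq(1) \<theta>'(3)[symmetric]] by auto
    obtain q' where q': "q' \<in> P" "f q (t, \<theta>) = f q' (t, \<theta>')"
      using strands_shift[where F="\<lambda>p \<theta>. f p (t, \<theta>)", OF D(2) fs pq(2) \<theta>'(3)[symmetric]] by auto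
    have "p' \<noteq> q'" using dist[OF pq(1,2), of \<theta> t] pq(3) p' q' by (auto simp: f_def)
    then show ?thesis using \<delta>(2)[OF p'(1) q'(1), of "(t, \<theta>')"] \<theta>' pq(4) p' q' by auto
  qed
  define Kc where "Kc = C\<^sup>2 * C + (1 + C\<^sup>2) * \<epsilon> * C + (2 + C\<^sup>2) * C\<^sup>2 * C"
  have Kc: "Kc > 0" using C(1) \<epsilon>_pos by (simp add: Kc_def add_pos_pos)
  \<comment> \<open>Makes Kc (1 + C)/r at most \<delta>/4, the error allowed to one strand.\<close>
  define r0 where "r0 = max 1 (4 * Kc * (1 + C) / \<delta>)"
  show ?thesis
  proof (rule that[of r0])
    fix r U assume r: "r > r0" and sec: "section_radius u1 r U"
    have r1: "r > 1" "4 * Kc * (1 + C) / \<delta> < r" using r by (auto simp: r0_def)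
    have U: "smooth_on UNIV (U p)" "U p (\<theta> + 2 * pi) = U (\<pi> p) \<theta>" "U p \<theta> > u1" "rad p (U p \<theta>) \<theta> = r\<^sup>2" if "p \<in> P" for p \<theta>
      using sec that unfolding section_radius_def by auto
    define E where "E p \<theta> = exp (- U p \<theta>)" for p \<theta>
    \<comment> \<open>The strand of the section without its factor \<open>cis (- \<theta>)\<close>
      and with the scaling undone: r^2 for the real part, r^3/\<epsilon> for the imaginary part,
      whose own factor is \<epsilon> exp (- 3 u).\<close>
    define zh where "zh p \<theta> = of_real ((r * E p \<theta>)\<^sup>2 * Re (es p (U p \<theta>) \<theta>)) + \<i> * of_real ((r * E p \<theta>) ^ 3 * Im (z p \<theta>))" for p \<theta>
    define err where "err p \<theta> = zh p \<theta> - z p \<theta>" for p \<theta>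
    have err_bound: "cmod (err p \<theta>) \<le> \<delta> / 4" if p: "p \<in> P" for p \<theta>
    proof -
      define \<rho> where "\<rho> = r * E p \<theta>"
      have Upos: "U p \<theta> > 0" using U(3)[OF p, of \<theta>] \<open>u1 \<ge> 0\<close> by linarith
      then have E01: "0 < E p \<theta>" "E p \<theta> \<le> 1" by (auto simp: E_def)
      have es: "cmod (es p (U p \<theta>) \<theta>) \<le> C" using C(4)[OF p] Upos by auto
      have "\<rho>\<^sup>2 = exp (- 2 * U p \<theta>) * rad p (U p \<theta>) \<theta>"
        unfolding U(4)[OF p] by (simp add: \<rho>_def E_def power_mult_distrib exp_double[symmetric])
      also have "\<dots> = 1 + (E p \<theta>) ^ 4 * (cmod (es p (U p \<theta>) \<theta>))\<^sup>2"
        by (simp add: rad_def E_def distrib_left exp_add[symmetric] mult.assoc[symmetric] exp_of_nat_mult[symmetric])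
      finally have \<rho>2: "\<rho>\<^sup>2 = 1 + (E p \<theta>) ^ 4 * (cmod (es p (U p \<theta>) \<theta>))\<^sup>2" .
      have "(E p \<theta>) ^ 4 * (cmod (es p (U p \<theta>) \<theta>))\<^sup>2 \<le> E p \<theta> * C\<^sup>2"
        using E01 es power_decreasing[of 1 4 "E p \<theta>"] by (intro mult_mono power_mono) auto
      then have \<rho>u: "\<rho>\<^sup>2 \<le> 1 + C\<^sup>2 * E p \<theta>" unfolding \<rho>2 by (simp add: mult.commute)
      have \<rho>0: "\<rho> > 0" using r1 E01 by (simp add: \<rho>_def)
      have "1 \<le> \<rho>\<^sup>2" unfolding \<rho>2 using E01 by simp
      then have \<rho>1: "1 \<le> \<rho>" using \<rho>0 by (intro power2_le_imp_le[of 1 \<rho>]) auto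
      have "\<rho>\<^sup>2 \<le> 1 + C\<^sup>2 * 1" by (rule order_trans[OF \<rho>u]) (use E01 in \<open>intro add_left_mono mult_left_mono, auto\<close>)
      also have "\<dots> \<le> (1 + C)\<^sup>2" using C(1) by (simp add: power2_eq_square algebra_simps)
      finally have "\<rho> \<le> 1 + C" using C(1) by (auto intro: power2_le_imp_le)
      then have Er: "E p \<theta> \<le> (1 + C) / r" using r1 by (simp add: \<rho>_def field_simps)
      have xy: "\<bar>Re (z p \<theta>)\<bar> \<le> C" "\<bar>Im (z p \<theta>)\<bar> \<le> C"
        using C(2)[OF p, of \<theta>] abs_Re_le_cmod[of "z p \<theta>"] abs_Im_le_cmod[of "z p \<theta>"] by auto
      have "cmod (err p \<theta>) \<le> \<bar>Re (err p \<theta>)\<bar> + \<bar>Im (err p \<theta>)\<bar>" by (rule cmod_le)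
      also have "\<dots> = \<bar>\<rho>\<^sup>2 * (Re (z p \<theta>) - \<epsilon> * E p \<theta> * y' p \<theta>) - Re (z p \<theta>)\<bar> + \<bar>\<rho> ^ 3 * Im (z p \<theta>) - Im (z p \<theta>)\<bar>"
        by (simp add: err_def zh_def es_def \<rho>_def E_def)
      also have "\<dots> \<le> Kc * E p \<theta>"
        unfolding Kc_def by (rule error_estimate[OF C(1) E01 \<rho>1 \<rho>u \<epsilon>_pos xy C(3)[OF p]])
      also have "\<dots> \<le> Kc * ((1 + C) / r)" using Er Kc by (intro mult_left_mono) auto
      also have "\<dots> \<le> \<delta> / 4" using r1 \<delta>(1) by (simp add: field_simps)
      finally show ?thesis .
    qed
    define a1 a2 where "a1 = 1 / r\<^sup>2" and "a2 = \<epsilon> / r ^ 3"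
    have a: "a1 > 0" "a2 > 0" using r1 \<epsilon>_pos by (auto simp: a1_def a2_def)
    define c where "c t p \<theta> = z0 p \<theta> + of_real ((1 - t) * \<beta> \<theta> * m p) * e + of_real (1 - t) * err p \<theta>" for t p \<theta>
    txt \<open>The section of radius \<open>r\<close> is close to the braid shrunk by \<open>r\<^sup>-\<^sup>2\<close> in the real and by
      \<open>\<epsilon> r\<^sup>-\<^sup>3\<close> in the imaginary direction; \<open>Z\<close> removes the error and this scaling simultaneously.\<close>
    define Z where "Z t p \<theta> = cis (- \<theta>) * (of_real (((1 - t) * a1 + t) * Re (c t p \<theta>)) + \<i> * of_real (((1 - t) * a2 + t) * Im (c t p \<theta>)))" for t p \<theta>
    have ss: "smooth_on S (\<lambda>x. es p (U p (h x)) (h x))" "smooth_on S (\<lambda>x. U p (h x))" "smooth_on S (\<lambda>x. z p (h x))"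
      "smooth_on S (\<lambda>x. z0 p (h x))" "smooth_on S (\<lambda>x. \<beta> (h x))"
      if "p \<in> P" "open S" "smooth_on S h" for p S and h :: "real \<times> real \<Rightarrow> real"
      by (intro smooth_on_es smooth_on_arg[OF that(2,3)] that U(1) D(3) D0(3) \<beta>(1))+
    have sZ: "smooth_on UNIV (\<lambda>x. Z (fst x) p (snd x))" if "p \<in> P" for p
      unfolding Z_def c_def err_def zh_def E_def
      by (intro smooth_intros ss[OF that] open_UNIV)
    have errs: "err p (\<theta> + 2 * pi) = err (\<pi> p) \<theta>" if "p \<in> P" for p \<theta>
      unfolding err_def zh_def E_def by (simp only: U(2)[OF that] es_shift[OF that] D(4)[OF that])
    have cs: "c t p (\<theta> + 2 * pi) = c t (\<pi> p) \<theta>" if "p \<in> P" for t p \<theta>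
      unfolding c_def by (simp only: errs[OF that] D0(4)[OF that] \<beta>(2) m[OF that])
    have ci: "cis (- (\<theta> + 2 * pi)) = cis (- \<theta>)" for \<theta>
      by (simp add: cis.ctr cos_diff sin_diff)
    have Zs: "Z t p (\<theta> + 2 * pi) = Z t (\<pi> p) \<theta>" if "p \<in> P" for t p \<theta>
      unfolding Z_def by (simp only: cs[OF that] ci)
    have Zdist: "p = q" if pq: "p \<in> P" "q \<in> P" and t: "t \<in> {0..1}" and eq: "Z t p \<theta> = Z t q \<theta>" for p q t \<theta>
    proof (rule ccontr)
      assume ne: "p \<noteq> q"
      \<comment> \<open>Both interpolated scalings stay positive, so they can be cancelled and only
        the gap between the strands matters.\<close>
      have "(1 - t) * b + t > 0" if "b > 0" for b
        using t that by (cases "t = 0") (auto intro!: add_nonneg_pos)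
      then have pos: "(1 - t) * a1 + t > 0" "(1 - t) * a2 + t > 0" using a by auto
      have "c t p \<theta> = c t q \<theta>"
        using eq pos by (simp add: Z_def complex_eq_iff[of "c t p \<theta>"]) (simp add: complex_eq_iff)
      then have "f p (1 - t, \<theta>) - f q (1 - t, \<theta>) = of_real (1 - t) * (err q \<theta> - err p \<theta>)"
        by (simp add: c_def f_def algebra_simps)
      then have "norm (f p (1 - t, \<theta>) - f q (1 - t, \<theta>)) \<le> 1 * (\<delta> / 4 + \<delta> / 4)"
        using t by (simp only: norm_mult norm_of_real)
          (intro mult_mono order_trans[OF norm_triangle_ineq4] add_mono err_bound pq, auto)
      then show False using gap[OF pq ne, of "1 - t" \<theta>] t \<delta>(1) by auto
    qed
    have strZ: "strands P \<pi> (Z t)" if "t \<in> {0..1}" for t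
    proof -
      have "smooth_on UNIV (Z t p)" if "p \<in> P" for p
        using smooth_on_arg[OF open_UNIV _ sZ[OF that], of "\<lambda>\<theta>. (t, \<theta>)"] by (simp add: smooth_intros)
      then show ?thesis unfolding strands_def using D(1,2) Zs Zdist that by blast
    qed
    have Z0: "Z 0 p \<theta> = of_real (exp (- 2 * U p \<theta>)) * cis (- \<theta>) * es p (U p \<theta>) \<theta>" if "p \<in> P" for p \<theta>
    proof -
      have c0: "c 0 p \<theta> = zh p \<theta>" using z[OF that] by (simp add: c_def err_def)
      have E2: "exp (- 2 * U p \<theta>) = (E p \<theta>)\<^sup>2" by (simp add: E_def exp_double[symmetric])
      have "of_real (a1 * Re (zh p \<theta>)) + \<i> * of_real (a2 * Im (zh p \<theta>)) = of_real ((E p \<theta>)\<^sup>2) * es p (U p \<theta>) \<theta>"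
        using r1 by (simp add: complex_eq_iff zh_def a1_def a2_def es_def E_def[symmetric] power_mult_distrib power2_eq_square power3_eq_cube)
      then show ?thesis unfolding Z_def c0 E2 by (simp add: mult_ac)
    qed
    have Z1: "Z 1 p \<theta> = cis (- \<theta>) * z0 p \<theta>" for p \<theta>
      by (simp add: Z_def c_def complex_eq[symmetric])
    have e0: "braid_of P (Z 0) = braid_of P (\<lambda>p \<theta>. of_real (exp (- 2 * U p \<theta>)) * cis (- \<theta>) * es p (U p \<theta>) \<theta>)"
      unfolding braid_of_def using Z0 by (intro Collect_cong ex_cong1) auto
    have e1: "braid_of P (Z 1) = braid_of P (\<lambda>p \<theta>. cis (- \<theta>) * z0 p \<theta>)"
      unfolding braid_of_def using Z1 by simp
    have iso: "braid_isotopic (card P) (to_S3 ` braid_of P (Z 0)) (to_S3 ` braid_of P (Z 1))"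
      by (rule braid_isotopic_strands[OF strZ str0(2) Zs sZ])
    have "strands P \<pi> (\<lambda>p \<theta>. of_real (exp (- 2 * U p \<theta>)) * cis (- \<theta>) * es p (U p \<theta>) \<theta>)"
    proof -
      have "(\<lambda>\<theta>. of_real (exp (- 2 * U p \<theta>)) * cis (- \<theta>) * es p (U p \<theta>) \<theta>) = Z 0 p" if "p \<in> P" for p
        using Z0[OF that] by auto
      moreover have "\<pi> p \<in> P" if "p \<in> P" for p using D(2) that bij_betwE by blast
      ultimately show ?thesis using strZ[of 0] unfolding strands_def by (simp add: Z0)
    qed
    then show "braid_isotopic (card P)
      (to_S3 ` braid_of P (\<lambda>p \<theta>. of_real (exp (- 2 * U p \<theta>)) * cis (- \<theta>) * es p (U p \<theta>) \<theta>))
      (to_S3 ` braid_of P (\<lambda>p \<theta>. cis (- \<theta>) * z0 p \<theta>)) \<and>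
      strands P \<pi> (\<lambda>p \<theta>. of_real (exp (- 2 * U p \<theta>)) * cis (- \<theta>) * es p (U p \<theta>) \<theta>)"
      using iso unfolding e0 e1 by blast
  qed
qed

text \<open>Increasing u at fixed angle gives a curve in \<open>L\<close> whose squared norm has
  derivative \<open>rad'\<close>, so its velocity is not orthogonal to the position.\<close>

lemma sheet_point_transverse:
  assumes p: "p \<in> P" and u: "u1 < u" "rad' p u \<theta> > 0" and L: "\<And>v. u1 < v \<Longrightarrow> sheet_point p v \<theta> \<in> L"
  shows "\<exists>w\<in>tangent_space L (sheet_point p u \<theta>). w \<bullet> sheet_point p u \<theta> \<noteq> 0"
proof -
  define d where "d = u - u1"
  define c where "c t = sheet_point p (u + t) \<theta>" for t
  have sc: "smooth_on UNIV c"
    unfolding c_def[abs_def] sheet_point_def Complex_eq by (intro smooth_intros smooth_on_es p open_UNIV)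
  define w where "w = der c 0"
  have dc: "(c has_vector_derivative w) (at 0)" unfolding w_def by (rule der(3)[OF sc])
  have "w \<in> tangent_space L (sheet_point p u \<theta>)"
    unfolding tangent_space_def
    by (intro CollectI exI[of _ d] conjI exI[of _ c] smooth_on_subset[OF sc] dc)
      (use u L in \<open>auto simp: d_def c_def\<close>)
  moreover have "w \<bullet> sheet_point p u \<theta> \<noteq> 0"
  proof -
    have "((\<lambda>t. c t \<bullet> c t) has_vector_derivative (c 0 \<bullet> w + w \<bullet> c 0)) (at 0)"
      by (rule bounded_bilinear.has_vector_derivative[OF bounded_bilinear_inner dc dc])
    then have 1: "((\<lambda>t. rad p (u + t) \<theta>) has_real_derivative 2 * (w \<bullet> sheet_point p u \<theta>)) (at 0)"
      by (simp add: c_def power2_norm_eq_inner[symmetric] norm_sheet_point has_real_derivative_iff_has_vector_derivative inner_commute)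
    have "((\<lambda>t. rad p (t + u) \<theta>) has_real_derivative rad' p u \<theta>) (at 0)"
      using DERIV_shift[of "\<lambda>u. rad p u \<theta>" "rad' p u \<theta>" 0 u] rad_deriv[OF p, of \<theta> u] by simp
    then have "2 * (w \<bullet> sheet_point p u \<theta>) = rad' p u \<theta>"
      using DERIV_unique[OF 1] by (simp add: add.commute)
    then show ?thesis using u(2) by auto
  qed
  ultimately show ?thesis by blast
qed

end

text \<open>For |a1| < 1 the disc equation keeps a2 within \<open>c\<close> of a centre, and for 0
  \<le> Re \<xi> \<le> u1 one period of the sheets is compact; what lies far out is therefore on the
  end.\<close>

lemma (in sheet_system) surf_far:
  "\<exists>C. \<forall>x\<in>surf. norm x > C \<longrightarrow> (\<exists>p\<in>P. \<exists>\<xi>. Re \<xi> > u1 \<and> x = (exp \<xi>, exp (- \<xi>) * g p \<xi>))"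
proof -
  let ?K = "cbox (Complex (-1) (-pi)) (Complex \<bar>u1\<bar> pi)"
  obtain C1 where C1: "C1 > 0" "\<And>p \<xi>. p \<in> P \<Longrightarrow> \<xi> \<in> ?K \<Longrightarrow> norm (exp \<xi>, exp (- \<xi>) * g p \<xi>) \<le> C1"
  proof (rule uniform_bound[OF finP compact_cbox, of "Complex (-1) (-pi)" "Complex \<bar>u1\<bar> pi" "\<lambda>p \<xi>. (exp \<xi>, exp (- \<xi>) * g p \<xi>)"])
    show "continuous_on ?K (\<lambda>\<xi>. (exp \<xi>, exp (- \<xi>) * g p \<xi>))" if "p \<in> P" for p
      by (intro continuous_intros cont_g that)
  qed auto
  obtain C2 where C2: "\<And>r. r \<in> R \<Longrightarrow> cmod r \<le> C2" "C2 > 0"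
    using finite_imp_bounded[OF finR] unfolding bounded_pos by auto
  show ?thesis
  proof (intro exI[of _ "max C1 (1 + (C2 + c))"] ballI impI)
    fix x assume x: "x \<in> surf" "norm x > max C1 (1 + (C2 + c))"
    show "\<exists>p\<in>P. \<exists>\<xi>. Re \<xi> > u1 \<and> x = (exp \<xi>, exp (- \<xi>) * g p \<xi>)"
    proof (cases "cmod (fst x) < 1")
      case True
      then obtain r where r: "r \<in> R" "fst x = ((snd x - r) / c) ^ n r" using mem_surf_centre x(1) by blast
      have "cmod ((snd x - r) / c) < 1"
      proof (rule ccontr)
        assume "\<not> ?thesis"
        then have "1 \<le> cmod ((snd x - r) / c) ^ n r" by (intro one_le_power) auto
        then have "1 \<le> cmod (fst x)" unfolding r(2) by (simp only: norm_power)
        then show False using True by simp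
      qed
      then have "cmod (snd x - r) < c" using c_pos by (simp add: norm_divide)
      then have "cmod (snd x) \<le> C2 + c" using C2(1)[OF r(1)] norm_triangle_sub[of "snd x" r] by linarith
      then have "norm x \<le> 1 + (C2 + c)"
        using True norm_Pair_le[of "fst x" "snd x"] by simp
      then show ?thesis using x(2) by simp
    next
      case False
      then have nz: "fst x \<noteq> 0" by auto
      define \<xi> where "\<xi> = Ln (fst x)"
      have e: "exp \<xi> = fst x" using nz by (simp add: \<xi>_def)
      obtain p where p: "p \<in> P" "fst x * snd x = g p \<xi>" using mem_surf[OF e] x(1) by auto
      have x': "x = (exp \<xi>, exp (- \<xi>) * g p \<xi>)"
        unfolding p(2)[symmetric] using nz by (simp add: prod_eq_iff e exp_minus)
      have "Re \<xi> > u1"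
      proof (rule ccontr)
        assume "\<not> ?thesis"
        moreover have "Re \<xi> \<ge> 0" using False nz by (simp add: \<xi>_def)
        ultimately have "\<xi> \<in> ?K"
          using mpi_less_Im_Ln[OF nz] Im_Ln_le_pi[OF nz] by (auto simp: in_cbox_complex_iff \<xi>_def)
        then show False using C1(2)[OF p(1)] x(2) x' by fastforce
      qed
      then show ?thesis using p(1) x' by blast
    qed
  qed
qed

theorem mainTheorem2:
  fixes N :: nat and K :: "C2 set"
  assumes "N \<ge> 1" and "braid_S3 N K"
  shows "\<exists>L :: C2 set. properly_embedded_submanifold 2 L \<and> Lagrangian L \<and>
    (\<forall>\<^sub>F r in at_top. transverse L (sphere 0 r) \<and>
       braid_S3 N (rot ` (\<lambda>p. (1 / r) *\<^sub>R p) ` (L \<inter> sphere 0 r)) \<and>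
       braid_isotopic N (rot ` (\<lambda>p. (1 / r) *\<^sub>R p) ` (L \<inter> sphere 0 r)) K)"
proof -
  obtain K' where K': "braid N K'" "K = to_S3 ` K'" using assms(2) unfolding braid_S3_def by auto
  obtain P \<pi> \<gamma> where str\<gamma>: "strands P \<pi> \<gamma>" and P: "card P = N" "K' = braid_of P \<gamma>"
    using braid_strands[OF K'(1) assms(1)] by metis
  note D\<gamma> = strandsD[OF str\<gamma>]
  have Pne: "P \<noteq> {}" using P assms(1) by auto
  \<comment> \<open>Compensates the factor \<open>cis (- \<theta>)\<close> that the braid coordinate
    of a section carries by \<open>to_S3_sheet_point\<close>.\<close>
  define z0 where "z0 p \<theta> = cis \<theta> * \<gamma> p \<theta>" for p \<theta>
  have \<gamma>z0: "cis (- \<theta>) * z0 p \<theta> = \<gamma> p \<theta>" for p \<theta> by (simp add: z0_def mult.assoc[symmetric] cis_mult)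
  have cis2: "cis (\<theta> + 2 * pi) = cis \<theta>" for \<theta> by (simp add: cis.ctr)
  have str0: "strands P \<pi> z0"
    unfolding strands_def
  proof (intro conjI ballI allI impI D\<gamma>(1,2))
    fix p assume p: "p \<in> P"
    show "smooth_on UNIV (z0 p)" unfolding z0_def[abs_def] by (intro smooth_intros D\<gamma>(3) p open_UNIV)
    show "z0 p (\<theta> + 2 * pi) = z0 (\<pi> p) \<theta>" for \<theta> using D\<gamma>(4)[OF p] cis2 by (simp add: z0_def)
    show "p = q" if "q \<in> P" "z0 p \<theta> = z0 q \<theta>" for q \<theta>
      using D\<gamma>(5)[OF p that(1), of \<theta>] that(2) by (simp add: z0_def)
  qed
  show ?thesis
  proof (rule exact_strands[OF str0])
  fix e \<beta> m A
  assume \<beta>: "smooth_on UNIV \<beta>" "\<And>\<theta>. \<beta> (\<theta> + 2 * pi) = \<beta> \<theta>"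
    and m: "\<And>p. p \<in> P \<Longrightarrow> m (\<pi> p) = m p"
    and dist: "\<And>p q \<theta> t. p \<in> P \<Longrightarrow> q \<in> P \<Longrightarrow> z0 p \<theta> + of_real (t * \<beta> \<theta> * m p) * e = z0 q \<theta> + of_real (t * \<beta> \<theta> * m q) * e \<Longrightarrow> p = q"
    and A: "\<And>p. p \<in> P \<Longrightarrow> smooth_on UNIV (A p)" "\<And>p \<theta>. p \<in> P \<Longrightarrow> A p (\<theta> + 2 * pi) = A (\<pi> p) \<theta>"
    "\<And>p \<theta>. p \<in> P \<Longrightarrow> (A p has_real_derivative Re (z0 p \<theta> + of_real (\<beta> \<theta> * m p) * e)) (at \<theta>)"
  define z where "z p \<theta> = z0 p \<theta> + of_real (\<beta> \<theta> * m p) * e" for p \<theta>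
  have strz: "strands P \<pi> z"
    unfolding strands_def
  proof (intro conjI ballI allI impI D\<gamma>(1,2))
    fix p assume p: "p \<in> P"
    show "smooth_on UNIV (z p)" unfolding z_def[abs_def] by (intro smooth_intros strandsD(3)[OF str0] \<beta> p open_UNIV)
    show "z p (\<theta> + 2 * pi) = z (\<pi> p) \<theta>" for \<theta> using strandsD(4)[OF str0 p] \<beta>(2) m[OF p] by (simp add: z_def)
    show "p = q" if "q \<in> P" "z p \<theta> = z q \<theta>" for q \<theta>
      using dist[OF p that(1), of \<theta> 1] that(2) by (simp add: z_def)
  qed
  obtain \<epsilon> R n c g where \<epsilon>: "\<epsilon> > 0" and sys: "sheet_system P \<pi> g R n c"
    and g: "\<And>p \<xi>. p \<in> P \<Longrightarrow> Re \<xi> > 3 \<Longrightarrow> g p \<xi> = exact_sheet \<epsilon> (z p) \<xi>"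
    using sheets_of_strands[OF strz A(1,2) A(3)[folded z_def]] by metis
  interpret S: sheet_system P \<pi> g R n c by (rule sys)
  interpret E: exact_end P \<pi> z \<epsilon> by unfold_locales (use strz \<epsilon> in auto)
  obtain L B where L: "closed L" "\<And>x. x \<in> L \<Longrightarrow> nice L x" "\<And>x. norm x \<ge> B \<Longrightarrow> x \<in> L \<longleftrightarrow> x \<in> S.surf"
    by (rule S.resolved_surface, rule that) (assumption | blast)+
  obtain u0 where u0: "\<And>u1. u0 \<le> u1 \<Longrightarrow> \<exists>r0. \<forall>r>r0. \<exists>U. E.section_radius u1 r U"
    "\<And>p u \<theta>. p \<in> P \<Longrightarrow> u0 \<le> u \<Longrightarrow> E.rad' p u \<theta> > 0"
    by (rule E.section_radius_exists, rule that) (assumption | blast)+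
  \<comment> \<open>Beyond 3 the sheets are exact, beyond \<open>u0\<close> the radius increases,
    and beyond \<open>B\<close> the points are untouched by the handles because their norm is at
    least exp u > u.\<close>
  define u1 where "u1 = max 3 (max u0 B)"
  have u1: "u1 \<ge> 3" "u0 \<le> u1" "B \<le> u1" by (auto simp: u1_def)
  obtain r1 where r1: "\<And>r. r > r1 \<Longrightarrow> \<exists>U. E.section_radius u1 r U" using u0(1)[OF u1(2)] by blast
  obtain r2 where r2: "\<And>r U. r > r2 \<Longrightarrow> E.section_radius u1 r U \<Longrightarrow> braid_isotopic (card P)
     (to_S3 ` braid_of P (\<lambda>p \<theta>. of_real (exp (- 2 * U p \<theta>)) * cis (- \<theta>) * E.es p (U p \<theta>) \<theta>))
     (to_S3 ` braid_of P (\<lambda>p \<theta>. cis (- \<theta>) * z0 p \<theta>)) \<and>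
     strands P \<pi> (\<lambda>p \<theta>. of_real (exp (- 2 * U p \<theta>)) * cis (- \<theta>) * E.es p (U p \<theta>) \<theta>)"
  proof (rule E.large_sections_isotopic[OF str0 Pne z_def \<beta> m dist])
    show "0 \<le> u1" using u1(1) by simp
  qed (assumption | rule that | blast)+
  obtain C where C: "\<And>x. x \<in> S.surf \<Longrightarrow> norm x > C \<Longrightarrow> \<exists>p\<in>P. \<exists>\<xi>. Re \<xi> > u1 \<and> x = (exp \<xi>, exp (- \<xi>) * g p \<xi>)"
    using S.surf_far by blast
  have pt: "(exp \<xi>, exp (- \<xi>) * g p \<xi>) = E.sheet_point p (Re \<xi>) (Im \<xi>)" if "p \<in> P" "Re \<xi> > u1" for p \<xi>
    using g[OF that(1), of \<xi>] that(2) u1(1) by (simp add: E.sheet_point_def E.exact_sheet_es)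
  have inL: "E.sheet_point p u \<theta> \<in> L" if "p \<in> P" "u > u1" for p u \<theta>
  proof -
    have "E.sheet_point p u \<theta> \<in> S.surf"
      unfolding S.surf_def using pt[OF that(1), of "Complex u \<theta>"] that
      by (intro UnI1 CollectI exI[of _ "Complex u \<theta>"] exI[of _ p]) auto
    moreover have "B \<le> norm (E.sheet_point p u \<theta>)"
    proof -
      have "B \<le> exp u" using u1 that(2) exp_ge_add_one_self[of u] by linarith
      also have "\<dots> = cmod (fst (E.sheet_point p u \<theta>))" by (simp add: E.sheet_point_def norm_exp_eq_Re)
      also have "\<dots> \<le> norm (E.sheet_point p u \<theta>)" by (metis norm_fst_le prod.collapse)
      finally show ?thesis .
    qed
    ultimately show ?thesis using L(3) by blast
  qed
  have main: "transverse (rot -` L) (sphere 0 r) \<and>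
       braid_S3 N (rot ` (\<lambda>p. (1 / r) *\<^sub>R p) ` (rot -` L \<inter> sphere 0 r)) \<and>
       braid_isotopic N (rot ` (\<lambda>p. (1 / r) *\<^sub>R p) ` (rot -` L \<inter> sphere 0 r)) K"
    if r: "r > max (max r1 r2) (max 0 (max B C))" for r
  proof -
    obtain U where U: "E.section_radius u1 r U" using r1[of r] r by auto
    have Up: "U p \<theta> > u1" "u > u1 \<Longrightarrow> E.rad p u \<theta> = r\<^sup>2 \<longleftrightarrow> u = U p \<theta>" if "p \<in> P" for p \<theta> u
      using U that unfolding E.section_radius_def by auto
    have Ur: "E.rad p (U p \<theta>) \<theta> = r\<^sup>2" if "p \<in> P" for p \<theta>
      using U that unfolding E.section_radius_def by auto
    define \<zeta> where "\<zeta> p \<theta> = of_real (exp (- 2 * U p \<theta>)) * cis (- \<theta>) * E.es p (U p \<theta>) \<theta>" for p \<theta>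
    have far: "\<exists>p\<in>P. \<exists>\<theta>. x = E.sheet_point p (U p \<theta>) \<theta>" if "x \<in> L" "norm x = r" for x
    proof -
      have "norm x > C" using that(2) r by simp
      have "x \<in> S.surf" using L(3)[of x] that r by auto
      then obtain p \<xi> where p: "p \<in> P" "Re \<xi> > u1" "x = (exp \<xi>, exp (- \<xi>) * g p \<xi>)" using C[OF _ \<open>norm x > C\<close>] by blast
      then have x: "x = E.sheet_point p (Re \<xi>) (Im \<xi>)" using pt by simp
      then have "E.rad p (Re \<xi>) (Im \<xi>) = r\<^sup>2" using E.norm_sheet_point[of p "Re \<xi>" "Im \<xi>"] that(2) by simp
      then show ?thesis using Up(2)[OF p(1,2)] p(1) x by auto
    qed
    have sec: "L \<inter> sphere 0 r = {E.sheet_point p (U p \<theta>) \<theta> |p \<theta>. p \<in> P}"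
    proof
      show "L \<inter> sphere 0 r \<subseteq> {E.sheet_point p (U p \<theta>) \<theta> |p \<theta>. p \<in> P}"
      proof
        fix x assume "x \<in> L \<inter> sphere 0 r"
        then have "x \<in> L" "norm x = r" by simp_all
        from far[OF this] show "x \<in> {E.sheet_point p (U p \<theta>) \<theta> |p \<theta>. p \<in> P}" by blast
      qed
      show "{E.sheet_point p (U p \<theta>) \<theta> |p \<theta>. p \<in> P} \<subseteq> L \<inter> sphere 0 r"
      proof
        fix x assume "x \<in> {E.sheet_point p (U p \<theta>) \<theta> |p \<theta>. p \<in> P}"
        then obtain p \<theta> where p: "p \<in> P" "x = E.sheet_point p (U p \<theta>) \<theta>" by auto
        have "(norm x)\<^sup>2 = r\<^sup>2" using Ur[OF p(1)] E.norm_sheet_point p(2) by auto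
        then have "norm x = r" using r by (simp add: power2_eq_iff_nonneg)
        then show "x \<in> L \<inter> sphere 0 r" using inL[OF p(1) Up(1)[OF p(1)]] p(2) by simp
      qed
    qed
    have "rot ` (\<lambda>p. (1 / r) *\<^sub>R p) ` (rot -` L \<inter> sphere 0 r) = (\<lambda>p. (1 / r) *\<^sub>R p) ` (L \<inter> sphere 0 r)"
    proof -
      have "rot ` (\<lambda>p. (1 / r) *\<^sub>R p) ` (rot -` L \<inter> sphere 0 r) = (\<lambda>p. (1 / r) *\<^sub>R p) ` rot ` (rot -` L \<inter> sphere 0 r)"
        unfolding image_image by (simp add: linear_scale[OF bounded_linear.linear[OF bounded_linear_rot]])
      also have "rot ` (rot -` L \<inter> sphere 0 r) = L \<inter> sphere 0 r"
      proof
        show "L \<inter> sphere 0 r \<subseteq> rot ` (rot -` L \<inter> sphere 0 r)"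
        proof
          fix x assume "x \<in> L \<inter> sphere 0 r"
          then have "unrot x \<in> rot -` L \<inter> sphere 0 r" using norm_rot[of "unrot x"] by simp
          then show "x \<in> rot ` (rot -` L \<inter> sphere 0 r)" by (metis image_eqI rot_unrot)
        qed
        show "rot ` (rot -` L \<inter> sphere 0 r) \<subseteq> L \<inter> sphere 0 r"
        proof
          fix x assume "x \<in> rot ` (rot -` L \<inter> sphere 0 r)"
          then obtain y where "x = rot y" "rot y \<in> L" "norm y = r"
            by (elim imageE IntE vimageE) (metis mem_sphere_0)
          then show "x \<in> L \<inter> sphere 0 r" using norm_rot[of y] by simp
        qed
      qed
      finally show ?thesis .
    qed
    also have "\<dots> = to_S3 ` braid_of P \<zeta>"
    proof -
      have "(1 / r) *\<^sub>R E.sheet_point p (U p \<theta>) \<theta> = to_S3 (cis \<theta>, \<zeta> p \<theta>)" if "p \<in> P" for p \<theta>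
        unfolding \<zeta>_def by (rule E.to_S3_sheet_point) (use Ur[OF that] r in auto)
      then have "{(1 / r) *\<^sub>R E.sheet_point p (U p \<theta>) \<theta> |p \<theta>. p \<in> P} = {to_S3 (cis \<theta>, \<zeta> p \<theta>) |p \<theta>. p \<in> P}"
        by (intro Collect_cong ex_cong1) auto
      moreover have "h ` {F p \<theta> |p \<theta>. p \<in> P} = {h (F p \<theta>) |p \<theta>. p \<in> P}"
        for h :: "C2 \<Rightarrow> C2" and F :: "complex \<Rightarrow> real \<Rightarrow> C2" by blast
      ultimately show ?thesis unfolding sec braid_of_def by simp
    qed
    finally have eq: "rot ` (\<lambda>p. (1 / r) *\<^sub>R p) ` (rot -` L \<inter> sphere 0 r) = to_S3 ` braid_of P \<zeta>" .
    have iso: "braid_isotopic N (to_S3 ` braid_of P \<zeta>) K" and str\<zeta>: "strands P \<pi> \<zeta>"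
      using r2[OF _ U] r unfolding \<zeta>_def[abs_def] \<gamma>z0 P K'(2) by auto
    have "braid_S3 N (to_S3 ` braid_of P \<zeta>)"
      unfolding braid_S3_def using braid_braid_of[OF str\<zeta> Pne] P(1) by auto
    moreover have "transverse (rot -` L) (sphere 0 r)"
    proof (rule transverse_rot_sphereI)
      show "r > 0" using r by auto
      fix x assume "x \<in> L" "norm x = r"
      then obtain p \<theta> where p: "p \<in> P" "x = E.sheet_point p (U p \<theta>) \<theta>" using far by blast
      have "u0 \<le> U p \<theta>" using Up(1)[OF p(1), of \<theta>] u1(2) by simp
      then show "\<exists>w\<in>tangent_space L x. w \<bullet> x \<noteq> 0"
        unfolding p(2) by (intro E.sheet_point_transverse[OF p(1) Up(1)[OF p(1)]] u0(2)[OF p(1)] inL[OF p(1)])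
    qed
    ultimately show ?thesis using iso unfolding eq by blast
  qed
  show ?thesis
  proof (intro exI[of _ "rot -` L"] conjI)
    show "properly_embedded_submanifold 2 (rot -` L)" by (rule nice_imp_properly_embedded[OF L(1,2)])
    show "Lagrangian (rot -` L)" by (rule nice_imp_Lagrangian[OF L(2)])
    show "\<forall>\<^sub>F r in at_top. transverse (rot -` L) (sphere 0 r) \<and>
       braid_S3 N (rot ` (\<lambda>p. (1 / r) *\<^sub>R p) ` (rot -` L \<inter> sphere 0 r)) \<and>
       braid_isotopic N (rot ` (\<lambda>p. (1 / r) *\<^sub>R p) ` (rot -` L \<inter> sphere 0 r)) K"
      by (rule eventually_mono[OF eventually_gt_at_top main])
  qed
qed
qed

end
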